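(* Fix $\rho\le -C_1$ and $\beta\in\mathcal{S}_\rho$. Then for any $\lambda,k\in\mathbb{Z}$, any $r$ with $\rho+C_1\le r\le 0$, any $l=1,\dots,N$, and any $1\le q\le\infty$, $$\|\varphi_\lambda(x)\,\sigma^\beta_\rho(x)\,\eta^{(r,l)}_r(D)\phi_k\|_{L^q_x}\lesssim 2^{-(\lambda+k+2r)}\Big(\|\phi_k\|_{L^q_x}+\max_{i,j}\|\Omega_{ij}\phi_k\|_{L^q_x}\Big)$$ with implicit constant independent of $\rho,\beta,\lambda,k,r,l,\phi$.
   Context: $\phi$ is a function on $\mathbb{R}^3$; $\hat x=x/|x|$, $\hat\xi=\xi/|\xi|$. $\chi:\mathbb{R}^3\to\mathbb{R}_+$ is smooth (radial), supported in $\{|\xi|\le 2\}$, equal to $1$ on $\{|\xi|\le1\}$, $\chi_k(\xi)=\chi(2^{-k}\xi)-\chi(2^{-(k-1)}\xi)$, $\phi_k=\mathcal{F}^{-1}(\chi_k\hat\phi)$; $\varphi_\lambda(x)=\chi_\lambda(x)$ is the dyadic cut-off to $|x|\sim2^\lambda$ in physical space. $\Omega_{ij}=x_i\partial_{x_j}-x_j\partial_{x_i}$. Physical angular cut-offs: $\sigma\in C_c^\infty$ is supported on $[0,101/100]$ and equals $1$ on $[0,1]$. For $\rho\le0$, $\mathcal{S}_\rho$ is a set of $\sim2^{-2\rho}$ points on $\mathbb{S}^2$ such that every $\hat x\in\mathbb{S}^2$ has some $\beta\in\mathcal{S}_\rho$ with $\|\hat x\times\beta\|\le2^\rho$, chosen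 so that $\|u\|_{L^2}\simeq(\sum_{\beta\in\mathcal S_\rho}\|\sigma^\beta_\rho u\|_{L^2}^2)^{1/2}$ uniformly in $\rho\le 0$, where $$\sigma^\beta_\rho(x)=\frac{\sigma(2^{-\rho}\|\hat x\times\beta\|)}{\sum_{\beta'\in\mathcal{S}_\rho}\sigma(2^{-\rho}\|\hat x\times\beta'\|)}.$$ Fourier angular cut-offs: there are absolute constants $C_1,C_2,C_3,C_4,N>0$ such that for every $\rho\le-C_1$ and $\beta\in\mathcal{S}_\rho$ one fixes a Whitney-type partition of unity on $\mathbb{S}^2$ (functions extended to be homogeneous of degree $0$ in $\xi$) consisting of $\eta^\beta_{\rho+C_2}$ and $\eta^{(r,l)}_r$ ($\rho+C_1\le r\le0$, $l=1,\dots,N$) with: (i) there are points $\alpha_{r,l}\in\mathbb{S}^2$ such that, with $\tilde\eta^\beta_{\rho+C_2}(\xi)=\sigma(2^{-(\rho+C_2)}\|\hat\xi\times\beta\|)$ and $\tilde\eta^{(r,l)}_r(\xi)=\sigma(2^{-(r-C_3)}\|\hat\xi\times\alpha_{r,l}\|)$ (a smaller constant $C_3$ being allowed when $r=0$), each of $\eta^\beta_{\rho+C_2},\eta_r^{(r,l)}$ equals the corresponding $\tilde\eta$ divided by $\tilde\eta^\beta_{\rho+C_2}+\sum_{r,l}\tilde\eta^{(r,l)}_r$; (ii) $\|\alpha_{r,l}\times\beta\|\simeq2^r$, and $\|\hat x\times\hat\xi\|\gtrsim2^r$ for all $\hat x\in\mathrm{supp}\,\sigma^\beta_\rho$ and $\hat\xi\in\mathrm{supp}\,\eta^{(r,l)}_r$;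 (iii) $\mathrm{supp}\,\eta^{(r',l')}_{r'}\cap\mathrm{supp}\,\eta^{(r,l)}_r=\emptyset$ if $|r-r'|\ge C_4$, and $\mathrm{supp}\,\eta^\beta_{\rho+C_2}\cap\mathrm{supp}\,\eta^{(r,l)}_r=\emptyset$ if $r\ge\rho+C_4$. Finally $\eta^{(r,l)}_r(D)\phi=\mathcal{F}^{-1}(\eta^{(r,l)}_r\hat\phi)$. *)

theory Defs
  imports "HOL-Analysis.Analysis" "HOL-Probability.Essential_Supremum"
begin

section \<open>Smoothness, supports and Lebesgue norms\<close>

text \<open>All iterated partial derivatives up to order \<open>k\<close> exist and are continuous; meant for open \<open>U\<close>.\<close>

primrec Ck_on :: "nat \<Rightarrow> 'a::euclidean_space set \<Rightarrow> ('a \<Rightarrow> 'b::real_normed_vector) \<Rightarrow> bool" where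
  "Ck_on 0 U f \<longleftrightarrow> continuous_on U f"
| "Ck_on (Suc k) U f \<longleftrightarrow> (\<forall>x\<in>U. f differentiable (at x)) \<and>
     (\<forall>b\<in>Basis. Ck_on k U (\<lambda>x. frechet_derivative f (at x) b))"

definition smooth_on :: "'a::euclidean_space set \<Rightarrow> ('a \<Rightarrow> 'b::real_normed_vector) \<Rightarrow> bool" where
  "smooth_on U f \<longleftrightarrow> (\<forall>k. Ck_on k U f)"

definition closed_support :: "'a::topological_space set \<Rightarrow> ('a \<Rightarrow> real) \<Rightarrow> 'a set" where
  "closed_support X f = closure (support_on X f)"

definition ennpowr :: "ennreal \<Rightarrow> real \<Rightarrow> ennreal" where
  "ennpowr x a = (if x = \<infinity> then \<infinity> else ennreal (enn2real x powr a))"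

definition Lnorm :: "ennreal \<Rightarrow> (real^3 \<Rightarrow> complex) \<Rightarrow> ennreal" where
  "Lnorm q f =
     (if q = \<infinity> then esssup lborel (\<lambda>x. ennreal (norm (f x)))
      else ennpowr (\<integral>\<^sup>+x. ennreal (norm (f x) powr enn2real q) \<partial>lborel) (1 / enn2real q))"

section \<open>Fourier multipliers\<close>

definition fourier :: "(real^3 \<Rightarrow> complex) \<Rightarrow> real^3 \<Rightarrow> complex" where
  "fourier f \<xi> = (LINT x|lborel. f x * cis (- (x \<bullet> \<xi>)))"

definition inv_fourier :: "(real^3 \<Rightarrow> complex) \<Rightarrow> real^3 \<Rightarrow> complex" where
  "inv_fourier g x = (LINT \<xi>|lborel. g \<xi> * cis (x \<bullet> \<xi>)) / of_real ((2 * pi) ^ 3)"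

text \<open>Functions that define a tempered distribution by absolutely convergent integration. This
  contains every \<open>L\<^sup>p\<close> space, \<open>1 \<le> p \<le> \<infinity>\<close>.\<close>

definition tempered_fun :: "(real^3 \<Rightarrow> complex) \<Rightarrow> bool" where
  "tempered_fun \<phi> \<longleftrightarrow> \<phi> \<in> borel_measurable lborel \<and>
     (\<exists>M::nat. integrable lborel (\<lambda>x. \<phi> x / of_real ((1 + norm x) ^ M)))"

text \<open>The Fourier transform of a tempered \<open>\<phi>\<close> is the distribution \<open>g \<mapsto> \<integral> \<phi> \<cdot> fourier g\<close>.\<close>

definition fourier_pairing :: "(real^3 \<Rightarrow> complex) \<Rightarrow> (real^3 \<Rightarrow> complex) \<Rightarrow> complex" where
  "fourier_pairing \<phi> g = (LINT y|lborel. \<phi> y * fourier g y)"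

text \<open>The inverse Fourier transform of \<open>m\<close> times the Fourier transform of \<open>\<phi>\<close>, for a symbol
  \<open>m\<close> that is smooth with compact support. The product is then a compactly supported
  distribution, so its inverse Fourier transform is the function obtained by pairing with the
  exponentials. For integrable \<open>\<phi>\<close> this is the usual formula, see the lemma below.\<close>

definition fourier_mult :: "(real^3 \<Rightarrow> real) \<Rightarrow> (real^3 \<Rightarrow> complex) \<Rightarrow> real^3 \<Rightarrow> complex" where
  "fourier_mult m \<phi> x =
     fourier_pairing \<phi> (\<lambda>\<xi>. of_real (m \<xi>) * cis (x \<bullet> \<xi>)) / of_real ((2 * pi) ^ 3)"

lemma cis_inner_measurable [measurable]:
  assumes [measurable]: "f \<in> borel_measurable M" "g \<in> borel_measurable M"
  shows "(\<lambda>x. cis (f x \<bullet> (g x :: real^3))) \<in> borel_measurable M"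
  unfolding cis_conv_exp by measurable

lemma fourier_mult_eq_inv_fourier:
  assumes \<phi>: "integrable lborel \<phi>" and m: "integrable lborel m"
  shows "fourier_mult m \<phi> x = inv_fourier (\<lambda>\<xi>. of_real (m \<xi>) * fourier \<phi> \<xi>) x"
proof -
  define h where "h = (\<lambda>(y, \<xi>). \<phi> y * (complex_of_real (m \<xi>) * cis (x \<bullet> \<xi>) * cis ((- \<xi>) \<bullet> y)))"
  have [measurable]: "\<phi> \<in> borel_measurable borel" "m \<in> borel_measurable borel"
    using \<phi> m by auto
  have h_meas: "h \<in> borel_measurable (lborel \<Otimes>\<^sub>M lborel)"
    unfolding h_def by measurable
  have "integrable (lborel \<Otimes>\<^sub>M lborel) h"
  proof (rule lborel_pair.Fubini_integrable[OF h_meas])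
    have "(LINT \<xi>|lborel. norm (h (y, \<xi>))) = norm (\<phi> y) * (LINT \<xi>|lborel. \<bar>m \<xi>\<bar>)" for y
      by (simp add: h_def norm_mult)
    then show "integrable lborel (\<lambda>y. LINT \<xi>|lborel. norm (h (y, \<xi>)))"
      using \<phi> by simp
    have "integrable lborel (\<lambda>\<xi>. h (y, \<xi>))" for y
    proof (rule Bochner_Integration.integrable_bound)
      show "integrable lborel (\<lambda>\<xi>. norm (\<phi> y) * \<bar>m \<xi>\<bar>)"
        using m by auto
      show "(\<lambda>\<xi>. h (y, \<xi>)) \<in> borel_measurable lborel"
        unfolding h_def split by measurable
    qed (auto simp: h_def norm_mult)
    then show "AE y in lborel. integrable lborel (\<lambda>\<xi>. h (y, \<xi>))"
      by simp
  qed
  then have int: "integrable (lborel \<Otimes>\<^sub>M lborel)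
      (\<lambda>(y, \<xi>). \<phi> y * (complex_of_real (m \<xi>) * cis (x \<bullet> \<xi>) * cis ((- \<xi>) \<bullet> y)))"
    by (simp add: h_def)
  have "(LINT y|lborel. \<phi> y * fourier (\<lambda>\<xi>. of_real (m \<xi>) * cis (x \<bullet> \<xi>)) y)
     = (LINT y|lborel. LINT \<xi>|lborel. \<phi> y * (of_real (m \<xi>) * cis (x \<bullet> \<xi>) * cis ((- \<xi>) \<bullet> y)))"
    by (simp add: fourier_def)
  also have "\<dots> = (LINT \<xi>|lborel. LINT y|lborel. \<phi> y * (of_real (m \<xi>) * cis (x \<bullet> \<xi>) * cis ((- \<xi>) \<bullet> y)))"
    using lborel_pair.Fubini_integral[OF int] by simp
  also have "\<dots> = (LINT \<xi>|lborel. of_real (m \<xi>) * fourier \<phi> \<xi> * cis (x \<bullet> \<xi>))"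
  proof (rule Bochner_Integration.integral_cong[OF refl])
    fix \<xi>
    have "(LINT y|lborel. \<phi> y * (of_real (m \<xi>) * cis (x \<bullet> \<xi>) * cis ((- \<xi>) \<bullet> y)))
      = (LINT y|lborel. (of_real (m \<xi>) * cis (x \<bullet> \<xi>)) * (\<phi> y * cis (- (y \<bullet> \<xi>))))"
      by (intro Bochner_Integration.integral_cong) (auto simp: inner_commute mult_ac)
    also have "\<dots> = (of_real (m \<xi>) * cis (x \<bullet> \<xi>)) * fourier \<phi> \<xi>"
      unfolding fourier_def by (rule integral_mult_right_zero)
    finally show "(LINT y|lborel. \<phi> y * (of_real (m \<xi>) * cis (x \<bullet> \<xi>) * cis ((- \<xi>) \<bullet> y)))
      = of_real (m \<xi>) * fourier \<phi> \<xi> * cis (x \<bullet> \<xi>)"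
      by (simp only: mult_ac)
  qed
  finally show ?thesis
    by (simp add: fourier_mult_def fourier_pairing_def inv_fourier_def)
qed

section \<open>Dyadic cut-offs and rotation fields\<close>

definition dyadic_cutoff :: "(real^3 \<Rightarrow> real) \<Rightarrow> int \<Rightarrow> real^3 \<Rightarrow> real" where
  "dyadic_cutoff chi k x = chi (2 powr (- k) *\<^sub>R x) - chi (2 powr (- (k - 1)) *\<^sub>R x)"

abbreviation LP :: "(real^3 \<Rightarrow> real) \<Rightarrow> int \<Rightarrow> (real^3 \<Rightarrow> complex) \<Rightarrow> real^3 \<Rightarrow> complex" where
  "LP chi k \<phi> \<equiv> fourier_mult (dyadic_cutoff chi k) \<phi>"

definition partial :: "3 \<Rightarrow> (real^3 \<Rightarrow> complex) \<Rightarrow> real^3 \<Rightarrow> complex" where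
  "partial j f x = frechet_derivative f (at x) (axis j 1)"

definition Omega :: "3 \<Rightarrow> 3 \<Rightarrow> (real^3 \<Rightarrow> complex) \<Rightarrow> real^3 \<Rightarrow> complex" where
  "Omega i j f x = of_real (x $ i) * partial j f x - of_real (x $ j) * partial i f x"

section \<open>Angular cut-offs\<close>

text \<open>Here \<open>sgn x\<close> is the direction \<open>x / \<bar>x\<bar>\<close>. Since \<open>cap\<close> only sees \<open>\<bar>sgn x \<times> a\<bar>\<close>, it is
  supported near both \<open>a\<close> and \<open>- a\<close>.\<close>

definition cap :: "(real \<Rightarrow> real) \<Rightarrow> real \<Rightarrow> real^3 \<Rightarrow> real^3 \<Rightarrow> real" where
  "cap \<sigma> s a x = \<sigma> (2 powr (- s) * norm (cross3 (sgn x) a))"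

definition angular_cutoff ::
  "(real \<Rightarrow> real) \<Rightarrow> real \<Rightarrow> (real^3) set \<Rightarrow> real^3 \<Rightarrow> real^3 \<Rightarrow> real" where
  "angular_cutoff \<sigma> \<rho> S \<beta> x = cap \<sigma> \<rho> \<beta> x / (\<Sum>\<beta>'\<in>S. cap \<sigma> \<rho> \<beta>' x)"

text \<open>The requirements on the set \<open>S\<close> of directions at scale \<open>\<rho>\<close>, all comparabilities holding
  with the constant \<open>A\<close>.\<close>

definition angular_net :: "(real \<Rightarrow> real) \<Rightarrow> real \<Rightarrow> real \<Rightarrow> (real^3) set \<Rightarrow> bool" where
  "angular_net \<sigma> A \<rho> S \<longleftrightarrow>
     finite S \<and> S \<subseteq> sphere 0 1 \<and>
     2 powr (- 2 * \<rho>) / A \<le> card S \<and> card S \<le> A * 2 powr (- 2 * \<rho>) \<and>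
     (\<forall>x\<in>sphere 0 1. \<exists>\<beta>\<in>S. norm (cross3 x \<beta>) \<le> 2 powr \<rho>) \<and>
     (\<forall>u. u \<in> borel_measurable lborel \<and> Lnorm 2 u < \<infinity> \<longrightarrow>
        (let sq = ennpowr (\<Sum>\<beta>\<in>S. (Lnorm 2 (\<lambda>x. of_real (angular_cutoff \<sigma> \<rho> S \<beta> x) * u x))\<^sup>2) (1/2)
         in Lnorm 2 u \<le> ennreal A * sq \<and> sq \<le> ennreal A * Lnorm 2 u))"

text \<open>The indices \<open>r\<close> are integers. At \<open>r = 0\<close> the constant \<open>C3\<close> is replaced by \<open>C3'\<close>.\<close>

definition scales :: "real \<Rightarrow> real \<Rightarrow> int set" where
  "scales C1 \<rho> = {r. \<rho> + C1 \<le> real_of_int r \<and> r \<le> 0}"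

definition eta_tilde ::
  "(real \<Rightarrow> real) \<Rightarrow> real \<Rightarrow> real \<Rightarrow> (int \<Rightarrow> nat \<Rightarrow> real^3) \<Rightarrow> int \<Rightarrow> nat \<Rightarrow> real^3 \<Rightarrow> real" where
  "eta_tilde \<sigma> C3 C3' \<alpha> r l = cap \<sigma> (real_of_int r - (if r = 0 then C3' else C3)) (\<alpha> r l)"

definition eta_tilde_sum ::
  "(real \<Rightarrow> real) \<Rightarrow> real \<Rightarrow> real \<Rightarrow> real \<Rightarrow> real \<Rightarrow> nat \<Rightarrow> real \<Rightarrow> real^3 \<Rightarrow>
   (int \<Rightarrow> nat \<Rightarrow> real^3) \<Rightarrow> real^3 \<Rightarrow> real" where
  "eta_tilde_sum \<sigma> C1 C2 C3 C3' N \<rho> \<beta> \<alpha> \<xi> =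
     cap \<sigma> (\<rho> + C2) \<beta> \<xi> + (\<Sum>r\<in>scales C1 \<rho>. \<Sum>l=1..N. eta_tilde \<sigma> C3 C3' \<alpha> r l \<xi>)"

definition eta_core ::
  "(real \<Rightarrow> real) \<Rightarrow> real \<Rightarrow> real \<Rightarrow> real \<Rightarrow> real \<Rightarrow> nat \<Rightarrow> real \<Rightarrow> real^3 \<Rightarrow>
   (int \<Rightarrow> nat \<Rightarrow> real^3) \<Rightarrow> real^3 \<Rightarrow> real" where
  "eta_core \<sigma> C1 C2 C3 C3' N \<rho> \<beta> \<alpha> \<xi> =
     cap \<sigma> (\<rho> + C2) \<beta> \<xi> / eta_tilde_sum \<sigma> C1 C2 C3 C3' N \<rho> \<beta> \<alpha> \<xi>"

definition eta ::
  "(real \<Rightarrow> real) \<Rightarrow> real \<Rightarrow> real \<Rightarrow> real \<Rightarrow> real \<Rightarrow> nat \<Rightarrow> real \<Rightarrow> real^3 \<Rightarrow>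
   (int \<Rightarrow> nat \<Rightarrow> real^3) \<Rightarrow> int \<Rightarrow> nat \<Rightarrow> real^3 \<Rightarrow> real" where
  "eta \<sigma> C1 C2 C3 C3' N \<rho> \<beta> \<alpha> r l \<xi> =
     eta_tilde \<sigma> C3 C3' \<alpha> r l \<xi> / eta_tilde_sum \<sigma> C1 C2 C3 C3' N \<rho> \<beta> \<alpha> \<xi>"

text \<open>The functions \<open>eta_core\<close> and \<open>eta\<close> form a Whitney-type partition of unity on the sphere. The
  lower bound on the normalising sum is what makes them a partition of unity, uniformly in
  \<open>\<rho>\<close> and \<open>\<beta>\<close>. If \<open>\<sigma> \<ge> 0\<close> and the regions where the caps equal \<open>1\<close> cover the sphere, it holds
  with \<open>A = 1\<close>. Supports are taken on the sphere because functions that are homogeneous of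
  degree \<open>0\<close> have the origin in their support in space.\<close>

definition whitney_partition ::
  "(real \<Rightarrow> real) \<Rightarrow> real \<Rightarrow> real \<Rightarrow> real \<Rightarrow> real \<Rightarrow> real \<Rightarrow> real \<Rightarrow> nat \<Rightarrow> real \<Rightarrow> (real^3) set \<Rightarrow>
   real^3 \<Rightarrow> (int \<Rightarrow> nat \<Rightarrow> real^3) \<Rightarrow> bool" where
  "whitney_partition \<sigma> A C1 C2 C3 C3' C4 N \<rho> S \<beta> \<alpha> \<longleftrightarrow>
     (let \<eta>core = eta_core \<sigma> C1 C2 C3 C3' N \<rho> \<beta> \<alpha>;
          \<eta> = eta \<sigma> C1 C2 C3 C3' N \<rho> \<beta> \<alpha>;
          supp = closed_support (sphere 0 1)
      in
      (\<forall>\<xi>\<in>sphere 0 1. 1 / A \<le> eta_tilde_sum \<sigma> C1 C2 C3 C3' N \<rho> \<beta> \<alpha> \<xi>) \<and>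
      (\<forall>r\<in>scales C1 \<rho>. \<forall>l\<in>{1..N}.
         \<alpha> r l \<in> sphere 0 1 \<and>
         2 powr r / A \<le> norm (cross3 (\<alpha> r l) \<beta>) \<and> norm (cross3 (\<alpha> r l) \<beta>) \<le> A * 2 powr r \<and>
         (\<forall>x\<in>supp (angular_cutoff \<sigma> \<rho> S \<beta>). \<forall>\<xi>\<in>supp (\<eta> r l).
            2 powr r / A \<le> norm (cross3 x \<xi>)) \<and>
         (\<forall>r'\<in>scales C1 \<rho>. \<forall>l'\<in>{1..N}. C4 \<le> \<bar>real_of_int (r - r')\<bar> \<longrightarrow> supp (\<eta> r' l') \<inter> supp (\<eta> r l) = {}) \<and>
         (\<rho> + C4 \<le> real_of_int r \<longrightarrow> supp \<eta>core \<inter> supp (\<eta> r l) = {})))"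

end

(*
  For a unit vector e put m(xi) = eta(xi) (e x xi) / |e x xi|^2, so that eta = (e x xi) . m. With
  e = x / |x| this writes |x| eta(D) phi_k at x as a sum of m_n(D) applied to the components of
  x x grad phi_k. Replacing x by y + (x - y) under the convolution turns y x grad into the rotation
  fields, while the factor x - y costs only the decay of the kernel. On the supports of the two
  angular cut-offs |e x xi| >~ 2^(k+r), and m times 2^(k+r) is a bump function adapted to a box of
  size 2^k along alpha_{r,l} and 2^(k+r) across, uniformly in all parameters; x - y is at most of
  size 2^(-k-r) there, which cancels the gradient up to a further 2^(-r). Hence all kernels are
  dominated by 2^(-k-2r) times an L^1-normalised weight, and Young's inequality gives the bound.
*)

theory Submission
  imports Defs "HOL-Probability.Characteristic_Functions" "HOL-Probability.Sinc_Integral"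
begin

section \<open>Derivatives bounded uniformly in a parameter\<close>

text \<open>The direction e changes with the point x, so the rewritten operator is not a
  convolution: every x brings the kernel of another multiplier. Young's inequality still applies
  because the dominating weight depends only on k, r and a frame with first axis alpha_{r,l}, never
  on e. Hence all estimates are about families of functions, with constants chosen before the
  parameter. Two things threaten this uniformity. The normalising sum of the partition has more and
  more terms as rho decreases; near the support of one piece all but boundedly many vanish, by the
  disjointness of the supports. And e may lie much farther than 2^r from the line through
  alpha_{r,l}, so that |e x xi| / 2^(k+r) has no upper bound; it is divided by its actual size, and
  the surplus only makes the symbol smaller. Mixed derivatives never occur: decay of order eight
  along each axis of the box already dominates the three Cauchy factors of the weight together with
  one linear factor, which pays for x - y.\<close>

text \<open>Only derivatives along the single direction \<open>b i\<close> are needed, and all bounds are uniform in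
  the parameter \<open>i\<close>. Scaling \<open>b i\<close> encodes the size of the region on which \<open>f i\<close> lives.\<close>

primrec bdd_derivs :: "nat \<Rightarrow> ('i \<Rightarrow> 'a::real_normed_vector set) \<Rightarrow> ('i \<Rightarrow> 'a) \<Rightarrow> ('i \<Rightarrow> 'a \<Rightarrow> real) \<Rightarrow> bool"
  where
  "bdd_derivs 0 V b f \<longleftrightarrow> (\<exists>C. \<forall>i. \<forall>x\<in>V i. \<bar>f i x\<bar> \<le> C)"
| "bdd_derivs (Suc n) V b f \<longleftrightarrow> (\<exists>C. \<forall>i. \<forall>x\<in>V i. \<bar>f i x\<bar> \<le> C) \<and>
     (\<exists>f'. (\<forall>i. \<forall>x\<in>V i. ((\<lambda>t. f i (x + t *\<^sub>R b i)) has_real_derivative f' i x) (at 0)) \<and>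
       bdd_derivs n V b f')"

lemma bdd_derivs_bounded: "bdd_derivs n V b f \<Longrightarrow> \<exists>C. \<forall>i. \<forall>x\<in>V i. \<bar>f i x\<bar> \<le> C"
  by (cases n) auto

lemma bdd_derivs_SucE:
  assumes "bdd_derivs (Suc n) V b f"
  obtains f' where "\<And>i x. x \<in> V i \<Longrightarrow> ((\<lambda>t. f i (x + t *\<^sub>R b i)) has_real_derivative f' i x) (at 0)"
    "bdd_derivs n V b f'"
  using assms unfolding bdd_derivs.simps by blast

lemma bdd_derivs_SucI:
  assumes "\<And>i x. x \<in> V i \<Longrightarrow> \<bar>f i x\<bar> \<le> C"
    "\<And>i x. x \<in> V i \<Longrightarrow> ((\<lambda>t. f i (x + t *\<^sub>R b i)) has_real_derivative f' i x) (at 0)"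
    "bdd_derivs n V b f'"
  shows "bdd_derivs (Suc n) V b f"
  unfolding bdd_derivs.simps using assms by blast

lemma bdd_derivs_SucD: "bdd_derivs (Suc n) V b f \<Longrightarrow> bdd_derivs n V b f"
proof (induction n arbitrary: f)
  case 0
  then show ?case by simp
next
  case (Suc n)
  obtain f' where f': "\<And>i x. x \<in> V i \<Longrightarrow> ((\<lambda>t. f i (x + t *\<^sub>R b i)) has_real_derivative f' i x) (at 0)" "bdd_derivs (Suc n) V b f'"
    by (rule bdd_derivs_SucE[OF Suc.prems]) (rule that)
  obtain C where "\<And>i x. x \<in> V i \<Longrightarrow> \<bar>f i x\<bar> \<le> C"
    using bdd_derivs_bounded[OF Suc.prems(1)] by blast
  then show ?case
    using f'(1) Suc.IH[OF f'(2)] by (rule bdd_derivs_SucI)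
qed

lemma bdd_derivs_subset:
  "bdd_derivs n V b f \<Longrightarrow> (\<And>i. U i \<subseteq> V i) \<Longrightarrow> bdd_derivs n U b f"
proof (induction n arbitrary: f)
  case 0 then show ?case by (auto; blast)
next
  case (Suc n)
  obtain f' where f': "\<And>i x. x \<in> V i \<Longrightarrow> ((\<lambda>t. f i (x + t *\<^sub>R b i)) has_real_derivative f' i x) (at 0)"
    "bdd_derivs n V b f'" by (rule bdd_derivs_SucE[OF Suc.prems(1)]) (rule that)
  obtain C where "\<And>i x. x \<in> V i \<Longrightarrow> \<bar>f i x\<bar> \<le> C"
    using bdd_derivs_bounded[OF Suc.prems(1)] by blast
  then show ?case
    using f' Suc.prems(2) by (intro bdd_derivs_SucI[where f' = f' and C = C] Suc.IH) (meson subsetD)+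
qed

text \<open>The bound is asked only where \<open>V i\<close> is nonempty, so parameters outside the
  admissible range impose nothing.\<close>

lemma bdd_derivs_const:
  assumes "\<And>i. V i \<noteq> {} \<Longrightarrow> \<bar>c i\<bar> \<le> C"
  shows "bdd_derivs n V b (\<lambda>i x. c i)"
  using assms
proof (induction n arbitrary: c C)
  case 0 then show ?case by (auto intro!: exI[of _ C])
next
  case (Suc n)
  show ?case
    by (rule bdd_derivs_SucI[where f' = "\<lambda>i x. 0" and C = C], use Suc.prems in blast, simp, rule Suc.IH[of _ 0]) simp
qed

lemma bdd_derivs_linear:
  assumes "\<And>i. linear (l i)" "\<And>i x. x \<in> V i \<Longrightarrow> \<bar>l i x\<bar> \<le> C" "\<And>i. V i \<noteq> {} \<Longrightarrow> \<bar>l i (b i)\<bar> \<le> C'"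
  shows "bdd_derivs n V b l"
proof (cases n)
  case 0 then show ?thesis using assms by auto
next
  case (Suc m)
  show ?thesis unfolding Suc
  proof (rule bdd_derivs_SucI[where f' = "\<lambda>i x. l i (b i)" and C = C])
    show "bdd_derivs m V b (\<lambda>i x. l i (b i))"
      using assms(3) by (rule bdd_derivs_const)
    show "((\<lambda>t. l i (x + t *\<^sub>R b i)) has_real_derivative l i (b i)) (at 0)" for i x
      unfolding linear_add[OF assms(1)] linear_cmul[OF assms(1)]
      by (auto intro!: derivative_eq_intros)
  qed (use assms in auto)
qed

section \<open>Algebra and composition of uniformly bounded families\<close>

lemma bdd_derivs_add:
  "bdd_derivs n V b f \<Longrightarrow> bdd_derivs n V b g \<Longrightarrow> bdd_derivs n V b (\<lambda>i x. f i x + g i x)"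
proof (induction n arbitrary: f g)
  case 0
  then obtain C D where "\<And>i x. x \<in> V i \<Longrightarrow> \<bar>f i x\<bar> \<le> C" "\<And>i x. x \<in> V i \<Longrightarrow> \<bar>g i x\<bar> \<le> D" by auto blast
  then have "\<forall>i. \<forall>x\<in>V i. \<bar>f i x + g i x\<bar> \<le> C + D"
    by (intro allI ballI order_trans[OF abs_triangle_ineq] add_mono)
  then show ?case unfolding bdd_derivs.simps by blast
next
  case (Suc n)
  obtain C D where CD: "\<And>i x. x \<in> V i \<Longrightarrow> \<bar>f i x\<bar> \<le> C" "\<And>i x. x \<in> V i \<Longrightarrow> \<bar>g i x\<bar> \<le> D"
    using Suc.prems[THEN bdd_derivs_bounded] by blast
  obtain f' where f': "\<And>i x. x \<in> V i \<Longrightarrow> ((\<lambda>t. f i (x + t *\<^sub>R b i)) has_real_derivative f' i x) (at 0)" "bdd_derivs n V b f'"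
    by (rule bdd_derivs_SucE[OF Suc.prems(1)]) (rule that)
  obtain g' where g': "\<And>i x. x \<in> V i \<Longrightarrow> ((\<lambda>t. g i (x + t *\<^sub>R b i)) has_real_derivative g' i x) (at 0)" "bdd_derivs n V b g'"
    by (rule bdd_derivs_SucE[OF Suc.prems(2)]) (rule that)
  show ?case
  proof (rule bdd_derivs_SucI[where C = "C + D" and f' = "\<lambda>i x. f' i x + g' i x"])
    show "\<bar>f i x + g i x\<bar> \<le> C + D" if "x \<in> V i" for i x
      using CD that by (intro order_trans[OF abs_triangle_ineq] add_mono)
  qed (auto intro: DERIV_add f' g' Suc.IH)
qed

lemma bdd_derivs_mult:
  "bdd_derivs n V b f \<Longrightarrow> bdd_derivs n V b g \<Longrightarrow> bdd_derivs n V b (\<lambda>i x. f i x * g i x)"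
proof (induction n arbitrary: f g)
  case 0
  obtain C D where CD: "\<And>i x. x \<in> V i \<Longrightarrow> \<bar>f i x\<bar> \<le> C" "\<And>i x. x \<in> V i \<Longrightarrow> \<bar>g i x\<bar> \<le> D"
    using 0[THEN bdd_derivs_bounded] by blast
  have "\<bar>f i x * g i x\<bar> \<le> C * D" if "x \<in> V i" for i x
    unfolding abs_mult using CD[OF that] by (intro mult_mono) auto
  then show ?case unfolding bdd_derivs.simps by blast
next
  case (Suc n)
  obtain C D where CD: "\<And>i x. x \<in> V i \<Longrightarrow> \<bar>f i x\<bar> \<le> C" "\<And>i x. x \<in> V i \<Longrightarrow> \<bar>g i x\<bar> \<le> D"
    using Suc.prems[THEN bdd_derivs_bounded] by blast
  obtain f' where f': "\<And>i x. x \<in> V i \<Longrightarrow> ((\<lambda>t. f i (x + t *\<^sub>R b i)) has_real_derivative f' i x) (at 0)" "bdd_derivs n V b f'"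
    by (rule bdd_derivs_SucE[OF Suc.prems(1)]) (rule that)
  obtain g' where g': "\<And>i x. x \<in> V i \<Longrightarrow> ((\<lambda>t. g i (x + t *\<^sub>R b i)) has_real_derivative g' i x) (at 0)" "bdd_derivs n V b g'"
    by (rule bdd_derivs_SucE[OF Suc.prems(2)]) (rule that)
  show ?case
  proof (rule bdd_derivs_SucI[where C = "C * D" and f' = "\<lambda>i x. f' i x * g i x + g' i x * f i x"])
    show "\<bar>f i x * g i x\<bar> \<le> C * D" if "x \<in> V i" for i x
      unfolding abs_mult using CD[OF that] by (intro mult_mono) auto
    show "((\<lambda>t. f i (x + t *\<^sub>R b i) * g i (x + t *\<^sub>R b i)) has_real_derivative f' i x * g i x + g' i x * f i x) (at 0)"
      if "x \<in> V i" for i x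
      using DERIV_mult'[OF f'(1)[OF that] g'(1)[OF that]] by (simp add: mult.commute add.commute)
    show "bdd_derivs n V b (\<lambda>i x. f' i x * g i x + g' i x * f i x)"
      by (intro bdd_derivs_add Suc.IH f'(2) g'(2) Suc.prems[THEN bdd_derivs_SucD])
  qed
qed

lemma bdd_derivs_uminus: "bdd_derivs n V b f \<Longrightarrow> bdd_derivs n V b (\<lambda>i x. - f i x)"
  using bdd_derivs_mult[OF bdd_derivs_const[of V "\<lambda>_. - 1" 1]] by simp

lemma bdd_derivs_diff:
  "bdd_derivs n V b f \<Longrightarrow> bdd_derivs n V b g \<Longrightarrow> bdd_derivs n V b (\<lambda>i x. f i x - g i x)"
  using bdd_derivs_add[OF _ bdd_derivs_uminus] by fastforce

lemma bdd_derivs_power2: "bdd_derivs n V b f \<Longrightarrow> bdd_derivs n V b (\<lambda>i x. (f i x)\<^sup>2)"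
  unfolding power2_eq_square by (rule bdd_derivs_mult)

lemma bdd_derivs_sum:
  "finite J \<Longrightarrow> (\<And>j. j \<in> J \<Longrightarrow> bdd_derivs n V b (f j)) \<Longrightarrow> bdd_derivs n V b (\<lambda>i x. \<Sum>j\<in>J. f j i x)"
  by (induction J rule: finite_induct) (auto intro!: bdd_derivs_add intro: bdd_derivs_const[where C = 0])

text \<open>The derivative \<open>- (1/f) * f' * (1/f)\<close> contains the reciprocal only
  undifferentiated, so the induction runs over the order with \<open>f\<close> fixed.\<close>

lemma bdd_derivs_inverse:
  assumes "0 < c" "\<And>i x. x \<in> V i \<Longrightarrow> c \<le> \<bar>f i x\<bar>"
  shows "bdd_derivs n V b f \<Longrightarrow> bdd_derivs n V b (\<lambda>i x. inverse (f i x))"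
proof (induction n)
  case 0
  have "\<bar>inverse (f i x)\<bar> \<le> inverse c" if "x \<in> V i" for i x
    unfolding abs_inverse by (rule le_imp_inverse_le[OF assms(2)[OF that] assms(1)])
  then show ?case unfolding bdd_derivs.simps by blast
next
  case (Suc n)
  obtain f' where f':
      "\<And>i x. x \<in> V i \<Longrightarrow> ((\<lambda>t. f i (x + t *\<^sub>R b i)) has_real_derivative f' i x) (at 0)" "bdd_derivs n V b f'"
    by (rule bdd_derivs_SucE[OF Suc.prems]) (rule that)
  have IH: "bdd_derivs n V b (\<lambda>i x. inverse (f i x))"
    by (rule Suc.IH[OF bdd_derivs_SucD[OF Suc.prems]])
  show ?case
  proof (rule bdd_derivs_SucI[where C = "inverse c" and f' = "\<lambda>i x. - (inverse (f i x) * f' i x * inverse (f i x))"])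
    show "\<bar>inverse (f i x)\<bar> \<le> inverse c" if "x \<in> V i" for i x
      unfolding abs_inverse by (rule le_imp_inverse_le[OF assms(2)[OF that] assms(1)])
    show "((\<lambda>t. inverse (f i (x + t *\<^sub>R b i))) has_real_derivative - (inverse (f i x) * f' i x * inverse (f i x))) (at 0)"
      if "x \<in> V i" for i x
    proof -
      have ne: "f i (x + 0 *\<^sub>R b i) \<noteq> 0" using assms(1) assms(2)[OF that] by auto
      show ?thesis using DERIV_inverse'[OF f'(1)[OF that] ne] by (simp only: scaleR_zero_left add_0_right)
    qed
    show "bdd_derivs n V b (\<lambda>i x. - (inverse (f i x) * f' i x * inverse (f i x)))"
      by (rule bdd_derivs_uminus[OF bdd_derivs_mult[OF bdd_derivs_mult[OF IH f'(2)] IH]])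
  qed
qed

lemma bdd_derivs_divide:
  assumes "bdd_derivs n V b f" "bdd_derivs n V b g" "0 < c" "\<And>i x. x \<in> V i \<Longrightarrow> c \<le> \<bar>g i x\<bar>"
  shows "bdd_derivs n V b (\<lambda>i x. f i x / g i x)"
  unfolding divide_inverse by (rule bdd_derivs_mult[OF assms(1) bdd_derivs_inverse[OF assms(3,4,2)]])

text \<open>The outer function is a single one, encoded as a family over \<open>unit\<close> so that
  the same predicate applies. The induction generalises over it because the chain rule brings in its
  derivative.\<close>

lemma bdd_derivs_compose:
  assumes "\<And>i x. x \<in> V i \<Longrightarrow> f i x \<in> S"
  shows "bdd_derivs n (\<lambda>_::unit. S) (\<lambda>_. 1) (\<lambda>_. F) \<Longrightarrow> bdd_derivs n V b f \<Longrightarrow> bdd_derivs n V b (\<lambda>i x. F (f i x))"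
proof (induction n arbitrary: F)
  case 0
  then show ?case using assms by auto
next
  case (Suc n)
  obtain C where C: "\<And>t. t \<in> S \<Longrightarrow> \<bar>F t\<bar> \<le> C"
    using bdd_derivs_bounded[OF Suc.prems(1)] by blast
  obtain f' where f': "\<And>i x. x \<in> V i \<Longrightarrow> ((\<lambda>t. f i (x + t *\<^sub>R b i)) has_real_derivative f' i x) (at 0)" "bdd_derivs n V b f'"
    by (rule bdd_derivs_SucE[OF Suc.prems(2)]) (rule that)
  obtain F' where F'0: "\<And>u x. x \<in> S \<Longrightarrow> ((\<lambda>t. F (x + t *\<^sub>R 1)) has_real_derivative F' u x) (at 0)"
      "bdd_derivs n (\<lambda>_::unit. S) (\<lambda>_. 1) F'"
    by (rule bdd_derivs_SucE[OF Suc.prems(1)]) (rule that)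
  then have F': "\<And>x. x \<in> S \<Longrightarrow> ((\<lambda>t. F (x + t)) has_real_derivative F' () x) (at 0)"
      "bdd_derivs n (\<lambda>_::unit. S) (\<lambda>_. 1) F'" by auto
  have F'D: "DERIV F x :> F' () x" if "x \<in> S" for x
    using F'(1)[OF that] DERIV_shift[of F "F' () x" 0 x] by (simp add: add.commute)
  show ?case
  proof (rule bdd_derivs_SucI[where C = C and f' = "\<lambda>i x. F' () (f i x) * f' i x"])
    show "\<bar>F (f i x)\<bar> \<le> C" if "x \<in> V i" for i x using C assms that by auto
    show "((\<lambda>t. F (f i (x + t *\<^sub>R b i))) has_real_derivative F' () (f i x) * f' i x) (at 0)"
      if "x \<in> V i" for i x
      using F'D[OF assms[OF that]] f'(1)[OF that] by (intro DERIV_chain2) auto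
    have eq: "(\<lambda>_. F' ()) = F'" by (auto simp: fun_eq_iff)
    have F'3: "bdd_derivs n (\<lambda>_::unit. S) (\<lambda>_. 1) (\<lambda>_. F' ())"
      unfolding eq by (rule F'(2))
    show "bdd_derivs n V b (\<lambda>i x. F' () (f i x) * f' i x)"
      by (rule bdd_derivs_mult[OF Suc.IH[OF F'3 bdd_derivs_SucD[OF Suc.prems(2)]] f'(2)])
  qed
qed

section \<open>Locality, gluing and sums over parameter-dependent index sets\<close>

lemma DERIV_line_cong:
  fixes V :: "'a::real_normed_vector set"
  assumes "open V" "x \<in> V" "\<And>y. y \<in> V \<Longrightarrow> f y = (g y :: real)"
  shows "((\<lambda>t. f (x + t *\<^sub>R b)) has_real_derivative d) (at 0) \<longleftrightarrow> ((\<lambda>t. g (x + t *\<^sub>R b)) has_real_derivative d) (at 0)"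
proof -
  have "((\<lambda>t. x + t *\<^sub>R b) \<longlongrightarrow> x + 0 *\<^sub>R b) (at 0)"
    by (intro tendsto_add tendsto_const tendsto_scaleR tendsto_ident_at)
  then have "\<forall>\<^sub>F t in at 0. x + t *\<^sub>R b \<in> V"
    using assms by (auto dest: topological_tendstoD)
  then have "\<forall>\<^sub>F t in nhds 0. x + t *\<^sub>R b \<in> V"
    using assms(2) by (auto simp: eventually_nhds_conv_at)
  then have "\<forall>\<^sub>F t in nhds 0. f (x + t *\<^sub>R b) = g (x + t *\<^sub>R b)"
    by (rule eventually_mono) (use assms in auto)
  then show ?thesis
    by (intro DERIV_cong_ev) auto
qed

lemma bdd_derivs_cong:
  assumes "\<And>i. open (V i)" "\<And>i x. x \<in> V i \<Longrightarrow> f i x = g i x" "bdd_derivs n V b f"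
  shows "bdd_derivs n V b g"
proof (cases n)
  case 0
  then show ?thesis using assms by auto
next
  case (Suc m)
  obtain C where C: "\<And>i x. x \<in> V i \<Longrightarrow> \<bar>f i x\<bar> \<le> C"
    using bdd_derivs_bounded[OF assms(3)] by blast
  obtain f' where f':
      "\<And>i x. x \<in> V i \<Longrightarrow> ((\<lambda>t. f i (x + t *\<^sub>R b i)) has_real_derivative f' i x) (at 0)" "bdd_derivs m V b f'"
    by (rule bdd_derivs_SucE[OF assms(3)[unfolded Suc]]) (rule that)
  show ?thesis unfolding Suc
  proof (rule bdd_derivs_SucI[where C = C and f' = f'])
    show "\<bar>g i x\<bar> \<le> C" if "x \<in> V i" for i x using C[OF that] assms(2)[OF that] by simp
    show "((\<lambda>t. g i (x + t *\<^sub>R b i)) has_real_derivative f' i x) (at 0)" if "x \<in> V i" for i x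
      using DERIV_line_cong[OF assms(1) that, of "f i" "g i"] assms(2) f'(1)[OF that] by blast
  qed (rule f')
qed

text \<open>On the overlap both derivative families differentiate the same function, so they agree
  and can be glued. Openness makes the glued family differentiable again at the next order.\<close>

lemma bdd_derivs_Un:
  assumes "\<And>i. open (V i)" "\<And>i. open (W i)"
  shows "bdd_derivs n V b f \<Longrightarrow> bdd_derivs n W b f \<Longrightarrow> bdd_derivs n (\<lambda>i. V i \<union> W i) b f"
proof (induction n arbitrary: f)
  case 0
  then obtain C D where "\<And>i x. x \<in> V i \<Longrightarrow> \<bar>f i x\<bar> \<le> C" "\<And>i x. x \<in> W i \<Longrightarrow> \<bar>f i x\<bar> \<le> D" by auto blast
  then have "\<forall>i. \<forall>x\<in>V i \<union> W i. \<bar>f i x\<bar> \<le> max C D" by fastforce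
  then show ?case unfolding bdd_derivs.simps by blast
next
  case (Suc n)
  obtain C D where "\<And>i x. x \<in> V i \<Longrightarrow> \<bar>f i x\<bar> \<le> C" "\<And>i x. x \<in> W i \<Longrightarrow> \<bar>f i x\<bar> \<le> D"
    using Suc.prems[THEN bdd_derivs_bounded] by blast
  then have CD: "\<bar>f i x\<bar> \<le> max C D" if "x \<in> V i \<union> W i" for i x
    using that by fastforce
  obtain f' where f': "\<And>i x. x \<in> V i \<Longrightarrow> ((\<lambda>t. f i (x + t *\<^sub>R b i)) has_real_derivative f' i x) (at 0)" "bdd_derivs n V b f'"
    by (rule bdd_derivs_SucE[OF Suc.prems(1)]) (rule that)
  obtain g' where g': "\<And>i x. x \<in> W i \<Longrightarrow> ((\<lambda>t. f i (x + t *\<^sub>R b i)) has_real_derivative g' i x) (at 0)" "bdd_derivs n W b g'"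
    by (rule bdd_derivs_SucE[OF Suc.prems(2)]) (rule that)
  define h where "h i x = (if x \<in> V i then f' i x else g' i x)" for i x
  have eq: "h i x = g' i x" if "x \<in> W i" for i x
    using DERIV_unique[OF f'(1) g'(1)] that by (auto simp: h_def)
  show ?case
  proof (rule bdd_derivs_SucI[OF CD, where f' = h])
    show "((\<lambda>t. f i (x + t *\<^sub>R b i)) has_real_derivative h i x) (at 0)" if "x \<in> V i \<union> W i" for i x
      using that f'(1) g'(1) by (auto simp: h_def)
    show "bdd_derivs n (\<lambda>i. V i \<union> W i) b h"
    proof (rule Suc.IH)
      show "bdd_derivs n V b h"
        by (rule bdd_derivs_cong[OF assms(1) _ f'(2)]) (simp add: h_def)
      show "bdd_derivs n W b h"
        by (rule bdd_derivs_cong[OF assms(2) _ g'(2)]) (simp add: eq)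
    qed
  qed
qed

text \<open>A case distinction on the parameter, encoded by emptying the domain for the parameters
  of the other case.\<close>

lemma bdd_derivs_cases:
  assumes "\<And>i. open (V i)"
    "bdd_derivs n (\<lambda>i. if Q i then V i else {}) b f" "bdd_derivs n (\<lambda>i. if Q i then {} else V i) b f"
  shows "bdd_derivs n V b f"
proof (rule bdd_derivs_subset[OF bdd_derivs_Un[OF _ _ assms(2,3)]])
  show "open (if Q i then V i else {})" "open (if Q i then {} else V i)"
    "V i \<subseteq> (if Q i then V i else {}) \<union> (if Q i then {} else V i)" for i
    using assms(1) by auto
qed

text \<open>The index set may vary with the parameter as long as its size stays bounded. The
  summation index becomes part of the parameter, which makes the bounds on the terms uniform in it
  as well.\<close>

lemma bdd_derivs_sum_dependent:
  assumes fin: "\<And>i. V i \<noteq> {} \<Longrightarrow> finite (J i) \<and> card (J i) \<le> M"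
  shows "bdd_derivs n (\<lambda>(i, j). if j \<in> J i then V i else {}) (\<lambda>(i, j). b i) (\<lambda>(i, j). f i j) \<Longrightarrow>
    bdd_derivs n V b (\<lambda>i x. \<Sum>j\<in>J i. f i j x)"
proof (induction n arbitrary: f)
  case 0
  obtain C where C1: "\<forall>ij. \<forall>x\<in>(case ij of (i, j) \<Rightarrow> if j \<in> J i then V i else {}). \<bar>(case ij of (i, j) \<Rightarrow> f i j) x\<bar> \<le> C"
    using bdd_derivs_bounded[OF 0] by (rule exE)
  have C0: "\<And>ij x. x \<in> (case ij of (i, j) \<Rightarrow> if j \<in> J i then V i else {}) \<Longrightarrow>
      \<bar>(case ij of (i, j) \<Rightarrow> f i j) x\<bar> \<le> C"
    using C1 by blast
  have C: "\<bar>f i j x\<bar> \<le> C" if "x \<in> V i" "j \<in> J i" for i j x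
    using C0[of x "(i, j)"] that by simp
  have "\<bar>\<Sum>j\<in>J i. f i j x\<bar> \<le> M * \<bar>C\<bar>" if "x \<in> V i" for i x
  proof -
    have "\<bar>\<Sum>j\<in>J i. f i j x\<bar> \<le> (\<Sum>j\<in>J i. \<bar>C\<bar>)"
      using order_trans[OF C[OF that] abs_ge_self] by (intro order_trans[OF sum_abs] sum_mono)
    also have "\<dots> = card (J i) * \<bar>C\<bar>" by simp
    also have "\<dots> \<le> M * \<bar>C\<bar>"
    proof (rule mult_right_mono)
      have "V i \<noteq> {}" using that by blast
      then show "real (card (J i)) \<le> real M" using fin[of i] by simp
    qed simp
    finally show ?thesis .
  qed
  then show ?case unfolding bdd_derivs.simps by blast
next
  case (Suc n)
  obtain C where C1: "\<forall>ij. \<forall>x\<in>(case ij of (i, j) \<Rightarrow> if j \<in> J i then V i else {}). \<bar>(case ij of (i, j) \<Rightarrow> f i j) x\<bar> \<le> C"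
    using bdd_derivs_bounded[OF Suc.prems] by (rule exE)
  have C0: "\<And>ij x. x \<in> (case ij of (i, j) \<Rightarrow> if j \<in> J i then V i else {}) \<Longrightarrow>
      \<bar>(case ij of (i, j) \<Rightarrow> f i j) x\<bar> \<le> C"
    using C1 by blast
  have C: "\<bar>f i j x\<bar> \<le> C" if "x \<in> V i" "j \<in> J i" for i j x
    using C0[of x "(i, j)"] that by simp
  have bd: "\<bar>\<Sum>j\<in>J i. f i j x\<bar> \<le> M * \<bar>C\<bar>" if "x \<in> V i" for i x
  proof -
    have "\<bar>\<Sum>j\<in>J i. f i j x\<bar> \<le> (\<Sum>j\<in>J i. \<bar>C\<bar>)"
      using order_trans[OF C[OF that] abs_ge_self] by (intro order_trans[OF sum_abs] sum_mono)
    also have "\<dots> = card (J i) * \<bar>C\<bar>" by simp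
    also have "\<dots> \<le> M * \<bar>C\<bar>"
    proof (rule mult_right_mono)
      have "V i \<noteq> {}" using that by blast
      then show "real (card (J i)) \<le> real M" using fin[of i] by simp
    qed simp
    finally show ?thesis .
  qed
  obtain f' where f'0: "\<And>ij x. x \<in> (case ij of (i, j) \<Rightarrow> if j \<in> J i then V i else {}) \<Longrightarrow>
      ((\<lambda>t. (case ij of (i, j) \<Rightarrow> f i j) (x + t *\<^sub>R (case ij of (i, j) \<Rightarrow> b i))) has_real_derivative f' ij x) (at 0)"
      "bdd_derivs n (\<lambda>(i, j). if j \<in> J i then V i else {}) (\<lambda>(i, j). b i) f'"
    by (rule bdd_derivs_SucE[OF Suc.prems]) (rule that)
  have f'1: "((\<lambda>t. f i j (x + t *\<^sub>R b i)) has_real_derivative f' (i, j) x) (at 0)" if "x \<in> V i" "j \<in> J i" for i j x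
    using f'0(1)[of x "(i, j)"] that by simp
  show ?case
  proof (rule bdd_derivs_SucI[OF bd, where f' = "\<lambda>i x. \<Sum>j\<in>J i. f' (i, j) x"])
    show "((\<lambda>t. \<Sum>j\<in>J i. f i j (x + t *\<^sub>R b i)) has_real_derivative (\<Sum>j\<in>J i. f' (i, j) x)) (at 0)"
      if "x \<in> V i" for i x
      by (intro DERIV_sum f'1[OF that])
    show "bdd_derivs n V b (\<lambda>i x. \<Sum>j\<in>J i. f' (i, j) x)"
      by (rule Suc.IH) (unfold case_prod_eta, rule f'0(2))
  qed
qed

section \<open>Smooth profiles of radial functions\<close>

lemma Ck_on_continuous: "Ck_on n U f \<Longrightarrow> continuous_on U f"
  by (cases n) (auto simp: continuous_on_eq_continuous_at differentiable_imp_continuous_within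
      intro!: differentiable_imp_continuous_on intro: differentiable_at_imp_differentiable_on)

lemma bdd_derivs_Ck_on:
  fixes f :: "real \<Rightarrow> real"
  assumes "{a..b} \<subseteq> U"
  shows "Ck_on n U f \<Longrightarrow> bdd_derivs n (\<lambda>_::unit. {a<..<b}) (\<lambda>_. 1) (\<lambda>_. f)"
proof (induction n arbitrary: f)
  have bd: "\<exists>C. \<forall>x\<in>{a<..<b}. \<bar>f x\<bar> \<le> C" if "Ck_on n U f" for n and f :: "real \<Rightarrow> real"
  proof -
    have "continuous_on {a..b} f"
      using Ck_on_continuous[OF that] assms by (rule continuous_on_subset)
    then have "bounded (f ` {a..b})"
      using compact_continuous_image compact_imp_bounded by blast
    then obtain C where "\<forall>x\<in>{a..b}. norm (f x) \<le> C"
      unfolding bounded_iff by blast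
    then have "\<forall>x\<in>{a<..<b}. \<bar>f x\<bar> \<le> C" by auto
    then show ?thesis ..
  qed
  {
    case 0
    then show ?case using bd[of 0] by simp
  next
    case (Suc n)
    obtain C where C: "\<forall>x\<in>{a<..<b}. \<bar>f x\<bar> \<le> C"
      using bd[OF Suc.prems] ..
    show ?case
    proof (rule bdd_derivs_SucI[where C = C and f' = "\<lambda>_ x. frechet_derivative f (at x) 1"])
      show "((\<lambda>t. f (x + t *\<^sub>R 1)) has_real_derivative frechet_derivative f (at x) 1) (at 0)"
        if "x \<in> {a<..<b}" for x
      proof -
        have "x \<in> U" using assms that by force
        then have "f differentiable (at x)"
          using Suc.prems by auto
        then have "(f has_derivative frechet_derivative f (at x)) (at x)"
          by (simp add: frechet_derivative_works)
        moreover have "frechet_derivative f (at x) = (\<lambda>h. frechet_derivative f (at x) 1 * h)"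
        proof
          fix h :: real
          have "linear (frechet_derivative f (at x))"
            by (rule linear_frechet_derivative) fact
          from linear_cmul[OF this, of h 1]
          show "frechet_derivative f (at x) h = frechet_derivative f (at x) 1 * h"
            by (simp add: mult.commute)
        qed
        ultimately have "(f has_real_derivative frechet_derivative f (at x) 1) (at x)"
          by (simp add: has_field_derivative_def)
        then show ?thesis
          using DERIV_shift[of f _ 0 x] by (simp add: add.commute)
      qed
      show "bdd_derivs n (\<lambda>_::unit. {a<..<b}) (\<lambda>_. 1) (\<lambda>_ x. frechet_derivative f (at x) 1)"
        using Suc by simp
    qed (use C in auto)
  }
qed

lemma bdd_derivs_sqrt:
  assumes "0 < a"
  shows "bdd_derivs n (\<lambda>_::unit. {a<..<b}) (\<lambda>_. 1) (\<lambda>_. sqrt)"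
proof (induction n)
  case 0
  have "\<forall>x\<in>{a<..<b}. \<bar>sqrt x\<bar> \<le> sqrt b" using assms by auto
  then show ?case by auto
next
  case (Suc n)
  show ?case
  proof (rule bdd_derivs_SucI[where C = "sqrt b" and f' = "\<lambda>_ x. inverse (sqrt x) * (1/2)"])
    show "((\<lambda>t. sqrt (x + t *\<^sub>R 1)) has_real_derivative inverse (sqrt x) * (1/2)) (at 0)"
      if "x \<in> {a<..<b}" for x
      using assms that by (auto intro!: derivative_eq_intros simp: field_simps)
    show "bdd_derivs n (\<lambda>_::unit. {a<..<b}) (\<lambda>_. 1) (\<lambda>_ x. inverse (sqrt x) * (1/2))"
    proof (intro bdd_derivs_mult bdd_derivs_inverse[where c = "sqrt a"])
      show "bdd_derivs n (\<lambda>_::unit. {a<..<b}) (\<lambda>_. 1) (\<lambda>i x. 1 / 2)"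
        by (rule bdd_derivs_const[where C = 1]) simp
    qed (use assms Suc in auto)
  qed (use assms in auto)
qed

text \<open>As a function of the square of its argument, a radial profile that is constant near the
  origin is smooth up to the origin.\<close>

lemma bdd_derivs_square_profile:
  fixes \<sigma> :: "real \<Rightarrow> real"
  assumes sm: "smooth_on {0<..} \<sigma>" and one: "\<And>t. 0 \<le> t \<Longrightarrow> t \<le> 1 \<Longrightarrow> \<sigma> t = 1"
    and zero: "\<And>t. R < t \<Longrightarrow> \<sigma> t = 0" and R: "1 \<le> R"
  obtains \<tau> where "\<And>n. bdd_derivs n (\<lambda>_::unit. UNIV) (\<lambda>_. 1) (\<lambda>_. \<tau>)"
    "\<And>t. 0 \<le> t \<Longrightarrow> \<sigma> t = \<tau> (t\<^sup>2)"
proof -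
  \<comment> \<open>The value 1 is kept for negative arguments too. The profile is then smooth on
    the whole line, and later compositions have no range condition to check.\<close>
  define \<tau> where "\<tau> u = (if u < 1 then 1 else \<sigma> (sqrt u))" for u
  have 1: "bdd_derivs n (\<lambda>_::unit. {1/4<..<(R+2)^2}) (\<lambda>_. 1) (\<lambda>_. \<tau>)" for n
  proof (rule bdd_derivs_cong)
    have sg: "bdd_derivs n (\<lambda>_::unit. {1/4<..<R+3}) (\<lambda>_. 1) (\<lambda>_. \<sigma>)"
      using sm unfolding smooth_on_def by (intro bdd_derivs_Ck_on[where U = "{0<..}"]) (auto simp del: Ck_on.simps)
    have rg: "sqrt x \<in> {1/4<..<R+3}" if x: "x \<in> {1/4<..<(R+2)^2}" for x
    proof -
      have "1/4 < x" "x < (R+2)^2" using x by (simp_all only: greaterThanLessThan_iff)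
      then have "(1/4)\<^sup>2 < x" by (simp add: power2_eq_square)
      then have "1/4 < sqrt x" by (rule real_less_rsqrt)
      moreover have "sqrt x < R + 2"
        by (rule real_less_lsqrt[OF _ \<open>x < (R+2)^2\<close>]) (use R in simp)
      ultimately have "1/4 < sqrt x" "sqrt x < R + 3" by linarith+
      then show ?thesis by (simp only: greaterThanLessThan_iff)
    qed
    show "bdd_derivs n (\<lambda>_::unit. {1/4<..<(R+2)^2}) (\<lambda>_. 1) (\<lambda>_ x. \<sigma> (sqrt x))"
      by (rule bdd_derivs_compose[OF rg sg bdd_derivs_sqrt]) simp_all
    show "\<sigma> (sqrt x) = \<tau> x" if "x \<in> {1/4<..<(R+2)^2}" for x
      using that by (auto simp: \<tau>_def intro!: one)
  qed auto
  have 2: "bdd_derivs n (\<lambda>_::unit. {..<1}) (\<lambda>_. 1) (\<lambda>_. \<tau>)" for n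
    by (rule bdd_derivs_cong[where f = "\<lambda>_ _. 1"]) (auto simp: \<tau>_def intro: bdd_derivs_const[where C = 1])
  have 3: "bdd_derivs n (\<lambda>_::unit. {(R+1)^2<..}) (\<lambda>_. 1) (\<lambda>_. \<tau>)" for n
  proof (rule bdd_derivs_cong[where f = "\<lambda>_ _. 0"])
    show "0 = \<tau> x" if "x \<in> {(R+1)^2<..}" for x
    proof -
      have "R + 1 < sqrt x" using that by (intro real_less_rsqrt) (simp only: greaterThan_iff)
      then have "R < sqrt x" "1 < sqrt x" using R by linarith+
      moreover have "1 < x" using \<open>1 < sqrt x\<close> real_sqrt_less_iff[of 1 x] by simp
      ultimately show ?thesis using zero by (simp add: \<tau>_def)
    qed
  qed (auto intro: bdd_derivs_const[where C = 0])
  \<comment> \<open>Three overlapping open sets cover the line: on one the profile is constant 1, on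
    one constant 0, and in between it is a composition of smooth functions away from the singularity
    of the square root.\<close>
  have "(R+1)^2 < (R+2)^2" using R by (intro power_strict_mono) auto
  then have U: "({1/4<..<(R+2)^2} \<union> {..<1}) \<union> {(R+1)^2<..} = UNIV"
    by auto
  have "bdd_derivs n (\<lambda>_::unit. UNIV) (\<lambda>_. 1) (\<lambda>_. \<tau>)" for n
    unfolding U[symmetric] by (intro bdd_derivs_Un 1 2 3) auto
  moreover have "\<sigma> t = \<tau> (t\<^sup>2)" if "0 \<le> t" for t
  proof (cases "t < 1")
    case True
    then have "t\<^sup>2 < 1" using that by (simp add: power_less_one_iff)
    then show ?thesis using one[of t] that True by (auto simp: \<tau>_def)
  next
    case False
    then have "1 \<le> t\<^sup>2" by simp
    then show ?thesis using that by (auto simp: \<tau>_def)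
  qed
  ultimately show ?thesis using that by blast
qed

lemma bdd_derivs_imp_continuous:
  assumes "bdd_derivs 1 (\<lambda>_::unit. UNIV) (\<lambda>_. 1) (\<lambda>_. \<tau> :: real \<Rightarrow> real)"
  shows "continuous_on UNIV \<tau>"
proof -
  obtain f' where f': "\<And>u x. ((\<lambda>t. \<tau> (x + t *\<^sub>R 1)) has_real_derivative f' (u::unit) x) (at 0)"
    using assms by (auto simp: One_nat_def)
  have "isCont \<tau> x" for x
    using f'[of x "()"] DERIV_shift[of \<tau> "f' () x" 0 x]
    by (auto simp: add.commute intro: DERIV_isCont)
  then show ?thesis by (simp add: continuous_on_eq_continuous_at)
qed

text \<open>\<open>Ck_on\<close> speaks only of derivatives along basis vectors, so the restriction
  to a coordinate axis stays inside the class.\<close>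

lemma Ck_on_line:
  fixes f :: "'a::euclidean_space \<Rightarrow> real"
  assumes e: "e \<in> Basis"
  shows "Ck_on n UNIV f \<Longrightarrow> Ck_on n UNIV (\<lambda>t::real. f (t *\<^sub>R e))"
proof (induction n arbitrary: f)
  case 0
  then show ?case by (auto intro!: continuous_intros elim: continuous_on_compose2)
next
  case (Suc n)
  have der: "((\<lambda>t. f (t *\<^sub>R e)) has_derivative (\<lambda>h. frechet_derivative f (at (t *\<^sub>R e)) (h *\<^sub>R e))) (at t)" for t :: real
  proof -
    have "(f has_derivative frechet_derivative f (at (t *\<^sub>R e))) (at (t *\<^sub>R e))"
      using Suc.prems by (simp add: frechet_derivative_works[symmetric])
    then show ?thesis
      by (rule has_derivative_compose[rotated]) (auto intro!: derivative_eq_intros)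
  qed
  have "frechet_derivative (\<lambda>t. f (t *\<^sub>R e)) (at t) 1 = frechet_derivative f (at (t *\<^sub>R e)) e" for t :: real
    unfolding frechet_derivative_at[OF der[of t], symmetric] by simp
  then have eq: "(\<lambda>t. frechet_derivative (\<lambda>t. f (t *\<^sub>R e)) (at t) 1) = (\<lambda>t. frechet_derivative f (at (t *\<^sub>R e)) e)"
    by blast
  have "Ck_on n UNIV (\<lambda>x. frechet_derivative f (at x) e)"
    using Suc.prems e by simp
  from Suc.IH[OF this] show ?case
    using der by (auto simp: eq differentiable_def)
qed

lemma Ck_on_subset: "Ck_on n U f \<Longrightarrow> V \<subseteq> U \<Longrightarrow> Ck_on n V f"
proof (induction n arbitrary: f)
  case 0
  then show ?case using continuous_on_subset by simp blast
next
  case (Suc n)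
  have "Ck_on n V (\<lambda>x. frechet_derivative f (at x) b)" if "b \<in> Basis" for b
    using Suc.IH[OF _ Suc.prems(2)] Suc.prems(1) that by simp
  moreover have "f differentiable (at x)" if "x \<in> V" for x
    using Suc.prems(1) subsetD[OF Suc.prems(2) that] by simp
  ultimately show ?case unfolding Ck_on.simps by blast
qed

lemma closed_support_zero: "x \<in> X \<Longrightarrow> x \<notin> closed_support X f \<Longrightarrow> f x = 0"
  unfolding closed_support_def support_on_def using closure_subset[of "{x \<in> X. f x \<noteq> 0}"] by auto

text \<open>A radial function is determined by its values on one ray, and along that ray it is
  constant near the origin, so the one-variable result applies.\<close>

lemma smooth_radial_profile:
  fixes chi :: "real^3 \<Rightarrow> real"
  assumes "smooth_on UNIV chi" "\<forall>\<xi> \<zeta>. norm \<xi> = norm \<zeta> \<longrightarrow> chi \<xi> = chi \<zeta>"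
    "closed_support UNIV chi \<subseteq> cball 0 2" "\<forall>\<xi>\<in>cball 0 1. chi \<xi> = 1"
  obtains \<tau> where "\<And>n. bdd_derivs n (\<lambda>_::unit. UNIV) (\<lambda>_. 1) (\<lambda>_. \<tau>)"
    "\<And>\<xi>. chi \<xi> = \<tau> ((norm \<xi>)\<^sup>2)"
proof -
  obtain e :: "real^3" where e: "e \<in> Basis" using nonempty_Basis by blast
  have e1: "norm e = 1" using e by simp
  have "Ck_on n UNIV (\<lambda>t::real. chi (t *\<^sub>R e))" for n
    using Ck_on_line[OF e] assms(1) by (auto simp: smooth_on_def)
  then have sm: "smooth_on {0<..} (\<lambda>t::real. chi (t *\<^sub>R e))"
    unfolding smooth_on_def by (blast intro: Ck_on_subset[OF _ subset_UNIV])
  obtain \<tau> where \<tau>: "\<And>n. bdd_derivs n (\<lambda>_::unit. UNIV) (\<lambda>_. 1) (\<lambda>_. \<tau>)"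
    "\<And>t. 0 \<le> t \<Longrightarrow> chi (t *\<^sub>R e) = \<tau> (t\<^sup>2)"
  proof (rule bdd_derivs_square_profile[OF sm, of 2])
    show "chi (t *\<^sub>R e) = 1" if "0 \<le> t" "t \<le> 1" for t
      using assms(4) that e1 by (auto simp: dist_norm)
    show "chi (t *\<^sub>R e) = 0" if "2 < t" for t
    proof -
      have "t *\<^sub>R e \<notin> cball 0 2" using that e1 by (auto simp: dist_norm)
      then show ?thesis using assms(3) by (intro closed_support_zero[of _ UNIV]) auto
    qed
  qed auto
  have "chi \<xi> = \<tau> ((norm \<xi>)\<^sup>2)" for \<xi>
  proof -
    have "norm \<xi> = norm (norm \<xi> *\<^sub>R e)" using e1 by simp
    then have "chi \<xi> = chi (norm \<xi> *\<^sub>R e)" using assms(2) by blast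
    then show ?thesis using \<tau>(2) by simp
  qed
  with \<tau>(1) show ?thesis using that by blast
qed

section \<open>Angular caps in an adapted frame\<close>

lemma norm_cross3_le: "norm (cross3 x y) \<le> norm x * norm y"
proof -
  have "(norm (cross3 x y))\<^sup>2 \<le> (norm x * norm y)\<^sup>2"
    using norm_cross_dot[of x y] zero_le_power2[of "x \<bullet> y"] by linarith
  then show ?thesis by (rule power2_le_imp_le) simp
qed

lemma norm_cross3_commute: "norm (cross3 x y) = norm (cross3 y x)"
  by (subst cross_skew) simp

text \<open>For unit vectors this is the triangle inequality for the sine of the angle between lines.\<close>

lemma norm_cross3_triangle:
  assumes "norm \<alpha> = 1"
  shows "norm (cross3 b a) \<le> norm b * norm (cross3 \<alpha> a) + norm (cross3 b \<alpha>) * norm a"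
proof -
  \<comment> \<open>The component of \<open>b\<close> orthogonal to the line through \<alpha>; its
    length is exactly |b x \<alpha>|.\<close>
  define w where "w = b - (b \<bullet> \<alpha>) *\<^sub>R \<alpha>"
  have aa: "\<alpha> \<bullet> \<alpha> = 1" using assms by (simp add: norm_eq_1)
  have "w \<bullet> w = b \<bullet> b - (b \<bullet> \<alpha>) * (b \<bullet> \<alpha>)"
    by (simp add: w_def inner_diff_left inner_diff_right aa inner_commute)
  moreover have "(norm (cross3 b \<alpha>))\<^sup>2 = (norm b)\<^sup>2 - (b \<bullet> \<alpha>)\<^sup>2"
    using norm_cross_dot[of b \<alpha>] assms by simp
  ultimately have "(norm w)\<^sup>2 = (norm (cross3 b \<alpha>))\<^sup>2"
    by (simp add: power2_norm_eq_inner[of w] power2_norm_eq_inner[of b]) (simp add: power2_eq_square)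
  then have w: "norm w = norm (cross3 b \<alpha>)"
    by simp
  have "b = (b \<bullet> \<alpha>) *\<^sub>R \<alpha> + w" by (simp add: w_def)
  then have "cross3 b a = (b \<bullet> \<alpha>) *\<^sub>R cross3 \<alpha> a + cross3 w a"
    by (metis cross_add_left cross_mult_left)
  then have "norm (cross3 b a) \<le> \<bar>b \<bullet> \<alpha>\<bar> * norm (cross3 \<alpha> a) + norm (cross3 w a)"
    using norm_triangle_ineq[of "(b \<bullet> \<alpha>) *\<^sub>R cross3 \<alpha> a" "cross3 w a"] by simp
  also have "\<dots> \<le> norm b * norm (cross3 \<alpha> a) + norm (cross3 b \<alpha>) * norm a"
    using Cauchy_Schwarz_ineq2[of b \<alpha>] assms norm_cross3_le[of w a] w
    by (intro add_mono mult_right_mono) auto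
  finally show ?thesis .
qed

lemma sum_components_power2: "(\<Sum>n\<in>UNIV. (x $ n)\<^sup>2) = (norm (x :: real^3))\<^sup>2"
  unfolding power2_norm_eq_inner inner_vec_def by (simp add: power2_eq_square)

text \<open>Each set lies in a sector of aperture \<open>O(s i)\<close> around the line through
  \<open>\<alpha> i\<close>, at distance comparable to \<open>\<kappa> i\<close> from the origin.
  The vector \<open>b i\<close> fits into the box carved out by this sector: length at most
  \<open>\<kappa> i\<close>, and at most \<open>\<kappa> i * s i\<close> across the axis. Moving by
  \<open>b i\<close> therefore changes quantities adapted to the box by O(1). Every requirement is
  conditional on a point of \<open>V i\<close>, so emptying some of the sets stays within the
  locale.\<close>

locale adapted_frame =
  fixes V :: "'i \<Rightarrow> (real^3) set" and b \<alpha> :: "'i \<Rightarrow> real^3" and s \<kappa> :: "'i \<Rightarrow> real" and D :: real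
  assumes open_V: "open (V i)"
    and D: "1 \<le> D"
    and s: "\<xi> \<in> V i \<Longrightarrow> 0 < s i" "\<xi> \<in> V i \<Longrightarrow> s i \<le> 1"
    and \<kappa>: "\<xi> \<in> V i \<Longrightarrow> 0 < \<kappa> i"
    and \<alpha>: "\<xi> \<in> V i \<Longrightarrow> norm (\<alpha> i) = 1"
    and b: "\<xi> \<in> V i \<Longrightarrow> norm (b i) \<le> \<kappa> i" "\<xi> \<in> V i \<Longrightarrow> norm (cross3 (b i) (\<alpha> i)) \<le> \<kappa> i * s i"
    and V: "\<xi> \<in> V i \<Longrightarrow> \<kappa> i / 8 < norm \<xi>" "\<xi> \<in> V i \<Longrightarrow> norm \<xi> < 8 * \<kappa> i"
      "\<xi> \<in> V i \<Longrightarrow> norm (cross3 (sgn \<xi>) (\<alpha> i)) \<le> D * s i"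
begin

lemma cross_sgn: "cross3 \<xi> a = norm \<xi> *\<^sub>R cross3 (sgn \<xi>) a"
  by (cases "\<xi> = 0") (simp_all add: sgn_div_norm cross_mult_left)

lemma cross_\<alpha>:
  assumes "\<xi> \<in> V i"
  shows "norm (cross3 \<xi> (\<alpha> i)) \<le> 8 * \<kappa> i * (D * s i)"
  using mult_mono[OF less_imp_le[OF V(2)[OF assms]] V(3)[OF assms]] \<kappa>[OF assms] cross_sgn[of \<xi> "\<alpha> i"]
  by simp

text \<open>The frame vectors \<open>b i\<close> are shorter in the directions orthogonal to \<open>\<alpha> i\<close>, so the linear
  form below is tame at the angular scale \<open>s i\<close> as soon as \<open>a i\<close> is within \<open>O(u i)\<close> of the
  line through \<open>\<alpha> i\<close>.\<close>

lemma bdd_derivs_cross: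
  assumes "\<And>i \<xi>. \<xi> \<in> V i \<Longrightarrow> norm (a i) \<le> 1 \<and> 0 < u i \<and> s i + norm (cross3 (\<alpha> i) (a i)) \<le> C * u i"
  shows "bdd_derivs n V b (\<lambda>i \<xi>. cross3 \<xi> (a i) $ j / (\<kappa> i * u i))"
proof (rule bdd_derivs_linear)
  show "linear (\<lambda>\<xi>. cross3 \<xi> (a i) $ j / (\<kappa> i * u i))" for i
    by (rule linearI) (simp_all add: cross_add_left cross_mult_left add_divide_distrib)
  have key: "\<bar>cross3 \<zeta> (a i) $ j / (\<kappa> i * u i)\<bar> \<le> 8 * D * C"
    if "\<xi> \<in> V i" and z: "norm \<zeta> \<le> 8 * \<kappa> i" "norm (cross3 \<zeta> (\<alpha> i)) \<le> 8 * \<kappa> i * (D * s i)" for \<xi> i \<zeta>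
  proof -
    note as = assms[OF that(1)] and k = \<kappa>[OF that(1)] and si = s[OF that(1)]
    have "norm (cross3 \<zeta> (a i)) \<le> norm \<zeta> * norm (cross3 (\<alpha> i) (a i)) + norm (cross3 \<zeta> (\<alpha> i)) * norm (a i)"
      by (rule norm_cross3_triangle[OF \<alpha>[OF that(1)]])
    also have "\<dots> \<le> (8 * \<kappa> i) * (D * norm (cross3 (\<alpha> i) (a i))) + (8 * \<kappa> i * (D * s i)) * 1"
    proof (intro add_mono mult_mono)
      show "norm (cross3 (\<alpha> i) (a i)) \<le> D * norm (cross3 (\<alpha> i) (a i))"
        using D mult_right_mono[of 1 D "norm (cross3 (\<alpha> i) (a i))"] by simp
    qed (use z as k si D in auto)
    also have "\<dots> = 8 * D * \<kappa> i * (s i + norm (cross3 (\<alpha> i) (a i)))"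
      by (simp add: algebra_simps)
    also have "\<dots> \<le> 8 * D * \<kappa> i * (C * u i)"
      using as k D by (intro mult_left_mono) auto
    finally have "\<bar>cross3 \<zeta> (a i) $ j\<bar> \<le> 8 * D * C * (\<kappa> i * u i)"
      using component_le_norm_cart[of "cross3 \<zeta> (a i)" j] by (simp add: algebra_simps)
    then show ?thesis
      using as k by (simp add: abs_mult pos_divide_le_eq)
  qed
  show "\<bar>cross3 \<xi> (a i) $ j / (\<kappa> i * u i)\<bar> \<le> 8 * D * C" if "\<xi> \<in> V i" for i \<xi>
    using V(2)[OF that] cross_\<alpha>[OF that] by (intro key[OF that]) auto
  show "\<bar>cross3 (b i) (a i) $ j / (\<kappa> i * u i)\<bar> \<le> 8 * D * C" if "V i \<noteq> {}" for i
  proof -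
    from that obtain \<xi> where x: "\<xi> \<in> V i" by blast
    have "\<kappa> i * s i \<le> 8 * \<kappa> i * (D * s i)"
      using mult_mono[of 1 "8 * D" "\<kappa> i * s i" "\<kappa> i * s i"] D \<kappa>[OF x] s[OF x] by (simp add: algebra_simps)
    then show ?thesis
      using b[OF x] \<kappa>[OF x] by (intro key[OF x]) linarith+
  qed
qed

lemma bdd_derivs_coordinate: "bdd_derivs n V b (\<lambda>i \<xi>. \<xi> $ j / \<kappa> i)"
proof (rule bdd_derivs_linear)
  show "linear (\<lambda>\<xi>::real^3. \<xi> $ j / \<kappa> i)" for i
    by (rule linearI) (simp_all add: add_divide_distrib)
  show "\<bar>\<xi> $ j / \<kappa> i\<bar> \<le> 8" if "\<xi> \<in> V i" for i \<xi>
    using V(2)[OF that] \<kappa>[OF that] component_le_norm_cart[of \<xi> j] by (simp add: pos_divide_le_eq)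
  show "\<bar>b i $ j / \<kappa> i\<bar> \<le> 1" if "V i \<noteq> {}" for i
  proof -
    from that obtain \<xi> where x: "\<xi> \<in> V i" by blast
    show ?thesis using b[OF x] \<kappa>[OF x] component_le_norm_cart[of "b i" j] by (simp add: pos_divide_le_eq)
  qed
qed

lemma bdd_derivs_norm_square: "bdd_derivs n V b (\<lambda>i \<xi>. (norm \<xi> / \<kappa> i)\<^sup>2)"
proof -
  have eq: "(norm \<xi> / \<kappa> i)\<^sup>2 = (\<Sum>j\<in>UNIV. (\<xi> $ j / \<kappa> i)\<^sup>2)" for i and \<xi> :: "real^3"
    by (simp add: power_divide sum_components_power2[symmetric] sum_divide_distrib)
  show ?thesis
    unfolding eq by (intro bdd_derivs_sum bdd_derivs_power2 bdd_derivs_coordinate) simp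
qed

lemma norm_square_ge:
  assumes "\<xi> \<in> V i"
  shows "1 / 64 \<le> \<bar>(norm \<xi> / \<kappa> i)\<^sup>2\<bar>"
proof -
  have "1 / 8 \<le> norm \<xi> / \<kappa> i"
    using V(1)[OF assms] \<kappa>[OF assms] by (simp add: pos_le_divide_eq)
  then have "(1 / 8)\<^sup>2 \<le> (norm \<xi> / \<kappa> i)\<^sup>2"
    by (rule power_mono) simp
  then show ?thesis by (simp add: power2_eq_square)
qed

text \<open>A dilation of size O(1 / \<kappa>) turns the squared radius into a bounded multiple of
  the normalised one.\<close>

lemma bdd_derivs_radial:
  assumes \<tau>: "\<And>n. bdd_derivs n (\<lambda>_::unit. UNIV) (\<lambda>_. 1) (\<lambda>_. \<tau>)" "\<And>\<xi> :: real^3. chi \<xi> = \<tau> ((norm \<xi>)\<^sup>2)"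
    and c: "\<And>i \<xi>. \<xi> \<in> V i \<Longrightarrow> \<bar>c i * \<kappa> i\<bar> \<le> C"
  shows "bdd_derivs n V b (\<lambda>i \<xi>. chi (c i *\<^sub>R \<xi>))"
proof (rule bdd_derivs_cong[OF open_V])
  show "bdd_derivs n V b (\<lambda>i \<xi>. \<tau> ((c i * \<kappa> i)\<^sup>2 * (norm \<xi> / \<kappa> i)\<^sup>2))"
  proof (rule bdd_derivs_compose[OF UNIV_I \<tau>(1)])
    have "\<bar>(c i * \<kappa> i)\<^sup>2\<bar> \<le> C\<^sup>2" if "V i \<noteq> {}" for i
    proof -
      from that obtain \<xi> where x: "\<xi> \<in> V i" by blast
      have "\<bar>c i * \<kappa> i\<bar>\<^sup>2 \<le> C\<^sup>2" using c[OF x] by (intro power_mono) auto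
      then show ?thesis by simp
    qed
    then show "bdd_derivs n V b (\<lambda>i \<xi>. (c i * \<kappa> i)\<^sup>2 * (norm \<xi> / \<kappa> i)\<^sup>2)"
      by (intro bdd_derivs_mult[OF bdd_derivs_const bdd_derivs_norm_square])
  qed
  show "\<tau> ((c i * \<kappa> i)\<^sup>2 * (norm \<xi> / \<kappa> i)\<^sup>2) = chi (c i *\<^sub>R \<xi>)" if "\<xi> \<in> V i" for i \<xi>
    using \<kappa>[OF that] by (simp add: \<tau>(2) power_mult_distrib power_divide)
qed

text \<open>If the axis of the sector is far from \<open>a\<close> on the scale \<open>s i\<close>,
  the triangle inequality for lines keeps the whole sector more than twice the radius
  \<open>2 powr t\<close> away from \<open>a\<close>, outside the support of \<sigma>.\<close>

lemma cap_far:
  assumes "\<xi> \<in> V i" "\<And>t. 101/100 < t \<Longrightarrow> \<sigma> t = 0"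
    "2 powr t \<le> C * s i" "(D + 2 * C) * s i < norm (cross3 (\<alpha> i) a)" "norm a = 1"
  shows "cap \<sigma> t a \<xi> = 0"
proof -
  have xi: "norm (sgn \<xi>) = 1"
    using V(1)[OF assms(1)] \<kappa>[OF assms(1)] by (auto simp: norm_sgn)
  have "norm (cross3 (\<alpha> i) a) \<le> norm (cross3 (sgn \<xi>) a) + norm (cross3 (\<alpha> i) (sgn \<xi>))"
    using norm_cross3_triangle[OF xi, of "\<alpha> i" a] \<alpha>[OF assms(1)] assms(5) by simp
  then have "2 * (2 powr t) < norm (cross3 (sgn \<xi>) a)"
    using V(3)[OF assms(1)] assms(3,4) norm_cross3_commute[of "\<alpha> i" "sgn \<xi>"] by (simp add: algebra_simps)
  then have "2 < norm (cross3 (sgn \<xi>) a) / 2 powr t"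
    by (simp add: pos_less_divide_eq)
  then have "2 < 2 powr (- t) * norm (cross3 (sgn \<xi>) a)"
    by (simp add: powr_minus divide_inverse mult.commute)
  then have "101/100 < 2 powr (- t) * norm (cross3 (sgn \<xi>) a)"
    by linarith
  then show ?thesis
    unfolding cap_def by (rule assms(2))
qed

text \<open>A quotient of quadratic forms in \<xi> replaces the norm of the cross product, which is
  not differentiable where it vanishes.\<close>

lemma cap_eq:
  assumes "\<And>t. 0 \<le> t \<Longrightarrow> \<sigma> t = \<tau> (t\<^sup>2)" "\<xi> \<in> V i"
  shows "cap \<sigma> t a \<xi> = \<tau> ((\<Sum>j\<in>UNIV. (cross3 \<xi> a $ j / (\<kappa> i * 2 powr t))\<^sup>2) / (norm \<xi> / \<kappa> i)\<^sup>2)"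
proof -
  have nz: "norm \<xi> \<noteq> 0" "\<kappa> i \<noteq> 0" using V(1)[OF assms(2)] \<kappa>[OF assms(2)] by auto
  have "(\<Sum>j\<in>UNIV. (cross3 \<xi> a $ j / (\<kappa> i * 2 powr t))\<^sup>2) = (norm (cross3 \<xi> a))\<^sup>2 / (\<kappa> i * 2 powr t)\<^sup>2"
    by (simp add: power_divide sum_components_power2[symmetric] sum_divide_distrib)
  also have "\<dots> / (norm \<xi> / \<kappa> i)\<^sup>2 = (2 powr (- t) * norm (cross3 (sgn \<xi>) a))\<^sup>2"
    using nz unfolding cross_sgn[of \<xi> a] by (simp add: powr_minus field_simps)
  finally show ?thesis
    by (simp add: cap_def assms(1))
qed

text \<open>Either the centre of the cap is within O(\<open>s i\<close>) of the axis, and the linear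
  forms \<xi> x \<open>a i\<close> are tame at the scale of the cap, or the cap vanishes on the
  entire sector.\<close>

lemma bdd_derivs_cap:
  assumes \<tau>: "\<And>n. bdd_derivs n (\<lambda>_::unit. UNIV) (\<lambda>_. 1) (\<lambda>_. \<tau>)" "\<And>t. 0 \<le> t \<Longrightarrow> \<sigma> t = \<tau> (t\<^sup>2)"
    and \<sigma>: "\<And>t. 101/100 < t \<Longrightarrow> \<sigma> t = 0"
    and C: "0 \<le> C" "\<And>i \<xi>. \<xi> \<in> V i \<Longrightarrow> norm (a i) = 1 \<and> 2 powr t i \<le> C * s i \<and> s i \<le> C * 2 powr t i"
  shows "bdd_derivs n V b (\<lambda>i. cap \<sigma> (t i) (a i))"
proof (rule bdd_derivs_cases[where Q = "\<lambda>i. norm (cross3 (\<alpha> i) (a i)) \<le> (D + 2 * C) * s i", OF open_V])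
  define W where "W i = (if norm (cross3 (\<alpha> i) (a i)) \<le> (D + 2 * C) * s i then V i else {})" for i
  interpret W: adapted_frame W b \<alpha> s \<kappa> D
    using open_V D s \<kappa> \<alpha> b V by unfold_locales (auto simp: W_def split: if_splits)
  show "bdd_derivs n W b (\<lambda>i. cap \<sigma> (t i) (a i))"
  proof (rule bdd_derivs_cong[OF W.open_V])
    show "bdd_derivs n W b (\<lambda>i \<xi>. \<tau> ((\<Sum>j\<in>UNIV. (cross3 \<xi> (a i) $ j / (\<kappa> i * 2 powr t i))\<^sup>2) / (norm \<xi> / \<kappa> i)\<^sup>2))"
    proof (rule bdd_derivs_compose[OF UNIV_I \<tau>(1)], rule bdd_derivs_divide[where c = "1/64"])
      have "norm (a i) \<le> 1 \<and> 0 < 2 powr t i \<and> s i + norm (cross3 (\<alpha> i) (a i)) \<le> ((1 + (D + 2 * C)) * C) * 2 powr t i"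
        if "\<xi> \<in> W i" for i \<xi>
      proof -
        have x: "\<xi> \<in> V i" and n: "norm (cross3 (\<alpha> i) (a i)) \<le> (D + 2 * C) * s i"
          using that by (auto simp: W_def split: if_splits)
        have "s i + norm (cross3 (\<alpha> i) (a i)) \<le> (1 + (D + 2 * C)) * s i"
          using n by (simp add: algebra_simps)
        also have "\<dots> \<le> (1 + (D + 2 * C)) * (C * 2 powr t i)"
          using C(1) C(2)[OF x] D by (intro mult_left_mono) auto
        finally show ?thesis using C(2)[OF x] by (simp add: mult.assoc)
      qed
      then show "bdd_derivs n W b (\<lambda>i \<xi>. \<Sum>j\<in>UNIV. (cross3 \<xi> (a i) $ j / (\<kappa> i * 2 powr t i))\<^sup>2)"
        by (intro bdd_derivs_sum bdd_derivs_power2 W.bdd_derivs_cross[where C = "(1 + (D + 2 * C)) * C"]) simp_all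
    qed (use W.bdd_derivs_norm_square W.norm_square_ge in auto)
  qed (use W.cap_eq[of \<sigma> \<tau>, OF \<tau>(2)] in auto)
next
  show "bdd_derivs n (\<lambda>i. if norm (cross3 (\<alpha> i) (a i)) \<le> (D + 2 * C) * s i then {} else V i) b (\<lambda>i. cap \<sigma> (t i) (a i))"
  proof (rule bdd_derivs_cong[where f = "\<lambda>_ _. 0"])
    show "0 = cap \<sigma> (t i) (a i) \<xi>" if "\<xi> \<in> (if norm (cross3 (\<alpha> i) (a i)) \<le> (D + 2 * C) * s i then {} else V i)" for i \<xi>
    proof -
      have x: "\<xi> \<in> V i" "(D + 2 * C) * s i < norm (cross3 (\<alpha> i) (a i))"
        using that by (auto split: if_splits)
      show ?thesis
        using cap_far[where t = "t i", OF x(1) \<sigma> _ x(2)] C(2)[OF x(1)] by simp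
    qed
  qed (auto intro: bdd_derivs_const[where C = 0] simp: open_V)
qed

end

text \<open>The telescoped sum of the dyadic cut-offs at k - 1, k and k + 1. It equals 1 where the
  cut-off at k lives and can be inserted beside it, so that the kernel of the angular piece carries
  its own radial localisation.\<close>

definition fat_cutoff :: "(real^3 \<Rightarrow> real) \<Rightarrow> int \<Rightarrow> real^3 \<Rightarrow> real" where
  "fat_cutoff chi k \<xi> = chi (2 powr (- (real_of_int k + 1)) *\<^sub>R \<xi>) - chi (2 powr (- (real_of_int k - 2)) *\<^sub>R \<xi>)"

lemma powr_neg_shift: "2 powr (- (real_of_int k + 1)) = 1 / (2 * 2 powr real_of_int k)"
  "2 powr (- (real_of_int k - 2)) = 4 / 2 powr real_of_int k"
proof -
  have e: "- (real_of_int k - 2) = 2 - real_of_int k" by simp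
  show "2 powr (- (real_of_int k + 1)) = 1 / (2 * 2 powr real_of_int k)"
    unfolding powr_minus_divide powr_add by simp
  show "2 powr (- (real_of_int k - 2)) = 4 / 2 powr real_of_int k"
    unfolding e powr_diff by simp
qed

section \<open>The symbol of the rotation fields\<close>

text \<open>All parameters over which the estimates have to be uniform. The direction \<open>dir\<close> stands for
  \<open>x / \<bar>x\<bar>\<close> and \<open>fvec\<close> is the vector along which symbols are differentiated.\<close>

datatype index = Index (rho: real) (beta: "real^3") (freq: int) (scl: int) (pos: nat) (dir: "real^3") (fvec: "real^3")

locale angular_setup =
  fixes chi :: "real^3 \<Rightarrow> real" and \<sigma> :: "real \<Rightarrow> real"
    and A C1 C2 C3 C3' C4 :: real and N :: nat
    and P :: "real set"
    and S :: "real \<Rightarrow> (real^3) set"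
    and \<alpha> :: "real \<Rightarrow> real^3 \<Rightarrow> int \<Rightarrow> nat \<Rightarrow> real^3"
  assumes chi_props: "smooth_on UNIV chi" "\<forall>\<xi>. 0 \<le> chi \<xi>" "\<forall>\<xi> \<zeta>. norm \<xi> = norm \<zeta> \<longrightarrow> chi \<xi> = chi \<zeta>"
      "closed_support UNIV chi \<subseteq> cball 0 2" "\<forall>\<xi>\<in>cball 0 1. chi \<xi> = 1"
    and sigma_props: "smooth_on {0<..} \<sigma>" "closed_support {0..} \<sigma> \<subseteq> {0..101/100}"
      "\<forall>t\<in>{0..1}. \<sigma> t = 1"
    and params: "0 < C1" "0 < C2" "0 < C3" "0 < C3'" "C3' \<le> C3" "0 < C4" "0 < N" "1 \<le> A"
    and P: "P \<subseteq> {..0}"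
    and net: "\<forall>\<rho>\<in>P. angular_net \<sigma> A \<rho> (S \<rho>)"
    and whitney: "\<forall>\<rho>\<in>P. \<rho> \<le> - C1 \<longrightarrow>
      (\<forall>\<beta>\<in>S \<rho>. whitney_partition \<sigma> A C1 C2 C3 C3' C4 N \<rho> (S \<rho>) \<beta> (\<alpha> \<rho> \<beta>))"
begin

abbreviation \<eta> where "\<eta> \<rho> \<beta> \<equiv> eta \<sigma> C1 C2 C3 C3' N \<rho> \<beta> (\<alpha> \<rho> \<beta>)"
abbreviation \<eta>core where "\<eta>core \<rho> \<beta> \<equiv> eta_core \<sigma> C1 C2 C3 C3' N \<rho> \<beta> (\<alpha> \<rho> \<beta>)"
abbreviation \<eta>sum where "\<eta>sum \<rho> \<beta> \<equiv> eta_tilde_sum \<sigma> C1 C2 C3 C3' N \<rho> \<beta> (\<alpha> \<rho> \<beta>)"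
abbreviation \<eta>tilde where "\<eta>tilde \<rho> \<beta> \<equiv> eta_tilde \<sigma> C3 C3' (\<alpha> \<rho> \<beta>)"
abbreviation supp where "supp \<equiv> closed_support (sphere (0::real^3) 1)"
abbreviation ac where "ac \<rho> \<beta> \<equiv> angular_cutoff \<sigma> \<rho> (S \<rho>) \<beta>"

lemma sigma_zero: "101/100 < t \<Longrightarrow> \<sigma> t = 0"
  using sigma_props(2) by (intro closed_support_zero[of _ "{0..}"]) auto

lemma sigma_profile:
  obtains \<tau> where "\<And>n. bdd_derivs n (\<lambda>_::unit. UNIV) (\<lambda>_. 1) (\<lambda>_. \<tau>)" "\<And>t. 0 \<le> t \<Longrightarrow> \<sigma> t = \<tau> (t\<^sup>2)"
proof (rule bdd_derivs_square_profile[OF sigma_props(1), of "101/100"])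
  show "\<sigma> t = 1" if "0 \<le> t" "t \<le> 1" for t using sigma_props(3) that by auto
  show "\<sigma> t = 0" if "101/100 < t" for t by (rule sigma_zero[OF that])
  fix \<tau> assume "\<And>n. bdd_derivs n (\<lambda>_::unit. UNIV) (\<lambda>_. 1) (\<lambda>_. \<tau>)" "\<And>t. 0 \<le> t \<Longrightarrow> \<sigma> t = \<tau> (t\<^sup>2)"
  then show thesis by (rule that)
qed simp

lemma chi_zero: assumes "2 < norm \<xi>" shows "chi \<xi> = 0"
proof (rule closed_support_zero[where f = chi, OF UNIV_I])
  have "\<xi> \<notin> cball 0 2" using assms by simp
  then show "\<xi> \<notin> closed_support UNIV chi" using chi_props(4) by blast
qed

lemma chi_one: "norm \<xi> \<le> 1 \<Longrightarrow> chi \<xi> = 1"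
  using chi_props(5) by simp

lemma fat_cutoff_zero:
  assumes "norm \<xi> < 2 powr k / 4 \<or> 4 * 2 powr k < norm \<xi>"
  shows "fat_cutoff chi k \<xi> = 0"
proof -
  have e: "norm (2 powr (- (real_of_int k + 1)) *\<^sub>R \<xi>) = norm \<xi> / (2 * 2 powr k)"
     "norm (2 powr (- (real_of_int k - 2)) *\<^sub>R \<xi>) = 4 * norm \<xi> / 2 powr k"
    unfolding norm_scaleR powr_neg_shift by simp_all
  from assms show ?thesis
  proof
    assume a: "norm \<xi> < 2 powr k / 4"
    moreover have p: "0 < 2 powr real_of_int k" by simp
    ultimately have "4 * norm \<xi> \<le> 1 * 2 powr k" "norm \<xi> \<le> 1 * (2 * 2 powr k)"
      using norm_ge_zero[of \<xi>] by linarith+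
    then have "4 * norm \<xi> / 2 powr k \<le> 1" "norm \<xi> / (2 * 2 powr k) \<le> 1"
      using p by (simp_all only: pos_divide_le_eq mult_pos_pos zero_less_numeral)
    then show ?thesis unfolding fat_cutoff_def by (simp add: chi_one e del: norm_scaleR minus_add_distrib minus_diff_eq)
  next
    assume a: "4 * 2 powr k < norm \<xi>"
    moreover have p: "0 < 2 powr real_of_int k" by simp
    ultimately have "2 * 2 powr k < 4 * norm \<xi>" "2 * (2 * 2 powr k) < norm \<xi>"
      using norm_ge_zero[of \<xi>] by linarith+
    then have "2 < 4 * norm \<xi> / 2 powr k" "2 < norm \<xi> / (2 * 2 powr k)"
      using p by (simp_all only: pos_less_divide_eq mult_pos_pos zero_less_numeral)
    then show ?thesis unfolding fat_cutoff_def by (simp add: chi_zero e del: norm_scaleR minus_add_distrib minus_diff_eq)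
  qed
qed

lemma cap_sgn: "cap \<sigma> t a (sgn \<xi>) = cap \<sigma> t a \<xi>"
proof -
  have "sgn (sgn \<xi>) = sgn \<xi>"
    by (simp add: sgn_div_norm[of "sgn \<xi>"] norm_sgn)
  then show ?thesis by (simp add: cap_def)
qed

lemma \<eta>_sgn: "\<eta>tilde \<rho> \<beta> r l (sgn \<xi>) = \<eta>tilde \<rho> \<beta> r l \<xi>" "\<eta>sum \<rho> \<beta> (sgn \<xi>) = \<eta>sum \<rho> \<beta> \<xi>"
  "\<eta> \<rho> \<beta> r l (sgn \<xi>) = \<eta> \<rho> \<beta> r l \<xi>" "ac \<rho> \<beta> (sgn \<xi>) = ac \<rho> \<beta> \<xi>"
  by (simp_all add: eta_tilde_def eta_tilde_sum_def eta_def angular_cutoff_def cap_sgn)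

lemma sgn_sphere: "\<xi> \<noteq> 0 \<Longrightarrow> sgn (\<xi>::real^3) \<in> sphere 0 1"
  by (simp add: norm_sgn)

definition base :: "real \<Rightarrow> real^3 \<Rightarrow> bool" where
  "base \<rho> \<beta> \<longleftrightarrow> \<rho> \<in> P \<and> \<rho> \<le> - C1 \<and> \<beta> \<in> S \<rho>"

lemma base_sum: "base \<rho> \<beta> \<Longrightarrow> \<xi> \<noteq> 0 \<Longrightarrow> 1 / A \<le> \<eta>sum \<rho> \<beta> \<xi>"
proof -
  assume "base \<rho> \<beta>" and x: "\<xi> \<noteq> 0"
  then have "whitney_partition \<sigma> A C1 C2 C3 C3' C4 N \<rho> (S \<rho>) \<beta> (\<alpha> \<rho> \<beta>)"
    using whitney unfolding base_def by blast
  from this[unfolded whitney_partition_def Let_def, THEN conjunct1, rule_format, OF sgn_sphere[OF x]]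
  show ?thesis by (simp add: \<eta>_sgn)
qed

lemma base_whitney:
  assumes "base \<rho> \<beta>" "r \<in> scales C1 \<rho>" "l \<in> {1..N}"
  shows "norm (\<alpha> \<rho> \<beta> r l) = 1"
    "x \<in> supp (ac \<rho> \<beta>) \<Longrightarrow> \<xi> \<in> supp (\<eta> \<rho> \<beta> r l) \<Longrightarrow> 2 powr r / A \<le> norm (cross3 x \<xi>)"
    "r' \<in> scales C1 \<rho> \<Longrightarrow> l' \<in> {1..N} \<Longrightarrow> C4 \<le> \<bar>real_of_int (r - r')\<bar> \<Longrightarrow>
      supp (\<eta> \<rho> \<beta> r' l') \<inter> supp (\<eta> \<rho> \<beta> r l) = {}"
    "\<rho> + C4 \<le> real_of_int r \<Longrightarrow> supp (\<eta>core \<rho> \<beta>) \<inter> supp (\<eta> \<rho> \<beta> r l) = {}"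
proof -
  have w: "whitney_partition \<sigma> A C1 C2 C3 C3' C4 N \<rho> (S \<rho>) \<beta> (\<alpha> \<rho> \<beta>)"
    using whitney assms(1) unfolding base_def by blast
  note w = w[unfolded whitney_partition_def Let_def, THEN conjunct2, rule_format, OF assms(2,3)]
  show "norm (\<alpha> \<rho> \<beta> r l) = 1" using w by simp
  show "x \<in> supp (ac \<rho> \<beta>) \<Longrightarrow> \<xi> \<in> supp (\<eta> \<rho> \<beta> r l) \<Longrightarrow> 2 powr r / A \<le> norm (cross3 x \<xi>)"
    using w by blast
  show "r' \<in> scales C1 \<rho> \<Longrightarrow> l' \<in> {1..N} \<Longrightarrow> C4 \<le> \<bar>real_of_int (r - r')\<bar> \<Longrightarrow>
      supp (\<eta> \<rho> \<beta> r' l') \<inter> supp (\<eta> \<rho> \<beta> r l) = {}"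
    using w by blast
  show "\<rho> + C4 \<le> real_of_int r \<Longrightarrow> supp (\<eta>core \<rho> \<beta>) \<inter> supp (\<eta> \<rho> \<beta> r l) = {}"
    using w by blast
qed

lemma base_beta: "base \<rho> \<beta> \<Longrightarrow> norm \<beta> = 1"
  using net unfolding base_def angular_net_def by (auto simp: subset_iff)

lemma finite_scales: "finite (scales C1 \<rho>)"
proof -
  have "scales C1 \<rho> \<subseteq> {\<lceil>\<rho> + C1\<rceil>..0}" by (auto simp: scales_def ceiling_le_iff)
  then show ?thesis by (rule finite_subset) simp
qed

text \<open>The normalising sum is bounded below, so the quotient vanishes only where its numerator
  does, and the unnormalised cap inherits the support property.\<close>

lemma \<eta>tilde_zero:
  assumes "base \<rho> \<beta>" "\<xi> \<noteq> 0" "sgn \<xi> \<notin> supp (\<eta> \<rho> \<beta> r l)"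
  shows "\<eta>tilde \<rho> \<beta> r l \<xi> = 0"
proof -
  have "\<eta> \<rho> \<beta> r l (sgn \<xi>) = 0"
    by (rule closed_support_zero[OF sgn_sphere[OF assms(2)] assms(3)])
  moreover have "0 < \<eta>sum \<rho> \<beta> \<xi>"
    using base_sum[OF assms(1,2)] params(8) by (intro less_le_trans[OF _ base_sum[OF assms(1,2)]]) simp
  ultimately show ?thesis
    unfolding \<eta>_sgn by (simp add: eta_def)
qed

lemma core_zero:
  assumes "base \<rho> \<beta>" "\<xi> \<noteq> 0" "sgn \<xi> \<notin> supp (\<eta>core \<rho> \<beta>)"
  shows "cap \<sigma> (\<rho> + C2) \<beta> \<xi> = 0"
proof -
  have "\<eta>core \<rho> \<beta> (sgn \<xi>) = 0"
    by (rule closed_support_zero[OF sgn_sphere[OF assms(2)] assms(3)])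
  moreover have "0 < \<eta>sum \<rho> \<beta> \<xi>"
    using base_sum[OF assms(1,2)] params(8) by (intro less_le_trans[OF _ base_sum[OF assms(1,2)]]) simp
  ultimately show ?thesis
    by (simp add: eta_core_def \<eta>_sgn cap_sgn)
qed

lemma closed_supp: "closed (supp f)"
  by (simp add: closed_support_def)

lemma supp_sphere: "\<xi> \<in> supp f \<Longrightarrow> norm \<xi> = 1"
proof -
  have "supp f \<subseteq> sphere 0 1"
    unfolding closed_support_def support_on_def by (rule closure_minimal) auto
  then show "\<xi> \<in> supp f \<Longrightarrow> norm \<xi> = 1" by auto
qed

text \<open>The radius 101/100 of the support of \<sigma> survives taking the closure; the strict
  bound with 2 leaves room for an open neighbourhood.\<close>

lemma supp_near:
  assumes "base \<rho> \<beta>" "r \<in> scales C1 \<rho>" "\<xi> \<in> supp (\<eta> \<rho> \<beta> r l)"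
  shows "norm (cross3 \<xi> (\<alpha> \<rho> \<beta> r l)) < 2 * 2 powr r"
proof -
  let ?T = "{\<xi>. norm (cross3 \<xi> (\<alpha> \<rho> \<beta> r l)) \<le> 101/100 * 2 powr r}"
  have "supp (\<eta> \<rho> \<beta> r l) \<subseteq> ?T"
    unfolding closed_support_def
  proof (rule closure_minimal)
    show "closed ?T"
      by (intro closed_Collect_le continuous_intros continuous_on_cross)
    show "support_on (sphere 0 1) (\<eta> \<rho> \<beta> r l) \<subseteq> ?T"
    proof
      fix \<xi> assume "\<xi> \<in> support_on (sphere 0 1) (\<eta> \<rho> \<beta> r l)"
      then have n: "norm \<xi> = 1" "\<eta> \<rho> \<beta> r l \<xi> \<noteq> 0" by (auto simp: support_on_def)
      then have sg: "sgn \<xi> = \<xi>" by (simp add: sgn_div_norm)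
      define t where "t = real_of_int r - (if r = 0 then C3' else C3)"
      have "\<sigma> (2 powr (- t) * norm (cross3 \<xi> (\<alpha> \<rho> \<beta> r l))) \<noteq> 0"
        using n sg by (auto simp: eta_def eta_tilde_def cap_def t_def)
      then have "2 powr (- t) * norm (cross3 \<xi> (\<alpha> \<rho> \<beta> r l)) \<le> 101/100"
        using sigma_zero by force
      then have "norm (cross3 \<xi> (\<alpha> \<rho> \<beta> r l)) / 2 powr t \<le> 101/100"
        unfolding powr_minus_divide by simp
      then have "norm (cross3 \<xi> (\<alpha> \<rho> \<beta> r l)) \<le> 101/100 * 2 powr t"
        by (simp add: pos_divide_le_eq)
      also have "\<dots> \<le> 101/100 * 2 powr r"
      proof (intro mult_left_mono powr_mono)
        show "t \<le> r" using params by (simp add: t_def)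
      qed simp_all
      finally show "\<xi> \<in> ?T" by simp
    qed
  qed
  then have "norm (cross3 \<xi> (\<alpha> \<rho> \<beta> r l)) \<le> 101/100 * 2 powr r"
    using assms(3) by blast
  moreover have "0 < 2 powr real_of_int r" by simp
  ultimately show ?thesis by linarith
qed

section \<open>A neighbourhood of the support of one angular piece\<close>

abbreviation "s i \<equiv> 2 powr real_of_int (scl i)"
abbreviation "\<kappa> i \<equiv> 2 powr real_of_int (freq i)"
abbreviation "ctr i \<equiv> \<alpha> (rho i) (beta i) (scl i) (pos i)"

definition valid :: "index \<Rightarrow> bool" where
  "valid i \<longleftrightarrow> base (rho i) (beta i) \<and> scl i \<in> scales C1 (rho i) \<and> pos i \<in> {1..N} \<and>
     dir i \<in> supp (ac (rho i) (beta i)) \<and>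
     norm (fvec i) \<le> \<kappa> i \<and> norm (cross3 (fvec i) (ctr i)) \<le> \<kappa> i * s i"

text \<open>By the Whitney property these supports are disjoint from that of the piece itself. Off
  this closed set only boundedly many terms of the normalising sum survive.\<close>

definition far :: "index \<Rightarrow> (real^3) set" where
  "far i = (\<Union>r'\<in>{r' \<in> scales C1 (rho i). C4 \<le> \<bar>real_of_int (scl i - r')\<bar>}. \<Union>l'\<in>{1..N}. supp (\<eta> (rho i) (beta i) r' l')) \<union>
     (if rho i + C4 \<le> scl i then supp (\<eta>core (rho i) (beta i)) else {})"

text \<open>An open neighbourhood of \<open>core i\<close>, obtained by relaxing every closed
  condition slightly. Derivatives are estimated here, where the lower bounds needed for division
  still hold.\<close>

definition nbhd :: "index \<Rightarrow> (real^3) set" where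
  "nbhd i = (if valid i then {\<xi>. \<kappa> i / 8 < norm \<xi> \<and> norm \<xi> < 8 * \<kappa> i \<and>
     norm (cross3 (sgn \<xi>) (ctr i)) < 2 * s i \<and> s i / (2 * A) < norm (cross3 (dir i) (sgn \<xi>)) \<and> sgn \<xi> \<notin> far i} else {})"

text \<open>A compact set outside which the angular piece times the fat cut-off vanishes.\<close>

definition core :: "index \<Rightarrow> (real^3) set" where
  "core i = {\<xi>. \<kappa> i / 4 \<le> norm \<xi> \<and> norm \<xi> \<le> 4 * \<kappa> i \<and> sgn \<xi> \<in> supp (\<eta> (rho i) (beta i) (scl i) (pos i))}"

lemma closed_far: "closed (far i)"
  unfolding far_def using finite_scales[of "rho i"] closed_supp
  by (intro closed_Un closed_UN) (auto intro: finite_subset[OF _ finite_scales[of "rho i"]])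

lemma nbhd_nonzero: "\<xi> \<in> nbhd i \<Longrightarrow> \<xi> \<noteq> 0"
  by (auto simp: nbhd_def split: if_splits)

lemma open_nbhd: "open (nbhd i)"
proof (cases "valid i")
  case True
  define T where "T = {\<theta>. norm (cross3 \<theta> (ctr i)) < 2 * s i} \<inter> {\<theta>. s i / (2 * A) < norm (cross3 (dir i) \<theta>)} \<inter> - far i"
  have "open T"
    unfolding T_def using closed_far
    by (intro open_Int open_Collect_less continuous_intros continuous_on_cross open_Compl)
  moreover have "continuous_on (- {0::real^3}) sgn"
    by (intro continuous_intros) auto
  ultimately have pre: "open (- {0} \<inter> sgn -` T)"
    by (intro continuous_open_preimage open_Compl closed_singleton)
  have "open {\<xi>::real^3. \<kappa> i / 8 < norm \<xi>}" "open {\<xi>::real^3. norm \<xi> < 8 * \<kappa> i}"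
    by (intro open_Collect_less continuous_intros)+
  then have "open ({\<xi>. \<kappa> i / 8 < norm \<xi>} \<inter> {\<xi>. norm \<xi> < 8 * \<kappa> i} \<inter> (- {0} \<inter> sgn -` T))"
    using pre by (intro open_Int[OF open_Int])
  also have "\<dots> = nbhd i"
    using nbhd_nonzero[of _ i] True by (auto simp: nbhd_def T_def)
  finally show ?thesis .
qed (simp add: nbhd_def)

lemma closed_core: "closed (core i)"
proof -
  have "closed ({\<xi>::real^3. \<kappa> i / 4 \<le> norm \<xi>} \<inter> {\<xi>. norm \<xi> \<le> 4 * \<kappa> i})"
    by (intro closed_Int closed_Collect_le continuous_intros)
  moreover have "continuous_on ({\<xi>::real^3. \<kappa> i / 4 \<le> norm \<xi>} \<inter> {\<xi>. norm \<xi> \<le> 4 * \<kappa> i}) sgn"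
    by (intro continuous_intros) (auto simp: not_le)
  ultimately have "closed ({\<xi>. \<kappa> i / 4 \<le> norm \<xi>} \<inter> {\<xi>. norm \<xi> \<le> 4 * \<kappa> i} \<inter> sgn -` supp (\<eta> (rho i) (beta i) (scl i) (pos i)))"
    using closed_supp by (intro continuous_closed_preimage)
  also have "\<dots> = core i" by (auto simp: core_def)
  finally show ?thesis .
qed

lemma core_subset: "valid i \<Longrightarrow> core i \<subseteq> nbhd i"
proof
  fix \<xi> assume v: "valid i" and x: "\<xi> \<in> core i"
  have x': "\<kappa> i / 4 \<le> norm \<xi>" "norm \<xi> \<le> 4 * \<kappa> i" "sgn \<xi> \<in> supp (\<eta> (rho i) (beta i) (scl i) (pos i))"
    using x by (auto simp: core_def)
  have v': "base (rho i) (beta i)" "scl i \<in> scales C1 (rho i)" "pos i \<in> {1..N}" "dir i \<in> supp (ac (rho i) (beta i))"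
    using v by (auto simp: valid_def)
  note w = base_whitney[OF v'(1-3)]
  have "s i / (2 * A) < s i / A"
    using params(8) by (intro divide_strict_left_mono) auto
  then have "s i / (2 * A) < norm (cross3 (dir i) (sgn \<xi>))"
    using w(2)[OF v'(4) x'(3)] by linarith
  moreover have "sgn \<xi> \<notin> far i"
  proof
    assume "sgn \<xi> \<in> far i"
    then consider r' l' where "r' \<in> scales C1 (rho i)" "C4 \<le> \<bar>real_of_int (scl i - r')\<bar>" "l' \<in> {1..N}"
        "sgn \<xi> \<in> supp (\<eta> (rho i) (beta i) r' l')"
      | "rho i + C4 \<le> scl i" "sgn \<xi> \<in> supp (\<eta>core (rho i) (beta i))"
      unfolding far_def by (auto split: if_splits)
    then show False
    proof cases
      case (1 r' l')
      then show ?thesis using w(3)[OF 1(1,3,2)] x'(3) by blast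
    next
      case 2
      then show ?thesis using w(4) x'(3) by blast
    qed
  qed
  moreover have "\<kappa> i / 8 < norm \<xi>" "norm \<xi> < 8 * \<kappa> i"
    using x'(1,2) powr_gt_zero[of 2 "real_of_int (freq i)"] by linarith+
  ultimately show "\<xi> \<in> nbhd i"
    using v supp_near[OF v'(1,2) x'(3)] by (simp add: nbhd_def)
qed

lemma nbhd_valid: "\<xi> \<in> nbhd i \<Longrightarrow> valid i"
  by (auto simp: nbhd_def split: if_splits)

lemma frame: "adapted_frame nbhd fvec ctr s \<kappa> 2"
proof
  show "s i \<le> 1" if "\<xi> \<in> nbhd i" for \<xi> i
    using nbhd_valid[OF that] powr_mono[of "real_of_int (scl i)" 0 2] by (auto simp: valid_def scales_def)
  show "norm (ctr i) = 1" if "\<xi> \<in> nbhd i" for \<xi> i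
    using nbhd_valid[OF that] base_whitney(1) by (simp add: valid_def)
qed (auto simp: open_nbhd dest: nbhd_valid[unfolded valid_def], auto simp: nbhd_def split: if_splits)

section \<open>The normalising sum and its quotients near one piece\<close>

definition near :: "index \<Rightarrow> (int \<times> nat) set" where
  "near i = {j \<in> scales C1 (rho i) \<times> {1..N}. \<bar>real_of_int (scl i - fst j)\<bar> < C4}"

lemma finite_near: "finite (near i)"
  unfolding near_def using finite_scales by simp

lemma card_near: "card (near i) \<le> nat (2 * \<lceil>C4\<rceil> + 1) * N"
proof -
  have "near i \<subseteq> {scl i - \<lceil>C4\<rceil>..scl i + \<lceil>C4\<rceil>} \<times> {1..N}"
  proof
    fix j assume "j \<in> near i"
    then have "snd j \<in> {1..N}" "\<bar>real_of_int (scl i - fst j)\<bar> < C4" by (auto simp: near_def)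
    moreover from this(2) have "\<bar>real_of_int (scl i - fst j)\<bar> \<le> real_of_int \<lceil>C4\<rceil>"
      using le_of_int_ceiling[of C4] by linarith
    then have "\<bar>scl i - fst j\<bar> \<le> \<lceil>C4\<rceil>"
      by (simp only: of_int_abs[symmetric] of_int_le_iff)
    ultimately show "j \<in> {scl i - \<lceil>C4\<rceil>..scl i + \<lceil>C4\<rceil>} \<times> {1..N}"
      by (cases j) auto
  qed
  then have "card (near i) \<le> card ({scl i - \<lceil>C4\<rceil>..scl i + \<lceil>C4\<rceil>} \<times> {1..N})"
    by (intro card_mono) auto
  also have "\<dots> = nat (2 * \<lceil>C4\<rceil> + 1) * N"
    by (simp add: card_cartesian_product algebra_simps)
  finally show ?thesis .
qed

lemma nbhd_base:
  assumes "\<xi> \<in> nbhd i"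
  shows "base (rho i) (beta i)" "scl i \<in> scales C1 (rho i)" "pos i \<in> {1..N}"
    "dir i \<in> supp (ac (rho i) (beta i))"
  using nbhd_valid[OF assms] by (auto simp: valid_def)

text \<open>Each omitted term has its support inside \<open>far i\<close>, which the neighbourhood
  avoids.\<close>

lemma sum_near:
  assumes x: "\<xi> \<in> nbhd i"
  shows "\<eta>sum (rho i) (beta i) \<xi> = (if rho i + C4 \<le> scl i then 0 else cap \<sigma> (rho i + C2) (beta i) \<xi>) +
    (\<Sum>j\<in>near i. \<eta>tilde (rho i) (beta i) (fst j) (snd j) \<xi>)"
proof -
  note b = nbhd_base[OF x]
  have f: "sgn \<xi> \<notin> far i" using x by (auto simp: nbhd_def split: if_splits)
  have "(\<Sum>r\<in>scales C1 (rho i). \<Sum>l=1..N. \<eta>tilde (rho i) (beta i) r l \<xi>) =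
      (\<Sum>j\<in>scales C1 (rho i) \<times> {1..N}. \<eta>tilde (rho i) (beta i) (fst j) (snd j) \<xi>)"
    by (simp add: sum.cartesian_product split_beta)
  also have "\<dots> = (\<Sum>j\<in>near i. \<eta>tilde (rho i) (beta i) (fst j) (snd j) \<xi>)"
  proof (rule sum.mono_neutral_right)
    show "\<forall>j\<in>scales C1 (rho i) \<times> {1..N} - near i. \<eta>tilde (rho i) (beta i) (fst j) (snd j) \<xi> = 0"
    proof
      fix j assume "j \<in> scales C1 (rho i) \<times> {1..N} - near i"
      then have "fst j \<in> scales C1 (rho i)" "snd j \<in> {1..N}" "C4 \<le> \<bar>real_of_int (scl i - fst j)\<bar>"
        by (auto simp: near_def)
      then have "sgn \<xi> \<notin> supp (\<eta> (rho i) (beta i) (fst j) (snd j))"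
        using f unfolding far_def by blast
      then show "\<eta>tilde (rho i) (beta i) (fst j) (snd j) \<xi> = 0"
        by (rule \<eta>tilde_zero[OF b(1) nbhd_nonzero[OF x]])
    qed
  qed (use finite_scales in \<open>auto simp: near_def\<close>)
  moreover have "cap \<sigma> (rho i + C2) (beta i) \<xi> = 0" if "rho i + C4 \<le> scl i"
    using f that by (intro core_zero[OF b(1) nbhd_nonzero[OF x]]) (simp add: far_def)
  ultimately show ?thesis
    by (simp add: eta_tilde_sum_def)
qed

text \<open>Reindexing along \<open>g\<close> lets pairs of a parameter and a summation index serve
  as parameters; empty sets encode the excluded pairs.\<close>

lemma frame_restrict:
  assumes "\<And>j. W j = nbhd (g j) \<or> W j = {}"
  shows "adapted_frame W (\<lambda>j. fvec (g j)) (\<lambda>j. ctr (g j)) (\<lambda>j. s (g j)) (\<lambda>j. \<kappa> (g j)) 2"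
proof -
  have sub: "\<xi> \<in> nbhd (g j)" if "\<xi> \<in> W j" for \<xi> j using assms[of j] that by auto
  have "open (W j)" for j using assms[of j] open_nbhd[of "g j"] by auto
  note op = this
  show ?thesis
  proof
    fix \<xi> j assume x: "\<xi> \<in> W j"
    note sub[OF x]
    note f = adapted_frame.s[OF frame this] adapted_frame.\<alpha>[OF frame this] adapted_frame.\<kappa>[OF frame this]
      adapted_frame.b[OF frame this] adapted_frame.V[OF frame this]
    show "0 < s (g j)" "s (g j) \<le> 1" "0 < \<kappa> (g j)" "norm (ctr (g j)) = 1" "norm (fvec (g j)) \<le> \<kappa> (g j)"
      "norm (cross3 (fvec (g j)) (ctr (g j))) \<le> \<kappa> (g j) * s (g j)" "\<kappa> (g j) / 8 < norm \<xi>"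
      "norm \<xi> < 8 * \<kappa> (g j)" "norm (cross3 (sgn \<xi>) (ctr (g j))) \<le> 2 * s (g j)"
      by (rule f)+
  qed (use op in auto)
qed

text \<open>One constant covers the shifts by C2 and C3 and the gap of less than C4 that separate
  the radii of neighbouring caps.\<close>

lemma scale_compare:
  assumes "\<bar>real_of_int r - t\<bar> \<le> C2 + C3 + C4"
  shows "2 powr t \<le> 2 powr (C2 + C3 + C4) * 2 powr real_of_int r" "2 powr real_of_int r \<le> 2 powr (C2 + C3 + C4) * 2 powr t"
  unfolding powr_add[symmetric] using assms by (auto intro!: powr_mono)

text \<open>The piece is selected by \<open>m\<close> as a function of the parameter, so one bound
  serves the numerator of \<open>\<eta>\<close> as well as all terms of the normalising sum.\<close>

lemma bdd_derivs_\<eta>tilde: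
  assumes W: "\<And>j. W j = nbhd (g j) \<or> W j = {}"
    and m: "\<And>j. W j \<noteq> {} \<Longrightarrow> m j \<in> near (g j)"
  shows "bdd_derivs n W (\<lambda>j. fvec (g j)) (\<lambda>j. \<eta>tilde (rho (g j)) (beta (g j)) (fst (m j)) (snd (m j)))"
proof -
  obtain \<tau> where \<tau>: "\<And>n. bdd_derivs n (\<lambda>_::unit. UNIV) (\<lambda>_. 1) (\<lambda>_. \<tau>)" "\<And>t. 0 \<le> t \<Longrightarrow> \<sigma> t = \<tau> (t\<^sup>2)"
    using sigma_profile by blast
  show ?thesis
    unfolding eta_tilde_def
  proof (rule adapted_frame.bdd_derivs_cap[OF frame_restrict[OF W] \<tau> sigma_zero, where C = "2 powr (C2 + C3 + C4)"])
    fix j \<xi> assume x: "\<xi> \<in> W j"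
    then have x': "\<xi> \<in> nbhd (g j)" using W[of j] by auto
    have mj: "fst (m j) \<in> scales C1 (rho (g j))" "snd (m j) \<in> {1..N}" "\<bar>real_of_int (scl (g j) - fst (m j))\<bar> < C4"
    proof -
      have "W j \<noteq> {}" using x by blast
      from m[OF this] show "fst (m j) \<in> scales C1 (rho (g j))" "snd (m j) \<in> {1..N}" "\<bar>real_of_int (scl (g j) - fst (m j))\<bar> < C4"
        by (auto simp: near_def mem_Times_iff)
    qed
    show "norm (\<alpha> (rho (g j)) (beta (g j)) (fst (m j)) (snd (m j))) = 1 \<and>
        2 powr (real_of_int (fst (m j)) - (if fst (m j) = 0 then C3' else C3)) \<le> 2 powr (C2 + C3 + C4) * s (g j) \<and>
        s (g j) \<le> 2 powr (C2 + C3 + C4) * 2 powr (real_of_int (fst (m j)) - (if fst (m j) = 0 then C3' else C3))"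
      using base_whitney(1)[OF nbhd_base(1)[OF x'] mj(1,2)] mj(3) params
      by (intro conjI scale_compare) auto
  qed auto
qed

lemma bdd_derivs_\<eta>sum: "bdd_derivs n nbhd fvec (\<lambda>i. \<eta>sum (rho i) (beta i))"
proof -
  obtain \<tau> where \<tau>: "\<And>n. bdd_derivs n (\<lambda>_::unit. UNIV) (\<lambda>_. 1) (\<lambda>_. \<tau>)" "\<And>t. 0 \<le> t \<Longrightarrow> \<sigma> t = \<tau> (t\<^sup>2)"
    using sigma_profile by blast
  have A1: "bdd_derivs n nbhd fvec (\<lambda>i \<xi>. \<Sum>j\<in>near i. \<eta>tilde (rho i) (beta i) (fst j) (snd j) \<xi>)"
  proof (rule bdd_derivs_sum_dependent)
    show "finite (near i) \<and> card (near i) \<le> nat (2 * \<lceil>C4\<rceil> + 1) * N" for i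
      using finite_near card_near by blast
    have "bdd_derivs n (\<lambda>x. if snd x \<in> near (fst x) then nbhd (fst x) else {}) (\<lambda>x. fvec (fst x))
      (\<lambda>x. \<eta>tilde (rho (fst x)) (beta (fst x)) (fst (snd x)) (snd (snd x)))"
      by (rule bdd_derivs_\<eta>tilde) (auto split: if_splits)
    then show "bdd_derivs n (\<lambda>(i, j). if j \<in> near i then nbhd i else {}) (\<lambda>(i, j). fvec i)
      (\<lambda>(i, j). \<eta>tilde (rho i) (beta i) (fst j) (snd j))"
      unfolding split_beta' by simp
  qed
  have A2: "bdd_derivs n nbhd fvec (\<lambda>i \<xi>. if rho i + C4 \<le> scl i then 0 else cap \<sigma> (rho i + C2) (beta i) \<xi>)"
  proof (rule bdd_derivs_cases[where Q = "\<lambda>i. rho i + C4 \<le> scl i", OF open_nbhd])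
    show "bdd_derivs n (\<lambda>i. if rho i + C4 \<le> scl i then nbhd i else {}) fvec
        (\<lambda>i \<xi>. if rho i + C4 \<le> scl i then 0 else cap \<sigma> (rho i + C2) (beta i) \<xi>)"
      by (rule bdd_derivs_cong[where f = "\<lambda>_ _. 0"])
         (auto simp: open_nbhd intro: bdd_derivs_const[where C = 0] split: if_splits)
    define W where "W i = (if rho i + C4 \<le> scl i then {} else nbhd i)" for i
    have fr: "adapted_frame W fvec ctr s \<kappa> 2"
      by (rule frame_restrict) (simp add: W_def)
    show "bdd_derivs n W fvec
        (\<lambda>i \<xi>. if rho i + C4 \<le> scl i then 0 else cap \<sigma> (rho i + C2) (beta i) \<xi>)"
    proof (rule bdd_derivs_cong)
      show "bdd_derivs n W fvec (\<lambda>i. cap \<sigma> (rho i + C2) (beta i))"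
      proof (rule adapted_frame.bdd_derivs_cap[OF fr \<tau> sigma_zero, where C = "2 powr (C2 + C3 + C4)"])
        fix i \<xi> assume x: "\<xi> \<in> W i"
        then have x': "\<xi> \<in> nbhd i" "\<not> rho i + C4 \<le> scl i" by (auto simp: W_def split: if_splits)
        \<comment> \<open>When the core cap takes part, the scale lies between rho + C1 and rho +
          C4, so this cap too has a radius comparable to that of the piece.\<close>
        have "rho i + C1 \<le> scl i" using nbhd_base(2)[OF x'(1)] by (simp add: scales_def)
        then have "\<bar>real_of_int (scl i) - (rho i + C2)\<bar> \<le> C2 + C3 + C4"
          using x'(2) params by (simp add: abs_le_iff)
        then show "norm (beta i) = 1 \<and> 2 powr (rho i + C2) \<le> 2 powr (C2 + C3 + C4) * s i \<and>
            s i \<le> 2 powr (C2 + C3 + C4) * 2 powr (rho i + C2)"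
          using base_beta[OF nbhd_base(1)[OF x'(1)]] by (intro conjI scale_compare)
      qed auto
    qed (auto simp: W_def open_nbhd split: if_splits)
  qed
  show ?thesis
    by (rule bdd_derivs_cong[OF open_nbhd _ bdd_derivs_add[OF A2 A1]]) (simp add: sum_near)
qed

lemma bdd_derivs_\<eta>: "bdd_derivs n nbhd fvec (\<lambda>i. \<eta> (rho i) (beta i) (scl i) (pos i))"
  unfolding eta_def
proof (rule bdd_derivs_divide[where c = "1 / A"])
  have "bdd_derivs n nbhd fvec (\<lambda>i. \<eta>tilde (rho i) (beta i) (fst (scl i, pos i)) (snd (scl i, pos i)))"
  proof (rule bdd_derivs_\<eta>tilde)
    fix i assume "nbhd i \<noteq> {}"
    then obtain \<xi> where "\<xi> \<in> nbhd i" by blast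
    from nbhd_base[OF this] show "(scl i, pos i) \<in> near i"
      using params by (simp add: near_def)
  qed simp
  then show "bdd_derivs n nbhd fvec (\<lambda>i. \<eta>tilde (rho i) (beta i) (scl i) (pos i))" by simp
  show "1 / A \<le> \<bar>\<eta>sum (rho i) (beta i) \<xi>\<bar>" if "\<xi> \<in> nbhd i" for i \<xi>
    using base_sum[OF nbhd_base(1)[OF that] nbhd_nonzero[OF that]] by linarith
qed (use params bdd_derivs_\<eta>sum in auto)

lemma bdd_derivs_fat_cutoff: "bdd_derivs n nbhd fvec (\<lambda>i. fat_cutoff chi (freq i))"
proof -
  obtain \<tau> where \<tau>: "\<And>n. bdd_derivs n (\<lambda>_::unit. UNIV) (\<lambda>_. 1) (\<lambda>_. \<tau>)" "\<And>\<xi>. chi \<xi> = \<tau> ((norm \<xi>)\<^sup>2)"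
    using smooth_radial_profile[OF chi_props(1,3,4,5)] by blast
  have "bdd_derivs n nbhd fvec (\<lambda>i \<xi>. chi ((1 / (2 * \<kappa> i)) *\<^sub>R \<xi>))" "bdd_derivs n nbhd fvec (\<lambda>i \<xi>. chi ((4 / \<kappa> i) *\<^sub>R \<xi>))"
    by (rule adapted_frame.bdd_derivs_radial[OF frame \<tau>, where C = 4], simp add: abs_mult)+
  then show ?thesis
    unfolding fat_cutoff_def powr_neg_shift by (rule bdd_derivs_diff)
qed

text \<open>The normalisation \<open>nrm i\<close> keeps the linear form \<open>\<xi> \<mapsto> \<xi> \<times> dir i\<close> bounded with all its
  derivatives even if \<open>dir i\<close> is much farther from the line through \<open>ctr i\<close> than \<open>s i\<close>.\<close>

definition nrm :: "index \<Rightarrow> real" where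
  "nrm i = max 1 (norm (cross3 (ctr i) (dir i)) / s i)"

definition cform :: "index \<Rightarrow> 3 \<Rightarrow> real^3 \<Rightarrow> real" where
  "cform i j \<xi> = cross3 \<xi> (dir i) $ j / (\<kappa> i * (s i * nrm i))"

lemma nrm_ge: "1 \<le> nrm i"
  by (simp add: nrm_def)

lemma dir_unit: "\<xi> \<in> nbhd i \<Longrightarrow> norm (dir i) = 1"
  using nbhd_base(4) supp_sphere by blast

lemma bdd_derivs_cform: "bdd_derivs n nbhd fvec (\<lambda>i. cform i j)"
  unfolding cform_def
proof (rule adapted_frame.bdd_derivs_cross[OF frame, where C = 2])
  fix i \<xi> assume x: "\<xi> \<in> nbhd i"
  have "norm (cross3 (ctr i) (dir i)) / s i \<le> nrm i" by (simp add: nrm_def)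
  then have "norm (cross3 (ctr i) (dir i)) \<le> s i * nrm i"
    by (simp add: pos_divide_le_eq mult.commute)
  moreover have "s i * 1 \<le> s i * nrm i"
    using nrm_ge by (intro mult_left_mono) auto
  moreover have "0 < s i * nrm i" using nrm_ge[of i] by (intro mult_pos_pos) auto
  ultimately show "norm (dir i) \<le> 1 \<and> 0 < s i * nrm i \<and> s i + norm (cross3 (ctr i) (dir i)) \<le> 2 * (s i * nrm i)"
    using dir_unit[OF x] unfolding mult_1_right by (intro conjI) linarith+
qed

lemma cform_square: "(\<Sum>j\<in>UNIV. (cform i j \<xi>)\<^sup>2) = (norm (cross3 \<xi> (dir i)) / (\<kappa> i * (s i * nrm i)))\<^sup>2"
  by (simp add: cform_def power_divide sum_components_power2[symmetric] sum_divide_distrib)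

text \<open>Both sizes hidden in \<open>s i * nrm i\<close> are controlled by w = |dir x sgn \<xi>|.
  The separation of the supports gives s \<le> 2 A w, and then the triangle inequality for lines
  gives |ctr x dir| \<le> 2 s + w \<le> (1 + 4 A) w.\<close>

lemma cform_lower:
  assumes x: "\<xi> \<in> nbhd i"
  shows "(1 / (8 * (1 + 4 * A)))\<^sup>2 \<le> (\<Sum>j\<in>UNIV. (cform i j \<xi>)\<^sup>2)"
proof -
  have A: "1 \<le> A" using params by simp
  have n: "\<kappa> i / 8 < norm \<xi>" "norm (cross3 (sgn \<xi>) (ctr i)) < 2 * s i" "s i / (2 * A) < norm (cross3 (dir i) (sgn \<xi>))"
    using x by (auto simp: nbhd_def split: if_splits)
  define w where "w = norm (cross3 (dir i) (sgn \<xi>))"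
  have sg: "norm (sgn \<xi>) = 1" using nbhd_nonzero[OF x] by (simp add: norm_sgn)
  have k: "0 < \<kappa> i" "0 < s i" by simp_all
  have sw: "s i \<le> 2 * A * w"
    using n(3) A by (simp add: pos_divide_less_eq w_def mult.commute)
  have "norm (cross3 (dir i) (ctr i)) \<le> norm (dir i) * norm (cross3 (sgn \<xi>) (ctr i)) + norm (cross3 (dir i) (sgn \<xi>)) * norm (ctr i)"
    by (rule norm_cross3_triangle[OF sg])
  also have "\<dots> \<le> 2 * s i + w"
    using n(2) dir_unit[OF x] adapted_frame.\<alpha>[OF frame x] by (simp add: w_def)
  finally have "norm (cross3 (ctr i) (dir i)) \<le> (1 + 4 * A) * w"
    using sw norm_cross3_commute[of "dir i" "ctr i"] by (simp add: algebra_simps)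
  moreover have "s i \<le> (1 + 4 * A) * w"
  proof -
    have "2 * A * w \<le> (1 + 4 * A) * w" using A by (intro mult_right_mono) (auto simp: w_def)
    then show ?thesis using sw by linarith
  qed
  ultimately have "s i * nrm i \<le> (1 + 4 * A) * w"
    using k by (auto simp: nrm_def max_def pos_le_divide_eq)
  then have "\<kappa> i * (s i * nrm i) \<le> \<kappa> i * ((1 + 4 * A) * w)"
    using k by (intro mult_left_mono) auto
  also have "\<dots> \<le> 8 * norm \<xi> * ((1 + 4 * A) * w)"
    using n(1) A by (intro mult_right_mono) (auto simp: w_def)
  also have "\<dots> = 8 * (1 + 4 * A) * norm (cross3 \<xi> (dir i))"
    using adapted_frame.cross_sgn[OF frame, of \<xi> "dir i"] norm_cross3_commute[of "dir i" "sgn \<xi>"] by (simp add: w_def)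
  finally have "1 / (8 * (1 + 4 * A)) \<le> norm (cross3 \<xi> (dir i)) / (\<kappa> i * (s i * nrm i))"
    using k nrm_ge[of i] A by (simp add: divide_le_eq le_divide_eq mult_pos_pos mult.commute)
  then show ?thesis
    unfolding cform_square using A by (intro power_mono) auto
qed

text \<open>The symbol of a vector field \<open>m\<close> with \<open>(dir \<times> \<xi>) \<bullet> m = \<eta>\<close> on the shell \<open>\<bar>\<xi>\<bar> \<approx> 2 powr freq\<close>. As
  \<open>\<bar>dir \<times> \<xi>\<bar>\<close> is at least of size \<open>2 powr (freq + scl)\<close> there, the factor \<open>s i * \<kappa> i\<close> makes it bounded.\<close>

definition mult0 :: "index \<Rightarrow> 3 \<Rightarrow> real^3 \<Rightarrow> real" where
  "mult0 i j \<xi> = s i * \<kappa> i * (cross3 (dir i) \<xi> $ j / (norm (cross3 (dir i) \<xi>))\<^sup>2) *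
     (\<eta> (rho i) (beta i) (scl i) (pos i) \<xi> * fat_cutoff chi (freq i) \<xi>)"

text \<open>In terms of the normalised forms only a factor \<open>1 / nrm i\<close>, at most 1,
  remains: a direction far from the axis makes the symbol smaller and does no harm.\<close>

lemma mult0_eq:
  assumes "\<xi> \<in> nbhd i"
  shows "mult0 i j \<xi> = - ((1 / nrm i) * (cform i j \<xi> / (\<Sum>j\<in>UNIV. (cform i j \<xi>)\<^sup>2))) *
     (\<eta> (rho i) (beta i) (scl i) (pos i) \<xi> * fat_cutoff chi (freq i) \<xi>)"
proof -
  have "0 < nrm i" using nrm_ge[of i] by linarith
  have k: "0 < \<kappa> i" "0 < s i" by simp_all
  have c: "cross3 (dir i) \<xi> = - cross3 \<xi> (dir i)" by (rule cross_skew)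
  define K T q where "K = \<kappa> i" "T = s i" "q = nrm i"
  have "T * K * (y / X\<^sup>2) = (1 / q) * ((y / (K * (T * q))) / (X / (K * (T * q)))\<^sup>2)" for X y :: real
    using \<open>0 < nrm i\<close> k unfolding K_T_q_def[symmetric]
    by (cases "X = 0") (simp_all add: divide_simps power2_eq_square)
  from this[of "cross3 \<xi> (dir i) $ j" "norm (cross3 \<xi> (dir i))"]
  show ?thesis
    unfolding mult0_def cform_square c cform_def[symmetric]
    by (simp add: cform_def K_T_q_def)
qed

lemma eta_fat_zero:
  assumes "\<xi> \<notin> core i"
  shows "\<eta> (rho i) (beta i) (scl i) (pos i) \<xi> * fat_cutoff chi (freq i) \<xi> = 0"
proof (cases "\<kappa> i / 4 \<le> norm \<xi> \<and> norm \<xi> \<le> 4 * \<kappa> i")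
  case True
  have "0 < \<kappa> i" by simp
  then have "\<xi> \<noteq> 0" using True by force
  have "sgn \<xi> \<notin> supp (\<eta> (rho i) (beta i) (scl i) (pos i))" using assms True by (simp add: core_def)
  from closed_support_zero[OF sgn_sphere[OF \<open>\<xi> \<noteq> 0\<close>] this]
  show ?thesis by (simp add: \<eta>_sgn)
next
  case False
  then have "norm \<xi> < \<kappa> i / 4 \<or> 4 * \<kappa> i < norm \<xi>" by linarith
  then show ?thesis using fat_cutoff_zero by simp
qed

lemma mult0_zero:
  assumes "\<xi> \<notin> core i"
  shows "mult0 i j \<xi> = 0"
  unfolding mult0_def eta_fat_zero[OF assms] by (rule mult_zero_right)

text \<open>The open sets \<open>nbhd i\<close> and the complement of \<open>core i\<close> cover
  the space, and the function vanishes on the second one.\<close>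

lemma bdd_derivs_extend:
  assumes "bdd_derivs n nbhd fvec f" "\<And>i \<xi>. valid i \<Longrightarrow> \<xi> \<notin> core i \<Longrightarrow> f i \<xi> = 0"
  shows "bdd_derivs n (\<lambda>i. if valid i then UNIV else {}) fvec f"
proof (rule bdd_derivs_subset[OF bdd_derivs_Un[OF open_nbhd _ assms(1)]])
  show "bdd_derivs n (\<lambda>i. if valid i then - core i else {}) fvec f"
    by (rule bdd_derivs_cong[where f = "\<lambda>_ _. 0"])
       (auto simp: assms(2) intro: bdd_derivs_const[where C = 0] open_Compl closed_core split: if_splits)
  show "open (if valid i then - core i else {})" for i
    using closed_core by (auto intro: open_Compl)
  show "(if valid i then UNIV else {}) \<subseteq> nbhd i \<union> (if valid i then - core i else {})" for i
    using core_subset[of i] by auto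
qed

lemma bdd_derivs_mult0_nbhd: "bdd_derivs n nbhd fvec (\<lambda>i. mult0 i j)"
proof -
  have "bdd_derivs n nbhd fvec (\<lambda>i \<xi>. - ((1 / nrm i) * (cform i j \<xi> / (\<Sum>j\<in>UNIV. (cform i j \<xi>)\<^sup>2))) *
     (\<eta> (rho i) (beta i) (scl i) (pos i) \<xi> * fat_cutoff chi (freq i) \<xi>))"
  proof (intro bdd_derivs_mult[OF bdd_derivs_uminus[OF bdd_derivs_mult] bdd_derivs_mult] bdd_derivs_\<eta> bdd_derivs_fat_cutoff)
    show "bdd_derivs n nbhd fvec (\<lambda>i \<xi>. 1 / nrm i)"
    proof (rule bdd_derivs_const)
      show "\<bar>1 / nrm i\<bar> \<le> 1" for i using nrm_ge[of i] by simp
    qed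
    show "bdd_derivs n nbhd fvec (\<lambda>i \<xi>. cform i j \<xi> / (\<Sum>j\<in>UNIV. (cform i j \<xi>)\<^sup>2))"
    proof (rule bdd_derivs_divide[OF bdd_derivs_cform])
      show "bdd_derivs n nbhd fvec (\<lambda>i \<xi>. \<Sum>j\<in>UNIV. (cform i j \<xi>)\<^sup>2)"
        by (intro bdd_derivs_sum bdd_derivs_power2 bdd_derivs_cform) simp
      show "0 < (1 / (8 * (1 + 4 * A)))\<^sup>2" using params(8) by simp
      show "(1 / (8 * (1 + 4 * A)))\<^sup>2 \<le> \<bar>\<Sum>j\<in>UNIV. (cform i j \<xi>)\<^sup>2\<bar>" if "\<xi> \<in> nbhd i" for i \<xi>
        using cform_lower[OF that] by linarith
    qed
  qed
  then show ?thesis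
    by (rule bdd_derivs_cong[OF open_nbhd, rotated]) (simp add: mult0_eq)
qed

lemma bdd_derivs_mult0: "bdd_derivs n (\<lambda>i. if valid i then UNIV else {}) fvec (\<lambda>i. mult0 i j)"
  by (rule bdd_derivs_extend[OF bdd_derivs_mult0_nbhd mult0_zero])

lemma bdd_derivs_mult1:
  "bdd_derivs n (\<lambda>i. if valid i then UNIV else {}) fvec (\<lambda>i \<xi>. \<xi> $ m / \<kappa> i * mult0 i j \<xi>)"
  by (rule bdd_derivs_extend[OF bdd_derivs_mult[OF adapted_frame.bdd_derivs_coordinate[OF frame] bdd_derivs_mult0_nbhd]])
     (simp add: mult0_zero)

end

section \<open>Kernels of compactly supported symbols\<close>

lemma integrable_lborel_translate:
  fixes f :: "'a::euclidean_space \<Rightarrow> 'b::{banach, second_countable_topology}"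
  assumes "integrable lborel f"
  shows "integrable lborel (\<lambda>x. f (x + c))" "(LINT x|lborel. f (x + c)) = (LINT x|lborel. f x)"
proof -
  have e: "lborel = distr lborel borel (\<lambda>x::'a. x + c)"
  proof -
    have "(+) c = (\<lambda>x. x + c)" by (simp add: fun_eq_iff add.commute)
    then show ?thesis using lborel_distr_plus[of c] by simp
  qed
  have m: "f \<in> borel_measurable borel" using assms by auto
  show "integrable lborel (\<lambda>x. f (x + c))"
    using assms by (subst (asm) e) (simp add: integrable_distr_eq m)
  show "(LINT x|lborel. f (x + c)) = (LINT x|lborel. f x)"
    by (subst (2) e) (simp add: integral_distr m)
qed

text \<open>The integral of a difference quotient vanishes by translation invariance.\<close>

lemma integral_directional_derivative_zero:
  fixes g g' :: "'a::euclidean_space \<Rightarrow> complex"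
  assumes der: "\<And>x. ((\<lambda>t. g (x + t *\<^sub>R b)) has_vector_derivative g' x) (at 0)"
    and bd: "\<And>x t. 0 \<le> t \<Longrightarrow> t \<le> 1 \<Longrightarrow> norm (g' (x + t *\<^sub>R b)) \<le> h x"
    and h: "integrable lborel h" and g: "integrable lborel g"
  shows "integrable lborel g'" "(LINT x|lborel. g' x) = 0"
proof -
  define d where "d n x = real (Suc n) *\<^sub>R (g (x + (1 / real (Suc n)) *\<^sub>R b) - g x)" for n x
  have der': "((\<lambda>t. g (x + t *\<^sub>R b)) has_vector_derivative g' (x + u *\<^sub>R b)) (at u)" for x u
  proof -
    have "((\<lambda>t. g ((x + u *\<^sub>R b) + t *\<^sub>R b)) has_derivative (\<lambda>t. t *\<^sub>R g' (x + u *\<^sub>R b))) (at ((\<lambda>t. t - u) u))"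
      using der[of "x + u *\<^sub>R b"] by (simp add: has_vector_derivative_def)
    then have "(((\<lambda>t. g ((x + u *\<^sub>R b) + t *\<^sub>R b)) \<circ> (\<lambda>t. t - u)) has_derivative (\<lambda>t. t *\<^sub>R g' (x + u *\<^sub>R b)) \<circ> (\<lambda>t. t)) (at u)"
      by (intro diff_chain_at) (auto intro!: derivative_eq_intros)
    then show ?thesis by (simp add: o_def has_vector_derivative_def scaleR_left_diff_distrib)
  qed
  have m[measurable]: "g \<in> borel_measurable borel" using g by auto
  have dm[measurable]: "d n \<in> borel_measurable lborel" for n
    unfolding d_def by measurable
  have lim: "(\<lambda>n. d n x) \<longlonglongrightarrow> g' x" for x
  proof -
    have "((\<lambda>t. norm (g (x + t *\<^sub>R b) - g x - t *\<^sub>R g' x) / norm t) \<longlongrightarrow> 0) (at 0)"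
      using der[of x] by (simp add: has_vector_derivative_def has_derivative_iff_norm)
    moreover have "filterlim (\<lambda>n. 1 / real (Suc n)) (at 0) sequentially"
      using LIMSEQ_inverse_real_of_nat by (simp add: filterlim_at inverse_eq_divide)
    ultimately have *: "(\<lambda>n. norm (g (x + (1 / real (Suc n)) *\<^sub>R b) - g x - (1 / real (Suc n)) *\<^sub>R g' x) / norm (1 / real (Suc n))) \<longlonglongrightarrow> 0"
      by (rule filterlim_compose)
    have "norm (g (x + (1 / real (Suc n)) *\<^sub>R b) - g x - (1 / real (Suc n)) *\<^sub>R g' x) / norm (1 / real (Suc n)) = norm (d n x - g' x)" for n
    proof -
      define w where "w = g (x + (1 / real (Suc n)) *\<^sub>R b) - g x"
      have "d n x - g' x = real (Suc n) *\<^sub>R (w - (1 / real (Suc n)) *\<^sub>R g' x)"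
        by (simp add: d_def w_def scaleR_right_diff_distrib del: of_nat_Suc)
      then show ?thesis by (simp add: w_def[symmetric] del: of_nat_Suc)
    qed
    then show ?thesis
      using * by (simp only:) (rule Lim_null[THEN iffD2], rule tendsto_norm_zero_cancel)
  qed
  \<comment> \<open>The mean value inequality on a segment of length at most 1 in the parameter; for
    this reason \<open>h x\<close> has to dominate the derivative along the whole segment starting
    at x.\<close>
  have dbd: "norm (d n x) \<le> h x" for n x
  proof -
    define e where "e = 1 / real (Suc n)"
    have e: "0 \<le> e" "e \<le> 1" by (auto simp: e_def divide_simps)
    have "norm (g (x + e *\<^sub>R b) - g (x + 0 *\<^sub>R b)) \<le> h x * norm (e - 0)"
    proof (rule differentiable_bound[of "{0..e}"])
      show "((\<lambda>t. g (x + t *\<^sub>R b)) has_derivative (\<lambda>t. t *\<^sub>R g' (x + u *\<^sub>R b))) (at u within {0..e})" for u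
        using der'[of x u] by (auto simp: has_vector_derivative_def intro: has_derivative_at_withinI)
      show "onorm (\<lambda>t. t *\<^sub>R g' (x + u *\<^sub>R b)) \<le> h x" if "u \<in> {0..e}" for u
        using bd[of u x] that e by (intro onorm_le) (auto simp: mult.commute[of "h x"] intro!: mult_left_mono)
    qed (use e in auto)
    then have "norm (d n x) \<le> real (Suc n) * (h x * e)"
      using e by (simp add: d_def e_def[symmetric] del: of_nat_Suc)
    then show ?thesis by (simp add: e_def)
  qed
  have gm: "g' \<in> borel_measurable lborel"
    by (rule borel_measurable_LIMSEQ_metric[OF dm lim])
  show "integrable lborel g'"
    by (rule integrable_dominated_convergence[where s = d, OF gm dm h]) (use lim dbd in auto)
  have "(\<lambda>n. LINT x|lborel. d n x) \<longlonglongrightarrow> (LINT x|lborel. g' x)"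
    by (rule integral_dominated_convergence[OF gm dm h]) (use lim dbd in auto)
  moreover have "(LINT x|lborel. d n x) = 0" for n
    unfolding d_def using g integrable_lborel_translate[OF g, of "(1 / real (Suc n)) *\<^sub>R b"]
    by (simp del: of_nat_Suc)
  ultimately show "(LINT x|lborel. g' x) = 0"
    using LIMSEQ_unique[OF _ tendsto_const] by auto
qed

section \<open>Integration by parts in oscillatory integrals\<close>

definition osc :: "(real^3 \<Rightarrow> real) \<Rightarrow> real^3 \<Rightarrow> complex" where
  "osc f z = (LINT \<xi>|lborel. of_real (f \<xi>) * cis (z \<bullet> \<xi>))"

lemma integrable_compact_support:
  fixes f :: "real^3 \<Rightarrow> real"
  assumes "f \<in> borel_measurable borel" "\<And>x. \<bar>f x\<bar> \<le> C" "\<And>x. x \<notin> B \<Longrightarrow> f x = 0" "compact B"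
  shows "integrable lborel f" "(LINT x|lborel. \<bar>f x\<bar>) \<le> C * measure lborel B"
proof -
  have B: "B \<in> sets lborel" "emeasure lborel B < \<infinity>"
    using emeasure_compact_finite[OF assms(4)] borel_compact[OF assms(4)] by auto
  have i: "integrable lborel (\<lambda>x. C * indicat_real B x)"
    using B by simp
  have bd: "\<bar>f x\<bar> \<le> C * indicat_real B x" for x
    using assms(2)[of x] assms(3)[of x] by (auto simp: indicator_def)
  show f: "integrable lborel f"
    by (rule Bochner_Integration.integrable_bound[OF i]) (use assms(1) bd in \<open>auto intro!: order_trans[OF bd abs_ge_self]\<close>)
  have "(LINT x|lborel. \<bar>f x\<bar>) \<le> (LINT x|lborel. C * indicat_real B x)"
    by (rule integral_mono[OF integrable_abs[OF f] i bd])
  also have "\<dots> = C * measure lborel B" using B by simp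
  finally show "(LINT x|lborel. \<bar>f x\<bar>) \<le> C * measure lborel B" .
qed

lemma cis_inner_measurable' [measurable]: "(\<lambda>\<xi>. cis (z \<bullet> (\<xi>::real^3))) \<in> borel_measurable borel"
  by (intro borel_measurable_continuous_onI continuous_intros)

lemma osc_integrable:
  fixes f :: "real^3 \<Rightarrow> real"
  assumes "integrable lborel f"
  shows "integrable lborel (\<lambda>\<xi>. of_real (f \<xi>) * cis (z \<bullet> \<xi>))"
proof (rule Bochner_Integration.integrable_bound[OF assms])
  have [measurable]: "f \<in> borel_measurable borel" using assms by auto
  show "(\<lambda>\<xi>. complex_of_real (f \<xi>) * cis (z \<bullet> \<xi>)) \<in> borel_measurable lborel"
    unfolding measurable_lborel1 by (intro borel_measurable_times cis_inner_measurable') measurable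
qed (auto simp: norm_mult)

lemma osc_le: "integrable lborel f \<Longrightarrow> norm (osc f z) \<le> (LINT x|lborel. \<bar>f x\<bar>)"
  unfolding osc_def by (rule order_trans[OF integral_norm_bound]) (simp add: norm_mult)

lemma cis_line_derivative:
  "((\<lambda>t. cis (z \<bullet> (x + t *\<^sub>R b))) has_vector_derivative (of_real (z \<bullet> b) * \<i> * cis (z \<bullet> x))) (at 0)"
proof -
  show ?thesis
    unfolding has_vector_derivative_def
    by (rule has_derivative_eq_rhs, rule has_derivative_cis, rule derivative_intros, rule has_derivative_add[OF has_derivative_const],
        rule has_derivative_scaleR_left[OF has_derivative_ident])
       (simp add: scaleR_conv_of_real mult_ac)
qed

text \<open>Differentiating the product of \<open>f\<close> and the exponential along
  \<open>b\<close> produces \<open>f'\<close> and a factor i (z . b); the integral of the total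
  derivative is zero.\<close>

lemma osc_by_parts:
  assumes fm: "f \<in> borel_measurable borel" and f: "\<And>x. \<bar>f x\<bar> \<le> C" "\<And>x. x \<notin> B \<Longrightarrow> f x = 0" and B: "compact B"
    and f': "\<And>x. ((\<lambda>t. f (x + t *\<^sub>R b)) has_real_derivative f' x) (at 0)" "\<And>x. \<bar>f' x\<bar> \<le> C'"
  shows "f' \<in> borel_measurable borel" "x \<notin> B \<Longrightarrow> f' x = 0" "\<bar>z \<bullet> b\<bar> * norm (osc f z) = norm (osc f' z)"
proof -
  have f'0: "f' x = 0" if "x \<notin> B" for x
  proof -
    have "((\<lambda>t. (\<lambda>_. 0) (x + t *\<^sub>R b)) has_real_derivative f' x) (at 0)"
      using DERIV_line_cong[of "- B" x f "\<lambda>_. 0"] f(2) f'(1)[of x] that B by (auto intro: open_Compl compact_imp_closed)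
    then show ?thesis using DERIV_unique[OF _ DERIV_const] by blast
  qed
  then show "x \<notin> B \<Longrightarrow> f' x = 0" .
  \<comment> \<open>The derivative is given only pointwise; as a limit of difference quotients it is
    measurable.\<close>
  show f'm: "f' \<in> borel_measurable borel"
  proof (rule borel_measurable_LIMSEQ_real)
    show "(\<lambda>n. (f (x + (1 / real (Suc n)) *\<^sub>R b) - f x) / (1 / real (Suc n))) \<longlonglongrightarrow> f' x" for x
    proof -
      have "((\<lambda>t. (f (x + t *\<^sub>R b) - f x) / t) \<longlongrightarrow> f' x) (at 0)"
        using f'(1)[of x] by (simp add: has_field_derivative_iff)
      moreover have "filterlim (\<lambda>n. 1 / real (Suc n)) (at 0) sequentially"
        using LIMSEQ_inverse_real_of_nat by (simp add: filterlim_at inverse_eq_divide)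
      ultimately show ?thesis by (rule filterlim_compose)
    qed
  qed (use fm in measurable)
  have C: "0 \<le> C" "0 \<le> C'" using f(1)[of 0] f'(2)[of 0] by linarith+
  note fi = integrable_compact_support(1)[OF fm f B] and f'i = integrable_compact_support(1)[OF f'm f'(2) f'0 B]
  define g where "g \<xi> = of_real (f \<xi>) * cis (z \<bullet> \<xi>)" for \<xi>
  define g' where "g' \<xi> = of_real (f' \<xi>) * cis (z \<bullet> \<xi>) + (of_real (z \<bullet> b) * \<i>) * (of_real (f \<xi>) * cis (z \<bullet> \<xi>))" for \<xi>
  obtain R where R: "\<And>x. x \<in> B \<Longrightarrow> norm x \<le> R" using compact_imp_bounded[OF B] by (auto simp: bounded_iff)
  have "(LINT x|lborel. g' x) = 0"
  proof (rule integral_directional_derivative_zero(2))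
    show "((\<lambda>t. g (x + t *\<^sub>R b)) has_vector_derivative g' x) (at 0)" for x
    proof -
      have "((\<lambda>t. complex_of_real (f (x + t *\<^sub>R b))) has_vector_derivative of_real (f' x)) (at 0)"
        using f'(1)[of x] by (intro has_vector_derivative_of_real) (simp add: has_real_derivative_iff_has_vector_derivative)
      from has_vector_derivative_mult[OF this cis_line_derivative[of z x b]]
      show ?thesis by (simp add: g_def g'_def mult_ac add_ac)
    qed
    show "integrable lborel g" unfolding g_def by (rule osc_integrable[OF fi])
    \<comment> \<open>Enlarging the ball by |b| makes one majorant valid on the whole segment from x
      to x + b.\<close>
    show "integrable lborel (\<lambda>x. (C' + \<bar>z \<bullet> b\<bar> * C) * indicat_real (cball 0 (R + norm b)) x)"
      by (intro integrable_mult_right integrable_real_indicator) (auto simp: emeasure_compact_finite[OF compact_cball, unfolded infinity_ennreal_def])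
    show "norm (g' (x + t *\<^sub>R b)) \<le> (C' + \<bar>z \<bullet> b\<bar> * C) * indicat_real (cball 0 (R + norm b)) x" if "0 \<le> t" "t \<le> 1" for x t
    proof (cases "x + t *\<^sub>R b \<in> B")
      case True
      have "norm (g' (x + t *\<^sub>R b)) \<le> \<bar>f' (x + t *\<^sub>R b)\<bar> + \<bar>z \<bullet> b\<bar> * \<bar>f (x + t *\<^sub>R b)\<bar>"
        unfolding g'_def by (rule order_trans[OF norm_triangle_ineq]) (simp add: norm_mult)
      also have "\<dots> \<le> C' + \<bar>z \<bullet> b\<bar> * C"
        using f f' by (intro add_mono mult_left_mono) auto
      finally have 1: "norm (g' (x + t *\<^sub>R b)) \<le> C' + \<bar>z \<bullet> b\<bar> * C" .
      have "norm x \<le> norm (x + t *\<^sub>R b) + norm (t *\<^sub>R b)"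
        using norm_triangle_ineq4[of "x + t *\<^sub>R b" "t *\<^sub>R b"] by simp
      also have "\<dots> \<le> R + 1 * norm b"
        using True R that by (intro add_mono) (auto intro: mult_left_le_one_le)
      finally have "x \<in> cball 0 (R + norm b)" by simp
      then show ?thesis using 1 by simp
    next
      case False
      then show ?thesis using C by (simp add: g'_def f f'0)
    qed
  qed
  moreover have "(LINT x|lborel. g' x) = osc f' z + (of_real (z \<bullet> b) * \<i>) * osc f z"
    unfolding g'_def osc_def using osc_integrable[OF fi, of z] osc_integrable[OF f'i, of z] by simp
  ultimately have "osc f' z = - ((of_real (z \<bullet> b) * \<i>) * osc f z)"
    by (simp add: eq_neg_iff_add_eq_0)
  then show "\<bar>z \<bullet> b\<bar> * norm (osc f z) = norm (osc f' z)"
    by (simp add: norm_mult)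
qed

text \<open>One integration by parts along \<open>b i\<close> per order, and the trivial bound at
  the end. The volume of the support is kept explicit since it later becomes the height of the
  kernel.\<close>

lemma osc_decay:
  assumes B: "\<And>i. Q i \<Longrightarrow> compact (B i)"
  shows "bdd_derivs n (\<lambda>i. if Q i then UNIV else {}) b f \<Longrightarrow>
    (\<And>i. Q i \<Longrightarrow> f i \<in> borel_measurable borel) \<Longrightarrow> (\<And>i x. Q i \<Longrightarrow> x \<notin> B i \<Longrightarrow> f i x = 0) \<Longrightarrow>
    \<exists>C. \<forall>i z. Q i \<longrightarrow> \<bar>z \<bullet> b i\<bar> ^ n * norm (osc (f i) z) \<le> C * measure lborel (B i)"
proof (induction n arbitrary: f)
  case 0
  obtain C where C: "\<And>i x. Q i \<Longrightarrow> \<bar>f i x\<bar> \<le> C"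
    using bdd_derivs_bounded[OF "0.prems"(1)] by (auto split: if_splits)
  have "norm (osc (f i) z) \<le> C * measure lborel (B i)" if "Q i" for i z
    using integrable_compact_support[OF "0.prems"(2)[OF that] C[OF that] "0.prems"(3)[OF that] B[OF that]] osc_le
    by (meson order_trans)
  then show ?case by auto
next
  case (Suc n)
  obtain C where C: "\<And>i x. Q i \<Longrightarrow> \<bar>f i x\<bar> \<le> C"
    using bdd_derivs_bounded[OF Suc.prems(1)] by (auto split: if_splits)
  obtain f' where f'0: "\<And>i x. x \<in> (if Q i then UNIV else {}) \<Longrightarrow> ((\<lambda>t. f i (x + t *\<^sub>R b i)) has_real_derivative f' i x) (at 0)"
     "bdd_derivs n (\<lambda>i. if Q i then UNIV else {}) b f'"
    by (rule bdd_derivs_SucE[OF Suc.prems(1)]) (rule that)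
  obtain C' where C': "\<And>i x. Q i \<Longrightarrow> \<bar>f' i x\<bar> \<le> C'"
    using bdd_derivs_bounded[OF f'0(2)] by (auto split: if_splits)
  have D: "((\<lambda>t. f i (x + t *\<^sub>R b i)) has_real_derivative f' i x) (at 0)" if "Q i" for i x
    using f'0(1) that by simp
  have ibp: "f' i \<in> borel_measurable borel" "x \<notin> B i \<Longrightarrow> f' i x = 0" "\<bar>z \<bullet> b i\<bar> * norm (osc (f i) z) = norm (osc (f' i) z)"
    if "Q i" for i x z
    using osc_by_parts[OF Suc.prems(2)[OF that] C[OF that] Suc.prems(3)[OF that] B[OF that] D[OF that] C'[OF that]]
    by blast+
  obtain K where K: "\<And>i z. Q i \<Longrightarrow> \<bar>z \<bullet> b i\<bar> ^ n * norm (osc (f' i) z) \<le> K * measure lborel (B i)"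
    using Suc.IH[OF f'0(2)] ibp(1,2) by blast
  have "\<bar>z \<bullet> b i\<bar> ^ Suc n * norm (osc (f i) z) \<le> K * measure lborel (B i)" if "Q i" for i z
  proof -
    have "\<bar>z \<bullet> b i\<bar> ^ Suc n * norm (osc (f i) z) = \<bar>z \<bullet> b i\<bar> ^ n * (\<bar>z \<bullet> b i\<bar> * norm (osc (f i) z))" by simp
    then show ?thesis using K[OF that, of z] by (simp only: ibp(3)[OF that])
  qed
  then show ?case by blast
qed

section \<open>Rotated boxes and anisotropic weights\<close>

lemma Basis_real3: "(Basis :: (real^3) set) = range (\<lambda>d. axis d 1)"
  by (auto simp: Basis_vec_def)

lemma prod_Basis_real3: "(\<Prod>b\<in>Basis. f (b :: real^3)) = (\<Prod>d\<in>UNIV. f (axis d 1))"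
  unfolding Basis_real3 by (subst prod.reindex) (auto simp: inj_on_def axis_eq_axis)

text \<open>It suffices to measure boxes. The preimage of a box is its image under the inverse map,
  and orthogonal images preserve Lebesgue measure.\<close>

lemma lborel_distr_orthogonal:
  fixes Q :: "real^3 \<Rightarrow> real^3"
  assumes Q: "orthogonal_transformation Q"
  shows "distr lborel borel Q = lborel"
proof (rule lborel_eqI[symmetric])
  fix l u :: "real^3"
  assume le: "\<And>b. b \<in> Basis \<Longrightarrow> l \<bullet> b \<le> u \<bullet> b"
  have Qm': "Q \<in> borel_measurable borel"
    using orthogonal_transformation_linear[OF Q]
    by (intro borel_measurable_continuous_onI linear_continuous_on) (simp add: linear_conv_bounded_linear)
  then have Qm: "Q \<in> borel_measurable lborel" by simp
  have inv: "orthogonal_transformation (inv Q)" "bij Q"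
    using Q orthogonal_transformation_inv orthogonal_transformation_bij by auto
  have pre: "Q -` box l u = inv Q ` box l u"
    using bij_vimage_eq_inv_image[OF inv(2)] .
  have lm: "box l u \<in> lmeasurable" by simp
  have "emeasure (distr lborel borel Q) (box l u) = emeasure lborel (Q -` box l u)"
    using Qm by (subst emeasure_distr) auto
  also have "\<dots> = emeasure lebesgue (Q -` box l u)"
    using measurable_sets[OF Qm, of "box l u"] by (simp add: emeasure_completion)
  also have "\<dots> = ennreal (measure lebesgue (inv Q ` box l u))"
    using measurable_orthogonal_image[OF inv(1) lm] unfolding pre by (simp add: emeasure_eq_measure2 fmeasurableD2)
  also have "\<dots> = ennreal (measure lebesgue (box l u))"
    by (simp add: measure_orthogonal_image[OF inv(1) lm])
  also have "\<dots> = emeasure lebesgue (box l u)"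
    using lm by (simp add: emeasure_eq_measure2 fmeasurableD2)
  also have "\<dots> = (\<Prod>b\<in>Basis. (u - l) \<bullet> b)"
    using le by (simp add: emeasure_lborel_box)
  finally show "emeasure (distr lborel borel Q) (box l u) = (\<Prod>b\<in>Basis. (u - l) \<bullet> b)" .
qed simp

lemma nn_integral_frame:
  fixes Q :: "real^3 \<Rightarrow> real^3" and c :: "3 \<Rightarrow> real"
  assumes Q: "orthogonal_transformation Q" and c: "\<And>d. 0 < c d" and g[measurable]: "g \<in> borel_measurable borel"
  shows "(\<integral>\<^sup>+x. g x \<partial>lborel) = ennreal (\<Prod>d\<in>UNIV. c d) * (\<integral>\<^sup>+u. g (Q (\<chi> d. c d * u $ d)) \<partial>lborel)"
proof -
  have Qm[measurable]: "Q \<in> borel_measurable borel"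
    using orthogonal_transformation_linear[OF Q]
    by (intro borel_measurable_continuous_onI linear_continuous_on) (simp add: linear_conv_bounded_linear)
  define T :: "real^3 \<Rightarrow> real^3" where "T x = 0 + (\<Sum>j\<in>Basis. (((\<chi> d. c d) \<bullet> j) * (x \<bullet> j)) *\<^sub>R j)" for x
  have T: "T x = (\<chi> d. c d * x $ d)" for x
  proof (rule vec_eq_iff[THEN iffD2, rule_format])
    fix d
    have "T x $ d = T x \<bullet> axis d 1" by (simp add: inner_axis)
    also have "\<dots> = ((\<chi> d. c d) \<bullet> axis d 1) * (x \<bullet> axis d 1)"
      unfolding T_def by (simp add: inner_sum_left_Basis axis_in_Basis_iff)
    also have "\<dots> = (\<chi> d. c d * x $ d) $ d" by (simp add: inner_axis)
    finally show "T x $ d = (\<chi> d. c d * x $ d) $ d" .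
  qed
  have Tm[measurable]: "T \<in> borel_measurable borel" unfolding T_def by measurable
  have l: "lborel = density (distr lborel borel T) (\<lambda>_. ennreal (\<Prod>j\<in>Basis. \<bar>(\<chi> d. c d) \<bullet> j\<bar>))"
    unfolding T_def by (rule lborel_affine_euclidean) (auto simp: Basis_real3 inner_axis c less_imp_neq[OF c, symmetric])
  have p: "(\<Prod>j\<in>Basis. \<bar>(\<chi> d. c d) \<bullet> (j :: real^3)\<bar>) = (\<Prod>d\<in>UNIV. c d)"
    unfolding prod_Basis_real3 using c by (simp add: inner_axis abs_of_pos)
  have "(\<integral>\<^sup>+x. g x \<partial>lborel) = (\<integral>\<^sup>+x. g (Q x) \<partial>lborel)"
    by (subst lborel_distr_orthogonal[OF Q, symmetric]) (simp add: nn_integral_distr)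
  also have "\<dots> = (\<integral>\<^sup>+x. ennreal (\<Prod>d\<in>UNIV. c d) * g (Q (T x)) \<partial>lborel)"
    by (subst l, subst nn_integral_density) (simp_all add: nn_integral_distr p)
  also have "\<dots> = ennreal (\<Prod>d\<in>UNIV. c d) * (\<integral>\<^sup>+x. g (Q (T x)) \<partial>lborel)"
    by (simp add: nn_integral_cmult)
  finally show ?thesis by (simp add: T)
qed

text \<open>A product of one-dimensional Cauchy kernels of widths \<open>1 / c d\<close> along the
  axes of \<open>Q\<close>. The numerators make its integral independent of \<open>c\<close> and
  \<open>Q\<close>.\<close>

definition weight :: "(3 \<Rightarrow> real) \<Rightarrow> (real^3 \<Rightarrow> real^3) \<Rightarrow> real^3 \<Rightarrow> real" where
  "weight c Q z = (\<Prod>d\<in>UNIV. c d / (1 + (c d * (Q (axis d 1) \<bullet> z))\<^sup>2))"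

lemma weight_measurable[measurable]: "weight c Q \<in> borel_measurable borel"
  unfolding weight_def by measurable

lemma weight_nonneg: "(\<And>d. 0 < c d) \<Longrightarrow> 0 \<le> weight c Q z"
  unfolding weight_def by (intro prod_nonneg divide_nonneg_nonneg) (auto intro: less_imp_le)

definition cauchy_mass :: ennreal where
  "cauchy_mass = (\<integral>\<^sup>+x. ennreal (\<Prod>d\<in>UNIV. 1 / (1 + ((x :: real^3) $ d)\<^sup>2)) \<partial>lborel)"

lemma cauchy_mass_finite: "cauchy_mass < \<infinity>"
proof -
  have 1: "(\<integral>\<^sup>+x. ennreal (1 / (1 + x\<^sup>2)) \<partial>lborel) < \<infinity>"
  proof -
    have "integrable lborel (\<lambda>x::real. inverse (1 + x\<^sup>2))"
      using integrable_inverse_1_plus_square by (simp add: set_integrable_def einterval_def)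
    then show ?thesis
      by (simp add: integrable_iff_bounded inverse_eq_divide)
  qed
  have "cauchy_mass = (\<integral>\<^sup>+x. (\<Prod>b\<in>Basis. ennreal (1 / (1 + ((x :: real^3) \<bullet> b)\<^sup>2))) \<partial>lborel)"
    unfolding cauchy_mass_def prod_Basis_real3 by (simp add: inner_axis prod_ennreal)
  also have "\<dots> = (\<Prod>b\<in>(Basis :: (real^3) set). (\<integral>\<^sup>+x. ennreal (1 / (1 + x\<^sup>2)) \<partial>lborel))"
    by (rule nn_integral_lborel_prod) auto
  also have "\<dots> < \<infinity>"
    using 1 by (simp add: ennreal_prod_eq_top less_top[symmetric] power_eq_top_ennreal)
  finally show ?thesis .
qed

lemma nn_integral_weight:
  assumes Q: "orthogonal_transformation Q" and c: "\<And>d. 0 < c d"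
  shows "(\<integral>\<^sup>+z. ennreal (weight c Q z) \<partial>lborel) = cauchy_mass"
proof -
  have Qd: "Q (axis d 1) \<bullet> Q v = v $ d" for d v
    using Q by (simp add: orthogonal_transformation_def inner_axis inner_commute)
  have c0: "c d \<noteq> 0" for d using c[of d] by simp
  have "(\<integral>\<^sup>+z. ennreal (weight c Q z) \<partial>lborel) =
      ennreal (\<Prod>d\<in>UNIV. 1 / c d) * (\<integral>\<^sup>+u. ennreal (weight c Q (Q (\<chi> d. 1 / c d * u $ d))) \<partial>lborel)"
    using c by (intro nn_integral_frame[OF Q]) auto
  also have "weight c Q (Q (\<chi> d. 1 / c d * u $ d)) = (\<Prod>d\<in>UNIV. c d) * (\<Prod>d\<in>UNIV. 1 / (1 + (u $ d)\<^sup>2))" for u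
    unfolding weight_def Qd prod.distrib[symmetric] using c0 by (intro prod.cong) auto
  then have "(\<integral>\<^sup>+u. ennreal (weight c Q (Q (\<chi> d. 1 / c d * u $ d))) \<partial>lborel) = ennreal (\<Prod>d\<in>UNIV. c d) * cauchy_mass"
    unfolding cauchy_mass_def using c by (subst nn_integral_cmult[symmetric]) (auto simp: ennreal_mult[symmetric] prod_nonneg less_imp_le intro!: nn_integral_cong)
  also have "ennreal (\<Prod>d\<in>UNIV. 1 / c d) * (ennreal (\<Prod>d\<in>UNIV. c d) * cauchy_mass) = cauchy_mass"
  proof -
    have "(\<Prod>d\<in>UNIV. 1 / c d) * (\<Prod>d\<in>UNIV. c d) = 1"
      unfolding prod.distrib[symmetric] using c0 by simp
    then show ?thesis
      using c by (simp add: mult.assoc[symmetric] ennreal_mult[symmetric] prod_nonneg less_imp_le)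
  qed
  finally show ?thesis .
qed

text \<open>Let v be the maximum of 1 and all |u d|. The left side times the Cauchy denominators is
  at most 4 v times 8 v^6 times x, of order v^7, while one of the hypotheses says v^8 x \<le> M.
  This explains the exponent 8 and the constant 32.\<close>

lemma weight_bound:
  fixes u :: "3 \<Rightarrow> real"
  assumes "0 \<le> x" "x \<le> M" "\<And>d. \<bar>u d\<bar> ^ 8 * x \<le> M"
  shows "(1 + (\<Sum>d\<in>UNIV. \<bar>u d\<bar>)) * x \<le> 32 * M * (\<Prod>d\<in>UNIV. 1 / (1 + (u d)\<^sup>2))"
proof -
  define v where "v = Max (insert 1 (range (\<lambda>d. \<bar>u d\<bar>)))"
  have v1: "1 \<le> v" and vu: "\<bar>u d\<bar> \<le> v" for d
    unfolding v_def by (intro Max_ge; simp)+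
  have "v \<in> insert 1 (range (\<lambda>d. \<bar>u d\<bar>))" unfolding v_def by (intro Max_in) auto
  then have "v = 1 \<or> (\<exists>d. v = \<bar>u d\<bar>)" by blast
  then have vx: "v ^ 8 * x \<le> M" using assms(2,3) by (elim disjE exE) simp_all
  have s: "1 + (\<Sum>d\<in>UNIV. \<bar>u d\<bar>) \<le> 4 * v"
    using v1 vu[of 1] vu[of 2] vu[of 3] unfolding sum_3 by linarith
  have p1: "1 + (u d)\<^sup>2 \<le> 2 * v\<^sup>2" for d
  proof -
    have "\<bar>u d\<bar>\<^sup>2 \<le> v\<^sup>2" by (rule power_mono[OF vu]) simp
    moreover have "1 \<le> v\<^sup>2" using v1 by (rule one_le_power)
    ultimately show ?thesis by simp
  qed
  have "(\<Prod>d\<in>UNIV. 1 + (u d)\<^sup>2) \<le> (\<Prod>d\<in>(UNIV::3 set). 2 * v\<^sup>2)"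
    by (intro prod_mono) (auto intro: p1)
  also have "\<dots> = 8 * v ^ 6" by (simp add: power_mult_distrib power_mult[symmetric])
  finally have p: "(\<Prod>d\<in>UNIV. 1 + (u d)\<^sup>2) \<le> 8 * v ^ 6" .
  have pp: "0 < (\<Prod>d\<in>UNIV. 1 + (u d)\<^sup>2)" by (intro prod_pos) (auto intro: add_pos_nonneg)
  have "(1 + (\<Sum>d\<in>UNIV. \<bar>u d\<bar>)) * x * (\<Prod>d\<in>UNIV. 1 + (u d)\<^sup>2) \<le> (4 * v) * x * (8 * v ^ 6)"
    using s p pp assms(1) v1 by (intro mult_mono) (auto intro: sum_nonneg add_nonneg_nonneg mult_nonneg_nonneg)
  also have "\<dots> = 32 * (v ^ 7 * x)" by (simp add: power_numeral_reduce)
  also have "\<dots> \<le> 32 * (v ^ 8 * x)"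
    using v1 assms(1) by (intro mult_left_mono mult_right_mono power_increasing) auto
  also have "\<dots> \<le> 32 * M" using vx by simp
  finally have "(1 + (\<Sum>d\<in>UNIV. \<bar>u d\<bar>)) * x \<le> 32 * M / (\<Prod>d\<in>UNIV. 1 + (u d)\<^sup>2)"
    using pp by (simp add: pos_le_divide_eq)
  then show ?thesis by (simp add: prod_dividef)
qed

section \<open>Gaussian integrals and an integrable majorant\<close>

definition gauss :: "real^3 \<Rightarrow> real" where "gauss x = exp (- (norm x)\<^sup>2 / 2)"

text \<open>Read off from the characteristic function of the standard normal distribution.\<close>

lemma gauss_1d:
  "integrable lborel (\<lambda>t. complex_of_real (exp (- t\<^sup>2 / 2)) * cis (t * a))"
  "(LINT t|lborel. complex_of_real (exp (- t\<^sup>2 / 2)) * cis (t * a)) = of_real (sqrt (2 * pi) * exp (- a\<^sup>2 / 2))"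
proof -
  have i: "integrable lborel (\<lambda>t::real. exp (- t\<^sup>2 / 2))"
  proof -
    have "integrable lborel (\<lambda>t. sqrt (2 * pi) * std_normal_density t)"
      by (intro integrable_mult_right integrable_normal_density) simp
    then show ?thesis by (simp add: std_normal_density_def)
  qed
  have m: "(\<lambda>t::real. cis (t * a)) \<in> borel_measurable borel"
    by (intro borel_measurable_continuous_onI continuous_intros)
  show I: "integrable lborel (\<lambda>t. complex_of_real (exp (- t\<^sup>2 / 2)) * cis (t * a))"
    by (rule Bochner_Integration.integrable_bound[OF i]) (use m in \<open>auto simp: norm_mult intro!: borel_measurable_times\<close>)
  have "char std_normal_distribution a = (LINT x|lborel. std_normal_density x *\<^sub>R iexp (a * x))"
    unfolding char_def by (subst integral_density) (auto simp: normal_density_nonneg)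
  also have "\<dots> = (LINT x|lborel. of_real (1 / sqrt (2 * pi)) * (complex_of_real (exp (- x\<^sup>2 / 2)) * cis (x * a)))"
    by (intro Bochner_Integration.integral_cong) (auto simp: std_normal_density_def scaleR_conv_of_real cis_conv_exp mult_ac)
  also have "\<dots> = of_real (1 / sqrt (2 * pi)) * (LINT x|lborel. complex_of_real (exp (- x\<^sup>2 / 2)) * cis (x * a))"
    by (rule integral_mult_right_zero)
  finally have e: "of_real (1 / sqrt (2 * pi)) * (LINT x|lborel. complex_of_real (exp (- x\<^sup>2 / 2)) * cis (x * a)) = complex_of_real (exp (- a\<^sup>2 / 2))"
    by (simp only: char_std_normal_distribution)
  have nz: "complex_of_real (sqrt (2 * pi)) \<noteq> 0" by simp
  show "(LINT t|lborel. complex_of_real (exp (- t\<^sup>2 / 2)) * cis (t * a)) = of_real (sqrt (2 * pi) * exp (- a\<^sup>2 / 2))"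
    unfolding of_real_mult e[symmetric] using nz by (simp add: field_simps)
qed

lemma gauss_fourier:
  "integrable lborel gauss"
  "(LINT x|lborel. of_real (gauss x) * cis (x \<bullet> w)) = of_real (sqrt (2 * pi) ^ 3 * gauss w)"
proof -
  interpret product_sigma_finite "\<lambda>_::real^3. lborel :: real measure" by standard
  define F where "F w b t = complex_of_real (exp (- t\<^sup>2 / 2)) * cis (t * (w \<bullet> b))" for w b :: "real^3" and t
  have Fi: "integrable lborel (F w b)" for w b unfolding F_def by (rule gauss_1d)
  have ip: "(\<Sum>b\<in>Basis. f b *\<^sub>R b) \<bullet> b = f b" if "b \<in> Basis" for f and b :: "real^3"
    using that by simp
  have prod: "of_real (gauss x) * cis (x \<bullet> w) = (\<Prod>b\<in>Basis. F w b (x \<bullet> b))" for x w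
  proof -
    have g: "gauss x = (\<Prod>b\<in>Basis. exp (- (x \<bullet> b)\<^sup>2 / 2))"
    proof -
      have "- (norm x)\<^sup>2 / 2 = (\<Sum>b\<in>Basis. - (x \<bullet> b)\<^sup>2 / 2)"
        unfolding power2_norm_eq_inner euclidean_inner[of x x]
        by (simp add: power2_eq_square sum_negf sum_divide_distrib)
      then show ?thesis unfolding gauss_def by (simp only: exp_sum[OF finite_Basis])
    qed
    have c: "cis (x \<bullet> w) = (\<Prod>b\<in>Basis. cis ((x \<bullet> b) * (w \<bullet> b)))"
      unfolding cis_conv_exp exp_sum[OF finite_Basis, symmetric]
      by (subst euclidean_inner) (simp add: sum_distrib_left)
    show ?thesis
      unfolding g c of_real_prod prod.distrib[symmetric] F_def ..
  qed
  have m: "(\<lambda>x. of_real (gauss x) * cis (x \<bullet> w)) \<in> borel_measurable borel" for w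
    unfolding gauss_def by (intro borel_measurable_continuous_onI continuous_intros) simp
  have I: "integrable lborel (\<lambda>x. of_real (gauss x) * cis (x \<bullet> w))" for w
    by (subst lborel_eq, subst integrable_distr_eq)
       (use m[of w] in \<open>auto simp: prod ip intro!: product_integrable_prod Fi\<close>)
  have "integrable lborel (\<lambda>x. norm (complex_of_real (gauss x) * cis (x \<bullet> 0)))"
    by (rule integrable_norm[OF I])
  moreover have "(\<lambda>x. norm (complex_of_real (gauss x) * cis (x \<bullet> 0))) = gauss"
    by (simp add: fun_eq_iff norm_mult gauss_def)
  ultimately show "integrable lborel gauss" by simp
  have "(LINT x|lborel. of_real (gauss x) * cis (x \<bullet> w)) = (LINT f|(\<Pi>\<^sub>M b\<in>Basis. lborel). (\<Prod>b\<in>Basis. F w b (f b)))"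
    by (subst lborel_eq, subst integral_distr) (use m[of w] in \<open>auto simp: prod ip\<close>)
  also have "\<dots> = (\<Prod>b\<in>Basis. LINT t|lborel. F w b t)"
    by (rule product_integral_prod) (auto intro: Fi)
  also have "\<dots> = (\<Prod>b\<in>Basis. of_real (sqrt (2 * pi)) * of_real (exp (- (w \<bullet> b)\<^sup>2 / 2)))"
    unfolding F_def gauss_1d(2) by simp
  \<comment> \<open>At frequency 0 the factors \<open>F\<close> are plain one-dimensional Gaussians,
    so the product formula can be read backwards to assemble \<open>gauss w\<close>.\<close>
  also have "\<dots> = of_real (sqrt (2 * pi)) ^ 3 * (\<Prod>b\<in>Basis. F 0 b (w \<bullet> b))"
    by (simp add: prod.distrib F_def)
  also have "(\<Prod>b\<in>Basis. F 0 b (w \<bullet> b)) = of_real (gauss w)"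
    using prod[of w 0] by simp
  finally show "(LINT x|lborel. of_real (gauss x) * cis (x \<bullet> w)) = of_real (sqrt (2 * pi) ^ 3 * gauss w)"
    by simp
qed

lemma integrable_cauchy: "integrable lborel (\<lambda>x::real^3. \<Prod>d\<in>UNIV. 1 / (1 + (x $ d)\<^sup>2))"
proof -
  have m: "(\<lambda>x::real^3. \<Prod>d\<in>UNIV. 1 / (1 + (x $ d)\<^sup>2)) \<in> borel_measurable lborel" by measurable
  have "0 \<le> (\<Prod>d\<in>UNIV. 1 / (1 + (x $ d)\<^sup>2))" for x :: "real^3"
    by (intro prod_nonneg) auto
  then show ?thesis
    using cauchy_mass_finite m unfolding cauchy_mass_def by (simp add: integrable_iff_bounded)
qed

text \<open>Each 1 + (x $ d)^2 is at most (1 + |x|)^2, so the sixth power dominates the product of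
  the three Cauchy denominators.\<close>

lemma integrable_decay6: "integrable lborel (\<lambda>x::real^3. 1 / (1 + norm x) ^ 6)"
proof (rule Bochner_Integration.integrable_bound[OF integrable_cauchy])
  show "AE x in lborel. norm (1 / (1 + norm x) ^ 6) \<le> norm (\<Prod>d\<in>UNIV. 1 / (1 + ((x::real^3) $ d)\<^sup>2))"
  proof (rule AE_I2)
    fix x :: "real^3"
    have p: "0 < (\<Prod>d\<in>UNIV. 1 + (x $ d)\<^sup>2)" by (intro prod_pos) (auto intro: add_pos_nonneg)
    have "1 + (x $ d)\<^sup>2 \<le> (1 + norm x)\<^sup>2" for d
    proof -
      have "\<bar>x $ d\<bar>\<^sup>2 \<le> (norm x)\<^sup>2" by (rule power_mono[OF component_le_norm_cart]) simp
      then have "(x $ d)\<^sup>2 \<le> (norm x)\<^sup>2" by simp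
      moreover have "(1 + norm x)\<^sup>2 = 1 + 2 * norm x + (norm x)\<^sup>2" by (simp add: power2_sum)
      ultimately show ?thesis using norm_ge_zero[of x] by linarith
    qed
    then have "(\<Prod>d\<in>UNIV. 1 + (x $ d)\<^sup>2) \<le> (\<Prod>d\<in>(UNIV::3 set). (1 + norm x)\<^sup>2)"
      by (intro prod_mono) auto
    also have "\<dots> = (1 + norm x) ^ 6" by (simp add: power_mult[symmetric])
    finally have "1 / (1 + norm x) ^ 6 \<le> 1 / (\<Prod>d\<in>UNIV. 1 + (x $ d)\<^sup>2)"
      using p by (intro divide_left_mono mult_pos_pos) auto
    also have "\<dots> = (\<Prod>d\<in>UNIV. 1 / (1 + (x $ d)\<^sup>2))" by (simp add: prod_dividef)
    finally show "norm (1 / (1 + norm x) ^ 6) \<le> norm (\<Prod>d\<in>UNIV. 1 / (1 + (x $ d)\<^sup>2))"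
      by simp
  qed
qed measurable

section \<open>Rapidly decreasing kernels and tempered functions\<close>

text \<open>Rapid decrease of the function alone; derivatives are carried along as separate
  functions with their own decay.\<close>

definition decays :: "('a::real_normed_vector \<Rightarrow> 'b::real_normed_vector) \<Rightarrow> bool" where
  "decays u \<longleftrightarrow> (\<forall>n::nat. \<exists>C. \<forall>y. (1 + norm y) ^ n * norm (u y) \<le> C)"

definition poly_growth :: "('a::real_normed_vector \<Rightarrow> 'b::real_normed_vector) \<Rightarrow> bool" where
  "poly_growth p \<longleftrightarrow> (\<exists>(M::nat) C. \<forall>y. norm (p y) \<le> C * (1 + norm y) ^ M)"

lemma decaysE:
  assumes "decays u"
  obtains C where "0 \<le> C" "\<And>y. (1 + norm y) ^ n * norm (u y) \<le> C"
proof -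
  obtain C where C: "\<And>y. (1 + norm y) ^ n * norm (u y) \<le> C"
    using assms unfolding decays_def by blast
  moreover have "0 \<le> C" by (rule order_trans[OF _ C[of 0]]) simp
  ultimately show thesis using that by blast
qed

lemma one_plus_norm_pos: "0 < (1 + norm y) ^ n"
  by (intro zero_less_power) (auto intro: add_pos_nonneg)

lemma decays_le:
  assumes "decays u"
  obtains C where "0 \<le> C" "\<And>y. norm (u y) \<le> C / (1 + norm y) ^ n"
proof -
  obtain C where "0 \<le> C" "\<And>y. (1 + norm y) ^ n * norm (u y) \<le> C" by (rule decaysE[OF assms]) (rule that)
  then show thesis
    by (intro that[of C]) (simp_all add: pos_le_divide_eq one_plus_norm_pos mult.commute)
qed

lemma poly_growth_power: "poly_growth p \<Longrightarrow> \<exists>(M::nat) C. 0 \<le> C \<and> (\<forall>y. norm (p y) \<le> C * (1 + norm y) ^ M)"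
proof -
  assume "poly_growth p"
  then obtain M :: nat and C where C: "\<And>y. norm (p y) \<le> C * (1 + norm y) ^ M" unfolding poly_growth_def by blast
  moreover have "0 \<le> C" using order_trans[OF norm_ge_zero C[of 0]] by simp
  ultimately show ?thesis by blast
qed

lemma decays_dominated:
  assumes "decays u" "\<And>y. norm (w y) \<le> K * ((1 + norm y) ^ M * norm (u y))" "0 \<le> K"
  shows "decays w"
  unfolding decays_def
proof
  fix n
  obtain C where C: "\<And>y. (1 + norm y) ^ (n + M) * norm (u y) \<le> C" by (rule decaysE[OF assms(1), where n = "n + M"]) (rule that)
  have "(1 + norm y) ^ n * norm (w y) \<le> K * C" for y
  proof -
    have "(1 + norm y) ^ n * norm (w y) \<le> (1 + norm y) ^ n * (K * ((1 + norm y) ^ M * norm (u y)))"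
      using assms(2) one_plus_norm_pos[of y n] by (intro mult_left_mono) auto
    also have "\<dots> = K * ((1 + norm y) ^ (n + M) * norm (u y))"
      by (simp add: power_add mult_ac)
    also have "\<dots> \<le> K * C" using C assms(3) by (intro mult_left_mono)
    finally show ?thesis .
  qed
  then show "\<exists>C. \<forall>y. (1 + norm y) ^ n * norm (w y) \<le> C" by blast
qed

lemma decays_mult_poly:
  fixes u p :: "'a::real_normed_vector \<Rightarrow> 'b::real_normed_field"
  assumes "decays u" "poly_growth p"
  shows "decays (\<lambda>y. p y * u y)"
proof -
  obtain M C where C: "0 \<le> C" "\<And>y. norm (p y) \<le> C * (1 + norm y) ^ M"
    using poly_growth_power[OF assms(2)] by blast
  show ?thesis
  proof (rule decays_dominated[OF assms(1) _ C(1)])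
    show "norm (p y * u y) \<le> C * ((1 + norm y) ^ M * norm (u y))" for y
      using mult_right_mono[OF C(2), of "norm (u y)" y] by (simp add: norm_mult mult.assoc)
  qed
qed

lemma decays_add: "decays u \<Longrightarrow> decays v \<Longrightarrow> decays (\<lambda>y. u y + v y)"
  unfolding decays_def
proof
  fix n
  assume "\<forall>n. \<exists>C. \<forall>y. (1 + norm y) ^ n * norm (u y) \<le> C" "\<forall>n. \<exists>C. \<forall>y. (1 + norm y) ^ n * norm (v y) \<le> C"
  then obtain C D where C: "\<And>y. (1 + norm y) ^ n * norm (u y) \<le> C" and D: "\<And>y. (1 + norm y) ^ n * norm (v y) \<le> D"
    by meson
  have "(1 + norm y) ^ n * norm (u y + v y) \<le> C + D" for y
  proof -
    have "(1 + norm y) ^ n * norm (u y + v y) \<le> (1 + norm y) ^ n * (norm (u y) + norm (v y))"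
      using one_plus_norm_pos[of y n] by (intro mult_left_mono norm_triangle_ineq) auto
    then show ?thesis using C[of y] D[of y] by (simp add: distrib_left)
  qed
  then show "\<exists>C. \<forall>y. (1 + norm y) ^ n * norm (u y + v y) \<le> C" by blast
qed

lemma one_plus_norm_triangle: "1 + norm (x + y) \<le> (1 + norm x) * (1 + norm y)"
proof -
  have "1 + norm (x + y) \<le> 1 + norm x + norm y" using norm_triangle_ineq[of x y] by simp
  moreover have "(1 + norm x) * (1 + norm y) = 1 + norm x + norm y + norm x * norm y" by (simp add: algebra_simps)
  ultimately show ?thesis using mult_nonneg_nonneg[OF norm_ge_zero[of x] norm_ge_zero[of y]] by linarith
qed

lemma one_plus_norm_triangle_power: "(1 + norm (x + y)) ^ n \<le> (1 + norm x) ^ n * (1 + norm y) ^ n"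
  unfolding power_mult_distrib[symmetric] by (rule power_mono[OF one_plus_norm_triangle]) auto

lemma decays_reflect:
  assumes "decays u"
  shows "decays (\<lambda>y. u (x - y))"
  unfolding decays_def
proof
  fix n
  obtain C where C: "\<And>y. (1 + norm y) ^ n * norm (u y) \<le> C" by (rule decaysE[OF assms, where n = n]) (rule that)
  have "(1 + norm y) ^ n * norm (u (x - y)) \<le> (1 + norm x) ^ n * C" for y
  proof -
    have "(1 + norm y) ^ n \<le> (1 + norm x) ^ n * (1 + norm (x - y)) ^ n"
      using one_plus_norm_triangle_power[of x "- (x - y)" n] by (simp only: norm_minus_cancel) simp
    then have "(1 + norm y) ^ n * norm (u (x - y)) \<le> ((1 + norm x) ^ n * (1 + norm (x - y)) ^ n) * norm (u (x - y))"
      by (rule mult_right_mono) simp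
    also have "\<dots> \<le> (1 + norm x) ^ n * C"
      unfolding mult.assoc using C[of "x - y"] one_plus_norm_pos[of x n] by (intro mult_left_mono) auto
    finally show ?thesis .
  qed
  then show "\<exists>C. \<forall>y. (1 + norm y) ^ n * norm (u (x - y)) \<le> C" by blast
qed

lemma decays_integrable:
  fixes u :: "real^3 \<Rightarrow> 'b::{banach, second_countable_topology}"
  assumes "decays u" "u \<in> borel_measurable borel"
  shows "integrable lborel u"
proof -
  obtain C where C0: "0 \<le> C" and C: "\<And>y. norm (u y) \<le> C / (1 + norm y) ^ 6" by (rule decays_le[OF assms(1), where n = 6]) (rule that)
  show ?thesis
  proof (rule Bochner_Integration.integrable_bound)
    show "integrable lborel (\<lambda>y::real^3. C * (1 / (1 + norm y) ^ 6))"
      by (intro integrable_mult_right integrable_decay6)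
    show "AE y in lborel. norm (u y) \<le> norm (C * (1 / (1 + norm y) ^ 6))"
      using C C0 by (intro AE_I2) simp
  qed (use assms(2) in simp)
qed

text \<open>The largest |z . b d| controls |z| because the directions span. The constants may depend
  on the directions: this qualitative decay serves only the convergence of integrals.\<close>

lemma decays_of_directions:
  fixes w :: "real^3 \<Rightarrow> 'b::real_normed_vector" and b :: "3 \<Rightarrow> real^3"
  assumes L: "\<And>z. norm z \<le> L * (\<Sum>d\<in>UNIV. \<bar>z \<bullet> b d\<bar>)"
    and C: "\<And>n d. \<exists>C. \<forall>z. \<bar>z \<bullet> b d\<bar> ^ n * norm (w z) \<le> C"
  shows "decays w"
  unfolding decays_def
proof
  fix n :: nat
  obtain C0 where C0: "\<And>z. norm (w z) \<le> C0" using C[of 1 0] by auto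
  obtain Cd where Cd: "\<And>d z. \<bar>z \<bullet> b d\<bar> ^ n * norm (w z) \<le> Cd d" using C[of _ n] by metis
  define D where "D = \<bar>C0\<bar> + (\<Sum>d\<in>UNIV. \<bar>Cd d\<bar>)"
  have D: "C0 \<le> D" "\<And>d. Cd d \<le> D"
  proof -
    show "C0 \<le> D" unfolding D_def using sum_nonneg[of UNIV "\<lambda>d. \<bar>Cd d\<bar>"] by linarith
    fix d
    have "\<bar>Cd d\<bar> \<le> (\<Sum>d\<in>UNIV. \<bar>Cd d\<bar>)" by (rule member_le_sum) auto
    then show "Cd d \<le> D" unfolding D_def by linarith
  qed
  have "(1 + norm z) ^ n * norm (w z) \<le> (1 + 3 * \<bar>L\<bar>) ^ n * D" for z
  proof -
    define v where "v = Max (insert 1 (range (\<lambda>d. \<bar>z \<bullet> b d\<bar>)))"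
    have v1: "1 \<le> v" and vu: "\<bar>z \<bullet> b d\<bar> \<le> v" for d
      unfolding v_def by (intro Max_ge; simp)+
    have "v \<in> insert 1 (range (\<lambda>d. \<bar>z \<bullet> b d\<bar>))" unfolding v_def by (intro Max_in) auto
    then have "v = 1 \<or> (\<exists>d. v = \<bar>z \<bullet> b d\<bar>)" by blast
    then have vx: "v ^ n * norm (w z) \<le> D"
      using order_trans[OF C0 D(1)] order_trans[OF Cd D(2)] by (elim disjE exE) simp_all
    have "(\<Sum>d\<in>UNIV. \<bar>z \<bullet> b d\<bar>) \<le> 3 * v"
      using vu[of 1] vu[of 2] vu[of 3] unfolding sum_3 by linarith
    then have "L * (\<Sum>d\<in>UNIV. \<bar>z \<bullet> b d\<bar>) \<le> \<bar>L\<bar> * (3 * v)"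
      by (intro mult_mono) (auto intro: sum_nonneg)
    then have "1 + norm z \<le> 1 * v + \<bar>L\<bar> * (3 * v)" using L[of z] v1 by linarith
    then have "1 + norm z \<le> (1 + 3 * \<bar>L\<bar>) * v" by (simp add: algebra_simps)
    then have "(1 + norm z) ^ n \<le> ((1 + 3 * \<bar>L\<bar>) * v) ^ n" by (rule power_mono) auto
    then have "(1 + norm z) ^ n * norm (w z) \<le> ((1 + 3 * \<bar>L\<bar>) * v) ^ n * norm (w z)"
      by (rule mult_right_mono) simp
    also have "\<dots> = (1 + 3 * \<bar>L\<bar>) ^ n * (v ^ n * norm (w z))" by (simp add: power_mult_distrib)
    also have "\<dots> \<le> (1 + 3 * \<bar>L\<bar>) ^ n * D" using vx by (intro mult_left_mono) auto
    finally show ?thesis .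
  qed
  then show "\<exists>C. \<forall>z. (1 + norm z) ^ n * norm (w z) \<le> C" by blast
qed

section \<open>Fourier inversion\<close>

lemma fubini_bounded:
  fixes h :: "(real^3) \<times> (real^3) \<Rightarrow> complex"
  assumes h: "h \<in> borel_measurable (lborel \<Otimes>\<^sub>M lborel)" and a: "integrable lborel a" and b: "integrable lborel b"
    and bd: "\<And>x y. norm (h (x, y)) \<le> a x * b y"
  shows "(LINT x|lborel. LINT y|lborel. h (x, y)) = (LINT y|lborel. LINT x|lborel. h (x, y))"
proof -
  have [measurable]: "a \<in> borel_measurable borel" "b \<in> borel_measurable borel" using a b by auto
  have "integrable (lborel \<Otimes>\<^sub>M lborel) (\<lambda>(x, y). a x * b y)"
  proof (rule lborel_pair.Fubini_integrable)
    show "(\<lambda>(x, y). a x * b y) \<in> borel_measurable (lborel \<Otimes>\<^sub>M lborel)" by measurable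
    show "integrable lborel (\<lambda>x. LINT y|lborel. norm (case (x, y) of (x, y) \<Rightarrow> a x * b y))"
      using a by (simp add: abs_mult)
    show "AE x in lborel. integrable lborel (\<lambda>y. case (x, y) of (x, y) \<Rightarrow> a x * b y)"
      using b by simp
  qed
  then have "integrable (lborel \<Otimes>\<^sub>M lborel) h"
    by (rule Bochner_Integration.integrable_bound) (use h bd in \<open>auto intro!: AE_I2 order_trans[OF bd abs_ge_self]\<close>)
  then have "integrable (lborel \<Otimes>\<^sub>M lborel) (\<lambda>(x, y). h (x, y))" by simp
  from lborel_pair.Fubini_integral[OF this] show ?thesis by simp
qed

lemma lborel_integral_affine3:
  fixes g :: "real^3 \<Rightarrow> complex"
  assumes "g \<in> borel_measurable borel" "0 < c"
  shows "(LINT x|lborel. g x) = of_real (c ^ 3) * (LINT x|lborel. g (t + c *\<^sub>R x))"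
proof -
  have l: "lborel = density (distr lborel borel (\<lambda>x::real^3. t + c *\<^sub>R x)) (\<lambda>_. ennreal (c ^ 3))"
    using lborel_affine[of c t] assms(2) by simp
  have "(LINT x|lborel. g x) = (LINT x|distr lborel borel (\<lambda>x::real^3. t + c *\<^sub>R x). c ^ 3 *\<^sub>R g x)"
    by (subst l, subst integral_density) (use assms in auto)
  also have "\<dots> = (LINT x|lborel. c ^ 3 *\<^sub>R g (t + c *\<^sub>R x))"
    by (subst integral_distr) (use assms in auto)
  finally show ?thesis by (simp add: scaleR_conv_of_real)
qed

lemma gauss_bounds: "0 \<le> gauss x" "gauss x \<le> 1" "gauss 0 = 1"
  by (simp_all add: gauss_def)

lemma gauss_measurable[measurable]: "gauss \<in> borel_measurable borel"
  unfolding gauss_def[abs_def] by measurable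

lemma gauss_scaled:
  assumes e: "0 < e"
  shows "(LINT z|lborel. of_real (gauss (e *\<^sub>R z)) * cis (z \<bullet> w)) = of_real ((1 / e) ^ 3 * (sqrt (2 * pi) ^ 3 * gauss ((1 / e) *\<^sub>R w)))"
proof -
  have "(LINT z|lborel. of_real (gauss (e *\<^sub>R z)) * cis (z \<bullet> w)) =
      of_real ((1 / e) ^ 3) * (LINT x|lborel. of_real (gauss (e *\<^sub>R (0 + (1 / e) *\<^sub>R x))) * cis ((0 + (1 / e) *\<^sub>R x) \<bullet> w))"
    using e by (intro lborel_integral_affine3) auto
  also have "(LINT x|lborel. of_real (gauss (e *\<^sub>R (0 + (1 / e) *\<^sub>R x))) * cis ((0 + (1 / e) *\<^sub>R x) \<bullet> w)) =
      (LINT x|lborel. of_real (gauss x) * cis (x \<bullet> ((1 / e) *\<^sub>R w)))"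
    using e by simp
  finally show ?thesis by (simp only: gauss_fourier(2) of_real_mult)
qed

lemma cis_neg_inner_measurable [measurable]:
  "(\<lambda>z. cis (- ((z::real^3) \<bullet> \<xi>))) \<in> borel_measurable borel" "(\<lambda>z. cis ((z::real^3) \<bullet> \<xi>)) \<in> borel_measurable borel"
  by (intro borel_measurable_continuous_onI continuous_intros)+

text \<open>Gaussian regularisation: damping the outer integral by \<open>gauss\<close> of a small
  multiple of z permits Fubini and turns it into an average of \<open>f\<close> around \<xi> against
  a Gaussian of small width. Both descriptions of the damped integral converge by dominated
  convergence.\<close>

lemma osc_inversion:
  assumes fc: "continuous_on UNIV f" and fi: "integrable lborel f" and fb: "\<And>x. \<bar>f x\<bar> \<le> C"
    and oi: "integrable lborel (osc f)"
  shows "(LINT z|lborel. osc f z * cis (- (z \<bullet> \<xi>))) = of_real ((2 * pi) ^ 3 * f \<xi>)"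
proof -
  define e where "e n = 1 / real (Suc n)" for n
  have e: "0 < e n" for n by (simp add: e_def)
  have e0: "e \<longlonglongrightarrow> 0" unfolding e_def using LIMSEQ_inverse_real_of_nat by (simp add: inverse_eq_divide)
  have [measurable]: "f \<in> borel_measurable borel" "osc f \<in> borel_measurable borel" using fi oi by auto
  define A where "A n = (LINT z|lborel. of_real (gauss (e n *\<^sub>R z)) * (osc f z * cis (- (z \<bullet> \<xi>))))" for n
  define c0 where "c0 = sqrt (2 * pi) ^ 3"
  have gc: "isCont gauss x" for x unfolding gauss_def by (intro continuous_intros) simp
  have lim1: "A \<longlonglongrightarrow> (LINT z|lborel. osc f z * cis (- (z \<bullet> \<xi>)))"
    unfolding A_def
  proof (rule integral_dominated_convergence[where w = "\<lambda>z. norm (osc f z)"])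
    show "AE z in lborel. (\<lambda>n. of_real (gauss (e n *\<^sub>R z)) * (osc f z * cis (- (z \<bullet> \<xi>)))) \<longlonglongrightarrow> osc f z * cis (- (z \<bullet> \<xi>))"
    proof (rule AE_I2)
      fix z :: "real^3"
      have "(\<lambda>n. e n *\<^sub>R z) \<longlonglongrightarrow> 0 *\<^sub>R z" by (intro tendsto_intros e0)
      then have "(\<lambda>n. gauss (e n *\<^sub>R z)) \<longlonglongrightarrow> gauss 0"
        using isCont_tendsto_compose[OF gc[of 0]] by simp
      then have "(\<lambda>n. complex_of_real (gauss (e n *\<^sub>R z)) * (osc f z * cis (- (z \<bullet> \<xi>)))) \<longlonglongrightarrow> of_real (gauss 0) * (osc f z * cis (- (z \<bullet> \<xi>)))"
        by (intro tendsto_intros)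
      then show "(\<lambda>n. complex_of_real (gauss (e n *\<^sub>R z)) * (osc f z * cis (- (z \<bullet> \<xi>)))) \<longlonglongrightarrow> osc f z * cis (- (z \<bullet> \<xi>))"
        by (simp add: gauss_bounds)
    qed
    show "AE z in lborel. norm (complex_of_real (gauss (e n *\<^sub>R z)) * (osc f z * cis (- (z \<bullet> \<xi>)))) \<le> norm (osc f z)" for n
      by (rule AE_I2) (simp add: norm_mult gauss_bounds mult_left_le_one_le)
  qed (use oi in \<open>simp_all add: borel_measurable_times\<close>)
  have A: "A n = of_real c0 * (LINT y|lborel. of_real (f (\<xi> + e n *\<^sub>R y) * gauss y))" for n
  proof -
    define h where "h = (\<lambda>(z, \<eta>). complex_of_real (gauss (e n *\<^sub>R z)) * (of_real (f \<eta>) * cis (z \<bullet> \<eta>) * cis (- (z \<bullet> \<xi>))))"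
    have gi: "integrable lborel (\<lambda>z. gauss (e n *\<^sub>R z))"
    proof -
      have "integrable lborel (\<lambda>z. gauss (0 + e n *\<^sub>R z))"
        using gauss_fourier(1) lborel_affine[of "e n" "0::real^3"] e[of n]
        by (subst (asm) lborel_affine[of "e n" 0]) (auto simp: integrable_density integrable_distr_eq)
      then show ?thesis by simp
    qed
    have "A n = (LINT z|lborel. LINT \<eta>|lborel. h (z, \<eta>))"
      by (simp only: A_def h_def osc_def prod.case integral_mult_right_zero integral_mult_left_zero)
    also have "\<dots> = (LINT \<eta>|lborel. LINT z|lborel. h (z, \<eta>))"
    proof (rule fubini_bounded[OF _ gi integrable_abs[OF fi]])
      show "h \<in> borel_measurable (lborel \<Otimes>\<^sub>M lborel)" unfolding h_def by measurable
      show "norm (h (z, \<eta>)) \<le> gauss (e n *\<^sub>R z) * \<bar>f \<eta>\<bar>" for z \<eta>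
        by (simp add: h_def norm_mult gauss_bounds)
    qed
    also have "(LINT z|lborel. h (z, \<eta>)) = of_real (f \<eta>) * (LINT z|lborel. of_real (gauss (e n *\<^sub>R z)) * cis (z \<bullet> (\<eta> - \<xi>)))" for \<eta>
      unfolding h_def split
      by (subst integral_mult_right_zero[symmetric]) (simp add: inner_diff_right cis_mult mult_ac)
    then have "(LINT \<eta>|lborel. LINT z|lborel. h (z, \<eta>)) =
        (LINT \<eta>|lborel. of_real (f \<eta> * ((1 / e n) ^ 3 * (c0 * gauss ((1 / e n) *\<^sub>R (\<eta> - \<xi>))))))"
      unfolding gauss_scaled[OF e] c0_def by (simp only: of_real_mult)
    also have "\<dots> = of_real (e n ^ 3) * (LINT y|lborel. of_real (f (\<xi> + e n *\<^sub>R y) * ((1 / e n) ^ 3 * (c0 * gauss ((1 / e n) *\<^sub>R (\<xi> + e n *\<^sub>R y - \<xi>))))))"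
      by (rule lborel_integral_affine3[OF _ e]) measurable
    also have "\<dots> = of_real (e n ^ 3) * (LINT y|lborel. of_real ((1 / e n) ^ 3 * c0) * of_real (f (\<xi> + e n *\<^sub>R y) * gauss y))"
      using e[of n] by (simp add: mult_ac)
    also have "\<dots> = of_real (e n ^ 3 * ((1 / e n) ^ 3 * c0)) * (LINT y|lborel. of_real (f (\<xi> + e n *\<^sub>R y) * gauss y))"
      by (simp only: integral_mult_right_zero of_real_mult mult.assoc)
    also have "e n ^ 3 * ((1 / e n) ^ 3 * c0) = c0"
      using e[of n] by (simp add: power_divide)
    finally show ?thesis .
  qed
  have "(\<lambda>n. LINT y|lborel. complex_of_real (f (\<xi> + e n *\<^sub>R y) * gauss y)) \<longlonglongrightarrow> (LINT y|lborel. of_real (f \<xi> * gauss y))"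
  proof (rule integral_dominated_convergence[where w = "\<lambda>y. C * gauss y"])
    show "integrable lborel (\<lambda>y. C * gauss y)" by (intro integrable_mult_right gauss_fourier)
    show "AE y in lborel. (\<lambda>n. complex_of_real (f (\<xi> + e n *\<^sub>R y) * gauss y)) \<longlonglongrightarrow> of_real (f \<xi> * gauss y)"
    proof (rule AE_I2)
      fix y :: "real^3"
      have "(\<lambda>n. \<xi> + e n *\<^sub>R y) \<longlonglongrightarrow> \<xi> + 0 *\<^sub>R y" by (intro tendsto_intros e0)
      moreover have "isCont f \<xi>" using fc by (simp add: continuous_on_eq_continuous_at)
      ultimately have "(\<lambda>n. f (\<xi> + e n *\<^sub>R y)) \<longlonglongrightarrow> f \<xi>"
        using isCont_tendsto_compose[of \<xi> f] by simp
      then show "(\<lambda>n. complex_of_real (f (\<xi> + e n *\<^sub>R y) * gauss y)) \<longlonglongrightarrow> of_real (f \<xi> * gauss y)"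
        by (intro tendsto_intros)
    qed
    show "AE y in lborel. norm (complex_of_real (f (\<xi> + e n *\<^sub>R y) * gauss y)) \<le> C * gauss y" for n
      using fb gauss_bounds by (intro AE_I2) (simp add: norm_mult mult_right_mono)
  qed measurable
  also have "(LINT y|lborel. complex_of_real (f \<xi> * gauss y)) = of_real (f \<xi>) * of_real c0"
    using gauss_fourier(2)[of 0] gauss_bounds(3) by (simp add: c0_def)
  finally have "(\<lambda>n. of_real c0 * (LINT y|lborel. complex_of_real (f (\<xi> + e n *\<^sub>R y) * gauss y))) \<longlonglongrightarrow> of_real c0 * (of_real (f \<xi>) * of_real c0)"
    by (intro tendsto_intros)
  then have "A \<longlonglongrightarrow> of_real c0 * (of_real (f \<xi>) * of_real c0)"
    unfolding A[abs_def, symmetric] by simp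
  then have "(LINT z|lborel. osc f z * cis (- (z \<bullet> \<xi>))) = of_real c0 * (of_real (f \<xi>) * of_real c0)"
    using lim1 LIMSEQ_unique by blast
  also have "\<dots> = of_real ((c0 * c0) * f \<xi>)" by simp
  \<comment> \<open>One factor \<open>c0\<close> comes from the Fourier transform of the Gaussian,
    the other from its total mass.\<close>
  also have "c0 * c0 = (2 * pi) ^ 3"
    unfolding c0_def power_mult_distrib[symmetric] by simp
  finally show ?thesis .
qed

section \<open>Convolution with a tempered function\<close>

definition tconv :: "(real^3 \<Rightarrow> complex) \<Rightarrow> (real^3 \<Rightarrow> complex) \<Rightarrow> real^3 \<Rightarrow> complex" where
  "tconv \<phi> K x = (LINT y|lborel. \<phi> y * K (x - y))"

definition kern :: "(real^3 \<Rightarrow> real) \<Rightarrow> real^3 \<Rightarrow> complex" where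
  "kern m z = osc m z / of_real ((2 * pi) ^ 3)"

lemma fourier_mult_eq_tconv: "fourier_mult m \<phi> x = tconv \<phi> (kern m) x"
proof -
  have "fourier (\<lambda>\<xi>. of_real (m \<xi>) * cis (x \<bullet> \<xi>)) y = osc m (x - y)" for y
    unfolding fourier_def osc_def
    by (intro Bochner_Integration.integral_cong) (auto simp: cis_mult mult.assoc inner_diff_left inner_diff_right inner_commute)
  then show ?thesis
    unfolding fourier_mult_def fourier_pairing_def tconv_def kern_def by simp
qed

lemma sum_components_le: "(\<Sum>j\<in>UNIV. \<bar>(h::real^3) $ j\<bar> * c) \<le> 3 * norm h * c" if "0 \<le> c"
proof -
  have "(\<Sum>j\<in>UNIV. \<bar>h $ j\<bar> * c) \<le> (\<Sum>j\<in>(UNIV::3 set). norm h * c)"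
    using that by (intro sum_mono mult_right_mono component_le_norm_cart)
  then show ?thesis by simp
qed

lemma cis_taylor: "norm (cis t - 1 - \<i> * of_real t) \<le> t\<^sup>2"
proof -
  have "norm (iexp t - (\<Sum>k\<le>1. (\<i> * t)^k / fact k)) \<le> \<bar>t\<bar> ^ Suc 1 / fact (Suc 1)"
    by (rule iexp_approx1)
  moreover have "(\<Sum>k\<le>1. (\<i> * complex_of_real t)^k / fact k) = 1 + \<i> * t"
    by (simp add: atMost_Suc numeral_2_eq_2[symmetric])
  ultimately have "norm (cis t - (1 + \<i> * t)) \<le> t\<^sup>2 / 2"
    by (simp add: cis_conv_exp power2_eq_square fact_2[simplified] abs_mult[symmetric])
  then show ?thesis
    using zero_le_power2[of t] unfolding diff_diff_eq by linarith
qed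

text \<open>On the compact support |h . \<xi>| is at most R |h|, so the second-order remainder of
  the exponential integrates to O(|h|^2).\<close>

lemma osc_has_derivative:
  assumes fm: "f \<in> borel_measurable borel" and fb: "\<And>x. \<bar>f x\<bar> \<le> C" and f0: "\<And>x. x \<notin> B \<Longrightarrow> f x = 0" and B: "compact B"
  shows "(osc f has_derivative (\<lambda>h. \<Sum>j\<in>UNIV. h $ j *\<^sub>R (\<i> * osc (\<lambda>\<xi>. \<xi> $ j * f \<xi>) z))) (at z)"
proof -
  obtain R where R: "\<And>x. x \<in> B \<Longrightarrow> norm x \<le> R" using compact_imp_bounded[OF B] by (auto simp: bounded_iff)
  have C: "0 \<le> C" using fb[of 0] by linarith
  note fi = integrable_compact_support(1)[OF fm fb f0 B]
  have fji: "integrable lborel (\<lambda>\<xi>. \<xi> $ j * f \<xi>)" for j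
  proof (rule integrable_compact_support(1)[OF _ _ _ B, where C = "\<bar>R\<bar> * C"])
    show "(\<lambda>\<xi>. \<xi> $ j * f \<xi>) \<in> borel_measurable borel" using fm by measurable
    show "\<bar>\<xi> $ j * f \<xi>\<bar> \<le> \<bar>R\<bar> * C" for \<xi>
    proof (cases "\<xi> \<in> B")
      case True
      have "\<bar>\<xi> $ j\<bar> \<le> \<bar>R\<bar>" using component_le_norm_cart[of \<xi> j] R[OF True] by linarith
      then show ?thesis using fb[of \<xi>] unfolding abs_mult by (intro mult_mono) auto
    qed (simp add: f0 C)
  qed (simp add: f0)
  define E where "E = \<bar>R\<bar>\<^sup>2 * (LINT \<xi>|lborel. \<bar>f \<xi>\<bar>)"
  have est: "norm (osc f (z + h) - osc f z - (\<Sum>j\<in>UNIV. h $ j *\<^sub>R (\<i> * osc (\<lambda>\<xi>. \<xi> $ j * f \<xi>) z))) \<le> (norm h)\<^sup>2 * E" for h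
  proof -
    note i1 = osc_integrable[OF fi, of z] osc_integrable[OF fi, of "z + h"]
    have i2: "integrable lborel (\<lambda>\<xi>. h $ j *\<^sub>R (\<i> * (of_real (\<xi> $ j * f \<xi>) * cis (z \<bullet> \<xi>))))" for j
      by (intro integrable_scaleR_right integrable_mult_right osc_integrable[OF fji])
    have "osc f (z + h) - osc f z - (\<Sum>j\<in>UNIV. h $ j *\<^sub>R (\<i> * osc (\<lambda>\<xi>. \<xi> $ j * f \<xi>) z)) =
       (LINT \<xi>|lborel. of_real (f \<xi>) * cis ((z + h) \<bullet> \<xi>) - of_real (f \<xi>) * cis (z \<bullet> \<xi>) -
          (\<Sum>j\<in>UNIV. h $ j *\<^sub>R (\<i> * (of_real (\<xi> $ j * f \<xi>) * cis (z \<bullet> \<xi>)))))"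
      unfolding osc_def using i1 i2
      by (simp add: Bochner_Integration.integral_diff Bochner_Integration.integrable_diff Bochner_Integration.integrable_sum Bochner_Integration.integral_sum)
    also have "\<dots> = (LINT \<xi>|lborel. of_real (f \<xi>) * cis (z \<bullet> \<xi>) * (cis (h \<bullet> \<xi>) - 1 - \<i> * of_real (h \<bullet> \<xi>)))"
    proof (intro Bochner_Integration.integral_cong refl)
      fix \<xi>
      have "(\<Sum>j\<in>UNIV. h $ j *\<^sub>R (\<i> * (of_real (\<xi> $ j * f \<xi>) * cis (z \<bullet> \<xi>)))) = of_real (f \<xi>) * cis (z \<bullet> \<xi>) * (\<i> * of_real (h \<bullet> \<xi>))"
        unfolding inner_vec_def by (simp add: sum_distrib_left scaleR_conv_of_real mult_ac)
      then show "of_real (f \<xi>) * cis ((z + h) \<bullet> \<xi>) - of_real (f \<xi>) * cis (z \<bullet> \<xi>) -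
          (\<Sum>j\<in>UNIV. h $ j *\<^sub>R (\<i> * (of_real (\<xi> $ j * f \<xi>) * cis (z \<bullet> \<xi>)))) = of_real (f \<xi>) * cis (z \<bullet> \<xi>) * (cis (h \<bullet> \<xi>) - 1 - \<i> * of_real (h \<bullet> \<xi>))"
        by (simp add: inner_add_left cis_mult[symmetric] algebra_simps)
    qed
    also have "norm \<dots> \<le> (LINT \<xi>|lborel. (norm h)\<^sup>2 * \<bar>R\<bar>\<^sup>2 * \<bar>f \<xi>\<bar>)"
    proof (rule order_trans[OF integral_norm_bound], rule integral_mono')
      show "integrable lborel (\<lambda>\<xi>. (norm h)\<^sup>2 * \<bar>R\<bar>\<^sup>2 * \<bar>f \<xi>\<bar>)"
        by (intro integrable_mult_right integrable_abs fi)
      show "norm (of_real (f \<xi>) * cis (z \<bullet> \<xi>) * (cis (h \<bullet> \<xi>) - 1 - \<i> * of_real (h \<bullet> \<xi>))) \<le> (norm h)\<^sup>2 * \<bar>R\<bar>\<^sup>2 * \<bar>f \<xi>\<bar>" for \<xi>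
      proof (cases "\<xi> \<in> B")
        case True
        have "\<bar>h \<bullet> \<xi>\<bar> \<le> norm h * norm \<xi>" by (rule Cauchy_Schwarz_ineq2)
        also have "\<dots> \<le> norm h * \<bar>R\<bar>" using R[OF True] by (intro mult_left_mono) auto
        finally have "\<bar>h \<bullet> \<xi>\<bar>\<^sup>2 \<le> (norm h * \<bar>R\<bar>)\<^sup>2" by (rule power_mono) simp
        then have "norm (cis (h \<bullet> \<xi>) - 1 - \<i> * of_real (h \<bullet> \<xi>)) \<le> (norm h)\<^sup>2 * \<bar>R\<bar>\<^sup>2"
          using cis_taylor[of "h \<bullet> \<xi>"] by (simp add: power_mult_distrib)
        then have "\<bar>f \<xi>\<bar> * norm (cis (h \<bullet> \<xi>) - 1 - \<i> * of_real (h \<bullet> \<xi>)) \<le> \<bar>f \<xi>\<bar> * ((norm h)\<^sup>2 * \<bar>R\<bar>\<^sup>2)"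
          by (rule mult_left_mono) simp
        then show ?thesis by (simp only: norm_mult norm_of_real norm_cis mult_1_right mult.commute)
      qed (simp add: f0)
    qed simp
    also have "\<dots> = (norm h)\<^sup>2 * E" by (simp add: E_def)
    finally show ?thesis .
  qed
  show ?thesis
  proof (rule has_derivativeI_sandwich[where e = 1 and H = "\<lambda>y. norm (y - z) * E"])
    show "bounded_linear (\<lambda>h. \<Sum>j\<in>UNIV. h $ j *\<^sub>R (\<i> * osc (\<lambda>\<xi>. \<xi> $ j * f \<xi>) z))"
      by (intro bounded_linear_sum bounded_linear_scaleR_const bounded_linear_vec_nth)
    show "norm (osc f y - osc f z - (\<Sum>j\<in>UNIV. (y - z) $ j *\<^sub>R (\<i> * osc (\<lambda>\<xi>. \<xi> $ j * f \<xi>) z))) / norm (y - z) \<le> norm (y - z) * E"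
      if "y \<noteq> z" for y
    proof -
      have "0 < norm (y - z)" using that by simp
      moreover have "norm (osc f y - osc f z - (\<Sum>j\<in>UNIV. (y - z) $ j *\<^sub>R (\<i> * osc (\<lambda>\<xi>. \<xi> $ j * f \<xi>) z))) \<le> norm (y - z) * E * norm (y - z)"
        using est[of "y - z"] by (simp add: power2_eq_square mult_ac)
      ultimately show ?thesis by (simp only: pos_divide_le_eq)
    qed
    have "((\<lambda>y. norm (y - z) * E) \<longlongrightarrow> norm (z - z) * E) (at z)" by (intro tendsto_intros)
    then show "((\<lambda>y. norm (y - z) * E) \<longlongrightarrow> 0) (at z)" by simp
  qed simp
qed

section \<open>Pairings and derivatives of convolutions with tempered functions\<close>

lemma temperedE:
  assumes "tempered_fun \<phi>"
  obtains M where "integrable lborel (\<lambda>y. norm (\<phi> y) / (1 + norm y) ^ M)" "\<phi> \<in> borel_measurable borel"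
proof -
  obtain M :: nat where M: "integrable lborel (\<lambda>x. \<phi> x / of_real ((1 + norm x) ^ M))" and m: "\<phi> \<in> borel_measurable borel"
    using assms unfolding tempered_fun_def by auto
  have "(\<lambda>y. norm (\<phi> y / of_real ((1 + norm y) ^ M))) = (\<lambda>y. norm (\<phi> y) / (1 + norm y) ^ M)"
    using one_plus_norm_pos[where ?'a = "real^3"] by (simp add: fun_eq_iff norm_divide norm_power del: of_real_power of_real_add)
  then show thesis using that[of M] integrable_norm[OF M] m by simp
qed

lemma tempered_bound:
  fixes \<phi> u :: "real^3 \<Rightarrow> complex"
  assumes i: "integrable lborel (\<lambda>y. norm (\<phi> y) / (1 + norm y) ^ M)" and m: "\<phi> \<in> borel_measurable borel"
    and um: "u \<in> borel_measurable borel" and u: "\<And>y. (1 + norm y) ^ M * norm (u y) \<le> D"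
  shows "integrable lborel (\<lambda>y. \<phi> y * u y)"
    "norm (LINT y|lborel. \<phi> y * u y) \<le> D * (LINT y|lborel. norm (\<phi> y) / (1 + norm y) ^ M)"
proof -
  have bd: "norm (\<phi> y * u y) \<le> D * (norm (\<phi> y) / (1 + norm y) ^ M)" for y
  proof -
    define p where "p = (1 + norm y) ^ M"
    have "p \<noteq> 0" using one_plus_norm_pos[of y M] unfolding p_def by linarith
    then have "norm (\<phi> y * u y) = (norm (\<phi> y) / p) * (p * norm (u y))"
      by (simp add: norm_mult)
    then have "norm (\<phi> y * u y) = (norm (\<phi> y) / (1 + norm y) ^ M) * ((1 + norm y) ^ M * norm (u y))"
      unfolding p_def .
    also have "\<dots> \<le> (norm (\<phi> y) / (1 + norm y) ^ M) * D"
      using u[of y] one_plus_norm_pos[of y M] by (intro mult_left_mono divide_nonneg_pos) auto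
    finally show ?thesis by (simp add: mult.commute)
  qed
  have i': "integrable lborel (\<lambda>y. D * (norm (\<phi> y) / (1 + norm y) ^ M))"
    by (intro integrable_mult_right i)
  show "integrable lborel (\<lambda>y. \<phi> y * u y)"
  proof (rule Bochner_Integration.integrable_bound[OF i'])
    show "AE y in lborel. norm (\<phi> y * u y) \<le> norm (D * (norm (\<phi> y) / (1 + norm y) ^ M))"
      by (rule AE_I2, rule order_trans[OF bd], unfold real_norm_def, rule abs_ge_self)
  qed (use m um in \<open>simp add: borel_measurable_times\<close>)
  have "norm (LINT y|lborel. \<phi> y * u y) \<le> (LINT y|lborel. D * (norm (\<phi> y) / (1 + norm y) ^ M))"
    by (rule order_trans[OF integral_norm_bound], rule integral_mono'[OF i' bd]) (rule order_trans[OF norm_ge_zero bd])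
  then show "norm (LINT y|lborel. \<phi> y * u y) \<le> D * (LINT y|lborel. norm (\<phi> y) / (1 + norm y) ^ M)"
    by (simp only: integral_mult_right_zero)
qed

lemma reflect_measurable [measurable]:
  fixes K :: "real^3 \<Rightarrow> complex"
  assumes "K \<in> borel_measurable borel"
  shows "(\<lambda>y. K (x - y)) \<in> borel_measurable borel"
proof -
  have "(\<lambda>y::real^3. x - y) \<in> borel_measurable borel"
    by (intro borel_measurable_continuous_onI continuous_intros)
  from measurable_compose[OF this assms] show ?thesis .
qed

text \<open>The weight at y is at most the product of the weights at x and at x - y, so decay of the
  kernel costs only a polynomial factor in x.\<close>

lemma reflect_bound:
  fixes K :: "real^3 \<Rightarrow> complex"
  assumes "\<And>z. (1 + norm z) ^ M * norm (K z) \<le> D"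
  shows "(1 + norm y) ^ M * norm (K (x - y)) \<le> (1 + norm x) ^ M * D"
proof -
  have "(1 + norm y) ^ M \<le> (1 + norm x) ^ M * (1 + norm (x - y)) ^ M"
    using one_plus_norm_triangle_power[of x "- (x - y)" M] by (simp only: norm_minus_cancel) simp
  then have "(1 + norm y) ^ M * norm (K (x - y)) \<le> ((1 + norm x) ^ M * (1 + norm (x - y)) ^ M) * norm (K (x - y))"
    by (rule mult_right_mono) simp
  also have "\<dots> \<le> (1 + norm x) ^ M * D"
    unfolding mult.assoc using assms one_plus_norm_pos[of x M] by (intro mult_left_mono) auto
  finally show ?thesis .
qed

lemma tconv_integrable:
  assumes "tempered_fun \<phi>" "decays K" "K \<in> borel_measurable borel"
  shows "integrable lborel (\<lambda>y. \<phi> y * K (x - y))"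
proof -
  obtain M where M: "integrable lborel (\<lambda>y. norm (\<phi> y) / (1 + norm y) ^ M)" "\<phi> \<in> borel_measurable borel"
    by (rule temperedE[OF assms(1)]) (rule that)
  obtain D where D: "\<And>z. (1 + norm z) ^ M * norm (K z) \<le> D" by (rule decaysE[OF assms(2), where n = M]) (rule that)
  show ?thesis
    by (rule tempered_bound(1)[OF M reflect_measurable[OF assms(3)] reflect_bound[OF D]])
qed

lemma tconv_poly_growth:
  assumes "tempered_fun \<phi>" "decays K" "K \<in> borel_measurable borel"
  shows "poly_growth (tconv \<phi> K)"
proof -
  obtain M where M: "integrable lborel (\<lambda>y. norm (\<phi> y) / (1 + norm y) ^ M)" "\<phi> \<in> borel_measurable borel"
    by (rule temperedE[OF assms(1)]) (rule that)
  obtain D where D: "\<And>z. (1 + norm z) ^ M * norm (K z) \<le> D" by (rule decaysE[OF assms(2), where n = M]) (rule that)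
  have "norm (tconv \<phi> K x) \<le> (D * (LINT y|lborel. norm (\<phi> y) / (1 + norm y) ^ M)) * (1 + norm x) ^ M" for x
    unfolding tconv_def using tempered_bound(2)[OF M reflect_measurable[OF assms(3)] reflect_bound[OF D], of x]
    by (simp only: mult_ac)
  then show ?thesis unfolding poly_growth_def by blast
qed

text \<open>Derivatives are taken at points within distance 1 of z, where the weight changes by at
  most \<open>2 ^ M\<close>. The mean value inequality is used twice, each time losing a factor 3
  because a linear form is bounded through its three coefficients; hence the 9.\<close>

lemma taylor_decay:
  fixes K :: "real^3 \<Rightarrow> complex"
  assumes D1: "\<And>z. (K has_derivative (\<lambda>h. \<Sum>j\<in>UNIV. h $ j *\<^sub>R K' j z)) (at z)"
    and D2: "\<And>j z. (K' j has_derivative (\<lambda>h. \<Sum>l\<in>UNIV. h $ l *\<^sub>R K'' j l z)) (at z)"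
    and bd: "\<And>j l z. (1 + norm z) ^ M * norm (K'' j l z) \<le> D"
    and h: "norm h \<le> 1"
  shows "(1 + norm z) ^ M * norm (K (z + h) - K z - (\<Sum>j\<in>UNIV. h $ j *\<^sub>R K' j z)) \<le> 9 * (2 ^ M * D) * (norm h)\<^sup>2"
proof -
  define E where "E = 2 ^ M * D / (1 + norm z) ^ M"
  have pz: "0 < (1 + norm z) ^ M" by (rule one_plus_norm_pos)
  have K'': "norm (K'' j l w) \<le> E" if "w \<in> cball z (norm h)" for j l w
  proof -
    have "norm (z - w) \<le> 1" using that h by (simp add: dist_norm)
    then have "(1 + norm (z - w)) ^ M \<le> 2 ^ M" by (intro power_mono) auto
    then have "(1 + norm w) ^ M * (1 + norm (z - w)) ^ M \<le> (1 + norm w) ^ M * 2 ^ M"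
      using one_plus_norm_pos[of w M] by (intro mult_left_mono) auto
    moreover have "(1 + norm z) ^ M \<le> (1 + norm w) ^ M * (1 + norm (z - w)) ^ M"
      using one_plus_norm_triangle_power[of w "z - w" M] by simp
    ultimately have "(1 + norm z) ^ M \<le> (1 + norm w) ^ M * 2 ^ M" by linarith
    then have "(1 + norm z) ^ M * norm (K'' j l w) \<le> ((1 + norm w) ^ M * 2 ^ M) * norm (K'' j l w)"
      by (rule mult_right_mono) simp
    also have "\<dots> = 2 ^ M * ((1 + norm w) ^ M * norm (K'' j l w))" by (simp only: mult_ac)
    also have "\<dots> \<le> 2 ^ M * D" using bd by (intro mult_left_mono) auto
    finally show ?thesis using pz by (simp add: E_def pos_le_divide_eq mult.commute)
  qed
  have E0: "0 \<le> E" using order_trans[OF norm_ge_zero K''[of z]] by simp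
  have on: "onorm (\<lambda>v. \<Sum>l\<in>UNIV. v $ l *\<^sub>R a l) \<le> 3 * c" if "\<And>l. norm (a l) \<le> c" "0 \<le> c" for a :: "3 \<Rightarrow> complex" and c
  proof (rule onorm_le)
    fix v :: "real^3"
    have "norm (\<Sum>l\<in>UNIV. v $ l *\<^sub>R a l) \<le> (\<Sum>l\<in>UNIV. \<bar>v $ l\<bar> * c)"
      by (rule sum_norm_le) (simp add: mult_left_mono that)
    also have "\<dots> \<le> 3 * norm v * c" by (rule sum_components_le[OF that(2)])
    finally show "norm (\<Sum>l\<in>UNIV. v $ l *\<^sub>R a l) \<le> 3 * c * norm v" by (simp add: mult_ac)
  qed
  have zc: "z \<in> cball z (norm h)" "z + h \<in> cball z (norm h)" by (simp_all add: dist_norm)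
  have K': "norm (K' j w - K' j z) \<le> 3 * E * norm h" if w: "w \<in> cball z (norm h)" for j w
  proof -
    have "norm (K' j w - K' j z) \<le> (3 * E) * norm (w - z)"
    proof (rule differentiable_bound[OF convex_cball _ _ w zc(1)])
      show "(K' j has_derivative (\<lambda>h. \<Sum>l\<in>UNIV. h $ l *\<^sub>R K'' j l v)) (at v within cball z (norm h))" for v
        by (rule has_derivative_at_withinI[OF D2])
      show "onorm (\<lambda>h. \<Sum>l\<in>UNIV. h $ l *\<^sub>R K'' j l v) \<le> 3 * E" if "v \<in> cball z (norm h)" for v
        by (rule on[OF K''[OF that] E0])
    qed
    also have "\<dots> \<le> (3 * E) * norm h"
      using w E0 by (intro mult_left_mono) (auto simp: dist_norm norm_minus_commute)
    finally show ?thesis .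
  qed
  define F where "F w = K w - (\<Sum>j\<in>UNIV. w $ j *\<^sub>R K' j z)" for w
  have "norm (F (z + h) - F z) \<le> (3 * (3 * E * norm h)) * norm (z + h - z)"
  proof (rule differentiable_bound[OF convex_cball _ _ zc(2) zc(1)])
    have "bounded_linear (\<lambda>w::real^3. \<Sum>j\<in>UNIV. w $ j *\<^sub>R K' j z)"
      by (intro bounded_linear_sum bounded_linear_scaleR_const bounded_linear_vec_nth)
    then have L: "((\<lambda>w::real^3. \<Sum>j\<in>UNIV. w $ j *\<^sub>R K' j z) has_derivative (\<lambda>w. \<Sum>j\<in>UNIV. w $ j *\<^sub>R K' j z)) (at v)" for v
      by (rule bounded_linear_imp_has_derivative)
    have "(F has_derivative (\<lambda>h. (\<Sum>j\<in>UNIV. h $ j *\<^sub>R K' j v) - (\<Sum>j\<in>UNIV. h $ j *\<^sub>R K' j z))) (at v)" for v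
      unfolding F_def[abs_def] by (rule has_derivative_diff[OF D1 L])
    then have "(F has_derivative (\<lambda>h. \<Sum>j\<in>UNIV. h $ j *\<^sub>R (K' j v - K' j z))) (at v)" for v
      by (simp only: scaleR_right_diff_distrib sum_subtractf)
    then show "(F has_derivative (\<lambda>h. \<Sum>j\<in>UNIV. h $ j *\<^sub>R (K' j v - K' j z))) (at v within cball z (norm h))" for v
      by (rule has_derivative_at_withinI)
    show "onorm (\<lambda>h. \<Sum>j\<in>UNIV. h $ j *\<^sub>R (K' j v - K' j z)) \<le> 3 * (3 * E * norm h)" if "v \<in> cball z (norm h)" for v
      by (rule on[OF K'[OF that]]) (use E0 in simp)
  qed
  moreover have "F (z + h) - F z = K (z + h) - K z - (\<Sum>j\<in>UNIV. h $ j *\<^sub>R K' j z)"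
    by (simp add: F_def scaleR_left_distrib sum.distrib)
  ultimately have "norm (K (z + h) - K z - (\<Sum>j\<in>UNIV. h $ j *\<^sub>R K' j z)) \<le> 9 * E * (norm h)\<^sup>2"
    by (simp add: power2_eq_square mult_ac)
  then have "(1 + norm z) ^ M * norm (K (z + h) - K z - (\<Sum>j\<in>UNIV. h $ j *\<^sub>R K' j z)) \<le> (1 + norm z) ^ M * (9 * E * (norm h)\<^sup>2)"
    using pz by (intro mult_left_mono) auto
  also have "\<dots> = 9 * (2 ^ M * D) * (norm h)\<^sup>2"
  proof -
    define p where "p = (1 + norm z) ^ M"
    have "p \<noteq> 0" using pz by (simp only: p_def less_imp_neq not_sym)
    then show ?thesis by (simp add: E_def p_def[symmetric])
  qed
  finally show ?thesis .
qed

text \<open>As \<phi> is integrable only against an inverse power of 1 + |y|, the Taylor remainder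
  of the kernel must be O(|h|^2) with the opposite power as weight. The decay of the second
  derivatives provides this.\<close>

lemma tconv_has_derivative:
  fixes K :: "real^3 \<Rightarrow> complex"
  assumes \<phi>: "tempered_fun \<phi>"
    and K: "decays K" "K \<in> borel_measurable borel"
    and K': "\<And>j. decays (K' j)" "\<And>j. K' j \<in> borel_measurable borel"
    and K'': "\<And>j l. decays (K'' j l)"
    and D1: "\<And>z. (K has_derivative (\<lambda>h. \<Sum>j\<in>UNIV. h $ j *\<^sub>R K' j z)) (at z)"
    and D2: "\<And>j z. (K' j has_derivative (\<lambda>h. \<Sum>l\<in>UNIV. h $ l *\<^sub>R K'' j l z)) (at z)"
  shows "(tconv \<phi> K has_derivative (\<lambda>h. \<Sum>j\<in>UNIV. h $ j *\<^sub>R tconv \<phi> (K' j) x)) (at x)"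
proof -
  obtain M where M: "integrable lborel (\<lambda>y. norm (\<phi> y) / (1 + norm y) ^ M)" "\<phi> \<in> borel_measurable borel"
    by (rule temperedE[OF \<phi>]) (rule that)
  have "\<exists>D. \<forall>z. (1 + norm z) ^ M * norm (K'' j l z) \<le> D" for j l
    using K''[of j l] unfolding decays_def by blast
  then obtain Dj where Dj: "\<And>j l z. (1 + norm z) ^ M * norm (K'' j l z) \<le> Dj j l" by metis
  define D where "D = Max (range (\<lambda>(j, l). Dj j l))"
  have D: "(1 + norm z) ^ M * norm (K'' j l z) \<le> D" for j l z
  proof -
    have "Dj j l \<le> D" unfolding D_def by (rule Max_ge) (auto intro: rev_image_eqI[of "(j, l)"])
    then show ?thesis using Dj[of z j l] by linarith
  qed
  define G where "G = (1 + norm x) ^ M * (9 * (2 ^ M * D)) * (LINT y|lborel. norm (\<phi> y) / (1 + norm y) ^ M)"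
  have est: "norm (tconv \<phi> K (x + h) - tconv \<phi> K x - (\<Sum>j\<in>UNIV. h $ j *\<^sub>R tconv \<phi> (K' j) x)) \<le> G * (norm h)\<^sup>2"
    if h: "norm h \<le> 1" for h
  proof -
    define u where "u z = K (z + h) - K z - (\<Sum>j\<in>UNIV. h $ j *\<^sub>R K' j z)" for z
    have um: "u \<in> borel_measurable borel" unfolding u_def using K(2) K'(2) by measurable
    have i1: "integrable lborel (\<lambda>y. \<phi> y * K (x + h - y))" "integrable lborel (\<lambda>y. \<phi> y * K (x - y))"
      by (rule tconv_integrable[OF \<phi> K])+
    have i2: "integrable lborel (\<lambda>y. h $ j *\<^sub>R (\<phi> y * K' j (x - y)))" for j
      by (intro integrable_scaleR_right tconv_integrable[OF \<phi> K'])
    have "tconv \<phi> K (x + h) - tconv \<phi> K x - (\<Sum>j\<in>UNIV. h $ j *\<^sub>R tconv \<phi> (K' j) x) =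
        (LINT y|lborel. \<phi> y * K (x + h - y) - \<phi> y * K (x - y) - (\<Sum>j\<in>UNIV. h $ j *\<^sub>R (\<phi> y * K' j (x - y))))"
      unfolding tconv_def using i1 i2
      by (simp add: Bochner_Integration.integral_diff Bochner_Integration.integrable_diff Bochner_Integration.integrable_sum Bochner_Integration.integral_sum)
    also have "\<dots> = (LINT y|lborel. \<phi> y * u (x - y))"
      by (intro Bochner_Integration.integral_cong) (auto simp: u_def algebra_simps sum_distrib_left)
    also have "norm \<dots> \<le> ((1 + norm x) ^ M * (9 * (2 ^ M * D) * (norm h)\<^sup>2)) * (LINT y|lborel. norm (\<phi> y) / (1 + norm y) ^ M)"
    proof (rule tempered_bound(2)[OF M reflect_measurable[OF um]])
      have "(1 + norm z) ^ M * norm (u z) \<le> 9 * (2 ^ M * D) * (norm h)\<^sup>2" for z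
        unfolding u_def by (rule taylor_decay[OF D1 D2 D h])
      then show "(1 + norm y) ^ M * norm (u (x - y)) \<le> (1 + norm x) ^ M * (9 * (2 ^ M * D) * (norm h)\<^sup>2)" for y
        by (rule reflect_bound)
    qed
    finally show ?thesis by (simp add: G_def mult_ac)
  qed
  show ?thesis
  proof (rule has_derivativeI_sandwich[where e = 1 and H = "\<lambda>y. G * norm (y - x)"])
    show "bounded_linear (\<lambda>h::real^3. \<Sum>j\<in>UNIV. h $ j *\<^sub>R tconv \<phi> (K' j) x)"
      by (intro bounded_linear_sum bounded_linear_scaleR_const bounded_linear_vec_nth)
    show "norm (tconv \<phi> K y - tconv \<phi> K x - (\<Sum>j\<in>UNIV. (y - x) $ j *\<^sub>R tconv \<phi> (K' j) x)) / norm (y - x) \<le> G * norm (y - x)"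
      if "y \<noteq> x" "dist y x < 1" for y
    proof -
      have "0 < norm (y - x)" using that by simp
      moreover have "norm (tconv \<phi> K y - tconv \<phi> K x - (\<Sum>j\<in>UNIV. (y - x) $ j *\<^sub>R tconv \<phi> (K' j) x)) \<le> G * norm (y - x) * norm (y - x)"
        using est[of "y - x"] that(2) by (simp add: power2_eq_square mult_ac dist_norm)
      ultimately show ?thesis by (simp only: pos_divide_le_eq)
    qed
    have "((\<lambda>y. G * norm (y - x)) \<longlongrightarrow> G * norm (x - x)) (at x)" by (intro tendsto_intros)
    then show "((\<lambda>y. G * norm (y - x)) \<longlongrightarrow> 0) (at x)" by simp
  qed simp
qed

text \<open>Fubini with a product majorant: the decay of \<open>K2\<close> compensates \<phi> up to
  a power of 1 + |y|, and the decay of \<open>K1\<close> absorbs that power.\<close>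

lemma tconv_assoc:
  assumes \<phi>: "tempered_fun \<phi>" and K1: "decays K1" "K1 \<in> borel_measurable borel"
    and K2: "decays K2" "K2 \<in> borel_measurable borel"
  shows "tconv \<phi> (\<lambda>z. LINT v|lborel. K1 (z - v) * K2 v) x = (LINT y|lborel. K1 (x - y) * tconv \<phi> K2 y)"
proof -
  obtain M where M: "integrable lborel (\<lambda>y. norm (\<phi> y) / (1 + norm y) ^ M)" "\<phi> \<in> borel_measurable borel"
    by (rule temperedE[OF \<phi>]) (rule that)
  obtain D where D: "\<And>z. (1 + norm z) ^ M * norm (K2 z) \<le> D" by (rule decaysE[OF K2(1), where n = M]) (rule that)
  note [measurable] = M(2) K1(2) K2(2)
  define h where "h = (\<lambda>(w, y). \<phi> w * (K1 (x - y) * K2 (y - w)))"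
  have "tconv \<phi> (\<lambda>z. LINT v|lborel. K1 (z - v) * K2 v) x = (LINT w|lborel. LINT y|lborel. h (w, y))"
    unfolding tconv_def
  proof (intro Bochner_Integration.integral_cong refl)
    fix w
    have "(LINT v|lborel. K1 (x - w - v) * K2 v) = of_real (1 ^ 3) * (LINT y|lborel. K1 (x - w - (- w + 1 *\<^sub>R y)) * K2 (- w + 1 *\<^sub>R y))"
      by (rule lborel_integral_affine3) (simp_all add: borel_measurable_times reflect_measurable K1(2) K2(2))
    also have "\<dots> = (LINT y|lborel. K1 (x - y) * K2 (y - w))" by simp
    finally show "\<phi> w * (LINT v|lborel. K1 (x - w - v) * K2 v) = (LINT y|lborel. h (w, y))"
      by (simp add: h_def)
  qed
  also have "\<dots> = (LINT y|lborel. LINT w|lborel. h (w, y))"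
  proof (rule fubini_bounded[OF _ M(1)])
    show "h \<in> borel_measurable (lborel \<Otimes>\<^sub>M lborel)" unfolding h_def by measurable
    have "poly_growth (\<lambda>y::real^3. complex_of_real ((1 + norm y) ^ M))"
      unfolding poly_growth_def by (rule exI[of _ M], rule exI[of _ 1]) (simp add: norm_power del: of_real_power of_real_add)
    from decays_mult_poly[OF decays_reflect[OF K1(1), of x] this]
    have "integrable lborel (\<lambda>y. complex_of_real ((1 + norm y) ^ M) * K1 (x - y))"
      by (rule decays_integrable) measurable
    from integrable_norm[OF this]
    show "integrable lborel (\<lambda>y. norm (complex_of_real ((1 + norm y) ^ M) * K1 (x - y)) * D)"
      by (rule integrable_mult_left)
    show "norm (h (w, y)) \<le> norm (\<phi> w) / (1 + norm w) ^ M * (norm (complex_of_real ((1 + norm y) ^ M) * K1 (x - y)) * D)" for w y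
    proof -
      have "(1 + norm w) ^ M * norm (K2 (y - w)) \<le> (1 + norm y) ^ M * D" by (rule reflect_bound[OF D])
      then have "norm (K2 (y - w)) \<le> (1 + norm y) ^ M * D / (1 + norm w) ^ M"
        using one_plus_norm_pos[of w M] by (simp add: pos_le_divide_eq mult.commute)
      then have "norm (\<phi> w) * (norm (K1 (x - y)) * norm (K2 (y - w))) \<le> norm (\<phi> w) * (norm (K1 (x - y)) * ((1 + norm y) ^ M * D / (1 + norm w) ^ M))"
        by (intro mult_left_mono) auto
      then show ?thesis
        by (simp add: h_def norm_mult norm_power mult_ac del: of_real_power of_real_add)
    qed
  qed
  also have "\<dots> = (LINT y|lborel. K1 (x - y) * tconv \<phi> K2 y)"
  proof (intro Bochner_Integration.integral_cong refl)
    fix y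
    have "(LINT w|lborel. h (w, y)) = (LINT w|lborel. K1 (x - y) * (\<phi> w * K2 (y - w)))"
      by (intro Bochner_Integration.integral_cong) (auto simp: h_def)
    then show "(LINT w|lborel. h (w, y)) = K1 (x - y) * tconv \<phi> K2 y"
      by (simp add: tconv_def)
  qed
  finally show ?thesis .
qed

text \<open>The kernel of \<open>f\<close> is written out as an integral; the integral over v, done
  first, is then the inversion formula for \<open>g\<close>.\<close>

lemma kern_product:
  assumes fi: "integrable lborel f" and oi: "integrable lborel (osc g)"
    and inv: "\<And>\<xi>. (LINT z|lborel. osc g z * cis (- (z \<bullet> \<xi>))) = of_real ((2 * pi) ^ 3 * g \<xi>)"
  shows "kern (\<lambda>\<xi>. f \<xi> * g \<xi>) z = (LINT v|lborel. kern f (z - v) * kern g v)"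
proof -
  have [measurable]: "f \<in> borel_measurable borel" "osc g \<in> borel_measurable borel" using fi oi by auto
  define h where "h = (\<lambda>(v, \<xi>). of_real (f \<xi>) * cis ((z - v) \<bullet> \<xi>) * osc g v)"
  have "(LINT v|lborel. osc f (z - v) * osc g v) = (LINT v|lborel. LINT \<xi>|lborel. h (v, \<xi>))"
    by (simp only: h_def osc_def[of f] prod.case integral_mult_left_zero)
  also have "\<dots> = (LINT \<xi>|lborel. LINT v|lborel. h (v, \<xi>))"
  proof (rule fubini_bounded[OF _ integrable_norm[OF oi] integrable_abs[OF fi]])
    show "h \<in> borel_measurable (lborel \<Otimes>\<^sub>M lborel)" unfolding h_def by measurable
    show "norm (h (v, \<xi>)) \<le> norm (osc g v) * \<bar>f \<xi>\<bar>" for v \<xi> by (simp add: h_def norm_mult)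
  qed
  also have "\<dots> = (LINT \<xi>|lborel. of_real ((2 * pi) ^ 3) * (of_real (f \<xi> * g \<xi>) * cis (z \<bullet> \<xi>)))"
  proof (intro Bochner_Integration.integral_cong refl)
    fix \<xi>
    have "(LINT v|lborel. h (v, \<xi>)) = (LINT v|lborel. (of_real (f \<xi>) * cis (z \<bullet> \<xi>)) * (osc g v * cis (- (v \<bullet> \<xi>))))"
      by (intro Bochner_Integration.integral_cong refl) (simp add: h_def inner_diff_left cis_mult mult_ac)
    also have "\<dots> = (of_real (f \<xi>) * cis (z \<bullet> \<xi>)) * of_real ((2 * pi) ^ 3 * g \<xi>)"
      unfolding inv[symmetric] by (rule integral_mult_right_zero)
    finally show "(LINT v|lborel. h (v, \<xi>)) = of_real ((2 * pi) ^ 3) * (of_real (f \<xi> * g \<xi>) * cis (z \<bullet> \<xi>))"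
      by (simp only: of_real_mult mult_ac)
  qed
  also have "\<dots> = of_real ((2 * pi) ^ 3) * osc (\<lambda>\<xi>. f \<xi> * g \<xi>) z"
    unfolding osc_def by (rule integral_mult_right_zero)
  finally have e: "(LINT v|lborel. osc f (z - v) * osc g v) = of_real ((2 * pi) ^ 3) * osc (\<lambda>\<xi>. f \<xi> * g \<xi>) z" .
  define c where "c = complex_of_real ((2 * pi) ^ 3)"
  have c: "c \<noteq> 0" by (simp add: c_def)
  have "(LINT v|lborel. kern f (z - v) * kern g v) = (LINT v|lborel. (osc f (z - v) * osc g v) / (c * c))"
    unfolding kern_def c_def[symmetric] by simp
  also have "\<dots> = (LINT v|lborel. osc f (z - v) * osc g v) / (c * c)" by (rule integral_divide_zero)
  also have "\<dots> = kern (\<lambda>\<xi>. f \<xi> * g \<xi>) z"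
    unfolding e kern_def c_def[symmetric] using c by simp
  finally show ?thesis ..
qed

lemma inverse_le_quotient: "0 < a \<Longrightarrow> 0 < b \<Longrightarrow> a \<le> b * c \<Longrightarrow> 1 / b \<le> c / (a::real)"
  by (simp add: field_simps)

text \<open>Since j and l differ, the factor y_j is constant in the direction of differentiation, so
  no third term arises. The sign of the integration by parts cancels that of the reflected kernel,
  and decay makes the total derivative integrate to zero.\<close>

lemma conv_by_parts:
  fixes M :: "real^3 \<Rightarrow> complex"
  assumes M: "decays M" "M \<in> borel_measurable borel"
    and M': "decays (M' l)" "M' l \<in> borel_measurable borel"
    and DM: "\<And>z. (M has_derivative (\<lambda>h. \<Sum>j\<in>UNIV. h $ j *\<^sub>R M' j z)) (at z)"
    and \<psi>: "poly_growth \<psi>" "\<psi> \<in> borel_measurable borel"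
    and \<psi>': "poly_growth (\<psi>' l)" "\<psi>' l \<in> borel_measurable borel"
    and D\<psi>: "\<And>z. (\<psi> has_derivative (\<lambda>h. \<Sum>j\<in>UNIV. h $ j *\<^sub>R \<psi>' j z)) (at z)"
    and jl: "j \<noteq> l"
  shows "integrable lborel (\<lambda>y. of_real (y $ j) * M' l (x - y) * \<psi> y)"
    "integrable lborel (\<lambda>y. of_real (y $ j) * M (x - y) * \<psi>' l y)"
    "(LINT y|lborel. of_real (y $ j) * M' l (x - y) * \<psi> y) = (LINT y|lborel. of_real (y $ j) * M (x - y) * \<psi>' l y)"
proof -
  note [measurable] = M(2) M'(2) \<psi>(2) \<psi>'(2)
  have yp: "poly_growth (\<lambda>y::real^3. complex_of_real (y $ j))"
    unfolding poly_growth_def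
    by (rule exI[of _ 1], rule exI[of _ 1]) (auto intro: order_trans[OF component_le_norm_cart])
  have dec: "decays (\<lambda>y. of_real (y $ j) * K (x - y) * p y)" if "decays K" "poly_growth p" for K p :: "real^3 \<Rightarrow> complex"
    using decays_mult_poly[OF decays_mult_poly[OF decays_reflect[OF that(1), of x] yp] that(2)] by (simp add: mult_ac)
  note d1 = dec[OF M'(1) \<psi>(1)] and d2 = dec[OF M(1) \<psi>'(1)] and d0 = dec[OF M(1) \<psi>(1)]
  show i1: "integrable lborel (\<lambda>y. of_real (y $ j) * M' l (x - y) * \<psi> y)"
    by (rule decays_integrable[OF d1]) measurable
  show i2: "integrable lborel (\<lambda>y. of_real (y $ j) * M (x - y) * \<psi>' l y)"
    by (rule decays_integrable[OF d2]) measurable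
  have i0: "integrable lborel (\<lambda>y. of_real (y $ j) * M (x - y) * \<psi> y)"
    by (rule decays_integrable[OF d0]) measurable
  define g' where "g' y = of_real (y $ j) * M (x - y) * \<psi>' l y + - 1 * (of_real (y $ j) * M' l (x - y) * \<psi> y)" for y
  have "poly_growth (\<lambda>y::real^3. - 1 :: complex)"
    unfolding poly_growth_def by (rule exI[of _ 0], rule exI[of _ 1]) simp
  from decays_add[OF d2 decays_mult_poly[OF d1 this]]
  have g'd: "decays g'" unfolding g'_def .
  obtain C where C: "0 \<le> C" "\<And>y. norm (g' y) \<le> C / (1 + norm y) ^ 6" by (rule decays_le[OF g'd, where n = 6]) (rule that)
  define b where "b = (axis l 1 :: real^3)"
  have b1: "norm b = 1" by (simp add: b_def norm_axis_1)
  have axs: "(\<Sum>i\<in>UNIV. b $ i *\<^sub>R a i) = a l" for a :: "3 \<Rightarrow> complex"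
    by (simp add: b_def axis_def if_distrib[of "\<lambda>c. c *\<^sub>R _"] cong: if_cong)
  have axs': "(\<Sum>i\<in>UNIV. (t *\<^sub>R b) $ i *\<^sub>R a i) = t *\<^sub>R a l" for a :: "3 \<Rightarrow> complex" and t
    unfolding axs[of a, symmetric] by (simp add: scaleR_sum_right)
  have "(LINT y|lborel. g' y) = 0"
  proof (rule integral_directional_derivative_zero(2)[OF _ _ _ i0, where b = b and h = "\<lambda>y. (C * 2 ^ 6) * (1 / (1 + norm y) ^ 6)"])
    show "integrable lborel (\<lambda>y::real^3. (C * 2 ^ 6) * (1 / (1 + norm y) ^ 6))"
      by (intro integrable_mult_right integrable_decay6)
    show "norm (g' (y + t *\<^sub>R b)) \<le> (C * 2 ^ 6) * (1 / (1 + norm y) ^ 6)" if "0 \<le> t" "t \<le> 1" for y t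
    proof -
      have "(1 + norm y) ^ 6 \<le> (1 + norm (y + t *\<^sub>R b)) ^ 6 * (1 + norm (- (t *\<^sub>R b))) ^ 6"
        using one_plus_norm_triangle_power[of "y + t *\<^sub>R b" "- (t *\<^sub>R b)" 6] by simp
      also have "\<dots> \<le> (1 + norm (y + t *\<^sub>R b)) ^ 6 * 2 ^ 6"
        using that b1 one_plus_norm_pos[of "y + t *\<^sub>R b" 6] by (intro mult_left_mono power_mono) auto
      finally have le: "(1 + norm y) ^ 6 \<le> (1 + norm (y + t *\<^sub>R b)) ^ 6 * 2 ^ 6" .
      have "1 / (1 + norm (y + t *\<^sub>R b)) ^ 6 \<le> 2 ^ 6 / (1 + norm y) ^ 6"
        by (rule inverse_le_quotient[OF one_plus_norm_pos one_plus_norm_pos le])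
      then have "C * (1 / (1 + norm (y + t *\<^sub>R b)) ^ 6) \<le> C * (2 ^ 6 / (1 + norm y) ^ 6)"
        using C(1) by (rule mult_left_mono)
      then show ?thesis using C(2)[of "y + t *\<^sub>R b"] by simp
    qed
    show "((\<lambda>t. of_real ((y + t *\<^sub>R b) $ j) * M (x - (y + t *\<^sub>R b)) * \<psi> (y + t *\<^sub>R b)) has_vector_derivative g' y) (at 0)" for y
    proof -
      have l1: "((\<lambda>t. y + t *\<^sub>R b) has_derivative (\<lambda>t. t *\<^sub>R b)) (at 0)"
        by (auto intro!: derivative_eq_intros)
      have l2: "((\<lambda>t. x - (y + t *\<^sub>R b)) has_derivative (\<lambda>t. - (t *\<^sub>R b))) (at 0)"
        by (auto intro!: derivative_eq_intros)
      have "(\<psi> has_derivative (\<lambda>h. \<Sum>j\<in>UNIV. h $ j *\<^sub>R \<psi>' j y)) (at (y + 0 *\<^sub>R b))"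
        using D\<psi>[of y] by simp
      from has_derivative_compose[OF l1 this]
      have dp: "((\<lambda>t. \<psi> (y + t *\<^sub>R b)) has_vector_derivative \<psi>' l y) (at 0)"
        unfolding axs' has_vector_derivative_def .
      have "(M has_derivative (\<lambda>h. \<Sum>j\<in>UNIV. h $ j *\<^sub>R M' j (x - y))) (at (x - (y + 0 *\<^sub>R b)))"
        using DM[of "x - y"] by simp
      from has_derivative_compose[OF l2 this]
      have dm: "((\<lambda>t. M (x - (y + t *\<^sub>R b))) has_vector_derivative - M' l (x - y)) (at 0)"
        unfolding scaleR_minus_left[symmetric] axs' has_vector_derivative_def by simp
      have bj: "b $ j = 0" using jl by (simp add: b_def axis_def)
      have "((\<lambda>t. (M (x - (y + t *\<^sub>R b))) * \<psi> (y + t *\<^sub>R b)) has_vector_derivative (M (x - (y + 0 *\<^sub>R b)) * \<psi>' l y + - M' l (x - y) * \<psi> (y + 0 *\<^sub>R b))) (at 0)"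
        by (rule has_vector_derivative_mult[OF dm dp])
      then have "((\<lambda>t. of_real (y $ j) * (M (x - (y + t *\<^sub>R b)) * \<psi> (y + t *\<^sub>R b))) has_vector_derivative of_real (y $ j) * (M (x - (y + 0 *\<^sub>R b)) * \<psi>' l y + - M' l (x - y) * \<psi> (y + 0 *\<^sub>R b))) (at 0)"
        by (rule has_vector_derivative_mult_right)
      then show ?thesis
        by (simp add: bj g'_def algebra_simps)
    qed
  qed
  moreover have "(LINT y|lborel. g' y) = (LINT y|lborel. of_real (y $ j) * M (x - y) * \<psi>' l y) - (LINT y|lborel. of_real (y $ j) * M' l (x - y) * \<psi> y)"
    unfolding g'_def using i1 i2 by simp
  ultimately show "(LINT y|lborel. of_real (y $ j) * M' l (x - y) * \<psi> y) = (LINT y|lborel. of_real (y $ j) * M (x - y) * \<psi>' l y)"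
    by simp
qed

section \<open>Uniform kernel bounds\<close>

lemma inner_frame:
  assumes "orthogonal_transformation Q"
  shows "Q (axis d 1) \<bullet> Q w = (w :: real^3) $ d"
  using assms by (simp add: orthogonal_transformation_def inner_axis inner_commute)

lemma norm_le_frame:
  fixes z :: "real^3" and Q :: "real^3 \<Rightarrow> real^3"
  assumes Q: "orthogonal_transformation Q"
  shows "norm z \<le> (\<Sum>d\<in>UNIV. \<bar>Q (axis d 1) \<bullet> z\<bar>)"
proof -
  obtain w where w: "z = Q w" using orthogonal_transformation_surj[OF Q] by (auto simp: surj_def)
  have "norm z = norm w" using Q w by (simp add: orthogonal_transformation_norm)
  also have "\<dots> \<le> (\<Sum>d\<in>UNIV. \<bar>w $ d\<bar>)" by (rule norm_le_l1_cart)
  finally show ?thesis unfolding w inner_frame[OF Q] .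
qed

text \<open>Crossing with the unit vector \<alpha> preserves inner products with vectors orthogonal
  to \<alpha>.\<close>

lemma inner_le_cross3:
  fixes \<xi> v \<alpha> :: "real^3"
  assumes "norm \<alpha> = 1" "norm v \<le> 1" "v \<bullet> \<alpha> = 0"
  shows "\<bar>\<xi> \<bullet> v\<bar> \<le> norm (cross3 \<xi> \<alpha>)"
proof -
  have "cross3 \<xi> \<alpha> \<bullet> cross3 v \<alpha> = \<xi> \<bullet> v"
    unfolding dot_cross using assms by (simp add: norm_eq_1 inner_commute)
  then have "\<bar>\<xi> \<bullet> v\<bar> \<le> norm (cross3 \<xi> \<alpha>) * norm (cross3 v \<alpha>)"
    using Cauchy_Schwarz_ineq2[of "cross3 \<xi> \<alpha>" "cross3 v \<alpha>"] by simp
  also have "\<dots> \<le> norm (cross3 \<xi> \<alpha>) * 1"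
    using norm_cross3_le[of v \<alpha>] assms by (intro mult_left_mono) auto
  finally show ?thesis by simp
qed

text \<open>Side lengths of the box that carries the symbol. Axis 1 will be aligned with the centre
  of the angular piece.\<close>

definition axes_len :: "int \<Rightarrow> int \<Rightarrow> 3 \<Rightarrow> real" where
  "axes_len k r d = (if d = 1 then 2 powr k else 2 powr k * 2 powr r)"

lemma axes_len_pos: "0 < axes_len k r d"
  by (simp add: axes_len_def)

context angular_setup
begin

text \<open>The frame \<open>Q\<close> is tied to the piece alone, while \<open>e\<close> ranges
  over the support of the physical cut-off; the kernel bounds are wanted for all such
  \<open>e\<close> with the same \<open>Q\<close>.\<close>

definition framed :: "real \<Rightarrow> real^3 \<Rightarrow> int \<Rightarrow> nat \<Rightarrow> real^3 \<Rightarrow> (real^3 \<Rightarrow> real^3) \<Rightarrow> bool" where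
  "framed \<rho> \<beta> r l e Q \<longleftrightarrow> base \<rho> \<beta> \<and> r \<in> scales C1 \<rho> \<and> l \<in> {1..N} \<and> e \<in> supp (ac \<rho> \<beta>) \<and>
     orthogonal_transformation Q \<and> Q (axis 1 1) = \<alpha> \<rho> \<beta> r l"

abbreviation "idx \<rho> \<beta> k r l e Q d \<equiv> Index \<rho> \<beta> k r l e (axes_len k r d *\<^sub>R Q (axis d 1))"

lemma framed_unit: "framed \<rho> \<beta> r l e Q \<Longrightarrow> norm (\<alpha> \<rho> \<beta> r l) = 1"
  using base_whitney(1) by (simp add: framed_def)

lemma scale_le_1: "r \<in> scales C1 \<rho> \<Longrightarrow> 2 powr real_of_int r \<le> 1"
  using powr_mono[of "real_of_int r" 0 2] by (simp add: scales_def)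

text \<open>All three scaled axes are admissible directions of differentiation: the long one is
  parallel to the centre of the piece, and the other two carry the extra factor
  \<open>2 powr r\<close>.\<close>

lemma framed_valid:
  assumes f: "framed \<rho> \<beta> r l e Q"
  shows "valid (idx \<rho> \<beta> k r l e Q d)"
proof -
  have Q: "orthogonal_transformation Q" "Q (axis 1 1) = \<alpha> \<rho> \<beta> r l" using f by (auto simp: framed_def)
  have s1: "2 powr real_of_int r \<le> 1" using scale_le_1 f by (auto simp: framed_def)
  have n: "norm (Q (axis d 1)) = 1" using Q(1) by (simp add: orthogonal_transformation_norm norm_axis_1)
  have "axes_len k r d \<le> 2 powr k"
    using s1 mult_left_mono[of "2 powr real_of_int r" 1 "2 powr real_of_int k"] by (simp add: axes_len_def)
  then have "norm (axes_len k r d *\<^sub>R Q (axis d 1)) \<le> 2 powr k"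
    using axes_len_pos[of k r d] n by simp
  moreover have "norm (cross3 (axes_len k r d *\<^sub>R Q (axis d 1)) (\<alpha> \<rho> \<beta> r l)) \<le> 2 powr k * 2 powr r"
  proof (cases "d = 1")
    case True
    then show ?thesis using Q(2) by (simp add: cross_mult_left)
  next
    case False
    have "norm (cross3 (Q (axis d 1)) (\<alpha> \<rho> \<beta> r l)) \<le> 1"
      using norm_cross3_le[of "Q (axis d 1)" "\<alpha> \<rho> \<beta> r l"] n framed_unit[OF f] by simp
    then show ?thesis using False mult_left_mono[of "norm (cross3 (Q (axis d 1)) (\<alpha> \<rho> \<beta> r l))" 1 "2 powr real_of_int k * 2 powr real_of_int r"]
      by (simp add: axes_len_def cross_mult_left)
  qed
  ultimately show ?thesis using f by (simp add: valid_def framed_def)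
qed

lemma compact_core: "compact (core i)"
proof -
  have "bounded (core i)"
    unfolding bounded_iff core_def by blast
  then show ?thesis using closed_core by (simp add: compact_eq_bounded_closed)
qed

text \<open>In rescaled frame coordinates every coordinate is at most 8 in absolute value: the long
  one since |\<xi>| \<le> 4 * 2^k, the others since they are controlled by |\<xi> x \<alpha>|, which
  is at most 4 * 2^k times 2 * 2^r. Adding three of them gives the radius 24.\<close>

lemma measure_core:
  assumes f: "framed \<rho> \<beta> r l e Q"
  shows "measure lborel (core (idx \<rho> \<beta> k r l e Q d)) \<le> (\<Prod>d\<in>UNIV. axes_len k r d) * measure lborel (cball (0::real^3) 24)"
proof -
  define i where "i = idx \<rho> \<beta> k r l e Q d"
  have Q: "orthogonal_transformation Q" "Q (axis 1 1) = \<alpha> \<rho> \<beta> r l" using f by (auto simp: framed_def)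
  have v: "valid i" unfolding i_def by (rule framed_valid[OF f])
  have cm: "core i \<in> sets borel" using closed_core by (rule borel_closed)
  have sub: "u \<in> cball 0 24" if u: "Q (\<chi> d. axes_len k r d * u $ d) \<in> core i" for u
  proof -
    define \<xi> where "\<xi> = Q (\<chi> d. axes_len k r d * u $ d)"
    have x: "\<xi> \<in> nbhd i" using core_subset[OF v] u by (auto simp: \<xi>_def)
    have n4: "norm \<xi> \<le> 4 * 2 powr k" using u by (simp add: core_def i_def \<xi>_def)
    have cr: "norm (cross3 \<xi> (\<alpha> \<rho> \<beta> r l)) \<le> (4 * 2 powr k) * (2 * 2 powr r)"
    proof -
      have "norm (cross3 (sgn \<xi>) (\<alpha> \<rho> \<beta> r l)) \<le> 2 * 2 powr r"
        using x by (simp add: nbhd_def i_def split: if_splits)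
      then show ?thesis
        using n4 unfolding adapted_frame.cross_sgn[OF frame, of \<xi>] norm_scaleR
        by (intro mult_mono) auto
    qed
    have ud: "\<bar>u $ d\<bar> \<le> 8" for d
    proof -
      have e: "Q (axis d 1) \<bullet> \<xi> = axes_len k r d * u $ d" by (simp add: \<xi>_def inner_frame[OF Q(1)])
      have nq: "norm (Q (axis d 1)) = 1" using Q(1) by (simp add: orthogonal_transformation_norm norm_axis_1)
      have "\<bar>Q (axis d 1) \<bullet> \<xi>\<bar> \<le> axes_len k r d * 8"
      proof (cases "d = 1")
        case True
        have "\<bar>Q (axis d 1) \<bullet> \<xi>\<bar> \<le> norm (Q (axis d 1)) * norm \<xi>" by (rule Cauchy_Schwarz_ineq2)
        then show ?thesis using nq n4 True by (simp add: axes_len_def)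
      next
        case False
        have "Q (axis d 1) \<bullet> \<alpha> \<rho> \<beta> r l = 0"
          unfolding Q(2)[symmetric] inner_frame[OF Q(1)] using False by (simp add: axis_def)
        then have "\<bar>\<xi> \<bullet> Q (axis d 1)\<bar> \<le> norm (cross3 \<xi> (\<alpha> \<rho> \<beta> r l))"
          using nq by (intro inner_le_cross3 framed_unit[OF f]) auto
        then show ?thesis using cr False by (simp add: axes_len_def inner_commute)
      qed
      then have "axes_len k r d * \<bar>u $ d\<bar> \<le> axes_len k r d * 8"
        unfolding e abs_mult using axes_len_pos[of k r d] by simp
      then show ?thesis using axes_len_pos[of k r d] by simp
    qed
    have "norm u \<le> (\<Sum>d\<in>UNIV. \<bar>u $ d\<bar>)" by (rule norm_le_l1_cart)
    also have "\<dots> \<le> 24" unfolding sum_3 using ud[of 1] ud[of 2] ud[of 3] by linarith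
    finally show ?thesis by simp
  qed
  have "emeasure lborel (core i) = (\<integral>\<^sup>+x. indicator (core i) x \<partial>lborel)" using cm by simp
  also have "\<dots> = ennreal (\<Prod>d\<in>UNIV. axes_len k r d) * (\<integral>\<^sup>+u. indicator (core i) (Q (\<chi> d. axes_len k r d * u $ d)) \<partial>lborel)"
    using cm by (intro nn_integral_frame[OF Q(1) axes_len_pos]) simp
  also have "\<dots> \<le> ennreal (\<Prod>d\<in>UNIV. axes_len k r d) * (\<integral>\<^sup>+u. indicator (cball (0::real^3) 24) u \<partial>lborel)"
  proof (intro mult_left_mono nn_integral_mono)
    show "indicator (core i) (Q (\<chi> d. axes_len k r d * u $ d)) \<le> (indicator (cball 0 24) u :: ennreal)" for u
      using sub[of u] by (auto simp: indicator_def)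
  qed simp
  also have "\<dots> = ennreal (\<Prod>d\<in>UNIV. axes_len k r d) * emeasure lborel (cball (0::real^3) 24)" by simp
  also have "\<dots> = ennreal ((\<Prod>d\<in>UNIV. axes_len k r d) * measure lborel (cball (0::real^3) 24))"
    using emeasure_compact_finite[OF compact_cball, of "0::real^3" 24] axes_len_pos[of k r]
    by (simp add: emeasure_eq_ennreal_measure ennreal_mult prod_nonneg less_imp_le less_top[symmetric])
  finally have "emeasure lborel (core i) \<le> ennreal ((\<Prod>d\<in>UNIV. axes_len k r d) * measure lborel (cball (0::real^3) 24))" .
  then have "measure lborel (core i) \<le> (\<Prod>d\<in>UNIV. axes_len k r d) * measure lborel (cball (0::real^3) 24)"
    unfolding measure_def by (intro enn2real_leI) (auto intro!: mult_nonneg_nonneg prod_nonneg less_imp_le[OF axes_len_pos])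
  then show ?thesis by (simp add: i_def)
qed

text \<open>The direction of differentiation is stored in the parameter. The last clause lets one
  and the same function be differentiated along each of the three axes.\<close>

definition symbol_class :: "(index \<Rightarrow> real^3 \<Rightarrow> real) \<Rightarrow> bool" where
  "symbol_class f \<longleftrightarrow> (\<forall>n. bdd_derivs n (\<lambda>i. if valid i then UNIV else {}) fvec f) \<and>
     (\<forall>i. f i \<in> borel_measurable borel) \<and> (\<forall>i \<xi>. valid i \<longrightarrow> \<xi> \<notin> core i \<longrightarrow> f i \<xi> = 0) \<and>
     (\<forall>\<rho> \<beta> k r l e v v'. f (Index \<rho> \<beta> k r l e v) = f (Index \<rho> \<beta> k r l e v'))"

text \<open>The linear factor in front of the kernel is the reserve that later absorbs one factor |x
  - y|.\<close>

definition dominated_kernel :: "(index \<Rightarrow> real^3 \<Rightarrow> real) \<Rightarrow> real \<Rightarrow> bool" where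
  "dominated_kernel f C \<longleftrightarrow> (\<forall>\<rho> \<beta> k r l e Q z. framed \<rho> \<beta> r l e Q \<longrightarrow>
    (1 + (\<Sum>d\<in>UNIV. \<bar>axes_len k r d * (Q (axis d 1) \<bullet> z)\<bar>)) * norm (osc (f (idx \<rho> \<beta> k r l e Q 1)) z) \<le> C * weight (axes_len k r) Q z)"

text \<open>Orders 0 and 8 of decay along the axes are fed into \<open>weight_bound\<close>. The
  volume of the box, the product of the side lengths, becomes the numerator of the weight.\<close>

lemma symbol_class_dominated:
  assumes F: "symbol_class f"
  shows "\<exists>C. dominated_kernel f C"
proof -
  have dec: "\<exists>C. \<forall>i z. valid i \<longrightarrow> \<bar>z \<bullet> fvec i\<bar> ^ n * norm (osc (f i) z) \<le> C * measure lborel (core i)" for n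
    using F by (intro osc_decay compact_core) (auto simp: symbol_class_def)
  obtain C0 where C0: "\<And>i z. valid i \<Longrightarrow> norm (osc (f i) z) \<le> C0 * measure lborel (core i)"
    using dec[of 0] by auto
  obtain C8 where C8: "\<And>i z. valid i \<Longrightarrow> \<bar>z \<bullet> fvec i\<bar> ^ 8 * norm (osc (f i) z) \<le> C8 * measure lborel (core i)"
    using dec[of 8] by auto
  define C where "C = max \<bar>C0\<bar> \<bar>C8\<bar>"
  define V where "V = measure lborel (cball (0::real^3) 24)"
  have "(1 + (\<Sum>d\<in>UNIV. \<bar>axes_len k r d * (Q (axis d 1) \<bullet> z)\<bar>)) * norm (osc (f (idx \<rho> \<beta> k r l e Q 1)) z) \<le> (32 * (C * V)) * weight (axes_len k r) Q z"
    if f: "framed \<rho> \<beta> r l e Q" for \<rho> \<beta> k r l e Q z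
  proof -
    define p where "p = (\<Prod>d\<in>UNIV. axes_len k r d)"
    define N where "N = norm (osc (f (idx \<rho> \<beta> k r l e Q 1)) z)"
    have fd: "f (idx \<rho> \<beta> k r l e Q d) = f (idx \<rho> \<beta> k r l e Q 1)" for d using F by (simp add: symbol_class_def)
    have mc: "D * measure lborel (core (idx \<rho> \<beta> k r l e Q d)) \<le> C * (p * V)" if "D \<le> C" for D d
    proof -
      have "D * measure lborel (core (idx \<rho> \<beta> k r l e Q d)) \<le> C * measure lborel (core (idx \<rho> \<beta> k r l e Q d))"
        using that by (intro mult_right_mono) auto
      also have "\<dots> \<le> C * (p * V)"
        unfolding p_def V_def by (intro mult_left_mono measure_core[OF f]) (simp add: C_def)
      finally show ?thesis .
    qed
    have CC: "C0 \<le> C" "C8 \<le> C" unfolding C_def by linarith+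
    have N0: "N \<le> C * (p * V)"
      using order_trans[OF C0[OF framed_valid[OF f, of k 1], of z] mc[OF CC(1), of 1]] unfolding N_def .
    have N8: "\<bar>axes_len k r d * (Q (axis d 1) \<bullet> z)\<bar> ^ 8 * N \<le> C * (p * V)" for d
    proof -
      have e: "z \<bullet> fvec (idx \<rho> \<beta> k r l e Q d) = axes_len k r d * (Q (axis d 1) \<bullet> z)" by (simp add: inner_commute)
      show ?thesis using order_trans[OF C8[OF framed_valid[OF f, of k d], of z] mc[OF CC(2), of d]] unfolding N_def fd[of d] e .
    qed
    have "(1 + (\<Sum>d\<in>UNIV. \<bar>axes_len k r d * (Q (axis d 1) \<bullet> z)\<bar>)) * N \<le> 32 * (C * (p * V)) * (\<Prod>d\<in>UNIV. 1 / (1 + (axes_len k r d * (Q (axis d 1) \<bullet> z))\<^sup>2))"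
      by (rule weight_bound[OF _ N0 N8]) (simp add: N_def)
    also have "\<dots> = (32 * (C * V)) * (p * (\<Prod>d\<in>UNIV. 1 / (1 + (axes_len k r d * (Q (axis d 1) \<bullet> z))\<^sup>2)))"
      by (simp only: mult_ac)
    also have "p * (\<Prod>d\<in>UNIV. 1 / (1 + (axes_len k r d * (Q (axis d 1) \<bullet> z))\<^sup>2)) = weight (axes_len k r) Q z"
      unfolding weight_def p_def prod.distrib[symmetric] by simp
    finally show ?thesis unfolding N_def .
  qed
  then have "dominated_kernel f (32 * (C * V))"
    unfolding dominated_kernel_def by blast
  then show ?thesis ..
qed

lemma symbol_class_decays:
  assumes F: "symbol_class f" and f: "framed \<rho> \<beta> r l e Q"
  shows "decays (osc (f (idx \<rho> \<beta> k r l e Q 1)))"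
proof (rule decays_of_directions[where b = "\<lambda>d. axes_len k r d *\<^sub>R Q (axis d 1)" and L = "1 / (2 powr k * 2 powr r)"])
  have Q: "orthogonal_transformation Q" and rs: "r \<in> scales C1 \<rho>" using f by (auto simp: framed_def)
  show "norm z \<le> 1 / (2 powr k * 2 powr r) * (\<Sum>d\<in>UNIV. \<bar>z \<bullet> (axes_len k r d *\<^sub>R Q (axis d 1))\<bar>)" for z
  proof -
    have al: "2 powr k * 2 powr r \<le> axes_len k r d" for d
      using scale_le_1[OF rs] mult_left_mono[of "2 powr real_of_int r" 1 "2 powr real_of_int k"] by (simp add: axes_len_def)
    then have "(\<Sum>d\<in>UNIV. (2 powr k * 2 powr r) * \<bar>Q (axis d 1) \<bullet> z\<bar>) \<le> (\<Sum>d\<in>UNIV. \<bar>z \<bullet> (axes_len k r d *\<^sub>R Q (axis d 1))\<bar>)"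
    proof (intro sum_mono)
      fix d
      have "\<bar>z \<bullet> (axes_len k r d *\<^sub>R Q (axis d 1))\<bar> = axes_len k r d * \<bar>Q (axis d 1) \<bullet> z\<bar>"
        by (simp add: abs_mult inner_commute abs_of_pos[OF axes_len_pos])
      then show "(2 powr k * 2 powr r) * \<bar>Q (axis d 1) \<bullet> z\<bar> \<le> \<bar>z \<bullet> (axes_len k r d *\<^sub>R Q (axis d 1))\<bar>"
        using mult_right_mono[OF al[of d], of "\<bar>Q (axis d 1) \<bullet> z\<bar>"] by simp
    qed
    moreover have "(2 powr k * 2 powr r) * norm z \<le> (\<Sum>d\<in>UNIV. (2 powr k * 2 powr r) * \<bar>Q (axis d 1) \<bullet> z\<bar>)"
      unfolding sum_distrib_left[symmetric] by (intro mult_left_mono norm_le_frame[OF Q]) simp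
    ultimately have "norm z * (2 powr k * 2 powr r) \<le> (\<Sum>d\<in>UNIV. \<bar>z \<bullet> (axes_len k r d *\<^sub>R Q (axis d 1))\<bar>)"
      by (simp only: mult.commute)
    then show ?thesis by (simp add: pos_le_divide_eq)
  qed
  fix n :: nat and d
  obtain C where C: "\<And>i z. valid i \<Longrightarrow> \<bar>z \<bullet> fvec i\<bar> ^ n * norm (osc (f i) z) \<le> C * measure lborel (core i)"
    using osc_decay[of valid core n fvec f] compact_core F by (auto simp: symbol_class_def)
  have fd: "f (idx \<rho> \<beta> k r l e Q d) = f (idx \<rho> \<beta> k r l e Q 1)" for d using F by (simp add: symbol_class_def)
  show "\<exists>C. \<forall>z. \<bar>z \<bullet> (axes_len k r d *\<^sub>R Q (axis d 1))\<bar> ^ n * norm (osc (f (idx \<rho> \<beta> k r l e Q 1)) z) \<le> C"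
    using C[OF framed_valid[OF f, of k d]] unfolding fd[of d] by auto
qed

section \<open>Measurability of the symbols and the two radial cut-offs\<close>

lemma chi_measurable[measurable]: "chi \<in> borel_measurable borel"
proof -
  have "Ck_on 0 UNIV chi" using chi_props(1) unfolding smooth_on_def by blast
  then show ?thesis by (simp add: borel_measurable_continuous_onI)
qed

lemma cap_measurable[measurable]: "cap \<sigma> t a \<in> borel_measurable borel"
proof -
  obtain \<tau> where \<tau>: "\<And>n. bdd_derivs n (\<lambda>_::unit. UNIV) (\<lambda>_. 1) (\<lambda>_. \<tau>)" "\<And>t. 0 \<le> t \<Longrightarrow> \<sigma> t = \<tau> (t\<^sup>2)"
    using sigma_profile by blast
  have [measurable]: "\<tau> \<in> borel_measurable borel"
    using bdd_derivs_imp_continuous[OF \<tau>(1)] by (rule borel_measurable_continuous_onI)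
  have [measurable]: "(\<lambda>x::real^3. cross3 x a) \<in> borel_measurable borel"
    by (intro borel_measurable_continuous_onI continuous_on_cross continuous_intros)
  \<comment> \<open>Smoothness of \<sigma> is known only on the positive half-line, so measurability
    is read off from the globally continuous profile.\<close>
  have "cap \<sigma> t a = (\<lambda>x. \<tau> ((2 powr (- t) * norm (cross3 (sgn x) a))\<^sup>2))"
    unfolding cap_def by (simp add: fun_eq_iff \<tau>(2))
  also have "\<dots> \<in> borel_measurable borel"
    unfolding sgn_div_norm by measurable
  finally show ?thesis .
qed

lemma eta_measurable[measurable]: "\<eta> \<rho> \<beta> r l \<in> borel_measurable borel"
  unfolding eta_def[abs_def] eta_tilde_sum_def eta_tilde_def by measurable

lemma ac_measurable[measurable]: "ac \<rho> \<beta> \<in> borel_measurable borel"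
  unfolding angular_cutoff_def[abs_def] by measurable

lemma fat_measurable[measurable]: "fat_cutoff chi k \<in> borel_measurable borel"
  unfolding fat_cutoff_def[abs_def] by measurable

lemma dyadic_measurable[measurable]: "dyadic_cutoff chi k \<in> borel_measurable borel"
  unfolding dyadic_cutoff_def[abs_def] by measurable

lemma mult0_measurable[measurable]: "mult0 i j \<in> borel_measurable borel"
proof -
  have "(\<lambda>x. cross3 (dir i) x $ j) \<in> borel_measurable borel"
    by (intro borel_measurable_continuous_onI continuous_on_component continuous_on_cross continuous_intros)
  moreover have "(\<lambda>x. norm (cross3 (dir i) x)) \<in> borel_measurable borel"
    by (intro borel_measurable_continuous_onI continuous_on_norm continuous_on_cross continuous_intros)
  ultimately show ?thesis
    unfolding mult0_def[abs_def]
    by (intro borel_measurable_times borel_measurable_divide borel_measurable_const borel_measurable_power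
        eta_measurable fat_measurable)
qed

lemma symbol_class_mult0: "symbol_class (\<lambda>i. mult0 i j)"
  unfolding symbol_class_def
proof (intro conjI allI impI)
  show "mult0 i j \<xi> = 0" if "valid i" "\<xi> \<notin> core i" for i \<xi>
    using that(2) by (rule mult0_zero)
  show "mult0 (Index \<rho> \<beta> k r l e v) j = mult0 (Index \<rho> \<beta> k r l e v') j" for \<rho> \<beta> k r l e v v'
    unfolding mult0_def[abs_def] index.sel ..
qed (rule bdd_derivs_mult0 mult0_measurable)+

lemma symbol_class_mult1: "symbol_class (\<lambda>i \<xi>. \<xi> $ m / \<kappa> i * mult0 i j \<xi>)"
  unfolding symbol_class_def
proof (intro conjI allI impI)
  show "\<xi> $ m / \<kappa> i * mult0 i j \<xi> = 0" if "valid i" "\<xi> \<notin> core i" for i \<xi>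
    using mult0_zero[OF that(2)] by simp
  show "(\<lambda>\<xi>. \<xi> $ m / \<kappa> (Index \<rho> \<beta> k r l e v) * mult0 (Index \<rho> \<beta> k r l e v) j \<xi>) =
      (\<lambda>\<xi>. \<xi> $ m / \<kappa> (Index \<rho> \<beta> k r l e v') * mult0 (Index \<rho> \<beta> k r l e v') j \<xi>)" for \<rho> \<beta> k r l e v v'
    unfolding mult0_def[abs_def] index.sel ..
  show "(\<lambda>\<xi>. \<xi> $ m / \<kappa> i * mult0 i j \<xi>) \<in> borel_measurable borel" for i
    by measurable
qed (rule bdd_derivs_mult1)

definition annulus :: "int \<Rightarrow> (real^3) set" where
  "annulus k = {\<xi>. 2 powr k / 2 \<le> norm \<xi> \<and> norm \<xi> \<le> 2 * 2 powr k}"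

lemma dyadic_eq: "dyadic_cutoff chi k \<xi> = chi ((1 / 2 powr k) *\<^sub>R \<xi>) - chi ((2 / 2 powr k) *\<^sub>R \<xi>)"
proof -
  have "2 powr (- (real_of_int k - 1)) = 2 / 2 powr real_of_int k"
    using powr_diff[of 2 1 "real_of_int k"] by simp
  moreover have "2 powr (- real_of_int k) = 1 / 2 powr real_of_int k" by (rule powr_minus_divide)
  ultimately show ?thesis unfolding dyadic_cutoff_def by simp
qed

lemma dyadic_zero:
  assumes "\<xi> \<notin> annulus k"
  shows "dyadic_cutoff chi k \<xi> = 0"
proof -
  define K where "K = 2 powr real_of_int k"
  have K: "0 < K" by (simp add: K_def)
  have "norm \<xi> < K / 2 \<or> 2 * K < norm \<xi>" using assms by (auto simp: annulus_def K_def not_le)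
  then show ?thesis
  proof
    assume "norm \<xi> < K / 2"
    then have "1 * norm \<xi> / K \<le> 1" "2 * norm \<xi> / K \<le> 1"
      using K norm_ge_zero[of \<xi>] unfolding pos_divide_le_eq[OF K] by linarith+
    then show ?thesis unfolding dyadic_eq K_def[symmetric] using K by (simp add: chi_one)
  next
    assume "2 * K < norm \<xi>"
    then have "2 < 1 * norm \<xi> / K" "2 < 2 * norm \<xi> / K"
      using K unfolding pos_less_divide_eq[OF K] by linarith+
    then show ?thesis unfolding dyadic_eq K_def[symmetric] using K by (simp add: chi_zero)
  qed
qed

lemma fat_one:
  assumes "\<xi> \<in> annulus k"
  shows "fat_cutoff chi k \<xi> = 1"
proof -
  define K where "K = 2 powr real_of_int k"
  have K: "0 < K" by (simp add: K_def)
  have n: "K / 2 \<le> norm \<xi>" "norm \<xi> \<le> 2 * K" using assms by (auto simp: annulus_def K_def)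
  have 1: "chi ((1 / (2 * K)) *\<^sub>R \<xi>) = 1"
    using n K by (intro chi_one) (simp add: pos_divide_le_eq)
  \<comment> \<open>On the inner sphere of the annulus the argument has length exactly 2. There
    \<open>chi\<close> vanishes by continuity from outside the ball, hence the approximation by
    slightly longer vectors.\<close>
  have 2: "chi ((4 / K) *\<^sub>R \<xi>) = 0"
  proof -
    have "2 \<le> norm ((4 / K) *\<^sub>R \<xi>)" using n K by (simp add: pos_le_divide_eq)
    have cont: "continuous_on UNIV chi"
      using chi_props(1) unfolding smooth_on_def by (metis Ck_on.simps(1))
    define y where "y = (4 / K) *\<^sub>R \<xi>"
    have "(\<lambda>n. chi ((1 + 1 / real (Suc n)) *\<^sub>R y)) \<longlonglongrightarrow> chi ((1 + 0) *\<^sub>R y)"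
    proof (rule isCont_tendsto_compose[of _ chi])
      show "isCont chi ((1 + 0) *\<^sub>R y)" using cont by (simp add: continuous_on_eq_continuous_at)
      have "(\<lambda>n. 1 / real (Suc n)) \<longlonglongrightarrow> 0" using LIMSEQ_inverse_real_of_nat by (simp add: inverse_eq_divide)
      then show "(\<lambda>n. (1 + 1 / real (Suc n)) *\<^sub>R y) \<longlonglongrightarrow> (1 + 0) *\<^sub>R y" by (intro tendsto_intros)
    qed
    moreover have "chi ((1 + t) *\<^sub>R y) = 0" if "0 < t" for t
    proof (rule chi_zero)
      have "2 \<le> norm y" unfolding y_def by fact
      have "2 < (1 + t) * 2" using that by simp
      also have "\<dots> \<le> (1 + t) * norm y"
        using \<open>2 \<le> norm y\<close> that by (intro mult_left_mono) auto
      finally show "2 < norm ((1 + t) *\<^sub>R y)" using that by simp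
    qed
    then have "chi ((1 + 1 / real (Suc n)) *\<^sub>R y) = 0" for n by simp
    ultimately have "(\<lambda>n::nat. 0) \<longlonglongrightarrow> chi y" by simp
    then have "chi y = 0" using LIMSEQ_unique tendsto_const by blast
    then show ?thesis by (simp add: y_def)
  qed
  show ?thesis
    unfolding fat_cutoff_def powr_neg_shift K_def[symmetric] using 1 2 by simp
qed

end

lemma kern_has_derivative:
  assumes "f \<in> borel_measurable borel" "\<And>x. \<bar>f x\<bar> \<le> C" "\<And>x. x \<notin> B \<Longrightarrow> f x = 0" "compact B"
  shows "(kern f has_derivative (\<lambda>h. \<Sum>j\<in>UNIV. h $ j *\<^sub>R (\<i> * kern (\<lambda>\<xi>. \<xi> $ j * f \<xi>) z))) (at z)"
proof -
  define c where "c = 1 / complex_of_real ((2 * pi) ^ 3)"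
  have k: "kern g = (\<lambda>z. osc g z * c)" for g by (simp add: kern_def c_def fun_eq_iff)
  have "((\<lambda>z. osc f z * c) has_derivative (\<lambda>h. (\<Sum>j\<in>UNIV. h $ j *\<^sub>R (\<i> * osc (\<lambda>\<xi>. \<xi> $ j * f \<xi>) z)) * c)) (at z)"
    by (rule has_derivative_mult_left[OF osc_has_derivative[OF assms]])
  then show ?thesis unfolding k by (simp add: sum_distrib_right mult.assoc)
qed

lemma kern_continuous:
  assumes "f \<in> borel_measurable borel" "\<And>x. \<bar>f x\<bar> \<le> C" "\<And>x. x \<notin> B \<Longrightarrow> f x = 0" "compact B"
  shows "kern f \<in> borel_measurable borel"
proof (rule borel_measurable_continuous_onI)
  show "continuous_on UNIV (kern f)"
    using has_derivative_continuous[OF kern_has_derivative[OF assms]] by (simp add: continuous_on_eq_continuous_at)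
qed

lemma norm_kern_le: "norm (kern f z) \<le> norm (osc f z)"
proof -
  have "1 \<le> (2 * pi) ^ 3" using pi_gt3 by (intro one_le_power) auto
  then have "norm (osc f z) / (2 * pi) ^ 3 \<le> norm (osc f z) / 1"
    by (intro divide_left_mono) auto
  then show ?thesis by (simp add: kern_def norm_divide norm_power norm_mult)
qed

lemma decays_kern: "decays (osc f) \<Longrightarrow> decays (kern f)"
  by (erule decays_dominated[where K = 1 and M = 0]) (simp_all add: norm_kern_le)

lemma decays_cmult:
  fixes u :: "'a::real_normed_vector \<Rightarrow> 'b::real_normed_field"
  assumes "decays u"
  shows "decays (\<lambda>z. c * u z)"
  by (rule decays_dominated[OF assms, where K = "norm c" and M = 0]) (simp_all add: norm_mult)

lemma kern_scale: "kern (\<lambda>\<xi>. c * f \<xi>) z = of_real c * kern f z"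
  unfolding kern_def osc_def by (simp add: mult.assoc)

lemma tconv_measurable:
  assumes [measurable]: "\<phi> \<in> borel_measurable borel" "K \<in> borel_measurable borel"
  shows "tconv \<phi> K \<in> borel_measurable borel"
proof -
  have "(\<lambda>(x, y). x - y) \<in> borel_measurable (borel \<Otimes>\<^sub>M (borel :: (real^3) measure))"
    by measurable
  then have "(\<lambda>(x, y). K (x - y)) \<in> borel_measurable (borel \<Otimes>\<^sub>M lborel)"
    using measurable_compose[OF _ assms(2), of "\<lambda>(x, y). x - y" "borel \<Otimes>\<^sub>M borel"] by (simp add: split_beta')
  then have "(\<lambda>(x, y). \<phi> y * K (x - y)) \<in> borel_measurable (borel \<Otimes>\<^sub>M lborel)"
    by measurable
  then show ?thesis
    unfolding tconv_def[abs_def] by (rule lborel.borel_measurable_lebesgue_integral)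
qed

lemma ennreal_norm_integral_le:
  fixes f :: "'a \<Rightarrow> complex"
  shows "ennreal (norm (LINT x|M. f x)) \<le> (\<integral>\<^sup>+x. ennreal (norm (f x)) \<partial>M)"
  by (cases "integrable M f") (auto simp: not_integrable_integral_eq intro: integral_norm_bound_ennreal)

text \<open>\<open>ca n\<close> and \<open>cb n\<close> are the two coordinates that follow n in
  cyclic order, which makes every component of a cross product the same expression.\<close>

definition ca :: "3 \<Rightarrow> 3" where "ca n = (if n = 1 then 2 else if n = 2 then 3 else 1)"
definition cb :: "3 \<Rightarrow> 3" where "cb n = (if n = 1 then 3 else if n = 2 then 1 else 2)"

lemma ca_neq_cb: "ca n \<noteq> cb n" "cb n \<noteq> ca n"
  using exhaust_3[of n] by (auto simp: ca_def cb_def)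

lemma cross3_component: "cross3 x y $ n = x $ ca n * y $ cb n - x $ cb n * y $ ca n"
  using exhaust_3[of n] by (auto simp: ca_def cb_def cross_components)

section \<open>Kernels of the frequency cut-off and derivatives of the frequency piece\<close>

context angular_setup
begin

lemma dyadic_bounded: "\<exists>C. \<forall>k \<xi>. \<bar>dyadic_cutoff chi k \<xi>\<bar> \<le> C"
proof -
  obtain \<tau> where \<tau>: "\<And>n. bdd_derivs n (\<lambda>_::unit. UNIV) (\<lambda>_. 1) (\<lambda>_. \<tau>)" "\<And>\<xi>. chi \<xi> = \<tau> ((norm \<xi>)\<^sup>2)"
    using smooth_radial_profile[OF chi_props(1,3,4,5)] by blast
  obtain C where C: "\<And>t. \<bar>\<tau> t\<bar> \<le> C" using bdd_derivs_bounded[OF \<tau>(1)[of 0]] by auto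
  have "\<bar>dyadic_cutoff chi k \<xi>\<bar> \<le> C + C" for k \<xi>
    unfolding dyadic_cutoff_def \<tau>(2)
    by (rule order_trans[OF abs_triangle_ineq4]) (intro add_mono C)
  then show ?thesis by blast
qed

lemma compact_annulus: "compact (annulus k)"
proof -
  have "closed (annulus k)" unfolding annulus_def by (intro closed_Collect_conj closed_Collect_le continuous_intros)
  moreover have "bounded (annulus k)" unfolding annulus_def bounded_iff by blast
  ultimately show ?thesis by (simp add: compact_eq_bounded_closed)
qed

text \<open>The parameter \<open>d\<close> only names the coordinate direction along which
  derivatives are taken. At angular scale 1 a sector is a full shell, so the calculus for sectors
  also covers the radial cut-offs.\<close>

definition shell :: "int \<Rightarrow> 3 \<Rightarrow> (real^3) set" where
  "shell k d = {\<xi>. 2 powr k / 8 < norm \<xi> \<and> norm \<xi> < 8 * 2 powr k}"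

definition coord :: "int \<Rightarrow> 3 \<Rightarrow> real^3" where
  "coord k d = 2 powr k *\<^sub>R axis d 1"

lemma shell_frame: "adapted_frame (shell k) (coord k) (\<lambda>_. axis 1 1) (\<lambda>_. 1) (\<lambda>_. 2 powr k) 2"
proof
  show "open (shell k d)" for d
    unfolding shell_def by (intro open_Collect_conj open_Collect_less continuous_intros)
  have n: "norm (coord k d) = 2 powr k" for d by (simp add: coord_def norm_axis_1)
  show "norm (coord k d) \<le> 2 powr k" for d using n by simp
  show "norm (cross3 (coord k d) (axis 1 1)) \<le> 2 powr k * 1" for d
    using norm_cross3_le[of "coord k d" "axis 1 1"] n[of d] by (simp add: norm_axis_1)
  show "norm (cross3 (sgn \<xi>) (axis 1 1)) \<le> 2 * 1" for \<xi> :: "real^3"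
  proof -
    have "norm (sgn \<xi>) \<le> 1" by (simp add: norm_sgn)
    then show ?thesis using norm_cross3_le[of "sgn \<xi>" "axis 1 1"] by (simp add: norm_axis_1)
  qed
qed (auto simp: shell_def norm_axis_1)

lemma bdd_derivs_dyadic: "bdd_derivs n (shell k) (coord k) (\<lambda>_. dyadic_cutoff chi k)"
proof -
  obtain \<tau> where \<tau>: "\<And>n. bdd_derivs n (\<lambda>_::unit. UNIV) (\<lambda>_. 1) (\<lambda>_. \<tau>)" "\<And>\<xi>. chi \<xi> = \<tau> ((norm \<xi>)\<^sup>2)"
    using smooth_radial_profile[OF chi_props(1,3,4,5)] by blast
  have "bdd_derivs n (shell k) (coord k) (\<lambda>_ \<xi>. chi ((1 / 2 powr k) *\<^sub>R \<xi>))" "bdd_derivs n (shell k) (coord k) (\<lambda>_ \<xi>. chi ((2 / 2 powr k) *\<^sub>R \<xi>))"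
    by (rule adapted_frame.bdd_derivs_radial[OF shell_frame \<tau>, where C = 2], simp)+
  then show ?thesis
    unfolding dyadic_eq by (rule bdd_derivs_diff)
qed

lemma bdd_derivs_comp: "bdd_derivs n (shell k) (coord k) (\<lambda>_ \<xi>. \<xi> $ j)"
proof (rule bdd_derivs_linear)
  show "linear (\<lambda>\<xi>::real^3. \<xi> $ j)" by (rule linearI) simp_all
  show "\<bar>\<xi> $ j\<bar> \<le> 8 * 2 powr k" if "\<xi> \<in> shell k d" for \<xi> d
    using that component_le_norm_cart[of \<xi> j] by (simp add: shell_def)
  show "\<bar>coord k d $ j\<bar> \<le> 2 powr k" for d
    using component_le_norm_cart[of "coord k d" j] by (simp add: coord_def norm_axis_1)
qed

text \<open>Used for \<open>g\<close> equal to 1, a coordinate, or a product of two coordinates: up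
  to powers of i these are the symbols of the cut-off and of its first and second
  derivatives.\<close>

lemma lp_symbol:
  fixes g :: "real^3 \<Rightarrow> real"
  assumes g: "\<And>n. bdd_derivs n (shell k) (coord k) (\<lambda>_. g)" and gm[measurable]: "g \<in> borel_measurable borel"
  shows "decays (osc (\<lambda>\<xi>. g \<xi> * dyadic_cutoff chi k \<xi>))" "\<exists>C. \<forall>\<xi>. \<bar>g \<xi> * dyadic_cutoff chi k \<xi>\<bar> \<le> C"
    "(\<lambda>\<xi>. g \<xi> * dyadic_cutoff chi k \<xi>) \<in> borel_measurable borel"
proof -
  define f where "f \<xi> = g \<xi> * dyadic_cutoff chi k \<xi>" for \<xi>
  have fm: "f \<in> borel_measurable borel" unfolding f_def by measurable
  then show "(\<lambda>\<xi>. g \<xi> * dyadic_cutoff chi k \<xi>) \<in> borel_measurable borel" by (simp add: f_def[abs_def])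
  have f0: "f \<xi> = 0" if "\<xi> \<notin> annulus k" for \<xi> using dyadic_zero[OF that] by (simp add: f_def)
  have sub: "annulus k \<subseteq> shell k d" for d
  proof
    fix \<xi> assume "\<xi> \<in> annulus k"
    then have "2 powr k / 2 \<le> norm \<xi>" "norm \<xi> \<le> 2 * 2 powr k" by (auto simp: annulus_def)
    moreover have "0 < 2 powr real_of_int k" by simp
    ultimately have "2 powr k / 8 < norm \<xi>" "norm \<xi> < 8 * 2 powr k" by linarith+
    then show "\<xi> \<in> shell k d" by (simp add: shell_def)
  qed
  have bd: "bdd_derivs n (\<lambda>i. if True then UNIV else {}) (coord k) (\<lambda>_. f)" for n
  proof (rule bdd_derivs_subset[OF bdd_derivs_Un])
    show "open (shell k i)" for i by (rule adapted_frame.open_V[OF shell_frame])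
    show "open (- annulus k)" using compact_annulus by (intro open_Compl compact_imp_closed)
    show "bdd_derivs n (shell k) (coord k) (\<lambda>_. f)"
      unfolding f_def by (intro bdd_derivs_mult g bdd_derivs_dyadic)
    show "bdd_derivs n (\<lambda>i. - annulus k) (coord k) (\<lambda>_. f)"
      by (rule bdd_derivs_cong[where f = "\<lambda>_ _. 0"])
         (auto simp: f0 intro: bdd_derivs_const[where C = 0] open_Compl compact_imp_closed[OF compact_annulus])
    show "(if True then UNIV else {}) \<subseteq> shell k i \<union> - annulus k" for i
      using sub[of i] by auto
  qed
  show "\<exists>C. \<forall>\<xi>. \<bar>g \<xi> * dyadic_cutoff chi k \<xi>\<bar> \<le> C"
    using bdd_derivs_bounded[OF bd[of 0]] by (auto simp: f_def)
  have "decays (osc f)"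
  proof (rule decays_of_directions[where b = "coord k" and L = "1 / 2 powr k"])
    show "norm z \<le> 1 / 2 powr k * (\<Sum>d\<in>UNIV. \<bar>z \<bullet> coord k d\<bar>)" for z
    proof -
      have "(\<Sum>d\<in>UNIV. \<bar>z \<bullet> coord k d\<bar>) = 2 powr k * (\<Sum>d\<in>UNIV. \<bar>z $ d\<bar>)"
        by (simp add: coord_def inner_axis abs_mult sum_distrib_left)
      then show ?thesis using norm_le_l1_cart[of z] by simp
    qed
    show "\<exists>C. \<forall>z. \<bar>z \<bullet> coord k d\<bar> ^ n * norm (osc f z) \<le> C" for n d
      using osc_decay[of "\<lambda>_. True" "\<lambda>_. annulus k", OF compact_annulus bd fm f0, of n] by blast
  qed
  then show "decays (osc (\<lambda>\<xi>. g \<xi> * dyadic_cutoff chi k \<xi>))" by (simp add: f_def[abs_def])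
qed

abbreviation "lpc k \<equiv> dyadic_cutoff chi k"
abbreviation "lpc1 k j \<equiv> (\<lambda>\<xi>. \<xi> $ j * dyadic_cutoff chi k \<xi>)"

lemma cut_facts:
  "decays (kern (lpc k))" "decays (kern (lpc1 k j))" "decays (kern (\<lambda>\<xi>. \<xi> $ l * lpc1 k j \<xi>))"
  "kern (lpc k) \<in> borel_measurable borel" "kern (lpc1 k j) \<in> borel_measurable borel"
  "(kern (lpc k) has_derivative (\<lambda>h. \<Sum>j\<in>UNIV. h $ j *\<^sub>R (\<i> * kern (lpc1 k j) z))) (at z)"
  "(kern (lpc1 k j) has_derivative (\<lambda>h. \<Sum>l\<in>UNIV. h $ l *\<^sub>R (\<i> * kern (\<lambda>\<xi>. \<xi> $ l * lpc1 k j \<xi>) z))) (at z)"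
  "decays (osc (lpc k))" "osc (lpc k) \<in> borel_measurable borel"
proof -
  have one: "bdd_derivs n (shell k) (coord k) (\<lambda>_ _. 1)" for n by (rule bdd_derivs_const[where C = 1]) simp
  note L0 = lp_symbol[OF one, unfolded mult_1, simplified]
  note L1 = lp_symbol[OF bdd_derivs_comp, of j k]
  have two: "bdd_derivs n (shell k) (coord k) (\<lambda>_ \<xi>. \<xi> $ l * \<xi> $ j)" for n
    by (intro bdd_derivs_mult bdd_derivs_comp)
  note L2 = lp_symbol[OF two, unfolded mult.assoc]
  have m1: "(\<lambda>\<xi>::real^3. \<xi> $ j) \<in> borel_measurable borel" "(\<lambda>\<xi>::real^3. \<xi> $ l * \<xi> $ j) \<in> borel_measurable borel" by measurable
  show d0: "decays (osc (lpc k))" using L0(1) by simp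
  then show "decays (kern (lpc k))" by (rule decays_kern)
  show "decays (kern (lpc1 k j))" using L1(1)[OF m1(1)] by (rule decays_kern)
  show "decays (kern (\<lambda>\<xi>. \<xi> $ l * lpc1 k j \<xi>))" using L2(1)[OF m1(2)] by (rule decays_kern)
  obtain C0 where C0: "\<And>\<xi>. \<bar>lpc k \<xi>\<bar> \<le> C0" using dyadic_bounded by blast
  obtain C1 where C1: "\<And>\<xi>. \<bar>lpc1 k j \<xi>\<bar> \<le> C1" using L1(2)[OF m1(1)] by blast
  have z1: "lpc1 k j \<xi> = 0" if "\<xi> \<notin> annulus k" for \<xi> using dyadic_zero[OF that] by simp
  note c0 = dyadic_measurable C0 dyadic_zero compact_annulus[of k]
  note c1 = L1(3)[OF m1(1)] C1 z1 compact_annulus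
  show "kern (lpc k) \<in> borel_measurable borel" by (rule kern_continuous[OF c0])
  show "kern (lpc1 k j) \<in> borel_measurable borel" by (rule kern_continuous[OF c1])
  show "(kern (lpc k) has_derivative (\<lambda>h. \<Sum>j\<in>UNIV. h $ j *\<^sub>R (\<i> * kern (lpc1 k j) z))) (at z)"
    by (rule kern_has_derivative[OF c0])
  show "(kern (lpc1 k j) has_derivative (\<lambda>h. \<Sum>l\<in>UNIV. h $ l *\<^sub>R (\<i> * kern (\<lambda>\<xi>. \<xi> $ l * lpc1 k j \<xi>) z))) (at z)"
    by (rule kern_has_derivative[OF c1])
  have "continuous_on UNIV (osc (lpc k))"
    using has_derivative_continuous[OF osc_has_derivative[OF c0]] by (simp add: continuous_on_eq_continuous_at)
  then show "osc (lpc k) \<in> borel_measurable borel" by (rule borel_measurable_continuous_onI)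
qed

text \<open>The partial derivatives of the frequency piece, given as convolutions in their own
  right, so that growth and measurability come from the general results on
  \<open>tconv\<close>.\<close>

definition dlp :: "int \<Rightarrow> (real^3 \<Rightarrow> complex) \<Rightarrow> 3 \<Rightarrow> real^3 \<Rightarrow> complex" where
  "dlp k \<phi> j = tconv \<phi> (\<lambda>z. \<i> * kern (lpc1 k j) z)"

lemma LP_eq: "LP chi k \<phi> = tconv \<phi> (kern (lpc k))"
  by (simp add: fun_eq_iff fourier_mult_eq_tconv)

lemma LP_facts:
  assumes \<phi>: "tempered_fun \<phi>"
  shows "poly_growth (LP chi k \<phi>)" "LP chi k \<phi> \<in> borel_measurable borel" "poly_growth (dlp k \<phi> j)" "dlp k \<phi> j \<in> borel_measurable borel"
    "(LP chi k \<phi> has_derivative (\<lambda>h. \<Sum>j\<in>UNIV. h $ j *\<^sub>R dlp k \<phi> j x)) (at x)"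
    "Omega i j (LP chi k \<phi>) x = of_real (x $ i) * dlp k \<phi> j x - of_real (x $ j) * dlp k \<phi> i x"
proof -
  have m: "\<phi> \<in> borel_measurable borel" using \<phi> by (simp add: tempered_fun_def)
  have d1: "decays (\<lambda>z. \<i> * kern (lpc1 k j) z)" for j by (intro decays_cmult cut_facts)
  have m1: "(\<lambda>z. \<i> * kern (lpc1 k j) z) \<in> borel_measurable borel" for j
    using cut_facts(5) by (intro borel_measurable_times borel_measurable_const)
  have d2: "decays (\<lambda>z. \<i> * (\<i> * kern (\<lambda>\<xi>. \<xi> $ l * lpc1 k j \<xi>) z))" for j l by (intro decays_cmult cut_facts)
  have D2: "((\<lambda>z. \<i> * kern (lpc1 k j) z) has_derivative (\<lambda>h. \<Sum>l\<in>UNIV. h $ l *\<^sub>R (\<i> * (\<i> * kern (\<lambda>\<xi>. \<xi> $ l * lpc1 k j \<xi>) z)))) (at z)" for j z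
  proof -
    have "((\<lambda>z. \<i> * kern (lpc1 k j) z) has_derivative (\<lambda>h. \<i> * (\<Sum>l\<in>UNIV. h $ l *\<^sub>R (\<i> * kern (\<lambda>\<xi>. \<xi> $ l * lpc1 k j \<xi>) z)))) (at z)"
      by (rule has_derivative_mult_right[OF cut_facts(7)])
    then show ?thesis by (simp add: sum_distrib_left)
  qed
  show "poly_growth (LP chi k \<phi>)" unfolding LP_eq by (rule tconv_poly_growth[OF \<phi> cut_facts(1,4)])
  show "LP chi k \<phi> \<in> borel_measurable borel" unfolding LP_eq by (rule tconv_measurable[OF m cut_facts(4)])
  show "poly_growth (dlp k \<phi> j)" unfolding dlp_def by (rule tconv_poly_growth[OF \<phi> d1 m1])
  show "dlp k \<phi> j \<in> borel_measurable borel" unfolding dlp_def by (rule tconv_measurable[OF m m1])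
  show D: "(LP chi k \<phi> has_derivative (\<lambda>h. \<Sum>j\<in>UNIV. h $ j *\<^sub>R dlp k \<phi> j x)) (at x)" for x
    unfolding LP_eq dlp_def by (rule tconv_has_derivative[OF \<phi> cut_facts(1,4) d1 m1 d2 cut_facts(6) D2])
  have "partial j (LP chi k \<phi>) x = dlp k \<phi> j x" for j
    unfolding partial_def frechet_derivative_at[OF D, symmetric]
    by (simp add: axis_def if_distrib[of "\<lambda>c. c *\<^sub>R _"] cong: if_cong)
  then show "Omega i j (LP chi k \<phi>) x = of_real (x $ i) * dlp k \<phi> j x - of_real (x $ j) * dlp k \<phi> i x"
    by (simp add: Omega_def)
qed

text \<open>The vector field points along dir x \<xi> and is divided by its squared length, so the
  pairing restores the localised piece. On the core the cross product is nonzero by the angular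
  separation; off the core both sides vanish.\<close>

lemma mult0_sum:
  assumes v: "valid i"
  shows "(\<Sum>n\<in>UNIV. cross3 (dir i) \<xi> $ n * mult0 i n \<xi>) =
    s i * \<kappa> i * (\<eta> (rho i) (beta i) (scl i) (pos i) \<xi> * fat_cutoff chi (freq i) \<xi>)"
proof (cases "\<xi> \<in> core i")
  case True
  then have "\<xi> \<in> nbhd i" using core_subset[OF v] by blast
  then have "s i / (2 * A) < norm (cross3 (dir i) (sgn \<xi>))" by (simp add: nbhd_def split: if_splits)
  moreover have "0 < s i / (2 * A)" using params(8) by simp
  ultimately have "cross3 (dir i) (sgn \<xi>) \<noteq> 0" by auto
  then have nz: "cross3 (dir i) \<xi> \<noteq> 0"
    by (simp add: sgn_div_norm cross_mult_right)
  define W where "W = (norm (cross3 (dir i) \<xi>))\<^sup>2"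
  define G where "G = s i * \<kappa> i * (\<eta> (rho i) (beta i) (scl i) (pos i) \<xi> * fat_cutoff chi (freq i) \<xi>)"
  have W: "W \<noteq> 0" using nz by (simp add: W_def)
  have "(\<Sum>n\<in>UNIV. cross3 (dir i) \<xi> $ n * mult0 i n \<xi>) = (\<Sum>n\<in>UNIV. (cross3 (dir i) \<xi> $ n)\<^sup>2 * (G / W))"
    unfolding mult0_def G_def W_def by (intro sum.cong) (simp_all add: power2_eq_square)
  also have "\<dots> = W * (G / W)"
    unfolding sum_distrib_right[symmetric] sum_components_power2 W_def ..
  finally show ?thesis using W by (simp add: G_def)
next
  case False
  then show ?thesis using eta_fat_zero[OF False] mult0_zero[OF False] by simp
qed

end

section \<open>Representation and domination of the kernel of the angular piece\<close>

lemma kern_sum: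
  assumes "\<And>n. integrable lborel (f n)"
  shows "kern (\<lambda>\<xi>. \<Sum>n\<in>(UNIV :: 3 set). f n \<xi>) z = (\<Sum>n\<in>UNIV. kern (f n) z)"
proof -
  have "osc (\<lambda>\<xi>. \<Sum>n\<in>(UNIV :: 3 set). f n \<xi>) z = (LINT \<xi>|lborel. (\<Sum>n\<in>UNIV. of_real (f n \<xi>) * cis (z \<bullet> \<xi>)))"
    unfolding osc_def by (simp add: sum_distrib_right)
  also have "\<dots> = (\<Sum>n\<in>UNIV. osc (f n) z)"
    unfolding osc_def using osc_integrable[OF assms] by (intro Bochner_Integration.integral_sum)
  finally show ?thesis by (simp add: kern_def sum_divide_distrib)
qed

lemma kern_linear2:
  assumes "integrable lborel f" "integrable lborel g"
  shows "kern (\<lambda>\<xi>. a * f \<xi> - b * g \<xi>) z = of_real a * kern f z - of_real b * kern g z"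
proof -
  have "osc (\<lambda>\<xi>. a * f \<xi> - b * g \<xi>) z = (LINT \<xi>|lborel. of_real a * (of_real (f \<xi>) * cis (z \<bullet> \<xi>)) - of_real b * (of_real (g \<xi>) * cis (z \<bullet> \<xi>)))"
    unfolding osc_def by (intro Bochner_Integration.integral_cong) (simp_all add: algebra_simps)
  also have "\<dots> = of_real a * osc f z - of_real b * osc g z"
    unfolding osc_def using osc_integrable[OF assms(1), of z] osc_integrable[OF assms(2), of z] by simp
  finally show ?thesis by (simp add: kern_def diff_divide_distrib)
qed

lemma decays_diff:
  fixes u v :: "'a::real_normed_vector \<Rightarrow> 'b::real_normed_field"
  assumes "decays u" "decays v" shows "decays (\<lambda>y. u y - v y)"
  using decays_add[OF assms(1) decays_cmult[OF assms(2), of "- 1"]] by simp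

context angular_setup
begin

lemma symbol_class_facts:
  assumes F: "symbol_class f" and v: "valid i"
  shows "\<exists>C. \<forall>x. \<bar>f i x\<bar> \<le> C" "f i \<in> borel_measurable borel" "\<And>x. x \<notin> core i \<Longrightarrow> f i x = 0" "integrable lborel (f i)"
proof -
  show b: "\<exists>C. \<forall>x. \<bar>f i x\<bar> \<le> C"
  proof -
    have "bdd_derivs 0 (\<lambda>i. if valid i then UNIV else {}) fvec f" using F unfolding symbol_class_def by blast
    then obtain C where C: "\<forall>i. \<forall>x\<in>(if valid i then UNIV else {}). \<bar>f i x\<bar> \<le> C" by (auto simp del: split_paired_All)
    show ?thesis using C[rule_format, of _ i] v by auto
  qed
  show m: "f i \<in> borel_measurable borel" using F unfolding symbol_class_def by blast
  show z: "x \<notin> core i \<Longrightarrow> f i x = 0" for x using F v unfolding symbol_class_def by blast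
  obtain C where "\<And>x. \<bar>f i x\<bar> \<le> C" using b by blast
  then show "integrable lborel (f i)" by (rule integrable_compact_support(1)[OF m _ z compact_core])
qed

text \<open>Up to the factor i, the symbol of the m-th partial derivative of the kernel of
  \<open>mult0 i n\<close>.\<close>

abbreviation "mm i n m \<equiv> (\<lambda>\<xi>. \<xi> $ m * mult0 i n \<xi>)"

lemma mm_eq: "mm i n m = (\<lambda>\<xi>. \<kappa> i * (\<xi> $ m / \<kappa> i * mult0 i n \<xi>))"
  by (simp add: fun_eq_iff)

lemma mm_integrable: "valid i \<Longrightarrow> integrable lborel (mm i n m)"
  unfolding mm_eq by (intro integrable_mult_right symbol_class_facts(4)[OF symbol_class_mult1])

lemma mult_kernel_facts:
  fixes k :: int
  assumes f: "framed \<rho> \<beta> r l e Q"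
  defines "i \<equiv> idx \<rho> \<beta> k r l e Q 1"
  shows "decays (kern (mult0 i n))" "decays (kern (mm i n m))"
    "kern (mult0 i n) \<in> borel_measurable borel" "kern (mm i n m) \<in> borel_measurable borel"
    "(kern (mult0 i n) has_derivative (\<lambda>h. \<Sum>j\<in>UNIV. h $ j *\<^sub>R (\<i> * kern (mm i n j) z))) (at z)"
proof -
  have v: "valid i" unfolding i_def by (rule framed_valid[OF f])
  note F0 = symbol_class_facts[OF symbol_class_mult0[of n] v]
  note F1 = symbol_class_facts[OF symbol_class_mult1[of m n] v]
  obtain C where C: "\<And>x. \<bar>mult0 i n x\<bar> \<le> C" using F0(1) by blast
  obtain C' where C': "\<And>x. \<bar>x $ m / \<kappa> i * mult0 i n x\<bar> \<le> C'" using F1(1) by blast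
  show "decays (kern (mult0 i n))"
    unfolding i_def by (rule decays_kern[OF symbol_class_decays[OF symbol_class_mult0 f]])
  have ke: "kern (mm i n m) = (\<lambda>z. of_real (\<kappa> i) * kern (\<lambda>\<xi>. \<xi> $ m / \<kappa> i * mult0 i n \<xi>) z)"
    unfolding mm_eq kern_scale ..
  show "decays (kern (mm i n m))"
    unfolding ke unfolding i_def by (rule decays_cmult[OF decays_kern[OF symbol_class_decays[OF symbol_class_mult1 f]]])
  show "kern (mult0 i n) \<in> borel_measurable borel" by (rule kern_continuous[OF F0(2) C F0(3) compact_core])
  show "kern (mm i n m) \<in> borel_measurable borel"
    unfolding ke by (intro borel_measurable_times borel_measurable_const kern_continuous[OF F1(2) C' F1(3) compact_core])
  show "(kern (mult0 i n) has_derivative (\<lambda>h. \<Sum>j\<in>UNIV. h $ j *\<^sub>R (\<i> * kern (mm i n j) z))) (at z)"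
    by (rule kern_has_derivative[OF F0(2) C F0(3) compact_core])
qed

text \<open>Every side of the box has length at least 2^(k+r), so 2^(k+r) |z| is below the linear
  factor in \<open>dominated_kernel\<close>. The symbol \<open>mm\<close> is 2^k times a symbol of
  the class; the two powers of 2^k cancel and leave \<open>1 / 2 powr r\<close>.\<close>

lemma kernel_weights:
  obtains C where "0 < C"
    "\<And>\<rho> \<beta> k r l e Q n z. framed \<rho> \<beta> r l e Q \<Longrightarrow>
      norm (kern (mult0 (idx \<rho> \<beta> k r l e Q 1) n) z) \<le> C * weight (axes_len k r) Q z"
    "\<And>\<rho> \<beta> k r l e Q n m z. framed \<rho> \<beta> r l e Q \<Longrightarrow>
      norm z * norm (kern (mm (idx \<rho> \<beta> k r l e Q 1) n m) z) \<le> C / 2 powr r * weight (axes_len k r) Q z"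
proof -
  have "\<exists>C0. \<forall>n. dominated_kernel (\<lambda>i. mult0 i n) (C0 n)"
    by (intro choice allI symbol_class_dominated symbol_class_mult0)
  then obtain C0 where C0: "\<And>n. dominated_kernel (\<lambda>i. mult0 i n) (C0 n)" by blast
  have "\<exists>D1. \<forall>p. dominated_kernel (\<lambda>i \<xi>. \<xi> $ (fst p) / \<kappa> i * mult0 i (snd p) \<xi>) (D1 p)"
    by (intro choice allI symbol_class_dominated symbol_class_mult1)
  then obtain D1 where D1: "\<And>p. dominated_kernel (\<lambda>i \<xi>. \<xi> $ (fst p) / \<kappa> i * mult0 i (snd p) \<xi>) (D1 p)" by blast
  define C where "C = 1 + (\<Sum>n\<in>UNIV. \<bar>C0 n\<bar>) + (\<Sum>p\<in>UNIV. \<bar>D1 p\<bar>)"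
  have s0: "0 \<le> (\<Sum>n\<in>UNIV. \<bar>C0 n\<bar>)" "0 \<le> (\<Sum>p\<in>UNIV. \<bar>D1 p\<bar>)" by (simp_all add: sum_nonneg)
  have le0: "C0 n \<le> C" for n
  proof -
    have "\<bar>C0 n\<bar> \<le> (\<Sum>n\<in>UNIV. \<bar>C0 n\<bar>)" by (rule member_le_sum) auto
    then show ?thesis using s0 abs_ge_self[of "C0 n"] unfolding C_def by linarith
  qed
  have le1: "D1 p \<le> C" for p
  proof -
    have "\<bar>D1 p\<bar> \<le> (\<Sum>p\<in>UNIV. \<bar>D1 p\<bar>)" by (rule member_le_sum) auto
    then show ?thesis using s0 abs_ge_self[of "D1 p"] unfolding C_def by linarith
  qed
  show thesis
  proof
    show "0 < C" using s0 unfolding C_def by linarith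
    fix \<rho> \<beta> k r l e Q and n m :: 3 and z :: "real^3" assume f: "framed \<rho> \<beta> r l e Q"
    define U where "U = (\<Sum>d\<in>UNIV. \<bar>axes_len k r d * (Q (axis d 1) \<bullet> z)\<bar>)"
    have U: "0 \<le> U" unfolding U_def by (intro sum_nonneg) simp
    have W: "0 \<le> weight (axes_len k r) Q z" by (rule weight_nonneg[OF axes_len_pos])
    define i where "i = idx \<rho> \<beta> k r l e Q 1"
    have Q: "orthogonal_transformation Q" and rs: "r \<in> scales C1 \<rho>" using f by (auto simp: framed_def)
    have "norm (osc (mult0 i n) z) \<le> (1 + U) * norm (osc (mult0 i n) z)"
      using mult_right_mono[of 1 "1 + U" "norm (osc (mult0 i n) z)"] U by simp
    also have "\<dots> \<le> C0 n * weight (axes_len k r) Q z"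
      using C0[of n, unfolded dominated_kernel_def, rule_format, OF f, of k z] unfolding U_def i_def .
    also have "\<dots> \<le> C * weight (axes_len k r) Q z" by (rule mult_right_mono[OF le0 W])
    finally show "norm (kern (mult0 (idx \<rho> \<beta> k r l e Q 1) n) z) \<le> C * weight (axes_len k r) Q z"
      unfolding i_def by (rule order_trans[OF norm_kern_le])
    define N where "N = norm (osc (\<lambda>\<xi>. \<xi> $ m / \<kappa> i * mult0 i n \<xi>) z)"
    have ki: "\<kappa> i = 2 powr k" by (simp add: i_def)
    have "(1 + U) * N \<le> D1 (m, n) * weight (axes_len k r) Q z"
      using D1[of "(m, n)", unfolded dominated_kernel_def, rule_format, OF f, of k z] unfolding U_def i_def N_def fst_conv snd_conv .
    also have "\<dots> \<le> C * weight (axes_len k r) Q z" by (rule mult_right_mono[OF le1 W])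
    finally have UN: "(1 + U) * N \<le> C * weight (axes_len k r) Q z" .
    have zU: "2 powr k * 2 powr r * norm z \<le> U"
    proof -
      have "2 powr k * 2 powr r * norm z \<le> 2 powr k * 2 powr r * (\<Sum>d\<in>UNIV. \<bar>Q (axis d 1) \<bullet> z\<bar>)"
        by (intro mult_left_mono norm_le_frame[OF Q]) simp
      also have "\<dots> \<le> U"
        unfolding U_def sum_distrib_left
      proof (rule sum_mono)
        fix d
        have "2 powr k * 2 powr r \<le> axes_len k r d"
          using scale_le_1[OF rs] mult_left_mono[of "2 powr real_of_int r" 1 "2 powr real_of_int k"] by (simp add: axes_len_def)
        then show "2 powr k * 2 powr r * \<bar>Q (axis d 1) \<bullet> z\<bar> \<le> \<bar>axes_len k r d * (Q (axis d 1) \<bullet> z)\<bar>"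
          unfolding abs_mult abs_of_pos[OF axes_len_pos] by (rule mult_right_mono) simp
      qed
      finally show ?thesis .
    qed
    have "norm z * norm (kern (mm i n m) z) = 2 powr k * norm z * norm (kern (\<lambda>\<xi>. \<xi> $ m / \<kappa> i * mult0 i n \<xi>) z)"
      unfolding mm_eq kern_scale by (simp add: ki norm_mult)
    also have "\<dots> \<le> 2 powr k * norm z * N"
      unfolding N_def by (intro mult_left_mono norm_kern_le) simp
    finally have "2 powr r * (norm z * norm (kern (mm i n m) z)) \<le> 2 powr r * (2 powr k * norm z * N)"
      by (rule mult_left_mono) simp
    also have "\<dots> = (2 powr k * 2 powr r * norm z) * N" by (simp only: mult_ac)
    also have "\<dots> \<le> U * N" by (rule mult_right_mono[OF zU]) (simp add: N_def)
    also have "\<dots> \<le> (1 + U) * N" by (rule mult_right_mono) (simp_all add: N_def)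
    also note UN
    finally show "norm z * norm (kern (mm (idx \<rho> \<beta> k r l e Q 1) n m) z) \<le> C / 2 powr r * weight (axes_len k r) Q z"
      unfolding i_def by (simp add: pos_le_divide_eq mult.commute)
  qed
qed

text \<open>The pairing identity for the symbols, transferred to kernels. The decay of the kernel of
  the angular piece is inherited from those of the vector field.\<close>

lemma eta_kernel:
  fixes k :: int
  assumes f: "framed \<rho> \<beta> r l e Q"
  defines "i \<equiv> idx \<rho> \<beta> k r l e Q 1"
  defines "p \<equiv> (\<lambda>\<xi>. \<eta> \<rho> \<beta> r l \<xi> * fat_cutoff chi k \<xi>)"
  shows "integrable lborel p" "decays (kern p)" "kern p \<in> borel_measurable borel"
    "of_real (2 powr r * 2 powr k) * kern p z =
      (\<Sum>n\<in>UNIV. of_real (e $ ca n) * kern (mm i n (cb n)) z - of_real (e $ cb n) * kern (mm i n (ca n)) z)"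
proof -
  have v: "valid i" unfolding i_def by (rule framed_valid[OF f])
  define c where "c = 2 powr real_of_int r * 2 powr real_of_int k"
  have c: "c \<noteq> 0" by (simp add: c_def)
  define q where "q n = (\<lambda>\<xi>. e $ ca n * mm i n (cb n) \<xi> - e $ cb n * mm i n (ca n) \<xi>)" for n
  have cp: "c * p \<xi> = (\<Sum>n\<in>UNIV. q n \<xi>)" for \<xi>
    using mult0_sum[OF v, of \<xi>] unfolding q_def cross3_component p_def c_def
    by (simp add: i_def algebra_simps)
  have qi: "integrable lborel (q n)" for n
    unfolding q_def by (intro Bochner_Integration.integrable_diff integrable_mult_right mm_integrable[OF v])
  have "integrable lborel (\<lambda>\<xi>. c * p \<xi>)" unfolding cp by (intro Bochner_Integration.integrable_sum qi)
  then show "integrable lborel p" using c by simp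
  have kq: "kern (q n) z = of_real (e $ ca n) * kern (mm i n (cb n)) z - of_real (e $ cb n) * kern (mm i n (ca n)) z" for n z
    unfolding q_def by (rule kern_linear2[OF mm_integrable[OF v] mm_integrable[OF v]])
  have k: "of_real c * kern p z = (\<Sum>n\<in>UNIV. kern (q n) z)" for z
    unfolding kern_scale[symmetric] cp by (rule kern_sum[OF qi])
  then show "of_real (2 powr r * 2 powr k) * kern p z =
      (\<Sum>n\<in>UNIV. of_real (e $ ca n) * kern (mm i n (cb n)) z - of_real (e $ cb n) * kern (mm i n (ca n)) z)"
    unfolding kq c_def .
  have kp: "kern p = (\<lambda>z. of_real (1 / c) * (\<Sum>n\<in>UNIV. kern (q n) z))"
    using c unfolding k[symmetric] by (simp add: fun_eq_iff)
  note mf = mult_kernel_facts[OF f, where k = k, folded i_def]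
  have dq: "decays (kern (q n))" for n
    unfolding kq[abs_def] by (intro decays_diff decays_cmult mf)
  have mq: "kern (q n) \<in> borel_measurable borel" for n
    unfolding kq[abs_def] by (intro borel_measurable_diff borel_measurable_times borel_measurable_const mf)
  show "decays (kern p)" unfolding kp sum_3 by (intro decays_cmult decays_add dq)
  show "kern p \<in> borel_measurable borel" unfolding kp
    by (intro borel_measurable_times borel_measurable_const borel_measurable_sum mq)
qed

text \<open>The fat cut-off is 1 on the annulus carrying the cut-off at k, so the multiplier
  factors. Inversion is applied to the radial factor only.\<close>

lemma fourier_mult_reproduce:
  assumes f: "framed \<rho> \<beta> r l e Q" and \<phi>: "tempered_fun \<phi>"
  shows "fourier_mult (\<lambda>\<xi>. \<eta> \<rho> \<beta> r l \<xi> * dyadic_cutoff chi k \<xi>) \<phi> x =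
    (LINT y|lborel. kern (\<lambda>\<xi>. \<eta> \<rho> \<beta> r l \<xi> * fat_cutoff chi k \<xi>) (x - y) * LP chi k \<phi> y)"
proof -
  define p where "p = (\<lambda>\<xi>. \<eta> \<rho> \<beta> r l \<xi> * fat_cutoff chi k \<xi>)"
  note ek = eta_kernel[OF f, where k = k, folded p_def]
  have eq: "(\<lambda>\<xi>. \<eta> \<rho> \<beta> r l \<xi> * dyadic_cutoff chi k \<xi>) = (\<lambda>\<xi>. p \<xi> * lpc k \<xi>)"
  proof
    fix \<xi>
    show "\<eta> \<rho> \<beta> r l \<xi> * dyadic_cutoff chi k \<xi> = p \<xi> * lpc k \<xi>"
      by (cases "\<xi> \<in> annulus k") (simp_all add: p_def fat_one dyadic_zero)
  qed
  have oi: "integrable lborel (osc (lpc k))" by (rule decays_integrable[OF cut_facts(8,9)])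
  obtain C where C: "\<And>\<xi>. \<bar>lpc k \<xi>\<bar> \<le> C" using dyadic_bounded by blast
  have ci: "integrable lborel (lpc k)"
    by (rule integrable_compact_support(1)[OF dyadic_measurable C dyadic_zero compact_annulus])
  have cc: "continuous_on UNIV (lpc k)"
  proof -
    have "Ck_on 0 UNIV chi" using chi_props(1) unfolding smooth_on_def by blast
    then have chi: "continuous_on UNIV chi" by simp
    have "continuous_on UNIV (\<lambda>\<xi>. chi (a *\<^sub>R \<xi>))" for a
      by (rule continuous_on_compose2[OF chi continuous_on_scaleR[OF continuous_on_const continuous_on_id]]) simp
    then show ?thesis unfolding dyadic_cutoff_def[abs_def] by (intro continuous_on_diff)
  qed
  have kp: "kern (\<lambda>\<xi>. p \<xi> * lpc k \<xi>) = (\<lambda>z. LINT v|lborel. kern p (z - v) * kern (lpc k) v)"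
    by (rule ext, rule kern_product[OF ek(1) oi osc_inversion[OF cc ci C oi]])
  have "fourier_mult (\<lambda>\<xi>. p \<xi> * lpc k \<xi>) \<phi> x = (LINT y|lborel. kern p (x - y) * LP chi k \<phi> y)"
    unfolding LP_eq fourier_mult_eq_tconv[of "\<lambda>\<xi>. p \<xi> * lpc k \<xi>"] kp
    by (rule tconv_assoc[OF \<phi> ek(2,3) cut_facts(1,4)])
  then show ?thesis unfolding eq p_def .
qed

definition gsum :: "int \<Rightarrow> (real^3 \<Rightarrow> complex) \<Rightarrow> 3 \<Rightarrow> real^3 \<Rightarrow> real" where
  "gsum k \<phi> n y = norm (Omega (ca n) (cb n) (LP chi k \<phi>) y) + norm (LP chi k \<phi> y)"

text \<open>Writing \<open>x = y + z\<close> in \<open>x \<times> \<nabla>\<close>, the part with \<open>y\<close> is moved onto \<open>LP chi k \<phi>\<close> by an integration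
  by parts, and the part with \<open>z\<close> is absorbed by the decay of the kernel at the cost of \<open>2 powr - r\<close>.\<close>

lemma cross_part:
  fixes k :: int and x :: "real^3"
  assumes f: "framed \<rho> \<beta> r l e Q" and \<phi>: "tempered_fun \<phi>" and C0: "0 < C"
    and C: "\<And>n z. norm (kern (mult0 (idx \<rho> \<beta> k r l e Q 1) n) z) \<le> C * weight (axes_len k r) Q z"
      "\<And>n m z. norm z * norm (kern (mm (idx \<rho> \<beta> k r l e Q 1) n m) z) \<le> C / 2 powr r * weight (axes_len k r) Q z"
  defines "i \<equiv> idx \<rho> \<beta> k r l e Q 1"
  defines "H \<equiv> (\<lambda>n y. (of_real (x $ ca n) * kern (mm i n (cb n)) (x - y) - of_real (x $ cb n) * kern (mm i n (ca n)) (x - y)) * LP chi k \<phi> y)"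
  shows "integrable lborel (H n)"
    "ennreal (norm (LINT y|lborel. H n y)) \<le> ennreal (2 * C / 2 powr r) * (\<integral>\<^sup>+y. ennreal (weight (axes_len k r) Q (x - y) * gsum k \<phi> n y) \<partial>lborel)"
proof -
  define \<psi> where "\<psi> = LP chi k \<phi>"
  define a b where "a = ca n" "b = cb n"
  define M where "M = kern (mult0 i n)"
  define T where "T m = kern (mm i n m)" for m
  define W where "W = weight (axes_len k r) Q"
  note mf = mult_kernel_facts[OF f, where k = k, folded i_def]
  note lf = LP_facts[OF \<phi>, where k = k, folded \<psi>_def]
  note Tf = mf(2)[where n = n, folded T_def] mf(4)[where n = n, folded T_def]
  note Mf = mf(1)[where n = n, folded M_def] mf(3)[where n = n, folded M_def]
  have ab: "a \<noteq> b" "b \<noteq> a" unfolding a_b_def by (rule ca_neq_cb)+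
  have T': "decays (\<lambda>z. \<i> * T m z)" "(\<lambda>z. \<i> * T m z) \<in> borel_measurable borel" for m
    by (rule decays_cmult[OF Tf(1)]) (rule borel_measurable_times[OF borel_measurable_const Tf(2)])
  have DM: "(M has_derivative (\<lambda>h. \<Sum>j\<in>UNIV. h $ j *\<^sub>R (\<i> * T j z))) (at z)" for z
    unfolding M_def T_def by (rule mf(5))
  have P1: "integrable lborel (\<lambda>y. of_real (y $ p) * (\<i> * T q (x - y)) * \<psi> y)"
      "integrable lborel (\<lambda>y. of_real (y $ p) * M (x - y) * dlp k \<phi> q y)"
      "(LINT y|lborel. of_real (y $ p) * (\<i> * T q (x - y)) * \<psi> y) = (LINT y|lborel. of_real (y $ p) * M (x - y) * dlp k \<phi> q y)"
    if "p \<noteq> q" for p q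
    by (rule conv_by_parts[where M = M and M' = "\<lambda>m z. \<i> * T m z" and x = x and \<psi> = \<psi> and \<psi>' = "dlp k \<phi>" and j = p and l = q],
        (rule Mf T' DM lf that)+)+
  note Pa = P1[OF ab(1)] and Pb = P1[OF ab(2)]
  define Om where "Om = Omega a b \<psi>"
  have Om: "Om y = of_real (y $ a) * dlp k \<phi> b y - of_real (y $ b) * dlp k \<phi> a y" for y
    unfolding Om_def by (rule lf(6))
  define R where "R y = (of_real ((x - y) $ a) * T b (x - y) - of_real ((x - y) $ b) * T a (x - y)) * \<psi> y" for y
  \<comment> \<open>The splitting x = y + (x - y) of the coefficients. The kernel derivative is
    \<open>\<i> * T\<close>, which is where the compensating factor \<open>- \<i>\<close> comes
    from.\<close>
  have Hd: "H n y = (- \<i>) * (of_real (y $ a) * (\<i> * T b (x - y)) * \<psi> y - of_real (y $ b) * (\<i> * T a (x - y)) * \<psi> y) + R y" for y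
    unfolding H_def R_def \<psi>_def[symmetric] a_b_def[symmetric] T_def[symmetric] by (simp add: algebra_simps)
  have zp: "poly_growth (\<lambda>z::real^3. complex_of_real (z $ m))" for m
    unfolding poly_growth_def by (rule exI[of _ 1], rule exI[of _ 1]) (auto intro: order_trans[OF component_le_norm_cart])
  have zm: "(\<lambda>z::real^3. complex_of_real (z $ m)) \<in> borel_measurable borel" for m by measurable
  define Z where "Z z = of_real (z $ a) * T b z - of_real (z $ b) * T a z" for z
  have Zd: "decays Z" unfolding Z_def[abs_def] by (intro decays_diff decays_mult_poly[OF Tf(1) zp])
  have Zm: "Z \<in> borel_measurable borel" unfolding Z_def[abs_def]
    by (intro borel_measurable_diff borel_measurable_times zm Tf(2))
  have RZ: "R y = \<psi> y * Z (x - y)" for y by (simp add: R_def Z_def)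
  have Ri: "integrable lborel R"
    unfolding RZ[abs_def]
    by (intro decays_integrable decays_mult_poly[OF decays_reflect[OF Zd] lf(1)] borel_measurable_times lf(2) reflect_measurable[OF Zm])
  have i12: "integrable lborel (\<lambda>y. of_real (y $ a) * (\<i> * T b (x - y)) * \<psi> y - of_real (y $ b) * (\<i> * T a (x - y)) * \<psi> y)"
    by (rule Bochner_Integration.integrable_diff[OF Pa(1) Pb(1)])
  have Hi: "integrable lborel (\<lambda>y. (- \<i>) * (of_real (y $ a) * (\<i> * T b (x - y)) * \<psi> y - of_real (y $ b) * (\<i> * T a (x - y)) * \<psi> y) + R y)"
    by (intro Bochner_Integration.integrable_add integrable_mult_right i12 Ri)
  then show "integrable lborel (H n)" unfolding Hd[abs_def] .
  have "(LINT y|lborel. H n y) = (- \<i>) * (LINT y|lborel. M (x - y) * Om y) + (LINT y|lborel. R y)"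
  proof -
    have "(LINT y|lborel. H n y) = (- \<i>) * (LINT y|lborel. of_real (y $ a) * (\<i> * T b (x - y)) * \<psi> y - of_real (y $ b) * (\<i> * T a (x - y)) * \<psi> y) + (LINT y|lborel. R y)"
      unfolding Hd
      by (subst Bochner_Integration.integral_add[OF integrable_mult_right[OF i12] Ri]) (simp only: integral_mult_right_zero)
    also have "(LINT y|lborel. of_real (y $ a) * (\<i> * T b (x - y)) * \<psi> y - of_real (y $ b) * (\<i> * T a (x - y)) * \<psi> y) =
        (LINT y|lborel. of_real (y $ a) * M (x - y) * dlp k \<phi> b y) - (LINT y|lborel. of_real (y $ b) * M (x - y) * dlp k \<phi> a y)"
      by (subst Bochner_Integration.integral_diff[OF Pa(1) Pb(1)]) (simp only: Pa(3) Pb(3))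
    also have "\<dots> = (LINT y|lborel. of_real (y $ a) * M (x - y) * dlp k \<phi> b y - of_real (y $ b) * M (x - y) * dlp k \<phi> a y)"
      by (rule Bochner_Integration.integral_diff[OF Pa(2) Pb(2), symmetric])
    also have "\<dots> = (LINT y|lborel. M (x - y) * Om y)"
      unfolding Om by (intro Bochner_Integration.integral_cong refl) (simp add: algebra_simps)
    finally show ?thesis .
  qed
  then have "norm (LINT y|lborel. H n y) \<le> norm (LINT y|lborel. M (x - y) * Om y) + norm (LINT y|lborel. R y)"
    using norm_triangle_ineq[of "(- \<i>) * (LINT y|lborel. M (x - y) * Om y)" "LINT y|lborel. R y"] by (simp add: norm_mult)
  then have "ennreal (norm (LINT y|lborel. H n y)) \<le> ennreal (norm (LINT y|lborel. M (x - y) * Om y)) + ennreal (norm (LINT y|lborel. R y))"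
    by (simp add: ennreal_plus[symmetric] del: ennreal_plus)
  also have "\<dots> \<le> (\<integral>\<^sup>+y. ennreal (norm (M (x - y) * Om y)) \<partial>lborel) + (\<integral>\<^sup>+y. ennreal (norm (R y)) \<partial>lborel)"
    by (intro add_mono ennreal_norm_integral_le)
  also have "\<dots> = (\<integral>\<^sup>+y. ennreal (norm (M (x - y) * Om y)) + ennreal (norm (R y)) \<partial>lborel)"
  proof (rule nn_integral_add[symmetric])
    have "Om \<in> borel_measurable borel"
      unfolding Om[abs_def] by (intro borel_measurable_diff borel_measurable_times zm lf(4))
    then show "(\<lambda>y. ennreal (norm (M (x - y) * Om y))) \<in> borel_measurable lborel"
      using reflect_measurable[OF Mf(2), of x] by simp
    show "(\<lambda>y. ennreal (norm (R y))) \<in> borel_measurable lborel"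
      using borel_measurable_integrable[OF Ri] by simp
  qed
  also have "\<dots> \<le> (\<integral>\<^sup>+y. ennreal (2 * C / 2 powr r) * ennreal (W (x - y) * gsum k \<phi> n y) \<partial>lborel)"
  proof (rule nn_integral_mono)
    fix y
    define S where "S = 2 powr real_of_int r"
    have S: "0 < S" "S \<le> 1" using scale_le_1 f by (auto simp: S_def framed_def)
    have W0: "0 \<le> W (x - y)" unfolding W_def by (rule weight_nonneg[OF axes_len_pos])
    \<comment> \<open>As S is at most 1, the better bound for the rotation term can be weakened to
      share the constant of the remainder, which loses 1 / S.\<close>
    have "C \<le> 2 * C / S"
    proof -
      have "C * S \<le> C * 1" using C0 S by (intro mult_left_mono) auto
      then show ?thesis using S C0 by (simp add: pos_le_divide_eq)
    qed
    then have "C * W (x - y) \<le> 2 * C / S * W (x - y)" by (rule mult_right_mono[OF _ W0])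
    then have "norm (M (x - y)) \<le> 2 * C / S * W (x - y)"
      using C(1)[of n "x - y"] unfolding M_def W_def i_def by linarith
    then have 1: "norm (M (x - y) * Om y) \<le> 2 * C / S * W (x - y) * norm (Om y)"
      unfolding norm_mult by (rule mult_right_mono) simp
    have t: "norm (of_real ((x - y) $ p) * T q (x - y)) \<le> C / S * W (x - y)" for p q
    proof -
      have "norm (of_real ((x - y) $ p) * T q (x - y)) \<le> norm (x - y) * norm (T q (x - y))"
        unfolding norm_mult norm_of_real by (intro mult_right_mono component_le_norm_cart) simp
      also have "\<dots> \<le> C / S * W (x - y)"
        unfolding T_def W_def S_def i_def by (rule C(2))
      finally show ?thesis .
    qed
    have "norm (of_real ((x - y) $ a) * T b (x - y) - of_real ((x - y) $ b) * T a (x - y)) \<le> C / S * W (x - y) + C / S * W (x - y)"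
      by (rule order_trans[OF norm_triangle_ineq4]) (intro add_mono t)
    also have "\<dots> = 2 * C / S * W (x - y)" by simp
    finally have 2: "norm (R y) \<le> 2 * C / S * W (x - y) * norm (\<psi> y)"
      unfolding R_def norm_mult by (rule mult_right_mono) simp
    have g: "gsum k \<phi> n y = norm (Om y) + norm (\<psi> y)" by (simp add: gsum_def Om_def \<psi>_def a_b_def)
    have "ennreal (norm (M (x - y) * Om y)) + ennreal (norm (R y)) = ennreal (norm (M (x - y) * Om y) + norm (R y))" by simp
    also have "\<dots> \<le> ennreal (2 * C / S * (W (x - y) * gsum k \<phi> n y))"
      unfolding g using 1 2 by (intro ennreal_leI) (simp add: algebra_simps)
    also have "\<dots> = ennreal (2 * C / S) * ennreal (W (x - y) * gsum k \<phi> n y)"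
      using C0 S W0 by (intro ennreal_mult) (auto simp: gsum_def)
    finally show "ennreal (norm (M (x - y) * Om y)) + ennreal (norm (R y)) \<le> ennreal (2 * C / 2 powr r) * ennreal (W (x - y) * gsum k \<phi> n y)"
      unfolding S_def .
  qed
  also have "\<dots> = ennreal (2 * C / 2 powr r) * (\<integral>\<^sup>+y. ennreal (W (x - y) * gsum k \<phi> n y) \<partial>lborel)"
  proof (rule nn_integral_cmult)
    have "(\<lambda>y. W (x - y)) \<in> borel_measurable borel"
    proof -
      have "(\<lambda>y::real^3. x - y) \<in> borel_measurable borel" by (intro borel_measurable_continuous_onI continuous_intros)
      from measurable_compose[OF this weight_measurable] show ?thesis by (simp add: W_def)
    qed
    moreover have "Om \<in> borel_measurable borel"
      unfolding Om[abs_def] by (intro borel_measurable_diff borel_measurable_times zm lf(4))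
    ultimately show "(\<lambda>y. ennreal (W (x - y) * gsum k \<phi> n y)) \<in> borel_measurable lborel"
      using lf(2) by (simp add: gsum_def[abs_def] Om_def \<psi>_def a_b_def)
  qed
  finally show "ennreal (norm (LINT y|lborel. H n y)) \<le> ennreal (2 * C / 2 powr r) * (\<integral>\<^sup>+y. ennreal (weight (axes_len k r) Q (x - y) * gsum k \<phi> n y) \<partial>lborel)"
    unfolding W_def .
qed

text \<open>Multiplication by |x| turns the components of x / |x| into those of x, and
  multiplication by 2^(k+r) clears the normalisation of the symbol. Dividing by the latter and
  adding the loss 2^(-r) of the remainder gives the power 2^(-k-2r).\<close>

lemma pointwise_bound:
  obtains C where "0 < C"
    "\<And>\<rho> \<beta> k r l x Q \<phi>. framed \<rho> \<beta> r l (sgn x) Q \<Longrightarrow> tempered_fun \<phi> \<Longrightarrow>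
      ennreal (norm x * norm (fourier_mult (\<lambda>\<xi>. \<eta> \<rho> \<beta> r l \<xi> * dyadic_cutoff chi k \<xi>) \<phi> x)) \<le>
        ennreal (C / (2 powr k * 2 powr r * 2 powr r)) *
        (\<Sum>n\<in>UNIV. \<integral>\<^sup>+y. ennreal (weight (axes_len k r) Q (x - y) * gsum k \<phi> n y) \<partial>lborel)"
proof -
  obtain C where C: "0 < C"
    "\<And>\<rho> \<beta> k r l e Q n z. framed \<rho> \<beta> r l e Q \<Longrightarrow>
      norm (kern (mult0 (idx \<rho> \<beta> k r l e Q 1) n) z) \<le> C * weight (axes_len k r) Q z"
    "\<And>\<rho> \<beta> k r l e Q n m z. framed \<rho> \<beta> r l e Q \<Longrightarrow>
      norm z * norm (kern (mm (idx \<rho> \<beta> k r l e Q 1) n m) z) \<le> C / 2 powr r * weight (axes_len k r) Q z"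
    by (rule kernel_weights) (rule that)
  show thesis
  proof
    show "0 < 2 * C" using C(1) by simp
    fix \<rho> \<beta> k r l x Q \<phi> assume f: "framed \<rho> \<beta> r l (sgn x) Q" and \<phi>: "tempered_fun \<phi>"
    define i where "i = idx \<rho> \<beta> k r l (sgn x) Q 1"
    define p where "p = (\<lambda>\<xi>. \<eta> \<rho> \<beta> r l \<xi> * fat_cutoff chi k \<xi>)"
    define F where "F = fourier_mult (\<lambda>\<xi>. \<eta> \<rho> \<beta> r l \<xi> * dyadic_cutoff chi k \<xi>) \<phi> x"
    define H where "H n y = (of_real (x $ ca n) * kern (mm i n (cb n)) (x - y) - of_real (x $ cb n) * kern (mm i n (ca n)) (x - y)) * LP chi k \<phi> y" for n y
    define I where "I n = (\<integral>\<^sup>+y. ennreal (weight (axes_len k r) Q (x - y) * gsum k \<phi> n y) \<partial>lborel)" for n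
    note cp = cross_part[OF f \<phi> C(1) C(2)[OF f] C(3)[OF f], where x = x, folded i_def]
    define c where "c = 2 powr real_of_int r * 2 powr real_of_int k"
    have c: "0 < c" by (simp add: c_def)
    have xs: "x $ m = norm x * sgn x $ m" for m
      by (cases "x = 0") (simp_all add: sgn_div_norm)
    have "of_real (c * norm x) * F = (LINT y|lborel. of_real (c * norm x) * (kern p (x - y) * LP chi k \<phi> y))"
      unfolding F_def fourier_mult_reproduce[OF f \<phi>] p_def by (rule integral_mult_right_zero[symmetric])
    also have "\<dots> = (LINT y|lborel. (\<Sum>n\<in>UNIV. H n y))"
    proof (intro Bochner_Integration.integral_cong refl)
      fix y
      have "of_real (c * norm x) * (kern p (x - y) * LP chi k \<phi> y) = of_real (norm x) * (of_real c * kern p (x - y)) * LP chi k \<phi> y"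
        by (simp add: mult_ac)
      also have "of_real c * kern p (x - y) = (\<Sum>n\<in>UNIV. of_real (sgn x $ ca n) * kern (mm i n (cb n)) (x - y) - of_real (sgn x $ cb n) * kern (mm i n (ca n)) (x - y))"
        unfolding c_def p_def i_def by (rule eta_kernel(4)[OF f])
      also have "of_real (norm x) * \<dots> * LP chi k \<phi> y = (\<Sum>n\<in>UNIV. H n y)"
        unfolding H_def sum_distrib_left sum_distrib_right
        by (intro sum.cong refl) (simp only: xs[of "ca _"] xs[of "cb _"] of_real_mult right_diff_distrib mult.assoc)
      finally show "of_real (c * norm x) * (kern p (x - y) * LP chi k \<phi> y) = (\<Sum>n\<in>UNIV. H n y)" .
    qed
    also have "\<dots> = (\<Sum>n\<in>UNIV. LINT y|lborel. H n y)"
      by (rule Bochner_Integration.integral_sum) (use cp(1) in \<open>simp add: H_def[abs_def] i_def\<close>)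
    finally have eq: "of_real (c * norm x) * F = (\<Sum>n\<in>UNIV. LINT y|lborel. H n y)" .
    have "ennreal (c * (norm x * norm F)) = ennreal (norm (\<Sum>n\<in>UNIV. LINT y|lborel. H n y))"
      unfolding eq[symmetric] using c by (simp add: norm_mult abs_mult mult_ac)
    also have "\<dots> \<le> ennreal (\<Sum>n\<in>UNIV. norm (LINT y|lborel. H n y))"
      by (intro ennreal_leI norm_sum)
    also have "\<dots> = (\<Sum>n\<in>UNIV. ennreal (norm (LINT y|lborel. H n y)))"
      by (simp add: sum_ennreal)
    also have "\<dots> \<le> (\<Sum>n\<in>UNIV. ennreal (2 * C / 2 powr r) * I n)"
      by (intro sum_mono) (use cp(2) in \<open>simp add: H_def[abs_def] i_def I_def\<close>)
    also have "\<dots> = ennreal (2 * C / 2 powr r) * (\<Sum>n\<in>UNIV. I n)" by (simp add: sum_distrib_left)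
    finally have main: "ennreal (c * (norm x * norm F)) \<le> ennreal (2 * C / 2 powr r) * (\<Sum>n\<in>UNIV. I n)" .
    have "ennreal (norm x * norm F) = ennreal (1 / c) * ennreal (c * (norm x * norm F))"
      using c by (simp add: ennreal_mult[symmetric])
    also have "\<dots> \<le> ennreal (1 / c) * (ennreal (2 * C / 2 powr r) * (\<Sum>n\<in>UNIV. I n))"
      by (intro mult_left_mono main) simp
    also have "\<dots> = ennreal (2 * C / (2 powr k * 2 powr r * 2 powr r)) * (\<Sum>n\<in>UNIV. I n)"
      using c C(1) unfolding mult.assoc[symmetric] by (subst ennreal_mult[symmetric]) (simp_all add: c_def mult_ac)
    finally show "ennreal (norm x * norm (fourier_mult (\<lambda>\<xi>. \<eta> \<rho> \<beta> r l \<xi> * dyadic_cutoff chi k \<xi>) \<phi> x)) \<le>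
        ennreal (2 * C / (2 powr k * 2 powr r * 2 powr r)) *
        (\<Sum>n\<in>UNIV. \<integral>\<^sup>+y. ennreal (weight (axes_len k r) Q (x - y) * gsum k \<phi> n y) \<partial>lborel)"
      unfolding F_def I_def .
  qed
qed

end

section \<open>Lebesgue norms\<close>

lemma nn_integral_lborel_translate:
  fixes f :: "real^3 \<Rightarrow> ennreal"
  assumes "f \<in> borel_measurable borel"
  shows "(\<integral>\<^sup>+x. f (x - y) \<partial>lborel) = (\<integral>\<^sup>+x. f x \<partial>lborel)"
proof -
  have "(\<integral>\<^sup>+x. f x \<partial>lborel) = (\<integral>\<^sup>+x. f x \<partial>distr lborel borel ((+) (- y)))"
    by (simp only: lborel_distr_plus)
  also have "\<dots> = (\<integral>\<^sup>+x. f (- y + x) \<partial>lborel)" by (rule nn_integral_distr) (use assms in auto)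
  finally show ?thesis by simp
qed

lemma nn_integral_lborel_reflect:
  fixes f :: "real^3 \<Rightarrow> ennreal"
  assumes "f \<in> borel_measurable borel"
  shows "(\<integral>\<^sup>+y. f (x - y) \<partial>lborel) = (\<integral>\<^sup>+x. f x \<partial>lborel)"
proof -
  have l: "lborel = density (distr lborel borel (\<lambda>y::real^3. x + (- 1) *\<^sub>R y)) (\<lambda>_. ennreal (\<bar>- 1 :: real\<bar> ^ DIM(real^3)))"
    by (rule lborel_affine) simp
  have m: "(\<lambda>y::real^3. x - y) \<in> borel_measurable borel" by (intro borel_measurable_continuous_onI continuous_intros)
  have "lborel = distr lborel borel (\<lambda>y::real^3. x - y)"
    using l by (simp add: density_1)
  then have "(\<integral>\<^sup>+z. f z \<partial>lborel) = (\<integral>\<^sup>+z. f z \<partial>distr lborel borel (\<lambda>y::real^3. x - y))" by (rule arg_cong)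
  also have "\<dots> = (\<integral>\<^sup>+y. f (x - y) \<partial>lborel)" by (rule nn_integral_distr) (use assms m in auto)
  finally show ?thesis ..
qed

text \<open>For a > c the second summand alone suffices, since \<open>t powr (1 - q)\<close> does
  not increase with t.\<close>

lemma le_add_powr:
  fixes a c q :: real
  assumes "0 \<le> a" "0 < c" "1 \<le> q"
  shows "a \<le> c + c powr (1 - q) * a powr q"
proof (cases "a \<le> c")
  case True
  then show ?thesis by (intro add_increasing2) auto
next
  case False
  then have a: "0 < a" using assms by simp
  have "a powr (1 - q) \<le> c powr (1 - q)" using False assms by (intro powr_mono2') auto
  then have "a powr (1 - q) * a powr q \<le> c powr (1 - q) * a powr q" by (rule mult_right_mono) simp
  moreover have "a powr (1 - q) * a powr q = a" using a by (simp add: powr_add[symmetric])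
  ultimately show ?thesis using assms by linarith
qed

text \<open>Jensen's inequality up to a constant, obtained by integrating the pointwise bound
  \<open>a \<le> c + c powr (1 - q) * a powr q\<close> for the optimal \<open>c\<close>.\<close>

lemma nn_integral_jensen:
  fixes w g :: "'a \<Rightarrow> real"
  assumes m: "w \<in> borel_measurable M" "g \<in> borel_measurable M" and nn: "\<And>y. 0 \<le> w y" "\<And>y. 0 \<le> g y"
    and w: "(\<integral>\<^sup>+y. ennreal (w y) \<partial>M) = ennreal mm" "0 \<le> mm" and q: "1 \<le> q"
    and J: "(\<integral>\<^sup>+y. ennreal (w y * g y powr q) \<partial>M) = ennreal j" "0 \<le> j"
  shows "(\<integral>\<^sup>+y. ennreal (w y * g y) \<partial>M) \<le> ennreal ((mm + 1) * j powr (1 / q))"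
proof -
  have bd: "(\<integral>\<^sup>+y. ennreal (w y * g y) \<partial>M) \<le> ennreal (c * mm + c powr (1 - q) * j)" if c: "0 < c" for c
  proof -
    have "(\<integral>\<^sup>+y. ennreal (w y * g y) \<partial>M) \<le> (\<integral>\<^sup>+y. ennreal c * ennreal (w y) + ennreal (c powr (1 - q)) * ennreal (w y * g y powr q) \<partial>M)"
    proof (rule nn_integral_mono)
      fix y
      have "w y * g y \<le> w y * (c + c powr (1 - q) * g y powr q)"
        using le_add_powr[OF nn(2) c q] nn(1) by (rule mult_left_mono)
      also have "\<dots> = c * w y + c powr (1 - q) * (w y * g y powr q)" by (simp add: algebra_simps)
      finally have "ennreal (w y * g y) \<le> ennreal (c * w y + c powr (1 - q) * (w y * g y powr q))" by (rule ennreal_leI)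
      also have "\<dots> = ennreal c * ennreal (w y) + ennreal (c powr (1 - q)) * ennreal (w y * g y powr q)"
        using nn c by (simp add: ennreal_mult[symmetric] ennreal_plus[symmetric] del: ennreal_plus)
      finally show "ennreal (w y * g y) \<le> ennreal c * ennreal (w y) + ennreal (c powr (1 - q)) * ennreal (w y * g y powr q)" .
    qed
    also have "\<dots> = ennreal c * ennreal mm + ennreal (c powr (1 - q)) * ennreal j"
      using m by (simp add: nn_integral_add nn_integral_cmult w J)
    also have "\<dots> = ennreal (c * mm + c powr (1 - q) * j)"
      using c w J by (simp add: ennreal_mult[symmetric] ennreal_plus[symmetric] del: ennreal_plus)
    finally show ?thesis .
  qed
  show ?thesis
  \<comment> \<open>For j = 0 the optimal c would be 0, which is not allowed; arbitrarily small
    positive values of c give the claim instead.\<close>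
  proof (cases "j = 0")
    case True
    have "(\<integral>\<^sup>+y. ennreal (w y * g y) \<partial>M) \<le> 0"
    proof (rule ennreal_le_epsilon)
      fix e :: real assume e: "0 < e"
      have "e / (mm + 1) * mm \<le> e" using e w(2) by (simp add: pos_divide_le_eq field_simps)
      then show "(\<integral>\<^sup>+y. ennreal (w y * g y) \<partial>M) \<le> 0 + ennreal e"
        using bd[of "e / (mm + 1)"] e w(2) True by (auto intro: order_trans[OF _ ennreal_leI])
    qed
    then show ?thesis using True by simp
  next
    case False
    then have j: "0 < j" using J by simp
    define c where "c = j powr (1 / q)"
    have c: "0 < c" using j by (simp add: c_def)
    have "c powr (1 - q) * j = j powr (1 / q * (1 - q)) * j powr 1"
      using j by (simp add: c_def powr_powr)
    also have "\<dots> = j powr (1 / q * (1 - q) + 1)" by (rule powr_add[symmetric])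
    also have "1 / q * (1 - q) + 1 = 1 / q" using q by (simp add: field_simps)
    finally have "c * mm + c powr (1 - q) * j = (mm + 1) * j powr (1 / q)"
      by (simp add: c_def algebra_simps)
    then show ?thesis using bd[OF c] by simp
  qed
qed

lemma sum_powr_le:
  fixes t :: "'i::finite \<Rightarrow> real"
  assumes "\<And>i. 0 \<le> t i" "1 \<le> q"
  shows "(\<Sum>i\<in>UNIV. t i) powr q \<le> real CARD('i) powr q * (\<Sum>i\<in>UNIV. t i powr q)"
proof -
  define v where "v = Max (range t)"
  have vi: "t i \<le> v" for i unfolding v_def by (rule Max_ge) auto
  have "v \<in> range t" unfolding v_def by (rule Max_in) auto
  then obtain i where i: "v = t i" by blast
  have "(\<Sum>i\<in>UNIV. t i) \<le> real CARD('i) * v" using sum_bounded_above[of UNIV t v] vi by simp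
  then have "(\<Sum>i\<in>UNIV. t i) powr q \<le> (real CARD('i) * v) powr q"
    using assms by (intro powr_mono2) (auto intro: sum_nonneg)
  also have "\<dots> = real CARD('i) powr q * v powr q" using assms(1)[of i] i by (simp add: powr_mult)
  also have "v powr q \<le> (\<Sum>i\<in>UNIV. t i powr q)"
    unfolding i by (rule member_le_sum) auto
  finally show ?thesis by (simp add: mult_left_mono)
qed

lemma ennpowr_le:
  assumes "x \<le> ennreal (c powr q)" "0 \<le> c" "1 \<le> q"
  shows "ennpowr x (1 / q) \<le> ennreal c"
proof -
  have xf: "x \<noteq> \<infinity>" using assms(1) by (auto simp: top_unique)
  have "enn2real x \<le> c powr q" using assms by (intro enn2real_leI) auto
  then have "enn2real x powr (1 / q) \<le> (c powr q) powr (1 / q)"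
    using assms by (intro powr_mono2) auto
  also have "\<dots> = c" using assms by (simp add: powr_powr)
  finally show ?thesis using xf by (simp add: ennpowr_def ennreal_leI)
qed

lemma ennpowr_leD:
  assumes "ennpowr x (1 / q) \<le> ennreal c" "0 \<le> c" "1 \<le> q"
  shows "x \<le> ennreal (c powr q)"
proof -
  have xf: "x \<noteq> \<infinity>" using assms(1) by (auto simp: ennpowr_def top_unique)
  then have "enn2real x powr (1 / q) \<le> c" using assms by (simp add: ennpowr_def)
  then have "(enn2real x powr (1 / q)) powr q \<le> c powr q" using assms by (intro powr_mono2) auto
  then have "enn2real x \<le> c powr q" using assms by (simp add: powr_powr)
  then have "ennreal (enn2real x) \<le> ennreal (c powr q)" by (rule ennreal_leI)
  moreover have "ennreal (enn2real x) = x" using xf by (simp add: less_top)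
  ultimately show ?thesis by (simp only:)
qed

text \<open>Young's inequality up to a constant, for a function dominated by a weighted average of
  finitely many others. One factor m + 1 comes from the Jensen bound, the other from the mass of the
  weight after the integrals are exchanged. The number of functions enters once through the power of
  a sum and once through adding up the integrals.\<close>

lemma Lnorm_convolution:
  fixes f :: "'i::finite \<Rightarrow> real^3 \<Rightarrow> complex" and W :: "real^3 \<Rightarrow> real"
  assumes fm: "\<And>i. f i \<in> borel_measurable borel" and um: "u \<in> borel_measurable borel" and Wm: "W \<in> borel_measurable borel"
    and W0: "\<And>z. 0 \<le> W z" and W: "(\<integral>\<^sup>+z. ennreal (W z) \<partial>lborel) = ennreal m" "0 \<le> m"
    and B: "0 < B" and q: "1 \<le> q" and T: "\<And>i. Lnorm q (f i) \<le> T"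
    and u: "AE x in lborel. ennreal (norm (u x)) \<le> ennreal B * (\<integral>\<^sup>+y. ennreal (W (x - y) * (\<Sum>i\<in>UNIV. norm (f i y))) \<partial>lborel)"
  shows "Lnorm q u \<le> ennreal (B * (m + 1)\<^sup>2 * (real CARD('i))\<^sup>2) * T"
proof -
  define N where "N = real CARD('i)"
  have N: "1 \<le> N" unfolding N_def using zero_less_card_finite[where ?'a = 'i] by linarith
  define g where "g y = (\<Sum>i\<in>UNIV. norm (f i y))" for y
  have gm: "g \<in> borel_measurable borel" unfolding g_def[abs_def] by (intro borel_measurable_sum) (use fm in measurable)
  have g0: "0 \<le> g y" for y unfolding g_def by (intro sum_nonneg) simp
  have rm: "(\<lambda>y. W (x - y)) \<in> borel_measurable borel" for x
  proof -
    have "(\<lambda>y::real^3. x - y) \<in> borel_measurable borel" by (intro borel_measurable_continuous_onI continuous_intros)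
    from measurable_compose[OF this Wm] show ?thesis .
  qed
  have Wx: "(\<integral>\<^sup>+y. ennreal (W (x - y)) \<partial>lborel) = ennreal m" for x
    using nn_integral_lborel_reflect[of "\<lambda>z. ennreal (W z)" x] Wm W(1) by simp
  define K where "K = B * (m + 1)\<^sup>2 * N\<^sup>2"
  have K: "0 < K" using B W(2) N by (simp add: K_def)
  show ?thesis
  proof (cases "T = \<infinity>")
    case True
    then have "ennreal K * T = top" using K by (simp add: ennreal_mult_top)
    then show ?thesis by (simp only: K_def N_def top_greatest)
  next
    case False
    then obtain t where t: "T = ennreal t" "0 \<le> t" by (cases T) auto
    have "Lnorm q u \<le> ennreal (K * t)"
    proof (cases "q = \<infinity>")
      case True
      have "AE y in lborel. \<forall>i\<in>(UNIV::'i set). ennreal (norm (f i y)) \<le> T"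
      proof (rule AE_finite_allI)
        fix i
        have "esssup lborel (\<lambda>x. ennreal (norm (f i x))) \<le> T" using T[of i] True by (simp add: Lnorm_def)
        then show "AE y in lborel. ennreal (norm (f i y)) \<le> T"
          using esssup_AE[of "\<lambda>x. ennreal (norm (f i x))" lborel] by (auto elim: eventually_mono order_trans)
      qed simp
      then have gt: "AE y in lborel. g y \<le> N * t"
      proof eventually_elim
        case (elim y)
        then have "norm (f i y) \<le> t" for i using t by (auto simp: ennreal_le_iff)
        then show ?case unfolding g_def N_def using sum_bounded_above[of UNIV "\<lambda>i. norm (f i y)" t] by simp
      qed
      have "(\<integral>\<^sup>+y. ennreal (W (x - y) * g y) \<partial>lborel) \<le> ennreal (N * t * m)" for x
      proof -
        have "(\<integral>\<^sup>+y. ennreal (W (x - y) * g y) \<partial>lborel) \<le> (\<integral>\<^sup>+y. ennreal (N * t) * ennreal (W (x - y)) \<partial>lborel)"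
        proof (rule nn_integral_mono_AE)
          show "AE y in lborel. ennreal (W (x - y) * g y) \<le> ennreal (N * t) * ennreal (W (x - y))"
            using gt
          proof eventually_elim
            case (elim y)
            then have "W (x - y) * g y \<le> N * t * W (x - y)" using mult_left_mono[OF elim W0[of "x - y"]] by (simp add: mult.commute)
            then have "ennreal (W (x - y) * g y) \<le> ennreal (N * t * W (x - y))" by (rule ennreal_leI)
            then show ?case using N t W0 by (simp add: ennreal_mult)
          qed
        qed
        also have "\<dots> = ennreal (N * t * m)"
          using rm[of x] N t W by (simp add: nn_integral_cmult Wx ennreal_mult)
        finally show ?thesis .
      qed
      note gb = this
      have "AE x in lborel. ennreal (norm (u x)) \<le> ennreal (K * t)"
        using u
      proof eventually_elim
        case (elim x)
        also have "ennreal B * (\<integral>\<^sup>+y. ennreal (W (x - y) * (\<Sum>i\<in>UNIV. norm (f i y))) \<partial>lborel) \<le> ennreal B * ennreal (N * t * m)"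
          using gb[of x] unfolding g_def by (rule mult_left_mono) simp
        also have "\<dots> = ennreal (B * (N * t * m))" using B N t W by (simp add: ennreal_mult)
        also have "\<dots> \<le> ennreal (K * t)"
        proof (rule ennreal_leI)
          have "N * m \<le> N\<^sup>2 * (m + 1)\<^sup>2"
          proof (rule mult_mono)
            show "N \<le> N\<^sup>2" using N by (simp add: power2_eq_square)
            have "m + 1 \<le> (m + 1)\<^sup>2" using W(2) by (simp add: power2_eq_square)
            then show "m \<le> (m + 1)\<^sup>2" by linarith
          qed (use N W(2) in auto)
          then have "(B * t) * (N * m) \<le> (B * t) * (N\<^sup>2 * (m + 1)\<^sup>2)" using B t by (intro mult_left_mono) auto
          then show "B * (N * t * m) \<le> K * t" by (simp add: K_def mult_ac)
        qed
        finally show ?case .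
      qed
      then show ?thesis unfolding Lnorm_def using True um by (auto intro!: esssup_I)
    next
      case False
      define p where "p = enn2real q"
      have p: "1 \<le> p" unfolding p_def using q False enn2real_mono[of 1 q] by (simp add: less_top)
      have fi: "(\<integral>\<^sup>+y. ennreal (norm (f i y) powr p) \<partial>lborel) \<le> ennreal (t powr p)" for i
        using T[of i] False p t by (intro ennpowr_leD) (auto simp: Lnorm_def p_def)
      have gp: "(\<integral>\<^sup>+y. ennreal (g y powr p) \<partial>lborel) \<le> ennreal (N powr p * (N * t powr p))"
      proof -
        have "(\<integral>\<^sup>+y. ennreal (g y powr p) \<partial>lborel) \<le> (\<integral>\<^sup>+y. ennreal (N powr p) * (\<Sum>i\<in>UNIV. ennreal (norm (f i y) powr p)) \<partial>lborel)"
        proof (rule nn_integral_mono)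
          fix y
          have "g y powr p \<le> N powr p * (\<Sum>i\<in>UNIV. norm (f i y) powr p)"
            unfolding g_def N_def by (rule sum_powr_le) (use p in auto)
          then have "ennreal (g y powr p) \<le> ennreal (N powr p * (\<Sum>i\<in>UNIV. norm (f i y) powr p))" by (rule ennreal_leI)
          then show "ennreal (g y powr p) \<le> ennreal (N powr p) * (\<Sum>i\<in>UNIV. ennreal (norm (f i y) powr p))"
            by (simp add: ennreal_mult sum_nonneg sum_ennreal)
        qed
        also have "\<dots> = ennreal (N powr p) * (\<Sum>i\<in>UNIV. \<integral>\<^sup>+y. ennreal (norm (f i y) powr p) \<partial>lborel)"
        proof -
          have "(\<integral>\<^sup>+y. ennreal (N powr p) * (\<Sum>i\<in>UNIV. ennreal (norm (f i y) powr p)) \<partial>lborel) =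
              ennreal (N powr p) * (\<integral>\<^sup>+y. (\<Sum>i\<in>UNIV. ennreal (norm (f i y) powr p)) \<partial>lborel)"
            by (rule nn_integral_cmult) (use fm in measurable)
          also have "(\<integral>\<^sup>+y. (\<Sum>i\<in>UNIV. ennreal (norm (f i y) powr p)) \<partial>lborel) =
              (\<Sum>i\<in>UNIV. \<integral>\<^sup>+y. ennreal (norm (f i y) powr p) \<partial>lborel)"
            by (rule nn_integral_sum) (use fm in measurable)
          finally show ?thesis .
        qed
        also have "\<dots> \<le> ennreal (N powr p) * (\<Sum>i\<in>(UNIV::'i set). ennreal (t powr p))"
          by (intro mult_left_mono sum_mono fi) simp
        also have "\<dots> = ennreal (N powr p * (N * t powr p))"
          by (simp add: N_def ennreal_mult ennreal_of_nat_eq_real_of_nat)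
        finally show ?thesis .
      qed
      define Jx where "Jx x = (\<integral>\<^sup>+y. ennreal (W (x - y) * g y powr p) \<partial>lborel)" for x
      have ux: "AE x in lborel. ennreal (norm (u x) powr p) \<le> ennreal ((B * (m + 1)) powr p) * Jx x"
        using u
      proof eventually_elim
        case (elim x)
        show ?case
        proof (cases "Jx x = \<infinity>")
          case True
          have "0 < (B * (m + 1)) powr p" using B W by simp
          then show ?thesis using True by (simp add: ennreal_mult_top)
        next
          case False
          then obtain j where j: "Jx x = ennreal j" "0 \<le> j" by (cases "Jx x") auto
          have "(\<integral>\<^sup>+y. ennreal (W (x - y) * g y) \<partial>lborel) \<le> ennreal ((m + 1) * j powr (1 / p))"
            by (rule nn_integral_jensen[OF _ _ W0 g0 Wx W(2) p j(1)[unfolded Jx_def] j(2)]) (use rm gm in simp_all)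
          then have "ennreal B * (\<integral>\<^sup>+y. ennreal (W (x - y) * g y) \<partial>lborel) \<le> ennreal B * ennreal ((m + 1) * j powr (1 / p))"
            by (rule mult_left_mono) simp
          then have "ennreal (norm (u x)) \<le> ennreal (B * ((m + 1) * j powr (1 / p)))"
            using elim B W unfolding g_def by (simp add: ennreal_mult)
          then have "norm (u x) \<le> (B * (m + 1)) * j powr (1 / p)"
            using B W by (simp add: ennreal_le_iff mult.assoc)
          then have "norm (u x) powr p \<le> ((B * (m + 1)) * j powr (1 / p)) powr p" using p by (intro powr_mono2) auto
          also have "\<dots> = (B * (m + 1)) powr p * j"
            using B W j p by (simp add: powr_mult powr_powr)
          finally have "ennreal (norm (u x) powr p) \<le> ennreal ((B * (m + 1)) powr p * j)" by (rule ennreal_leI)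
          then show ?thesis using j by (simp add: ennreal_mult)
        qed
      qed
      have pm: "(\<lambda>(x, y). ennreal (W (x - y) * g y powr p)) \<in> borel_measurable (lborel \<Otimes>\<^sub>M lborel)"
      proof -
        have "(\<lambda>z. fst z - snd z) \<in> borel_measurable (borel \<Otimes>\<^sub>M (borel :: (real^3) measure))" by measurable
        from measurable_compose[OF this Wm]
        have 1: "(\<lambda>z. W (fst z - snd z)) \<in> borel_measurable (lborel \<Otimes>\<^sub>M lborel)" by (simp add: measurable_cong_sets[OF sets_pair_measure_cong[OF sets_lborel sets_lborel] refl])
        have 2: "(\<lambda>z. g (snd z)) \<in> borel_measurable (lborel \<Otimes>\<^sub>M lborel)"
          using measurable_compose[OF measurable_snd[of lborel lborel], of g borel] gm by simp
        show ?thesis unfolding split_beta' using 1 2 by measurable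
      qed
      have "(\<integral>\<^sup>+x. Jx x \<partial>lborel) = (\<integral>\<^sup>+y. \<integral>\<^sup>+x. ennreal (W (x - y) * g y powr p) \<partial>lborel \<partial>lborel)"
        unfolding Jx_def by (rule lborel_pair.Fubini'[OF pm, symmetric])
      also have "\<dots> = (\<integral>\<^sup>+y. ennreal m * ennreal (g y powr p) \<partial>lborel)"
      proof (rule nn_integral_cong)
        fix y
        have "(\<integral>\<^sup>+x. ennreal (W (x - y) * g y powr p) \<partial>lborel) = (\<integral>\<^sup>+x. ennreal (W (x - y)) * ennreal (g y powr p) \<partial>lborel)"
          using W0 by (simp add: ennreal_mult)
        also have "\<dots> = (\<integral>\<^sup>+x. ennreal (W (x - y)) \<partial>lborel) * ennreal (g y powr p)"
          by (rule nn_integral_multc) (use Wm in measurable)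
        also have "(\<integral>\<^sup>+x. ennreal (W (x - y)) \<partial>lborel) = ennreal m"
          using nn_integral_lborel_translate[of "\<lambda>z. ennreal (W z)" y] Wm W(1) by simp
        finally show "(\<integral>\<^sup>+x. ennreal (W (x - y) * g y powr p) \<partial>lborel) = ennreal m * ennreal (g y powr p)" .
      qed
      also have "\<dots> = ennreal m * (\<integral>\<^sup>+y. ennreal (g y powr p) \<partial>lborel)"
        by (rule nn_integral_cmult) (use gm in measurable)
      also have "\<dots> \<le> ennreal m * ennreal (N powr p * (N * t powr p))" by (intro mult_left_mono gp) simp
      finally have Ji: "(\<integral>\<^sup>+x. Jx x \<partial>lborel) \<le> ennreal (m * (N powr p * (N * t powr p)))"
        using W N by (simp add: ennreal_mult)
      have Jm: "Jx \<in> borel_measurable lborel"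
        unfolding Jx_def[abs_def] using pm by (rule lborel.borel_measurable_nn_integral)
      have "(\<integral>\<^sup>+x. ennreal (norm (u x) powr p) \<partial>lborel) \<le> (\<integral>\<^sup>+x. ennreal ((B * (m + 1)) powr p) * Jx x \<partial>lborel)"
        by (rule nn_integral_mono_AE[OF ux])
      also have "\<dots> = ennreal ((B * (m + 1)) powr p) * (\<integral>\<^sup>+x. Jx x \<partial>lborel)" by (rule nn_integral_cmult[OF Jm])
      also have "\<dots> \<le> ennreal ((B * (m + 1)) powr p) * ennreal (m * (N powr p * (N * t powr p)))" by (intro mult_left_mono Ji) simp
      also have "\<dots> = ennreal ((B * (m + 1)) powr p * (m * (N powr p * (N * t powr p))))"
        using W N by (simp add: ennreal_mult)
      also have "\<dots> \<le> ennreal ((K * t) powr p)"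
      proof (rule ennreal_leI)
        \<comment> \<open>Constants must be p-th powers for the final root to leave something
          independent of p. This works for m + 1 and N since both are at least 1.\<close>
        have m1: "m \<le> (m + 1) powr p"
        proof -
          have "(m + 1) powr 1 \<le> (m + 1) powr p" using p W by (intro powr_mono) auto
          then show ?thesis using W by simp
        qed
        have n1: "N \<le> N powr p" using powr_mono[of 1 p N] p N by simp
        have "m * (N powr p * (N * t powr p)) \<le> (m + 1) powr p * (N powr p * (N powr p * t powr p))"
          using m1 n1 W N by (intro mult_mono mult_left_mono mult_right_mono) auto
        then have "(B * (m + 1)) powr p * (m * (N powr p * (N * t powr p))) \<le> (B * (m + 1)) powr p * ((m + 1) powr p * (N powr p * (N powr p * t powr p)))"
          by (rule mult_left_mono) simp
        also have "\<dots> = (K * t) powr p"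
          unfolding K_def power2_eq_square using B W N t by (simp add: powr_mult mult_ac)
        finally show "(B * (m + 1)) powr p * (m * (N powr p * (N * t powr p))) \<le> (K * t) powr p" .
      qed
      finally have "(\<integral>\<^sup>+x. ennreal (norm (u x) powr p) \<partial>lborel) \<le> ennreal ((K * t) powr p)" .
      then have "ennpowr (\<integral>\<^sup>+x. ennreal (norm (u x) powr p) \<partial>lborel) (1 / p) \<le> ennreal (K * t)"
        by (rule ennpowr_le) (use K t p in auto)
      then show ?thesis using False by (simp add: Lnorm_def p_def)
    qed
    then show ?thesis using K t by (simp add: ennreal_mult K_def N_def)
  qed
qed

section \<open>Boundedness of the angular cut-off and the final estimate\<close>

context angular_setup
begin

text \<open>Testing the \<open>L\<^sup>2\<close> bound of the net on the indicator functions of the sets where the cut-off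
  exceeds \<open>A\<close> shows that these sets are null.\<close>

lemma ac_bound:
  assumes b: "base \<rho> \<beta>"
  shows "AE x in lborel. \<bar>ac \<rho> \<beta> x\<bar> \<le> A"
proof -
  \<comment> \<open>Intersecting with balls makes the test functions square integrable. The sign of
    \<sigma> is unrestricted, so the quotient defining the cut-off has no evident bound by
    1.\<close>
  define E where "E n = {x \<in> cball 0 (real n). A < \<bar>ac \<rho> \<beta> x\<bar>}" for n
  have A: "1 \<le> A" using params by simp
  have Em: "E n \<in> sets borel" for n
  proof -
    have "E n = cball 0 (real n) \<inter> {x \<in> space borel. A < \<bar>ac \<rho> \<beta> x\<bar>}" by (auto simp: E_def)
    also have "\<dots> \<in> sets borel" by (intro sets.Int) (auto, measurable)
    finally show ?thesis .
  qed
  have Ef: "emeasure lborel (E n) < \<infinity>" for n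
  proof -
    have "emeasure lborel (E n) \<le> emeasure lborel (cball (0::real^3) (real n))"
      by (rule emeasure_mono) (auto simp: E_def)
    also have "\<dots> < \<infinity>" by (rule emeasure_compact_finite[OF compact_cball])
    finally show ?thesis .
  qed
  have null: "AE x in lborel. x \<notin> E n" for n
  proof -
    define u where "u x = complex_of_real (indicator (E n) x)" for x
    define v where "v = measure lborel (E n)"
    have ev: "emeasure lborel (E n) = ennreal v" using Ef[of n] by (simp add: v_def emeasure_eq_ennreal_measure less_top[symmetric])
    have v: "0 \<le> v" by (simp add: v_def)
    have um: "u \<in> borel_measurable borel" unfolding u_def[abs_def] using Em by measurable
    have L2: "Lnorm 2 w = ennpowr (\<integral>\<^sup>+x. ennreal ((norm (w x))\<^sup>2) \<partial>lborel) (1 / 2)" for w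
      by (simp add: Lnorm_def powr_numeral)
    have "(\<integral>\<^sup>+x. ennreal ((norm (u x))\<^sup>2) \<partial>lborel) = (\<integral>\<^sup>+x. indicator (E n) x \<partial>lborel)"
      by (intro nn_integral_cong) (simp add: u_def indicator_def)
    also have "\<dots> = ennreal v" using Em ev by simp
    finally have Lu: "Lnorm 2 u = ennreal (v powr (1 / 2))" unfolding L2 by (simp add: ennpowr_def v)
    have "angular_net \<sigma> A \<rho> (S \<rho>)" using net b by (simp add: base_def)
    then have fin: "finite (S \<rho>)" and nl: "ennpowr (\<Sum>\<beta>\<in>S \<rho>. (Lnorm 2 (\<lambda>x. of_real (ac \<rho> \<beta> x) * u x))\<^sup>2) (1/2) \<le> ennreal A * Lnorm 2 u"
      using um Lu unfolding angular_net_def Let_def by auto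
    define w where "w x = of_real (ac \<rho> \<beta> x) * u x" for x
    have "(Lnorm 2 w)\<^sup>2 \<le> (\<Sum>\<beta>\<in>S \<rho>. (Lnorm 2 (\<lambda>x. of_real (ac \<rho> \<beta> x) * u x))\<^sup>2)"
      unfolding w_def[abs_def] by (rule member_le_sum) (use fin b in \<open>auto simp: base_def\<close>)
    also have "\<dots> \<le> ennreal ((A * v powr (1 / 2)) powr 2)"
      by (rule ennpowr_leD) (use nl Lu A v in \<open>auto simp: ennreal_mult\<close>)
    finally have w2: "(Lnorm 2 w)\<^sup>2 \<le> ennreal (A\<^sup>2 * v)"
      using A v by (simp add: powr_mult powr_powr powr_numeral)
    define X where "X = (\<integral>\<^sup>+x. ennreal ((norm (w x))\<^sup>2) \<partial>lborel)"
    have Xf: "X \<noteq> \<infinity>"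
    proof
      assume "X = \<infinity>"
      then have "Lnorm 2 w = \<infinity>" unfolding L2 X_def[symmetric] by (simp add: ennpowr_def)
      then show False using w2 by (simp add: power2_eq_square top_unique ennreal_top_mult)
    qed
    have "X \<le> ennreal (A\<^sup>2 * v)"
    proof -
      have xr: "X = ennreal (enn2real X)" using Xf by (simp add: less_top)
      have "(Lnorm 2 w)\<^sup>2 = ennreal (enn2real X powr (1/2)) ^ 2"
        unfolding L2 X_def[symmetric] using Xf by (simp add: ennpowr_def)
      also have "\<dots> = ennreal ((enn2real X powr (1/2)) ^ 2)" by (simp add: ennreal_power)
      also have "(enn2real X powr (1/2)) ^ 2 = enn2real X" by (simp add: powr_half_sqrt)
      also have "ennreal (enn2real X) = X" using xr by simp
      finally show ?thesis using w2 by simp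
    qed
    moreover have "(\<integral>\<^sup>+x. ennreal (A\<^sup>2) * indicator (E n) x \<partial>lborel) = ennreal (A\<^sup>2 * v)"
      using Em ev v by (simp add: nn_integral_cmult ennreal_mult)
    \<comment> \<open>On \<open>E n\<close> the squared cut-off exceeds A^2, but the integrals
      compare the other way round. Their nonnegative difference therefore vanishes almost
      everywhere, which is impossible on \<open>E n\<close>.\<close>
    ultimately have le: "X \<le> (\<integral>\<^sup>+x. ennreal (A\<^sup>2) * indicator (E n) x \<partial>lborel)" by simp
    have ge: "ennreal (A\<^sup>2) * indicator (E n) x \<le> ennreal ((norm (w x))\<^sup>2)" for x
    proof (cases "x \<in> E n")
      case True
      then have "A\<^sup>2 \<le> \<bar>ac \<rho> \<beta> x\<bar>\<^sup>2" using A by (intro power_mono) (auto simp: E_def)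
      then show ?thesis using True by (simp add: w_def u_def norm_mult)
    qed simp
    have wm: "(\<lambda>x. ennreal ((norm (w x))\<^sup>2)) \<in> borel_measurable lborel"
      unfolding w_def[abs_def] using um by measurable
    have im: "(\<lambda>x. ennreal (A\<^sup>2) * indicator (E n) x) \<in> borel_measurable lborel" using Em by measurable
    have "(\<integral>\<^sup>+x. ennreal (A\<^sup>2) * indicator (E n) x \<partial>lborel) \<noteq> \<infinity>"
      using Em ev v by (simp add: nn_integral_cmult ennreal_mult_eq_top_iff)
    then have "(\<integral>\<^sup>+x. ennreal ((norm (w x))\<^sup>2) - ennreal (A\<^sup>2) * indicator (E n) x \<partial>lborel) =
        X - (\<integral>\<^sup>+x. ennreal (A\<^sup>2) * indicator (E n) x \<partial>lborel)"
      unfolding X_def by (intro nn_integral_diff wm im AE_I2 ge) auto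
    also have "\<dots> = 0" using le Xf by (simp add: diff_eq_0_iff_ennreal less_top)
    finally have "(\<integral>\<^sup>+x. ennreal ((norm (w x))\<^sup>2) - ennreal (A\<^sup>2) * indicator (E n) x \<partial>lborel) = 0" .
    then have "AE x in lborel. ennreal ((norm (w x))\<^sup>2) - ennreal (A\<^sup>2) * indicator (E n) x = 0"
      by (subst (asm) nn_integral_0_iff_AE) (use wm im in auto)
    then show ?thesis
    proof eventually_elim
      case (elim x)
      show ?case
      proof
        assume x: "x \<in> E n"
        then have "A\<^sup>2 < \<bar>ac \<rho> \<beta> x\<bar>\<^sup>2" using A by (intro power_strict_mono) (auto simp: E_def)
        then have "0 < ennreal (\<bar>ac \<rho> \<beta> x\<bar>\<^sup>2 - A\<^sup>2)" by simp
        then show False using elim x by (simp add: w_def u_def norm_mult ennreal_minus)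
      qed
    qed
  qed
  have "AE x in lborel. \<forall>n. x \<notin> E n" using null by (simp add: AE_all_countable)
  then show ?thesis
  proof eventually_elim
    case (elim x)
    obtain n where "norm x \<le> real n" using real_arch_simple by blast
    then show ?case using elim[rule_format, of n] by (auto simp: E_def)
  qed
qed

text \<open>One frame serves every direction in the support; this makes the weight independent of
  the point x.\<close>

lemma frame_exists:
  assumes "base \<rho> \<beta>" "r \<in> scales C1 \<rho>" "l \<in> {1..N}"
  obtains Q where "orthogonal_transformation Q" "\<And>e. e \<in> supp (ac \<rho> \<beta>) \<Longrightarrow> framed \<rho> \<beta> r l e Q"
proof -
  have "norm (axis 1 1 :: real^3) = norm (\<alpha> \<rho> \<beta> r l)"
    using base_whitney(1)[OF assms(1-3)] by (simp add: norm_axis_1)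
  then obtain Q :: "real^3 \<Rightarrow> real^3" where Q: "orthogonal_transformation Q" "Q (axis 1 1) = \<alpha> \<rho> \<beta> r l"
    by (rule orthogonal_transformation_exists)
  show thesis by (rule that[OF Q(1)]) (use Q assms in \<open>auto simp: framed_def\<close>)
qed

lemma fourier_mult_measurable:
  assumes \<phi>: "tempered_fun \<phi>" and f [measurable]: "f \<in> borel_measurable borel"
  shows "fourier_mult f \<phi> \<in> borel_measurable borel"
proof -
  have "(\<lambda>(z, \<xi>). complex_of_real (f \<xi>) * cis (z \<bullet> \<xi>)) \<in> borel_measurable (borel \<Otimes>\<^sub>M lborel)"
    by measurable
  then have "osc f \<in> borel_measurable borel"
    unfolding osc_def[abs_def] by (rule lborel.borel_measurable_lebesgue_integral)
  then have "kern f \<in> borel_measurable borel" unfolding kern_def[abs_def] by measurable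
  moreover have "\<phi> \<in> borel_measurable borel" using \<phi> by (simp add: tempered_fun_def)
  ultimately have "tconv \<phi> (kern f) \<in> borel_measurable borel" by (intro tconv_measurable)
  then show ?thesis by (simp add: fun_eq_iff fourier_mult_eq_tconv[abs_def])
qed

text \<open>Six functions, each of the three rotation fields paired with a copy of the frequency
  piece, so that the sum of the \<open>gsum\<close> terms runs over a single finite index
  type.\<close>

definition piece :: "int \<Rightarrow> (real^3 \<Rightarrow> complex) \<Rightarrow> 3 \<times> bool \<Rightarrow> real^3 \<Rightarrow> complex" where
  "piece k \<phi> i = (if snd i then Omega (ca (fst i)) (cb (fst i)) (LP chi k \<phi>) else LP chi k \<phi>)"

lemma gsum_piece: "(\<Sum>n\<in>UNIV. gsum k \<phi> n y) = (\<Sum>i\<in>UNIV. norm (piece k \<phi> i y))"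
proof -
  have "(\<Sum>i\<in>UNIV. norm (piece k \<phi> i y)) = (\<Sum>n\<in>UNIV. \<Sum>b\<in>UNIV. norm (piece k \<phi> (n, b) y))"
    by (simp add: sum.cartesian_product UNIV_Times_UNIV[symmetric] split_beta del: UNIV_Times_UNIV)
  also have "\<dots> = (\<Sum>n\<in>UNIV. gsum k \<phi> n y)"
    by (intro sum.cong refl) (simp add: UNIV_bool piece_def gsum_def add.commute)
  finally show ?thesis ..
qed

lemma piece_measurable: "tempered_fun \<phi> \<Longrightarrow> piece k \<phi> i \<in> borel_measurable borel"
proof -
  assume \<phi>: "tempered_fun \<phi>"
  have c: "(\<lambda>x::real^3. complex_of_real (x $ j)) \<in> borel_measurable borel" for j by measurable
  have "Omega a b (LP chi k \<phi>) \<in> borel_measurable borel" for a b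
  proof -
    have "Omega a b (LP chi k \<phi>) = (\<lambda>x. of_real (x $ a) * dlp k \<phi> b x - of_real (x $ b) * dlp k \<phi> a x)"
      by (rule ext, rule LP_facts(6)[OF \<phi>])
    then show ?thesis using LP_facts(4)[OF \<phi>] c by (simp add: borel_measurable_diff borel_measurable_times)
  qed
  then show ?thesis using LP_facts(2)[OF \<phi>] by (simp add: piece_def)
qed

lemma main_estimate:
  assumes q: "1 \<le> q"
  shows "\<exists>K>0. \<forall>\<rho>\<in>P. \<rho> \<le> - C1 \<longrightarrow>
    (\<forall>\<beta>\<in>S \<rho>. \<forall>L::int. \<forall>k::int. \<forall>r\<in>scales C1 \<rho>. \<forall>l\<in>{1..N}. \<forall>\<phi>. tempered_fun \<phi> \<longrightarrow>
      Lnorm q (\<lambda>x. of_real (dyadic_cutoff chi L x * angular_cutoff \<sigma> \<rho> (S \<rho>) \<beta> x) *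
          fourier_mult (\<lambda>\<xi>. eta \<sigma> C1 C2 C3 C3' N \<rho> \<beta> (\<alpha> \<rho> \<beta>) r l \<xi> * dyadic_cutoff chi k \<xi>) \<phi> x)
      \<le> ennreal (K * 2 powr (- (L + k + 2 * r))) *
          (Lnorm q (LP chi k \<phi>) + (MAX (i, j)\<in>UNIV. Lnorm q (Omega i j (LP chi k \<phi>)))))"
proof -
  obtain C where C: "0 < C"
    "\<And>\<rho> \<beta> k r l x Q \<phi>. framed \<rho> \<beta> r l (sgn x) Q \<Longrightarrow> tempered_fun \<phi> \<Longrightarrow>
      ennreal (norm x * norm (fourier_mult (\<lambda>\<xi>. \<eta> \<rho> \<beta> r l \<xi> * dyadic_cutoff chi k \<xi>) \<phi> x)) \<le>
        ennreal (C / (2 powr k * 2 powr r * 2 powr r)) *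
        (\<Sum>n\<in>UNIV. \<integral>\<^sup>+y. ennreal (weight (axes_len k r) Q (x - y) * gsum k \<phi> n y) \<partial>lborel)"
    by (rule pointwise_bound) (rule that)
  obtain D0 where D0: "\<And>k \<xi>. \<bar>dyadic_cutoff chi k \<xi>\<bar> \<le> D0" using dyadic_bounded by blast
  define D where "D = \<bar>D0\<bar> + 1"
  have D: "0 < D" "\<And>k \<xi>. \<bar>dyadic_cutoff chi k \<xi>\<bar> \<le> D"
  proof -
    show "0 < D" unfolding D_def by linarith
    show "\<bar>dyadic_cutoff chi k \<xi>\<bar> \<le> D" for k \<xi> using D0[of k \<xi>] unfolding D_def by linarith
  qed
  have A: "1 \<le> A" using params by simp
  define m where "m = enn2real cauchy_mass"
  have m: "cauchy_mass = ennreal m" "0 \<le> m" using cauchy_mass_finite by (simp_all add: m_def less_top)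
  define n6 where "n6 = real CARD(3 \<times> bool)"
  have n6: "0 < n6" by (simp add: n6_def)
  \<comment> \<open>D bounds the dyadic cut-off and A the angular one, 2 comes from |x| \<ge> 2^L /
    2 on the annulus, and C is the kernel constant. The remaining factors come from the convolution
    inequality for six functions.\<close>
  define K where "K = (2 * D * A * C) * (m + 1)\<^sup>2 * n6\<^sup>2"
  have K: "0 < K" using D C A m n6 by (simp add: K_def)
  show ?thesis
  proof (intro exI[of _ K] conjI ballI allI impI K)
    fix \<rho> \<beta> and L k r :: int and l \<phi>
    assume h: "\<rho> \<in> P" "\<rho> \<le> - C1" "\<beta> \<in> S \<rho>" "r \<in> scales C1 \<rho>" "l \<in> {1..N}" and \<phi>: "tempered_fun \<phi>"
    have b: "base \<rho> \<beta>" using h by (simp add: base_def)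
    obtain Q where Q: "orthogonal_transformation Q" "\<And>e. e \<in> supp (ac \<rho> \<beta>) \<Longrightarrow> framed \<rho> \<beta> r l e Q"
      by (rule frame_exists[OF b h(4,5)]) (rule that)
    define F where "F = fourier_mult (\<lambda>\<xi>. \<eta> \<rho> \<beta> r l \<xi> * dyadic_cutoff chi k \<xi>) \<phi>"
    define u where "u x = of_real (dyadic_cutoff chi L x * ac \<rho> \<beta> x) * F x" for x
    define W where "W = weight (axes_len k r) Q"
    define c where "c = 2 powr real_of_int k * 2 powr real_of_int r * 2 powr real_of_int r"
    have c: "0 < c" by (simp add: c_def)
    define B where "B = 2 * D * A * C / (2 powr real_of_int L * c)"
    have B: "0 < B" using D A C c by (simp add: B_def)
    define T where "T = Lnorm q (LP chi k \<phi>) + (MAX (i, j)\<in>UNIV. Lnorm q (Omega i j (LP chi k \<phi>)))"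
    have Tp: "Lnorm q (piece k \<phi> i) \<le> T" for i
    proof (cases "snd i")
      case True
      have "Lnorm q (Omega (ca (fst i)) (cb (fst i)) (LP chi k \<phi>)) \<le> (MAX (i, j)\<in>UNIV. Lnorm q (Omega i j (LP chi k \<phi>)))"
        by (rule Max_ge) (auto intro: rev_image_eqI[of "(ca (fst i), cb (fst i))"])
      then show ?thesis using True by (simp add: piece_def T_def add_increasing)
    next
      case False
      then show ?thesis by (simp add: piece_def T_def)
    qed
    have W0: "0 \<le> W z" for z unfolding W_def by (rule weight_nonneg[OF axes_len_pos])
    have Wm: "W \<in> borel_measurable borel" unfolding W_def by (rule weight_measurable)
    have Wi: "(\<integral>\<^sup>+z. ennreal (W z) \<partial>lborel) = ennreal m"
      unfolding W_def m(1)[symmetric] by (rule nn_integral_weight[OF Q(1) axes_len_pos])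
    have rm: "(\<lambda>y. W (x - y)) \<in> borel_measurable borel" for x
    proof -
      have "(\<lambda>y::real^3. x - y) \<in> borel_measurable borel" by (intro borel_measurable_continuous_onI continuous_intros)
      from measurable_compose[OF this Wm] show ?thesis .
    qed
    have gm: "gsum k \<phi> n \<in> borel_measurable borel" for n
      using piece_measurable[OF \<phi>, of k "(n, True)"] piece_measurable[OF \<phi>, of k "(n, False)"]
      unfolding gsum_def[abs_def] piece_def by (simp add: borel_measurable_add)
    have sumW: "(\<Sum>n\<in>UNIV. \<integral>\<^sup>+y. ennreal (W (x - y) * gsum k \<phi> n y) \<partial>lborel) = (\<integral>\<^sup>+y. ennreal (W (x - y) * (\<Sum>i\<in>UNIV. norm (piece k \<phi> i y))) \<partial>lborel)" for x
    proof -
      have "(\<Sum>n\<in>UNIV. \<integral>\<^sup>+y. ennreal (W (x - y) * gsum k \<phi> n y) \<partial>lborel) = (\<integral>\<^sup>+y. (\<Sum>n\<in>UNIV. ennreal (W (x - y) * gsum k \<phi> n y)) \<partial>lborel)"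
        by (rule nn_integral_sum[symmetric]) (use rm[of x] gm in simp)
      also have "\<dots> = (\<integral>\<^sup>+y. ennreal (W (x - y) * (\<Sum>i\<in>UNIV. norm (piece k \<phi> i y))) \<partial>lborel)"
      proof (rule nn_integral_cong)
        fix y
        have "(\<Sum>n\<in>UNIV. ennreal (W (x - y) * gsum k \<phi> n y)) = ennreal (\<Sum>n\<in>UNIV. W (x - y) * gsum k \<phi> n y)"
          by (rule sum_ennreal) (use W0 in \<open>simp add: gsum_def\<close>)
        then show "(\<Sum>n\<in>UNIV. ennreal (W (x - y) * gsum k \<phi> n y)) = ennreal (W (x - y) * (\<Sum>i\<in>UNIV. norm (piece k \<phi> i y)))"
          by (simp only: sum_distrib_left[symmetric] gsum_piece)
      qed
      finally show ?thesis .
    qed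
    have Fm: "F \<in> borel_measurable borel"
      unfolding F_def by (rule fourier_mult_measurable[OF \<phi>]) measurable
    have um: "u \<in> borel_measurable borel"
      unfolding u_def[abs_def] using Fm by measurable
    have "AE x in lborel. ennreal (norm (u x)) \<le> ennreal B * (\<integral>\<^sup>+y. ennreal (W (x - y) * (\<Sum>i\<in>UNIV. norm (piece k \<phi> i y))) \<partial>lborel)"
      using ac_bound[OF b]
    proof eventually_elim
      case (elim x)
      define I where "I = (\<integral>\<^sup>+y. ennreal (W (x - y) * (\<Sum>i\<in>UNIV. norm (piece k \<phi> i y))) \<partial>lborel)"
      show ?case
      proof (cases "dyadic_cutoff chi L x = 0 \<or> ac \<rho> \<beta> x = 0")
        case True
        then show ?thesis by (auto simp: u_def)
      next
        case False
        then have xa: "x \<in> annulus L" using dyadic_zero by blast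
        have l2: "0 < 2 powr real_of_int L" by simp
        have xL: "2 powr L / 2 \<le> norm x" using xa by (simp add: annulus_def)
        then have x0: "x \<noteq> 0" using l2 by (auto simp del: powr_gt_zero)
        \<comment> \<open>Where the angular cut-off does not vanish, the direction of x lies in its
          support, and this makes it an admissible value of \<open>e\<close> in the kernel
          bound.\<close>
        have "ac \<rho> \<beta> (sgn x) \<noteq> 0" using False by (simp add: \<eta>_sgn)
        then have "sgn x \<in> supp (ac \<rho> \<beta>)" using closed_support_zero[OF sgn_sphere[OF x0]] by blast
        from C(2)[OF Q(2)[OF this] \<phi>, of k]
        have main: "ennreal (norm x * norm (F x)) \<le> ennreal (C / c) * I"
          unfolding F_def[symmetric] c_def[symmetric] W_def[symmetric] sumW I_def[symmetric] .
        have "norm (u x) = \<bar>dyadic_cutoff chi L x\<bar> * \<bar>ac \<rho> \<beta> x\<bar> * norm (F x)"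
          by (simp add: u_def norm_mult abs_mult)
        also have "\<dots> \<le> D * A * norm (F x)"
          using D elim A by (intro mult_mono mult_right_mono) auto
        also have "\<dots> \<le> D * A * (2 / 2 powr L * (norm x * norm (F x)))"
        proof -
          have "1 \<le> 2 / 2 powr L * norm x" using xL l2 by (simp add: pos_le_divide_eq)
          then have "1 * norm (F x) \<le> 2 / 2 powr L * norm x * norm (F x)" by (rule mult_right_mono) simp
          then show ?thesis using D A by (intro mult_left_mono) (auto simp: mult.assoc)
        qed
        finally have "ennreal (norm (u x)) \<le> ennreal (D * A * (2 / 2 powr L) * (norm x * norm (F x)))"
          by (intro ennreal_leI) (simp add: mult_ac)
        also have "\<dots> = ennreal (D * A * (2 / 2 powr L)) * ennreal (norm x * norm (F x))"
          using D A by (intro ennreal_mult) auto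
        also have "\<dots> \<le> ennreal (D * A * (2 / 2 powr L)) * (ennreal (C / c) * I)"
          by (rule mult_left_mono[OF main]) simp
        also have "\<dots> = ennreal (D * A * (2 / 2 powr L) * (C / c)) * I"
          using D A C c by (subst ennreal_mult) (auto simp: mult.assoc)
        also have "D * A * (2 / 2 powr L) * (C / c) = B" by (simp add: B_def)
        finally show ?thesis unfolding I_def .
      qed
    qed
    from Lnorm_convolution[OF piece_measurable[OF \<phi>] um Wm W0 Wi m(2) B q Tp this]
    have "Lnorm q u \<le> ennreal (B * (m + 1)\<^sup>2 * n6\<^sup>2) * T" unfolding n6_def .
    also have "B * (m + 1)\<^sup>2 * n6\<^sup>2 = K * 2 powr (- (L + k + 2 * r))"
    proof -
      have "2 powr (- (real_of_int L + real_of_int k + 2 * real_of_int r)) = 1 / (2 powr real_of_int L * c)"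
        unfolding powr_minus_divide c_def by (simp add: powr_add[symmetric] algebra_simps)
      then show ?thesis by (simp add: K_def B_def mult_ac)
    qed
    finally show "Lnorm q (\<lambda>x. of_real (dyadic_cutoff chi L x * angular_cutoff \<sigma> \<rho> (S \<rho>) \<beta> x) *
          fourier_mult (\<lambda>\<xi>. eta \<sigma> C1 C2 C3 C3' N \<rho> \<beta> (\<alpha> \<rho> \<beta>) r l \<xi> * dyadic_cutoff chi k \<xi>) \<phi> x)
      \<le> ennreal (K * 2 powr (- (L + k + 2 * r))) *
          (Lnorm q (LP chi k \<phi>) + (MAX (i, j)\<in>UNIV. Lnorm q (Omega i j (LP chi k \<phi>))))"
      unfolding T_def u_def[abs_def] F_def .
  qed
qed

end

theorem lemma5p2:
  fixes chi :: "real^3 \<Rightarrow> real" and \<sigma> :: "real \<Rightarrow> real"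
    and A C1 C2 C3 C3' C4 :: real and N :: nat
    and P :: "real set"
    and S :: "real \<Rightarrow> (real^3) set"
    and \<alpha> :: "real \<Rightarrow> real^3 \<Rightarrow> int \<Rightarrow> nat \<Rightarrow> real^3"
    and q :: ennreal
  assumes chi_props: "smooth_on UNIV chi" "\<forall>\<xi>. 0 \<le> chi \<xi>" "\<forall>\<xi> \<zeta>. norm \<xi> = norm \<zeta> \<longrightarrow> chi \<xi> = chi \<zeta>"
      "closed_support UNIV chi \<subseteq> cball 0 2" "\<forall>\<xi>\<in>cball 0 1. chi \<xi> = 1"
    and sigma_props: "smooth_on {0<..} \<sigma>" "closed_support {0..} \<sigma> \<subseteq> {0..101/100}"
      "\<forall>t\<in>{0..1}. \<sigma> t = 1"
    and params: "0 < C1" "0 < C2" "0 < C3" "0 < C3'" "C3' \<le> C3" "0 < C4" "0 < N" "1 \<le> A"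
    and P: "P \<subseteq> {..0}"
    and net: "\<forall>\<rho>\<in>P. angular_net \<sigma> A \<rho> (S \<rho>)"
    and whitney: "\<forall>\<rho>\<in>P. \<rho> \<le> - C1 \<longrightarrow>
      (\<forall>\<beta>\<in>S \<rho>. whitney_partition \<sigma> A C1 C2 C3 C3' C4 N \<rho> (S \<rho>) \<beta> (\<alpha> \<rho> \<beta>))"
    and q: "1 \<le> q"
  shows "\<exists>K>0. \<forall>\<rho>\<in>P. \<rho> \<le> - C1 \<longrightarrow>
    (\<forall>\<beta>\<in>S \<rho>. \<forall>L::int. \<forall>k::int. \<forall>r\<in>scales C1 \<rho>. \<forall>l\<in>{1..N}. \<forall>\<phi>. tempered_fun \<phi> \<longrightarrow>
      Lnorm q (\<lambda>x. of_real (dyadic_cutoff chi L x * angular_cutoff \<sigma> \<rho> (S \<rho>) \<beta> x) *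
          fourier_mult (\<lambda>\<xi>. eta \<sigma> C1 C2 C3 C3' N \<rho> \<beta> (\<alpha> \<rho> \<beta>) r l \<xi> * dyadic_cutoff chi k \<xi>) \<phi> x)
      \<le> ennreal (K * 2 powr (- (L + k + 2 * r))) *
          (Lnorm q (LP chi k \<phi>) + (MAX (i, j)\<in>UNIV. Lnorm q (Omega i j (LP chi k \<phi>)))))"
proof -
  interpret angular_setup chi \<sigma> A C1 C2 C3 C3' C4 N P S \<alpha>
    by (rule angular_setup.intro) (rule assms)+
  show ?thesis by (rule main_estimate[OF q])
qed

end
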